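(* Let $B_1\subset B_2\subset\Omega$ be concentric balls of radii $1$ and $2$. Let $\mathcal A,\mathcal B$ satisfy the structure conditions \[ \mathcal A(x,u,z)\cdot z\ge w_1(x)\left(a^{-1}|z|^p-d_1|u|^p-g\right),\quad |\mathcal A(x,u,z)|\le w_1(x)\left(a|z|^{p-1}+b|u|^{p-1}+e\right), \] \[ |\mathcal B(x,u,z)|\le w_2(x)\left(c|z|^{p-1}+d_2|u|^{p-1}+f\right) \] for a constant $a>0$ and measurable functions $b,c,d_1,d_2,e,f,g:\Omega\to[0,\infty)$ (evaluated at $x$). Suppose that there exists $0<\varepsilon<1$ such that \[ b,e\in L^{\frac{D_1}{p-1},w_1}(B_2),\quad c\left(\tfrac{w_2}{w_1}\right)^{1-\frac1p}\in L^{\frac{D}{1-\varepsilon},w_2}(B_2),\quad d_1,g\in L^{\frac{D_1}{p-\varepsilon},w_1}(B_2),\quad d_2,f\in L^{\frac{D}{p-\varepsilon},w_2}(B_2). \] Then there exists a constant $C>0$ depending on $a$ and on the norms of $b$ in $L^{\frac{D_1}{p-1},w_1}(B_2)$, of $c\left(\tfrac{w_2}{w_1}\right)^{1-\frac1p}$ in $L^{\frac{D}{1-\varepsilon},w_2}(B_2)$, of $d_1$ in $L^{\frac{D_1}{p-\varepsilon},w_1}(B_2)$ and of $d_2$ in $L^{\frac{D}{p-\varepsilon},w_2}(B_2)$ such that for any weak solution $u$ of $\operatorname{div}\mathcal A(x,u,\nabla u)=\mathcal B(x,u,\nabla u)$ in $B_2$ we have \[ \|u\|_{L^\infty(B_1)}\le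 C\left([u]_{p,B_2}+k\right), \] where \[ k=\left[\left(⨍_{B_2}|e|^{\frac{D_1}{p-1}}w_1\,dx\right)^{\frac{p-1}{D_1}}+\left(⨍_{B_2}|f|^{\frac{D}{p-\varepsilon}}w_2\,dx\right)^{\frac{p-\varepsilon}{D}}\right]^{\frac1{p-1}}+\left[\left(⨍_{B_2}|g|^{\frac{D_1}{p-\varepsilon}}w_1\,dx\right)^{\frac{p-\varepsilon}{D_1}}\right]^{\frac1p} \] and, for $s>1$ and a ball $B\subseteq\Omega$, with $\bar u=|u|+k$, \[ [u]_{s,B}=\left(⨍_B|\bar u|^s w_1\,dx\right)^{\frac1s}+\left(⨍_B|\bar u|^s w_2\,dx\right)^{\frac1s}. \]
   Context: Setting. $\Omega\subseteq\mathbb R^N$ is open; balls are open, $l(B)$ is the radius of $B$, and $\rho B$ is the ball with the same center as $B$ and radius multiplied by $\rho>0$. The functions $\mathcal A:\Omega\times\mathbb R\times\mathbb R^N\to\mathbb R^N$ and $\mathcal B:\Omega\times\mathbb R\times\mathbb R^N\to\mathbb R$ are such that the compositions $\mathcal A(x,u,\nabla u)$, $\mathcal B(x,u,\nabla u)$ are measurable. Weights. $w_1,w_2$ are non-negative locally integrable functions on $\Omega$. For $w\in\{w_1,w_2\}$ write $w(B)=\int_B w\,dx$ and $⨍_B f w\,dx=\frac1{w(B)}\int_B f w\,dx$. Standing assumptions: (i) each $w\in\{w_1,w_2\}$ is doubling: there is $\gamma>0$ with $w(2B)\le\gamma w(B)$ for every ball with $2B\subset\Omega$ (the smallest such $\gamma$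 is denoted $\gamma_w$), and $0<w<\infty$ Lebesgue-a.e.; (ii) $w_1$ satisfies the local $(1,p)$-Poincaré inequality: there are $\rho\ge1$ and $C_1>0$ such that for $u\in C^1(\Omega)$ and all balls $B$ with $\rho B\subset\Omega$, $⨍_B|u-u_{B,w_1}|w_1\,dx\le C_1 l(B)\left(⨍_{\rho B}|\nabla u|^p w_1\,dx\right)^{1/p}$, where $u_{B,w_1}=⨍_B u\,w_1\,dx$; (iii) there are $q>p$ and $C>0$ such that $\frac rR\left(\frac{w_2(B_r)}{w_2(B_R)}\right)^{1/q}\le C\left(\frac{w_1(B_r)}{w_1(B_R)}\right)^{1/p}$ for all balls $B_r\subset B_R\subset\Omega$ of radii $r$, $R$. Put $D_1=\log_2\gamma_{w_1}$ and $D=\frac{qp}{q-p}$; it is assumed that $1<p<\min\{D_1,D\}$. Function spaces. $L^{s,w}(U)$ is the space of measurable $u$ with $\int_U|u|^s w\,dx<\infty$, with the norm $\|u\|_{s,w}=(\int_U|u|^sw\,dx)^{1/s}$. $H^{1,p,w_1}(U)$ is the completion of $\{u\in C^1(U):u,\partial_i u\in L^{p,w_1}(U)\ \forall i\}$ under the norm $\left(\|u\|_{p,w_1}^p+\sum_i\|\partial_i u\|_{p,w_1}^p\right)^{1/p}$ (under the assumptions on $w_1$, elements of this space have a uniquely defined gradient), and $H^{1,p,w_1}_{loc}(U)$ is its local version. Weak solution of $\operatorname{div}\mathcal A=\mathcal B$ in an open set $U\subseteq\Omega$: a function $u\in H^{1,p,w_1}_{loc}(U)$ with $\int_U\mathcal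 A(x,u,\nabla u)\cdot\nabla\varphi+\mathcal B(x,u,\nabla u)\varphi\,dx=0$ for all $\varphi\in C_c^\infty(U)$. Constants may also depend on the fixed data $N,p,q,\varepsilon$, the weights and the balls, but not on $u$. *)

theory Defs
  imports "HOL-Analysis.Analysis" "HOL-Probability.Essential_Supremum"
begin

text \<open>Weights are total functions \<open>real ^ 'n \<Rightarrow> real\<close> of which only the values on \<open>\<Omega>\<close>
  matter. All integrals of nonnegative functions are taken in \<open>ennreal\<close>, so that a divergent
  integral is \<open>\<infinity>\<close> and not the default value \<open>0\<close> of the Bochner integral.\<close>

definition epowr :: "ennreal \<Rightarrow> real \<Rightarrow> ennreal"
  where "epowr t r = (if t = \<infinity> then \<infinity> else ennreal (enn2real t powr r))"
  \<comment> \<open>only used for exponents \<open>r > 0\<close>\<close>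

subsection \<open>Smooth functions\<close>

definition pderivative :: "'n \<Rightarrow> (real ^ 'n \<Rightarrow> real) \<Rightarrow> real ^ 'n \<Rightarrow> real"
  where "pderivative i f x = frechet_derivative f (at x) (axis i 1)"

definition grad :: "(real ^ 'n \<Rightarrow> real) \<Rightarrow> real ^ 'n \<Rightarrow> real ^ 'n"
  where "grad f x = (\<chi> i. pderivative i f x)"

primrec Ck_on :: "nat \<Rightarrow> (real ^ 'n) set \<Rightarrow> (real ^ 'n \<Rightarrow> real) \<Rightarrow> bool" where
  "Ck_on 0 U f \<longleftrightarrow> continuous_on U f"
| "Ck_on (Suc k) U f \<longleftrightarrow>
     (\<forall>x\<in>U. f differentiable (at x)) \<and> (\<forall>i. Ck_on k U (pderivative i f))"
  \<comment> \<open>meant for open \<open>U\<close>\<close>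

definition test_function :: "(real ^ 'n) set \<Rightarrow> (real ^ 'n \<Rightarrow> real) \<Rightarrow> bool"
  where "test_function U \<phi> \<longleftrightarrow>
    (\<forall>k. Ck_on k UNIV \<phi>) \<and> compact (closure {x. \<phi> x \<noteq> 0}) \<and> closure {x. \<phi> x \<noteq> 0} \<subseteq> U"

subsection \<open>Weighted measures, averages and Lebesgue spaces\<close>

definition wmeas :: "(real ^ 'n \<Rightarrow> real) \<Rightarrow> (real ^ 'n) set \<Rightarrow> ennreal"
  where "wmeas w B = (\<integral>\<^sup>+x\<in>B. ennreal (w x) \<partial>lebesgue)"

definition wavg :: "(real ^ 'n \<Rightarrow> real) \<Rightarrow> (real ^ 'n) set \<Rightarrow> (real ^ 'n \<Rightarrow> ennreal) \<Rightarrow> ennreal"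
  where "wavg w B h = (\<integral>\<^sup>+x\<in>B. (h x * ennreal (w x)) \<partial>lebesgue) / wmeas w B"

definition wmean :: "(real ^ 'n \<Rightarrow> real) \<Rightarrow> (real ^ 'n) set \<Rightarrow> (real ^ 'n \<Rightarrow> real) \<Rightarrow> real"
  where "wmean w B u = (LINT x:B|lebesgue. u x * w x) / enn2real (wmeas w B)"

definition Lnorm :: "real \<Rightarrow> (real ^ 'n \<Rightarrow> real) \<Rightarrow> (real ^ 'n) set \<Rightarrow> (real ^ 'n \<Rightarrow> real) \<Rightarrow> ennreal"
  where "Lnorm s w U f =
    epowr (\<integral>\<^sup>+x\<in>U. (ennreal (\<bar>f x\<bar> powr s) * ennreal (w x)) \<partial>lebesgue) (1 / s)"

definition Lspace :: "real \<Rightarrow> (real ^ 'n \<Rightarrow> real) \<Rightarrow> (real ^ 'n) set \<Rightarrow> (real ^ 'n \<Rightarrow> real) set"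
  where "Lspace s w U = {f. f \<in> borel_measurable (lebesgue_on U) \<and>
    (\<integral>\<^sup>+x\<in>U. (ennreal (\<bar>f x\<bar> powr s) * ennreal (w x)) \<partial>lebesgue) < \<infinity>}"

subsection \<open>Assumptions on the weights\<close>

definition loc_integrable_weight :: "(real ^ 'n) set \<Rightarrow> (real ^ 'n \<Rightarrow> real) \<Rightarrow> bool"
  where "loc_integrable_weight \<Omega> w \<longleftrightarrow>
    (\<forall>x\<in>\<Omega>. 0 \<le> w x) \<and> (\<forall>K. compact K \<and> K \<subseteq> \<Omega> \<longrightarrow> set_integrable lebesgue K w)"

definition doubling_with :: "(real ^ 'n) set \<Rightarrow> (real ^ 'n \<Rightarrow> real) \<Rightarrow> real \<Rightarrow> bool"
  where "doubling_with \<Omega> w \<gamma> \<longleftrightarrow> 0 < \<gamma> \<and>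
    (\<forall>x r. 0 < r \<and> ball x (2 * r) \<subseteq> \<Omega> \<longrightarrow>
       wmeas w (ball x (2 * r)) \<le> ennreal \<gamma> * wmeas w (ball x r))"

definition doubling_weight :: "(real ^ 'n) set \<Rightarrow> (real ^ 'n \<Rightarrow> real) \<Rightarrow> bool"
  where "doubling_weight \<Omega> w \<longleftrightarrow>
    (\<exists>\<gamma>. doubling_with \<Omega> w \<gamma>) \<and> (AE x in lebesgue_on \<Omega>. 0 < w x)"

text \<open>If \<open>\<Omega>\<close> is open and nonempty and \<open>w\<close> is a locally integrable doubling weight, this infimum
  is attained, i.e. it is the smallest doubling constant.\<close>

definition doubling_const :: "(real ^ 'n) set \<Rightarrow> (real ^ 'n \<Rightarrow> real) \<Rightarrow> real"
  where "doubling_const \<Omega> w = Inf {\<gamma>. doubling_with \<Omega> w \<gamma>}"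

definition poincare_weight :: "(real ^ 'n) set \<Rightarrow> real \<Rightarrow> (real ^ 'n \<Rightarrow> real) \<Rightarrow> bool"
  where "poincare_weight \<Omega> p w \<longleftrightarrow>
    (\<exists>\<rho> C1. 1 \<le> \<rho> \<and> 0 < C1 \<and>
      (\<forall>u x r. Ck_on 1 \<Omega> u \<and> 0 < r \<and> ball x (\<rho> * r) \<subseteq> \<Omega> \<longrightarrow>
         wavg w (ball x r) (\<lambda>y. ennreal \<bar>u y - wmean w (ball x r) u\<bar>)
         \<le> ennreal (C1 * r) *
            epowr (wavg w (ball x (\<rho> * r)) (\<lambda>y. ennreal (norm (grad u y) powr p))) (1 / p)))"

definition balanced_weights ::
  "(real ^ 'n) set \<Rightarrow> real \<Rightarrow> real \<Rightarrow> (real ^ 'n \<Rightarrow> real) \<Rightarrow> (real ^ 'n \<Rightarrow> real) \<Rightarrow> bool"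
  where "balanced_weights \<Omega> p q w1 w2 \<longleftrightarrow>
    (\<exists>C>0. \<forall>x y r R. 0 < r \<and> 0 < R \<and> ball x r \<subseteq> ball y R \<and> ball y R \<subseteq> \<Omega> \<longrightarrow>
       ennreal (r / R) * epowr (wmeas w2 (ball x r) / wmeas w2 (ball y R)) (1 / q)
       \<le> ennreal C * epowr (wmeas w1 (ball x r) / wmeas w1 (ball y R)) (1 / p))"

subsection \<open>Weighted Sobolev spaces and weak solutions\<close>

definition H1norm :: "real \<Rightarrow> (real ^ 'n \<Rightarrow> real) \<Rightarrow> (real ^ 'n) set \<Rightarrow>
    (real ^ 'n \<Rightarrow> real) \<Rightarrow> (real ^ 'n \<Rightarrow> real ^ 'n) \<Rightarrow> ennreal"
  where "H1norm p w U u v =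
    epowr (epowr (Lnorm p w U u) p + (\<Sum>i\<in>UNIV. epowr (Lnorm p w U (\<lambda>x. v x $ i)) p)) (1 / p)"

text \<open>By completeness of the weighted Lebesgue space, an element of the completion of the
  \<open>C\<^sup>1\<close> functions is a pair \<open>(u, v)\<close> of a function and its gradient, both in the weighted
  Lebesgue space, which is the limit of pairs \<open>(\<phi> n, grad (\<phi> n))\<close>. For weights satisfying the
  Poincare inequality, \<open>v\<close> is determined by \<open>u\<close> almost everywhere.\<close>

definition H1 :: "real \<Rightarrow> (real ^ 'n \<Rightarrow> real) \<Rightarrow> (real ^ 'n) set \<Rightarrow>
    (real ^ 'n \<Rightarrow> real) \<Rightarrow> (real ^ 'n \<Rightarrow> real ^ 'n) \<Rightarrow> bool"
  where "H1 p w U u v \<longleftrightarrow>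
    u \<in> Lspace p w U \<and> (\<forall>i. (\<lambda>x. v x $ i) \<in> Lspace p w U) \<and>
    (\<exists>\<phi> :: nat \<Rightarrow> real ^ 'n \<Rightarrow> real.
       (\<forall>n. Ck_on 1 U (\<phi> n) \<and> \<phi> n \<in> Lspace p w U \<and> (\<forall>i. pderivative i (\<phi> n) \<in> Lspace p w U)) \<and>
       (\<lambda>n. H1norm p w U (\<lambda>x. \<phi> n x - u x) (\<lambda>x. grad (\<phi> n) x - v x)) \<longlonglongrightarrow> 0)"

definition H1_loc :: "real \<Rightarrow> (real ^ 'n \<Rightarrow> real) \<Rightarrow> (real ^ 'n) set \<Rightarrow>
    (real ^ 'n \<Rightarrow> real) \<Rightarrow> (real ^ 'n \<Rightarrow> real ^ 'n) \<Rightarrow> bool"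
  where "H1_loc p w U u v \<longleftrightarrow>
    (\<forall>V. open V \<and> compact (closure V) \<and> closure V \<subseteq> U \<longrightarrow> H1 p w V u v)"

definition measurable_compositions :: "real \<Rightarrow> (real ^ 'n \<Rightarrow> real) \<Rightarrow> (real ^ 'n) set \<Rightarrow>
    (real ^ 'n \<Rightarrow> real \<Rightarrow> real ^ 'n \<Rightarrow> real ^ 'n) \<Rightarrow>
    (real ^ 'n \<Rightarrow> real \<Rightarrow> real ^ 'n \<Rightarrow> real) \<Rightarrow> bool"
  where "measurable_compositions p w \<Omega> A B \<longleftrightarrow>
    (\<forall>U u v. open U \<and> U \<subseteq> \<Omega> \<and> H1_loc p w U u v \<longrightarrow>
       (\<lambda>x. A x (u x) (v x)) \<in> borel_measurable (lebesgue_on U) \<and>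
       (\<lambda>x. B x (u x) (v x)) \<in> borel_measurable (lebesgue_on U))"

definition weak_solution :: "real \<Rightarrow> (real ^ 'n \<Rightarrow> real) \<Rightarrow>
    (real ^ 'n \<Rightarrow> real \<Rightarrow> real ^ 'n \<Rightarrow> real ^ 'n) \<Rightarrow>
    (real ^ 'n \<Rightarrow> real \<Rightarrow> real ^ 'n \<Rightarrow> real) \<Rightarrow>
    (real ^ 'n) set \<Rightarrow> (real ^ 'n \<Rightarrow> real) \<Rightarrow> bool"
  where "weak_solution p w A B U u \<longleftrightarrow>
    (\<exists>v. H1_loc p w U u v \<and>
      (\<forall>\<phi>. test_function U \<phi> \<longrightarrow>
         set_integrable lebesgue U
           (\<lambda>x. A x (u x) (v x) \<bullet> grad \<phi> x + B x (u x) (v x) * \<phi> x) \<and>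
         (LINT x:U|lebesgue. A x (u x) (v x) \<bullet> grad \<phi> x + B x (u x) (v x) * \<phi> x) = 0))"

subsection \<open>Structure conditions and the quantities in the estimate\<close>

definition coefficient :: "(real ^ 'n) set \<Rightarrow> (real ^ 'n \<Rightarrow> real) \<Rightarrow> bool"
  where "coefficient \<Omega> h \<longleftrightarrow> h \<in> borel_measurable (lebesgue_on \<Omega>) \<and> (\<forall>x\<in>\<Omega>. 0 \<le> h x)"

definition structure_conditions ::
  "(real ^ 'n) set \<Rightarrow> real \<Rightarrow> (real ^ 'n \<Rightarrow> real) \<Rightarrow> (real ^ 'n \<Rightarrow> real) \<Rightarrow>
   (real ^ 'n \<Rightarrow> real \<Rightarrow> real ^ 'n \<Rightarrow> real ^ 'n) \<Rightarrow> (real ^ 'n \<Rightarrow> real \<Rightarrow> real ^ 'n \<Rightarrow> real) \<Rightarrow>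
   real \<Rightarrow> (real ^ 'n \<Rightarrow> real) \<Rightarrow> (real ^ 'n \<Rightarrow> real) \<Rightarrow> (real ^ 'n \<Rightarrow> real) \<Rightarrow> (real ^ 'n \<Rightarrow> real) \<Rightarrow>
   (real ^ 'n \<Rightarrow> real) \<Rightarrow> (real ^ 'n \<Rightarrow> real) \<Rightarrow> (real ^ 'n \<Rightarrow> real) \<Rightarrow> bool"
  where "structure_conditions \<Omega> p w1 w2 A B a b c d1 d2 e f g \<longleftrightarrow>
    (\<forall>x\<in>\<Omega>. \<forall>u z.
       A x u z \<bullet> z \<ge> w1 x * (inverse a * norm z powr p - d1 x * \<bar>u\<bar> powr p - g x) \<and>
       norm (A x u z) \<le> w1 x * (a * norm z powr (p - 1) + b x * \<bar>u\<bar> powr (p - 1) + e x) \<and>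
       \<bar>B x u z\<bar> \<le> w2 x * (c x * norm z powr (p - 1) + d2 x * \<bar>u\<bar> powr (p - 1) + f x))"

definition k_const ::
  "real \<Rightarrow> real \<Rightarrow> real \<Rightarrow> real \<Rightarrow> (real ^ 'n \<Rightarrow> real) \<Rightarrow> (real ^ 'n \<Rightarrow> real) \<Rightarrow> (real ^ 'n) set \<Rightarrow>
   (real ^ 'n \<Rightarrow> real) \<Rightarrow> (real ^ 'n \<Rightarrow> real) \<Rightarrow> (real ^ 'n \<Rightarrow> real) \<Rightarrow> ennreal"
  where "k_const p \<epsilon> D1 D w1 w2 B e f g =
    epowr
      (epowr (wavg w1 B (\<lambda>x. ennreal (\<bar>e x\<bar> powr (D1 / (p - 1))))) ((p - 1) / D1) +
       epowr (wavg w2 B (\<lambda>x. ennreal (\<bar>f x\<bar> powr (D / (p - \<epsilon>))))) ((p - \<epsilon>) / D))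
      (1 / (p - 1)) +
    epowr (epowr (wavg w1 B (\<lambda>x. ennreal (\<bar>g x\<bar> powr (D1 / (p - \<epsilon>))))) ((p - \<epsilon>) / D1)) (1 / p)"

definition bracket ::
  "ennreal \<Rightarrow> (real ^ 'n \<Rightarrow> real) \<Rightarrow> (real ^ 'n \<Rightarrow> real) \<Rightarrow> real \<Rightarrow> (real ^ 'n) set \<Rightarrow>
   (real ^ 'n \<Rightarrow> real) \<Rightarrow> ennreal"
  where "bracket k w1 w2 s B u =
    epowr (wavg w1 B (\<lambda>x. epowr (ennreal \<bar>u x\<bar> + k) s)) (1 / s) +
    epowr (wavg w2 B (\<lambda>x. epowr (ennreal \<bar>u x\<bar> + k) s)) (1 / s)"

end

theory Submission
  imports Defs "HOL-Real_Asymp.Real_Asymp"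
begin

text \<open>The proof is Moser's iteration. The doubling and Poincare inequalities turn into a weighted
  Sobolev inequality by chaining averages over shrinking balls, the covering lemma (which gives
  a weak type estimate) and Maz'ya's truncation. The balance condition is what lets the chain gain
  the exponent \<open>q\<close> for \<open>w2\<close>; for \<open>w1\<close> itself the doubling inequality is the balance condition
  of exponent \<open>p * D1 / (D1 - p)\<close>.

  After the inhomogeneous terms are absorbed into the coefficients by means of
  \<open>\<bar>u\<bar> + s\<close> with \<open>s > 0\<close>, \<open>s \<ge> k\<close>, one tests the equation with a cutoff times a power of
  \<open>\<bar>u\<bar> + s\<close>, truncated at a level that tends to infinity afterwards. The lower order terms are
  estimated by the Hoelder and Sobolev inequalities; since \<open>\<epsilon> > 0\<close>, they can be absorbed into the
  left-hand side at the price of a power of the iteration exponent. The resulting reverse Hoelder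
  inequality is iterated on balls shrinking to \<open>ball x0 1\<close>.\<close>

section \<open>Hoelder inequalities\<close>

text \<open>The constant may see the solution only through four norms, yet the equation is tested
  with powers of an unbounded \<open>u\<close>. So two kinds of bounds run side by side. Qualitative
  ones (\<open>N0\<close>, \<open>u_higher\<close>, \<open>A_bound\<close>, the truncation level)
  depend on the solution; they make integrals finite and admit Sobolev test functions, and none of
  them survives in the final inequality. Quantitative ones (\<open>CS\<close>, \<open>KK\<close>,
  \<open>K2\<close>) depend on weights, exponents, \<open>a\<close> and the norms. Absorption links
  them: with Y = X + \<zeta>, the main energy plus the known integrals, every lower order term is at
  most a constant times Y^(1 - \<epsilon>/p) \<zeta>^(\<epsilon>/p). This is sublinear in Y, and Y
  is finite thanks to the truncation, so Y can be divided out. The radii 1 < 5/4 < 11/8 < 3/2 < 7/4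
  < 2 belong to the conclusion, the start of the iteration, the smooth test functions, the Sobolev
  inequality, the cut-off weights and the equation. The shift \<open>s\<close> must be positive
  although \<open>k\<close> may vanish; a final limit removes the difference.\<close>

lemma nn_integral_Holder2:
  fixes f g :: "'a \<Rightarrow> real"
  assumes [measurable]: "f \<in> borel_measurable M" "g \<in> borel_measurable M"
    and nn: "\<And>x. 0 \<le> f x" "\<And>x. 0 \<le> g x" "0 \<le> P" "0 \<le> Q"
    and f: "(\<integral>\<^sup>+x. ennreal (f x) \<partial>M) \<le> ennreal P"
    and g: "(\<integral>\<^sup>+x. ennreal (g x) \<partial>M) \<le> ennreal Q"
    and ab: "0 < a" "0 < b" "a + b = 1"
  shows "(\<integral>\<^sup>+x. ennreal (f x powr a * g x powr b) \<partial>M) \<le> ennreal (P powr a * Q powr b)"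
\<comment> \<open>Young's inequality below is normalised by dividing by \<open>P\<close> and
  \<open>Q\<close>; if one of these bounds vanishes, one factor is 0 almost everywhere.\<close>
proof (cases "P = 0 \<or> Q = 0")
  case True
  have "AE x in M. f x = 0 \<or> g x = 0"
  proof (cases "P = 0")
    case True
    then have "(\<integral>\<^sup>+x. ennreal (f x) \<partial>M) = 0" using f by simp
    then have "AE x in M. ennreal (f x) = 0" by (subst (asm) nn_integral_0_iff_AE) auto
    then show ?thesis using nn by (auto simp: ennreal_eq_0_iff antisym)
  next
    case False
    then have "(\<integral>\<^sup>+x. ennreal (g x) \<partial>M) = 0" using g True by simp
    then have "AE x in M. ennreal (g x) = 0" by (subst (asm) nn_integral_0_iff_AE) auto
    then show ?thesis using nn by (auto simp: ennreal_eq_0_iff antisym)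
  qed
  then have "(\<integral>\<^sup>+x. ennreal (f x powr a * g x powr b) \<partial>M) = (\<integral>\<^sup>+x. 0 \<partial>M)"
    by (intro nn_integral_cong_AE) auto
  then show ?thesis by simp
next
  case False
  then have PQ: "0 < P" "0 < Q" using nn by auto
  have young: "x powr a * y powr b \<le> a * x + b * y" if "0 \<le> x" "0 \<le> y" for x y :: real
  proof (cases "x = 0 \<or> y = 0")
    case True
    then show ?thesis using ab that by auto
  next
    case False
    then show ?thesis using Youngs_inequality_0[of a b x y] ab that by simp
  qed
  define c where "c = P powr a * Q powr b"
  have c0: "0 \<le> c" by (simp add: c_def)
  have pt: "f x powr a * g x powr b \<le> c * a / P * f x + c * b / Q * g x" for x
  proof -
    have "f x powr a * g x powr b = c * ((f x / P) powr a * (g x / Q) powr b)"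
      using PQ nn by (simp add: c_def powr_divide)
    also have "\<dots> \<le> c * (a * (f x / P) + b * (g x / Q))"
      using PQ nn by (intro mult_left_mono young c0) auto
    finally show ?thesis by (simp add: algebra_simps)
  qed
  have "(\<integral>\<^sup>+x. ennreal (f x powr a * g x powr b) \<partial>M)
      \<le> (\<integral>\<^sup>+x. ennreal (c * a / P) * ennreal (f x) + ennreal (c * b / Q) * ennreal (g x) \<partial>M)"
    using PQ ab c0 nn pt
    by (intro nn_integral_mono) (simp add: ennreal_mult[symmetric] ennreal_plus[symmetric] del: ennreal_plus)
  also have "\<dots> = ennreal (c * a / P) * (\<integral>\<^sup>+x. ennreal (f x) \<partial>M) + ennreal (c * b / Q) * (\<integral>\<^sup>+x. ennreal (g x) \<partial>M)"
    by (simp add: nn_integral_add nn_integral_cmult)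
  also have "\<dots> \<le> ennreal (c * a / P) * ennreal P + ennreal (c * b / Q) * ennreal Q"
    using f g by (intro add_mono mult_left_mono) auto
  also have "\<dots> = ennreal (c * a / P * P + c * b / Q * Q)"
    using PQ ab c0 nn by (simp add: ennreal_mult[symmetric] ennreal_plus[symmetric] del: ennreal_plus)
  also have "c * a / P * P + c * b / Q * Q = c * (a + b)"
    using PQ by (simp add: field_simps)
  also have "\<dots> = c" using ab by simp
  finally show ?thesis by (simp add: c_def)
qed

text \<open>The two-factor inequality is used twice: \<open>g\<close> and \<open>h\<close> are
  merged first, with exponents renormalised by \<open>b + c\<close>. Hypotheses that are upper
  bounds, zero included, let the result of one inequality feed the next.\<close>

lemma nn_integral_Holder3:
  fixes f g h :: "'a \<Rightarrow> real"
  assumes [measurable]: "f \<in> borel_measurable M" "g \<in> borel_measurable M" "h \<in> borel_measurable M"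
    and nn: "\<And>x. 0 \<le> f x" "\<And>x. 0 \<le> g x" "\<And>x. 0 \<le> h x" "0 \<le> P" "0 \<le> Q" "0 \<le> R"
    and f: "(\<integral>\<^sup>+x. ennreal (f x) \<partial>M) \<le> ennreal P"
    and g: "(\<integral>\<^sup>+x. ennreal (g x) \<partial>M) \<le> ennreal Q"
    and h: "(\<integral>\<^sup>+x. ennreal (h x) \<partial>M) \<le> ennreal R"
    and ab: "0 < a" "0 < b" "0 < c" "a + b + c = 1"
  shows "(\<integral>\<^sup>+x. ennreal (f x powr a * g x powr b * h x powr c) \<partial>M)
    \<le> ennreal (P powr a * Q powr b * R powr c)"
proof -
  have "(\<integral>\<^sup>+x. ennreal (f x powr a * (g x powr (b / (b + c)) * h x powr (c / (b + c))) powr (b + c)) \<partial>M)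
    \<le> ennreal (P powr a * (Q powr (b / (b + c)) * R powr (c / (b + c))) powr (b + c))"
    using nn ab
    by (intro nn_integral_Holder2 f nn_integral_Holder2[OF _ _ _ _ _ _ g h])
       (auto simp: add_divide_distrib[symmetric])
  then show ?thesis
    using nn ab by (simp add: powr_mult powr_powr mult.assoc)
qed

lemma nn_integral_Holder4:
  fixes f g h i :: "'a \<Rightarrow> real"
  assumes [measurable]: "f \<in> borel_measurable M" "g \<in> borel_measurable M" "h \<in> borel_measurable M"
      "i \<in> borel_measurable M"
    and nn: "\<And>x. 0 \<le> f x" "\<And>x. 0 \<le> g x" "\<And>x. 0 \<le> h x" "\<And>x. 0 \<le> i x" "0 \<le> P" "0 \<le> Q" "0 \<le> R" "0 \<le> S"
    and f: "(\<integral>\<^sup>+x. ennreal (f x) \<partial>M) \<le> ennreal P"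
    and g: "(\<integral>\<^sup>+x. ennreal (g x) \<partial>M) \<le> ennreal Q"
    and h: "(\<integral>\<^sup>+x. ennreal (h x) \<partial>M) \<le> ennreal R"
    and i: "(\<integral>\<^sup>+x. ennreal (i x) \<partial>M) \<le> ennreal S"
    and ab: "0 < a" "0 < b" "0 < c" "0 < d" "a + b + c + d = 1"
  shows "(\<integral>\<^sup>+x. ennreal (f x powr a * g x powr b * h x powr c * i x powr d) \<partial>M)
    \<le> ennreal (P powr a * Q powr b * R powr c * S powr d)"
proof -
  let ?s = "b + c + d"
  have "(\<integral>\<^sup>+x. ennreal (f x powr a * (g x powr (b / ?s) * h x powr (c / ?s) * i x powr (d / ?s)) powr ?s) \<partial>M)
    \<le> ennreal (P powr a * (Q powr (b / ?s) * R powr (c / ?s) * S powr (d / ?s)) powr ?s)"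
    using nn ab
    by (intro nn_integral_Holder2 f nn_integral_Holder3[OF _ _ _ _ _ _ _ _ _ g h i])
       (auto simp: add_divide_distrib[symmetric])
  then show ?thesis
    using nn ab by (simp add: powr_mult powr_powr mult.assoc)
qed

section \<open>Continuously differentiable functions and mollification\<close>

text \<open>The gradient is an argument and not a derived term, so that products, compositions and
  limits of pairs (function, gradient) are handled by the rules for \<open>GDERIV\<close>.
  \<open>Ck_on_1_C1_on\<close> and \<open>C1_on_Ck_on_1\<close> translate to the coordinatewise
  notion.\<close>

definition C1_on :: "('a::real_inner) set \<Rightarrow> ('a \<Rightarrow> real) \<Rightarrow> ('a \<Rightarrow> 'a) \<Rightarrow> bool"
  where "C1_on U f D \<longleftrightarrow> (\<forall>x\<in>U. GDERIV f x :> D x) \<and> continuous_on U D"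

lemma GDERIV_D: "C1_on U f D \<Longrightarrow> x \<in> U \<Longrightarrow> GDERIV f x :> D x"
  by (simp add: C1_on_def)

lemma GDERIV_isCont: "GDERIV f x :> D \<Longrightarrow> isCont f x"
  unfolding gderiv_def by (rule has_derivative_continuous)

lemma C1_on_continuous: "C1_on U f D \<Longrightarrow> continuous_on U f"
  by (meson C1_on_def GDERIV_isCont continuous_at_imp_continuous_on)

lemma GDERIV_pderivative:
  fixes f :: "real ^ 'n \<Rightarrow> real"
  assumes "GDERIV f x :> D"
  shows "pderivative i f x = D $ i"
proof -
  have "frechet_derivative f (at x) = (\<lambda>h. inner h D)"
    using assms unfolding gderiv_def by (simp add: frechet_derivative_at[symmetric])
  then show ?thesis
    by (simp add: pderivative_def inner_axis')
qed

lemma GDERIV_grad: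
  fixes f :: "real ^ 'n \<Rightarrow> real"
  assumes "GDERIV f x :> D"
  shows "grad f x = D"
  by (simp add: grad_def vec_eq_iff GDERIV_pderivative[OF assms])

lemma differentiable_GDERIV:
  fixes f :: "real ^ 'n \<Rightarrow> real"
  assumes "f differentiable (at x)"
  shows "GDERIV f x :> grad f x"
proof -
  let ?f' = "frechet_derivative f (at x)"
  have d: "(f has_derivative ?f') (at x)"
    using assms frechet_derivative_works by blast
  then have lin: "linear ?f'" using has_derivative_linear by blast
  have "?f' h = inner h (grad f x)" for h
  proof -
    have "?f' h = ?f' (\<Sum>i\<in>UNIV. (h $ i) *\<^sub>R axis i 1)"
      using basis_expansion[of h] by (simp add: scalar_mult_eq_scaleR)
    also have "\<dots> = (\<Sum>i\<in>UNIV. (h $ i) * ?f' (axis i 1))"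
      using lin by (simp add: linear_sum linear_cmul)
    also have "\<dots> = inner h (grad f x)"
      by (simp add: inner_vec_def grad_def pderivative_def)
    finally show ?thesis .
  qed
  then have "?f' = (\<lambda>h. inner h (grad f x))" by auto
  then show ?thesis using d by (simp add: gderiv_def)
qed

lemma Ck_on_1_C1_on:
  fixes f :: "real ^ 'n \<Rightarrow> real"
  assumes "Ck_on 1 U f"
  shows "C1_on U f (grad f)"
  using assms
  by (auto simp: C1_on_def One_nat_def intro!: differentiable_GDERIV)
     (auto simp: grad_def[abs_def] intro!: continuous_on_vec_lambda)

lemma C1_on_Ck_on_1:
  fixes f :: "real ^ 'n \<Rightarrow> real"
  assumes "C1_on U f D"
  shows "Ck_on 1 U f"
proof -
  have "f differentiable (at x)" if "x \<in> U" for x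
    using GDERIV_D[OF assms that] unfolding gderiv_def differentiable_def by blast
  moreover have "continuous_on U (pderivative i f)" for i
  proof -
    have "continuous_on U (\<lambda>x. D x $ i)"
      using assms by (intro continuous_intros) (simp add: C1_on_def)
    then show ?thesis
      by (rule continuous_on_eq) (simp add: GDERIV_pderivative[OF GDERIV_D[OF assms]])
  qed
  ultimately show ?thesis by (simp add: One_nat_def)
qed

lemma C1_on_subset: "C1_on U f D \<Longrightarrow> V \<subseteq> U \<Longrightarrow> C1_on V f D"
  by (auto simp: C1_on_def intro: continuous_on_subset)

section \<open>Flat functions and smooth kernels\<close>

definition beta :: "nat \<Rightarrow> real \<Rightarrow> real"
  where "beta m t = (if t > 0 then exp (- inverse t) * inverse t ^ m else 0)"

lemma beta_tendsto_0: "((\<lambda>h. beta m h) \<longlongrightarrow> 0) (at 0)"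
proof -
  have "((\<lambda>x. x ^ m / exp x) \<longlongrightarrow> (0::real)) at_top" by (rule tendsto_power_div_exp_0)
  then have "((\<lambda>h. (inverse h) ^ m / exp (inverse h)) \<longlongrightarrow> (0::real)) (at_right 0)"
    by (rule filterlim_compose) (rule filterlim_inverse_at_top_right)
  moreover have "\<forall>\<^sub>F h in at_right (0::real). (inverse h) ^ m / exp (inverse h) = beta m h"
    by (auto simp: eventually_at_filter beta_def exp_minus divide_inverse power_inverse mult.commute)
  ultimately have r: "((\<lambda>h. beta m h) \<longlongrightarrow> 0) (at_right 0)"
    by (rule Lim_transform_eventually)
  have "\<forall>\<^sub>F h in at_left (0::real). 0 = beta m h"
    by (auto simp: eventually_at_filter beta_def)
  then have l: "((\<lambda>h. beta m h) \<longlongrightarrow> 0) (at_left 0)"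
    by (rule Lim_transform_eventually[OF tendsto_const])
  show ?thesis using l r filterlim_split_at_real by blast
qed

text \<open>The powers of \<open>inverse t\<close> make the family closed under differentiation;
  \<open>beta 0\<close> is the classical flat function exp(-1/t). At the origin the difference
  quotient of \<open>beta m\<close> is \<open>beta (m + 1)\<close>, which tends to 0.\<close>

lemma beta_DERIV: "DERIV (beta m) t :> beta (m + 2) t - real m * beta (m + 1) t"
proof -
  consider "t > 0" | "t < 0" | "t = 0" by linarith
  then show ?thesis
  proof cases
    case 1
    have "DERIV (\<lambda>t. exp (- inverse t) * inverse t ^ m) t :> exp (- inverse t) * inverse t ^ (m + 2) - real m * (exp (- inverse t) * inverse t ^ (m + 1))"
    proof -
      have e: "DERIV (\<lambda>t. exp (- inverse t)) t :> exp (- inverse t) * (inverse t)\<^sup>2"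
        using 1 by (auto intro!: derivative_eq_intros simp: power2_eq_square)
      have i: "DERIV (\<lambda>t. inverse t ^ m) t :> real m * (inverse t ^ (m - 1) * (- ((inverse t)\<^sup>2)))"
        using 1 by (auto intro!: derivative_eq_intros simp: power2_eq_square)
      show ?thesis
        by (rule DERIV_cong[OF DERIV_mult[OF e i]], cases m) (simp_all add: power2_eq_square algebra_simps)
    qed
    then have "DERIV (beta m) t :> exp (- inverse t) * inverse t ^ (m + 2) - real m * (exp (- inverse t) * inverse t ^ (m + 1))"
      by (rule has_field_derivative_transform_within_open[where S="{0<..}"]) (use 1 in \<open>auto simp: beta_def\<close>)
    then show ?thesis using 1 by (simp add: beta_def)
  next
    case 2
    have "DERIV (beta m) t :> 0"
      by (rule has_field_derivative_transform_within_open[where S="{..<0}" and f="\<lambda>_. 0"]) (use 2 in \<open>auto simp: beta_def\<close>)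
    then show ?thesis using 2 by (simp add: beta_def)
  next
    case 3
    have "\<forall>\<^sub>F h in at (0::real). beta (m + 1) h = (beta m (0 + h) - beta m 0) / h"
      by (auto simp: eventually_at_filter beta_def divide_inverse intro!: always_eventually)
    then have "((\<lambda>h. (beta m (0 + h) - beta m 0) / h) \<longlongrightarrow> 0) (at 0)"
      by (rule Lim_transform_eventually[OF beta_tendsto_0])
    then have "DERIV (beta m) 0 :> 0" by (simp add: DERIV_def)
    then show ?thesis using 3 by (simp add: beta_def)
  qed
qed

text \<open>Combinations of flat functions of e - |x|^2 with polynomial coefficients. Every partial
  derivative stays in the class, so a single first-order computation yields all orders required by
  \<open>Ck_on\<close>. For e = \<delta>^2 the members vanish where |x| \<ge> \<delta>.\<close>

inductive bump_alg :: "real \<Rightarrow> (real ^ 'n \<Rightarrow> real) \<Rightarrow> bool" for e where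
  base: "bump_alg e (\<lambda>x. beta m (e - inner x x))"
| cmult: "bump_alg e f \<Longrightarrow> bump_alg e (\<lambda>x. c * f x)"
| coord: "bump_alg e f \<Longrightarrow> bump_alg e (\<lambda>x. (x $ i) * f x)"
| add: "bump_alg e f \<Longrightarrow> bump_alg e g \<Longrightarrow> bump_alg e (\<lambda>x. f x + g x)"

lemma GDERIV_coord: "GDERIV (\<lambda>x :: real ^ 'n. x $ i) x :> axis i 1"
  unfolding gderiv_def
  using bounded_linear_imp_has_derivative[OF bounded_linear_vec_nth] by (simp add: inner_axis)

lemma GDERIV_inner_self: "GDERIV (\<lambda>x :: 'a::real_inner. e - inner x x) x :> (-2) *\<^sub>R x"
  unfolding gderiv_def
  by (auto intro!: derivative_eq_intros simp: inner_commute)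

lemma bump_alg_GDERIV:
  fixes f :: "real ^ 'n \<Rightarrow> real"
  assumes "bump_alg e f"
  shows "\<exists>D. (\<forall>x. GDERIV f x :> D x) \<and> (\<forall>i. bump_alg e (\<lambda>x. D x $ i))"
  using assms
proof induction
  case (base m)
  let ?b = "\<lambda>x :: real ^ 'n. beta (m + 2) (e - inner x x) + (- real m) * beta (m + 1) (e - inner x x)"
  let ?D = "\<lambda>x :: real ^ 'n. (beta (m + 2) (e - inner x x) - real m * beta (m + 1) (e - inner x x)) *\<^sub>R ((-2) *\<^sub>R x)"
  have "GDERIV (\<lambda>x. beta m (e - inner x x)) x :> ?D x" for x
    by (rule GDERIV_DERIV_compose[OF GDERIV_inner_self beta_DERIV])
  moreover have "bump_alg e (\<lambda>x. ?D x $ i)" for i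
  proof -
    have "bump_alg e (\<lambda>x. (x $ i) * ((-2) * ?b x))"
      by (intro bump_alg.intros)
    then show ?thesis by (simp add: algebra_simps)
  qed
  ultimately show ?case by (intro exI[of _ ?D]) blast
next
  case (cmult f c)
  then obtain D where D: "\<And>x. GDERIV f x :> D x" "\<And>i. bump_alg e (\<lambda>x. D x $ i)" by blast
  have "GDERIV (\<lambda>x. c * f x) x :> c *\<^sub>R D x" for x
    by (rule GDERIV_subst[OF GDERIV_mult[OF GDERIV_const D(1)]]) simp
  moreover have "bump_alg e (\<lambda>x. (c *\<^sub>R D x) $ i)" for i
    using bump_alg.cmult[OF D(2)] by simp
  ultimately show ?case by (intro exI[of _ "\<lambda>x. c *\<^sub>R D x"]) blast
next
  case (coord f j)
  then obtain D where D: "\<And>x. GDERIV f x :> D x" "\<And>i. bump_alg e (\<lambda>x. D x $ i)" by blast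
  have "GDERIV (\<lambda>x. (x $ j) * f x) x :> (x $ j) *\<^sub>R D x + f x *\<^sub>R axis j 1" for x
    by (rule GDERIV_mult[OF GDERIV_coord D(1)])
  moreover have "bump_alg e (\<lambda>x. ((x $ j) *\<^sub>R D x + f x *\<^sub>R axis j 1) $ i)" for i
  proof -
    have "bump_alg e (\<lambda>x. (x $ j) * D x $ i + (axis j 1 $ i) * f x)"
      by (intro bump_alg.intros D coord)
    then show ?thesis by (simp add: mult.commute)
  qed
  ultimately show ?case by (intro exI[of _ "\<lambda>x. (x $ j) *\<^sub>R D x + f x *\<^sub>R axis j 1"]) blast
next
  case (add f g)
  then obtain D D' where D: "\<And>x. GDERIV f x :> D x" "\<And>i. bump_alg e (\<lambda>x. D x $ i)"
      "\<And>x. GDERIV g x :> D' x" "\<And>i. bump_alg e (\<lambda>x. D' x $ i)" by blast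
  have "GDERIV (\<lambda>x. f x + g x) x :> D x + D' x" for x
    by (rule GDERIV_add[OF D(1,3)])
  moreover have "bump_alg e (\<lambda>x. (D x + D' x) $ i)" for i
    using bump_alg.add[OF D(2,4)] by simp
  ultimately show ?case by (intro exI[of _ "\<lambda>x. D x + D' x"]) blast
qed

lemma bump_alg_continuous:
  fixes f :: "real ^ 'n \<Rightarrow> real"
  assumes "bump_alg e f"
  shows "continuous_on A f"
  using bump_alg_GDERIV[OF assms] GDERIV_isCont continuous_at_imp_continuous_on by metis

lemma bump_alg_C1:
  fixes f :: "real ^ 'n \<Rightarrow> real"
  assumes "bump_alg e f"
  obtains D where "C1_on UNIV f D" "\<And>i. bump_alg e (\<lambda>x. D x $ i)"
proof -
  from bump_alg_GDERIV[OF assms] obtain D where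
    D: "\<And>x. GDERIV f x :> D x" "\<And>i. bump_alg e (\<lambda>x. D x $ i)" by blast
  have "continuous_on UNIV (\<lambda>x. \<chi> i. D x $ i)"
    by (intro continuous_on_vec_lambda bump_alg_continuous[OF D(2)])
  then have "C1_on UNIV f D" using D by (simp add: C1_on_def)
  then show ?thesis using D that by blast
qed

section \<open>Convolution and mollification\<close>

lemma GDERIV_integral_cbox:
  fixes f :: "'a::euclidean_space \<Rightarrow> 'b::euclidean_space \<Rightarrow> real"
  assumes d: "\<And>x t. t \<in> cbox a b \<Longrightarrow> GDERIV (\<lambda>x. f x t) x :> D x t"
    and c: "continuous_on (UNIV \<times> cbox a b) (\<lambda>(x, t). D x t)"
    and f: "\<And>x. continuous_on (cbox a b) (f x)"
  shows "GDERIV (\<lambda>x. integral (cbox a b) (f x)) x :> integral (cbox a b) (D x)"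
proof -
  \<comment> \<open>The Leibniz rule speaks of derivatives as bounded linear maps. This embedding of
    gradients is itself linear and bounded, so it commutes with the integral.\<close>
  let ?L = "\<lambda>x t. blinfun_inner_left (D x t)"
  have DI: "D x integrable_on cbox a b"
    by (intro integrable_continuous continuous_on_compose2[OF c, of _ "\<lambda>t. (x, t)", simplified] continuous_intros) auto
  have "((\<lambda>x. integral (cbox a b) (f x)) has_derivative blinfun_apply (integral (cbox a b) (?L x))) (at x within UNIV)"
  proof (rule leibniz_rule)
    show "((\<lambda>x. f x t) has_derivative blinfun_apply (?L x t)) (at x within UNIV)" if "t \<in> cbox a b" for x t
      using d[OF that, of x] by (simp add: gderiv_def blinfun_inner_left.rep_eq[abs_def])
    show "f x integrable_on cbox a b" for x
      by (intro integrable_continuous f)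
    show "continuous_on (UNIV \<times> cbox a b) (\<lambda>(x, t). ?L x t)"
      using bounded_linear.continuous_on[OF bounded_linear_blinfun_inner_left c]
      by (simp add: case_prod_beta')
  qed auto
  moreover have "integral (cbox a b) (?L x) = blinfun_inner_left (integral (cbox a b) (D x))"
    using integral_linear[OF DI bounded_linear_blinfun_inner_left] by (simp add: o_def)
  ultimately show ?thesis
    by (simp add: gderiv_def blinfun_inner_left.rep_eq[abs_def])
qed

lemma GDERIV_shift:
  assumes "GDERIV f (x - y) :> D"
  shows "GDERIV (\<lambda>x. f (x - y)) x :> D"
proof -
  have "((\<lambda>x. x - y) has_derivative (\<lambda>h. h)) (at x)"
    by (auto intro!: derivative_eq_intros)
  from has_derivative_compose[OF this, of f] assms show ?thesis
    unfolding gderiv_def by simp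
qed

lemma lborel_integral_reflect:
  fixes h :: "'a::euclidean_space \<Rightarrow> real"
  assumes "continuous_on UNIV h"
  shows "(\<integral>y. h y \<partial>lborel) = (\<integral>z. h (x - z) \<partial>lborel)"
proof -
  have m: "h \<in> borel_measurable borel"
    using assms by (rule borel_measurable_continuous_onI)
  have "(lborel :: 'a measure) = density (distr lborel borel (\<lambda>z. x + (-1) *\<^sub>R z)) (\<lambda>_. (\<bar>-1\<bar>::real)^DIM('a))"
    by (rule lborel_affine) simp
  then have e: "(lborel :: 'a measure) = distr lborel borel (\<lambda>z. x - z)"
    by (simp add: density_1)
  have "(\<integral>y. h y \<partial>lborel) = (\<integral>y. h y \<partial>(distr lborel borel (\<lambda>z. x - z)))"
    using e by simp
  also have "\<dots> = (\<integral>z. h (x - z) \<partial>lborel)"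
    by (rule integral_distr) (auto simp: m)
  finally show ?thesis .
qed

text \<open>A bridge between the two integrals in use: differentiation under the integral sign works
  over a compact box, the reflection y to x - y over the whole space.\<close>

lemma integral_cbox_lborel:
  fixes h :: "'a::euclidean_space \<Rightarrow> real"
  assumes "continuous_on UNIV h" "\<And>x. x \<notin> cbox a b \<Longrightarrow> h x = 0"
  shows "integral (cbox a b) h = (\<integral>y. h y \<partial>lborel)"
proof -
  have "integrable lborel (\<lambda>x. indicator (cbox a b) x *\<^sub>R h x)"
    by (rule borel_integrable_compact) (auto intro: continuous_on_subset[OF assms(1)])
  moreover have eq: "(\<lambda>x. indicator (cbox a b) x *\<^sub>R h x) = h"
    by (rule ext) (use assms(2) in \<open>auto simp: indicator_def\<close>)
  ultimately have "integral UNIV h = (\<integral>y. h y \<partial>lborel)"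
    using integral_lborel by simp
  moreover have "integral UNIV (\<lambda>x. if x \<in> cbox a b then h x else 0) = integral (cbox a b) h"
    by (rule integral_restrict_UNIV)
  moreover have "(\<lambda>x. if x \<in> cbox a b then h x else 0) = h"
    by (rule ext) (use assms(2) in auto)
  ultimately show ?thesis by simp
qed

lemma cball_subset_cbox_One:
  fixes x :: "'a::euclidean_space"
  shows "cball x r \<subseteq> cbox (x - r *\<^sub>R One) (x + r *\<^sub>R One)"
proof
  fix y assume y: "y \<in> cball x r"
  have "\<bar>(y - x) \<bullet> i\<bar> \<le> r" if "i \<in> Basis" for i
    using Basis_le_norm[OF that, of "y - x"] y by (simp add: dist_norm norm_minus_commute)
  then show "y \<in> cbox (x - r *\<^sub>R One) (x + r *\<^sub>R One)"
    by (auto simp: mem_box inner_diff_left inner_add_left abs_le_iff algebra_simps)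
qed

lemma C1_on_outside_support:
  assumes "C1_on UNIV f D" "closed K" "\<And>x. x \<notin> K \<Longrightarrow> f x = 0" "x \<notin> K"
  shows "D x = 0"
proof -
  have "GDERIV f x :> 0"
    unfolding gderiv_def
    by (rule has_derivative_transform_within_open[where s="- K" and f="\<lambda>_. 0"])
       (use assms in auto)
  moreover have "GDERIV f x :> D x" using assms by (simp add: C1_on_def)
  ultimately have "(\<lambda>h. inner h (D x)) = (\<lambda>h. inner h 0)"
    unfolding gderiv_def by (rule has_derivative_unique[symmetric])
  then have "inner (D x) (D x) = inner (D x) 0" by metis
  then show ?thesis by simp
qed

text \<open>All derivatives fall on the kernel, so \<psi> need only be continuous. The induction
  generalises the kernel, whose partial derivatives are again in \<open>bump_alg\<close>.\<close>

lemma Ck_on_convolution: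
  fixes \<psi> :: "real ^ 'n \<Rightarrow> real"
  assumes \<psi>: "continuous_on UNIV \<psi>" and "bump_alg e \<kappa>"
  shows "Ck_on k UNIV (\<lambda>x. integral (cbox a b) (\<lambda>y. \<psi> y * \<kappa> (x - y)))"
  using assms(2)
proof (induction k arbitrary: \<kappa>)
  case (Suc k)
  from bump_alg_C1[OF Suc.prems] obtain D where
    D: "C1_on UNIV \<kappa> D" "\<And>i. bump_alg e (\<lambda>x. D x $ i)" by blast
  have cD: "continuous_on A D" for A
    using D(1) by (auto simp: C1_on_def intro: continuous_on_subset)
  have c\<psi>: "continuous_on A \<psi>" for A
    using \<psi> continuous_on_subset by blast
  have c\<kappa>: "continuous_on A \<kappa>" for A
    by (rule bump_alg_continuous[OF Suc.prems])
  let ?F = "\<lambda>x. integral (cbox a b) (\<lambda>y. \<psi> y * \<kappa> (x - y))"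
  have g: "GDERIV ?F x :> integral (cbox a b) (\<lambda>y. \<psi> y *\<^sub>R D (x - y))" for x
  proof (rule GDERIV_integral_cbox)
    show "GDERIV (\<lambda>x. \<psi> y * \<kappa> (x - y)) x :> \<psi> y *\<^sub>R D (x - y)" for x y
      by (rule GDERIV_subst[OF GDERIV_mult[OF GDERIV_const GDERIV_shift[OF GDERIV_D[OF D(1)]]]]) auto
    show "continuous_on (UNIV \<times> cbox a b) (\<lambda>(x, y). \<psi> y *\<^sub>R D (x - y))"
      unfolding case_prod_beta'
      by (intro continuous_intros continuous_on_compose2[OF c\<psi>[of UNIV]] continuous_on_compose2[OF cD[of UNIV]]) auto
    show "continuous_on (cbox a b) (\<lambda>y. \<psi> y * \<kappa> (x - y))" for x
      by (intro continuous_intros c\<psi> continuous_on_compose2[OF c\<kappa>[of UNIV]]) auto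
  qed
  have "pderivative i ?F = (\<lambda>x. integral (cbox a b) (\<lambda>y. \<psi> y * D (x - y) $ i))" for i
  proof
    fix x
    have int: "(\<lambda>y. \<psi> y *\<^sub>R D (x - y)) integrable_on cbox a b"
      by (intro integrable_continuous continuous_intros c\<psi> continuous_on_compose2[OF cD[of UNIV]]) auto
    have "pderivative i ?F x = integral (cbox a b) (\<lambda>y. \<psi> y *\<^sub>R D (x - y)) $ i"
      by (rule GDERIV_pderivative[OF g])
    also have "\<dots> = integral (cbox a b) (\<lambda>y. (\<psi> y *\<^sub>R D (x - y)) $ i)"
      using integral_linear[OF int bounded_linear_vec_nth[of i]] by (simp add: o_def)
    finally show "pderivative i ?F x = integral (cbox a b) (\<lambda>y. \<psi> y * D (x - y) $ i)" by simp
  qed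
  moreover have "Ck_on k UNIV (\<lambda>x. integral (cbox a b) (\<lambda>y. \<psi> y * D (x - y) $ i))" for i
    by (rule Suc.IH[OF D(2)])
  moreover have "?F differentiable (at x)" for x
    using g[of x] unfolding gderiv_def differentiable_def by blast
  ultimately show ?case by simp
next
  case 0
  from bump_alg_C1[OF 0] obtain D where
    D: "C1_on UNIV \<kappa> D" by blast
  have c\<psi>: "continuous_on A \<psi>" for A
    using \<psi> continuous_on_subset by blast
  have c\<kappa>: "continuous_on A \<kappa>" for A
    by (rule bump_alg_continuous[OF 0])
  have "continuous_on UNIV (\<lambda>x. integral (cbox a b) (\<lambda>y. \<psi> y * \<kappa> (x - y)))"
    by (intro integral_continuous_on_param)
       (auto simp: case_prod_beta' intro!: continuous_intros continuous_on_compose2[OF c\<psi>[of UNIV]] continuous_on_compose2[OF c\<kappa>[of UNIV]])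
  then show ?case by simp
qed

text \<open>The convolution is written in two ways: with the shift on the kernel it is smooth, with
  the shift on \<psi> its gradient is an average of \<open>D\<close>. Uniform continuity of \<psi>
  and \<open>D\<close> makes function and gradient uniformly close at once.\<close>

lemma mollification:
  fixes \<psi> :: "real ^ 'n \<Rightarrow> real"
  assumes C1: "C1_on UNIV \<psi> D" and supp: "\<And>x. x \<notin> cball x0 r \<Longrightarrow> \<psi> x = 0"
    and r: "r < r'" "0 < r" and \<eta>: "0 < \<eta>"
  obtains \<phi> where "\<And>k. Ck_on k UNIV \<phi>" "\<And>x. x \<notin> cball x0 r' \<Longrightarrow> \<phi> x = 0"
    "\<And>x. \<bar>\<phi> x - \<psi> x\<bar> \<le> \<eta>" "\<And>x. norm (grad \<phi> x - D x) \<le> \<eta>"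
proof -
  have cD: "continuous_on A D" for A
    using C1 by (auto simp: C1_on_def intro: continuous_on_subset)
  have c\<psi>: "continuous_on A \<psi>" for A
    using C1_on_continuous[OF C1] continuous_on_subset by blast
  have D0: "D x = 0" if "x \<notin> cball x0 r" for x
    by (rule C1_on_outside_support[OF C1 closed_cball supp that])
  have "uniformly_continuous_on (cball x0 (r + 2)) \<psi>" "uniformly_continuous_on (cball x0 (r + 2)) D"
    by (auto intro!: compact_uniformly_continuous c\<psi> cD)
  note uc = this
  obtain d1 where d1: "d1 > 0" "\<And>x y. x \<in> cball x0 (r + 2) \<Longrightarrow> y \<in> cball x0 (r + 2) \<Longrightarrow> dist y x < d1 \<Longrightarrow> dist (\<psi> y) (\<psi> x) < \<eta>"
    using uniformly_continuous_onE[OF uc(1) \<eta>] by metis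
  obtain d2 where d2: "d2 > 0" "\<And>x y. x \<in> cball x0 (r + 2) \<Longrightarrow> y \<in> cball x0 (r + 2) \<Longrightarrow> dist y x < d2 \<Longrightarrow> dist (D y) (D x) < \<eta>"
    using uniformly_continuous_onE[OF uc(2) \<eta>] by metis
  \<comment> \<open>\<open>d1\<close> and \<open>d2\<close> give the closeness \<eta>; the bound 1
    keeps shifted points in the ball of radius r + 2 on which uniform continuity was taken; r' - r
    limits the spread of the support.\<close>
  define \<delta> where "\<delta> = min (min d1 d2) (min 1 (r' - r))"
  have \<delta>: "0 < \<delta>" "\<delta> \<le> d1" "\<delta> \<le> d2" "\<delta> \<le> 1" "\<delta> \<le> r' - r"
    using d1 d2 r by (auto simp: \<delta>_def)
  have close: "dist (\<psi> (x - z)) (\<psi> x) \<le> \<eta> \<and> dist (D (x - z)) (D x) \<le> \<eta>" if z: "norm z < \<delta>" for x z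
  proof (cases "x \<in> cball x0 (r + 1)")
    case True
    have "dist x0 (x - z) \<le> dist x0 x + norm z"
      using dist_triangle[of x0 "x - z" x] by (simp add: dist_norm)
    then have "x - z \<in> cball x0 (r + 2)" "x \<in> cball x0 (r + 2)" using True z \<delta> by auto
    moreover have "dist (x - z) x < \<delta>" using z by (simp add: dist_norm)
    ultimately show ?thesis using d1(2)[of x "x - z"] d2(2)[of x "x - z"] \<delta> by (simp add: less_eq_real_def)
  next
    case False
    have "dist x0 x \<le> dist x0 (x - z) + norm z"
      using dist_triangle[of x0 x "x - z"] by (simp add: dist_norm)
    then have "x - z \<notin> cball x0 r" "x \<notin> cball x0 r" using False z \<delta> by auto
    then show ?thesis using supp D0 \<eta> by simp
  qed
  let ?e = "\<delta>\<^sup>2"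
  define \<kappa>0 :: "real ^ 'n \<Rightarrow> real" where "\<kappa>0 = (\<lambda>z. beta 0 (?e - inner z z))"
  have ba0: "bump_alg ?e \<kappa>0" unfolding \<kappa>0_def by (rule bump_alg.base)
  have ck0: "continuous_on A \<kappa>0" for A by (rule bump_alg_continuous[OF ba0])
  have \<kappa>0nn: "0 \<le> \<kappa>0 z" for z by (simp add: \<kappa>0_def beta_def)
  have nrm: "norm z < \<delta> \<longleftrightarrow> inner z z < ?e" for z :: "real ^ 'n"
    using \<delta> by (simp add: dot_square_norm power_mono_iff not_le[symmetric] del: not_le)
  have \<kappa>0out: "\<kappa>0 z = 0" if "\<not> norm z < \<delta>" for z
    using that by (simp add: nrm \<kappa>0_def beta_def)
  define l u :: "real ^ 'n" where lu: "l = 0 - \<delta> *\<^sub>R One" "u = 0 + \<delta> *\<^sub>R One"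
  have box: "cball 0 \<delta> \<subseteq> cbox l u" unfolding lu by (rule cball_subset_cbox_One)
  have \<kappa>0box: "\<kappa>0 z = 0" if "z \<notin> cbox l u" for z
    by (rule \<kappa>0out) (use that box in \<open>auto simp: subset_iff\<close>)
  define c where "c = integral (cbox l u) \<kappa>0"
  have "c > 0"
  proof -
    have "0 \<le> c" unfolding c_def by (intro integral_nonneg integrable_continuous ck0 \<kappa>0nn)
    moreover have "c \<noteq> 0"
    proof
      assume "c = 0"
      moreover have "(\<kappa>0 has_integral c) (cbox l u)"
        unfolding c_def by (intro integrable_integral integrable_continuous ck0)
      ultimately have "(\<kappa>0 has_integral 0) (cbox l u)" by simp
      then have "\<kappa>0 0 = 0"
        by (rule has_integral_0_cbox_imp_0[OF ck0 \<kappa>0nn])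
           (use \<delta> in \<open>auto simp: lu mem_box box_ne_empty inner_Basis\<close>)
      then show False using \<delta> by (simp add: \<kappa>0_def beta_def)
    qed
    ultimately show ?thesis by simp
  qed
  define \<kappa> where "\<kappa> = (\<lambda>z. inverse c * \<kappa>0 z)"
  have ba: "bump_alg ?e \<kappa>" unfolding \<kappa>_def by (intro bump_alg.cmult ba0)
  have ck: "continuous_on A \<kappa>" for A by (rule bump_alg_continuous[OF ba])
  have \<kappa>nn: "0 \<le> \<kappa> z" for z using \<kappa>0nn \<open>c > 0\<close> by (simp add: \<kappa>_def)
  have \<kappa>out: "\<kappa> z = 0" if "\<not> norm z < \<delta>" for z using \<kappa>0out[OF that] by (simp add: \<kappa>_def)
  have \<kappa>1: "integral (cbox l u) \<kappa> = 1"
    using \<open>c > 0\<close> unfolding \<kappa>_def integral_mult_right c_def[symmetric] by (rule left_inverse[OF less_imp_neq[symmetric]])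
  let ?a = "x0 - r *\<^sub>R One" and ?b = "x0 + r *\<^sub>R One"
  define \<phi> where "\<phi> = (\<lambda>x. integral (cbox ?a ?b) (\<lambda>y. \<psi> y * \<kappa> (x - y)))"
  have \<phi>2: "\<phi> x = integral (cbox l u) (\<lambda>z. \<psi> (x - z) * \<kappa> z)" for x
  proof -
    have "\<phi> x = (\<integral>y. \<psi> y * \<kappa> (x - y) \<partial>lborel)"
      unfolding \<phi>_def
    proof (rule integral_cbox_lborel)
      show "continuous_on UNIV (\<lambda>y. \<psi> y * \<kappa> (x - y))"
        by (intro continuous_intros c\<psi> continuous_on_compose2[OF ck[of UNIV]]) auto
      show "\<psi> y * \<kappa> (x - y) = 0" if "y \<notin> cbox ?a ?b" for y
      proof -
        have "y \<notin> cball x0 r" using that cball_subset_cbox_One[of x0 r] by blast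
        then show ?thesis using supp by simp
      qed
    qed
    also have "\<dots> = (\<integral>z. \<psi> (x - z) * \<kappa> (x - (x - z)) \<partial>lborel)"
      by (rule lborel_integral_reflect)
         (intro continuous_intros c\<psi> continuous_on_compose2[OF ck[of UNIV]], auto)
    also have "\<dots> = (\<integral>z. \<psi> (x - z) * \<kappa> z \<partial>lborel)" by simp
    also have "\<dots> = integral (cbox l u) (\<lambda>z. \<psi> (x - z) * \<kappa> z)"
    proof (rule integral_cbox_lborel[symmetric])
      show "continuous_on UNIV (\<lambda>z. \<psi> (x - z) * \<kappa> z)"
        by (intro continuous_intros ck continuous_on_compose2[OF c\<psi>[of UNIV]]) auto
      show "\<psi> (x - z) * \<kappa> z = 0" if "z \<notin> cbox l u" for z
        using \<kappa>0box[OF that] by (simp add: \<kappa>_def)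
    qed
    finally show ?thesis .
  qed
  have g: "GDERIV \<phi> x :> integral (cbox l u) (\<lambda>z. \<kappa> z *\<^sub>R D (x - z))" for x
    unfolding \<phi>2
  proof (rule GDERIV_integral_cbox)
    show "GDERIV (\<lambda>x. \<psi> (x - z) * \<kappa> z) x :> \<kappa> z *\<^sub>R D (x - z)" for x z
      by (rule GDERIV_subst[OF GDERIV_mult[OF GDERIV_shift[OF GDERIV_D[OF C1]] GDERIV_const]]) auto
    show "continuous_on (UNIV \<times> cbox l u) (\<lambda>(x, z). \<kappa> z *\<^sub>R D (x - z))"
      unfolding case_prod_beta'
      by (intro continuous_intros continuous_on_compose2[OF ck[of UNIV]] continuous_on_compose2[OF cD[of UNIV]]) auto
    show "continuous_on (cbox l u) (\<lambda>z. \<psi> (x - z) * \<kappa> z)" for x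
      by (intro continuous_intros ck continuous_on_compose2[OF c\<psi>[of UNIV]]) auto
  qed
  \<comment> \<open>Averaging against a kernel of integral 1 supported in |z| < \<delta>. The range
    is any Euclidean space, so that the claim serves both \<psi> and its gradient.\<close>
  have av: "norm (integral (cbox l u) (\<lambda>z. \<kappa> z *\<^sub>R F (x - z)) - F x) \<le> \<eta>"
    if F: "\<And>A. continuous_on A F" "\<And>z. norm z < \<delta> \<Longrightarrow> dist (F (x - z)) (F x) \<le> \<eta>"
    for F :: "real ^ 'n \<Rightarrow> 'b::euclidean_space" and x
  proof -
    have i1: "(\<lambda>z. \<kappa> z *\<^sub>R F (x - z)) integrable_on cbox l u"
      by (intro integrable_continuous continuous_intros ck continuous_on_compose2[OF F(1)[of UNIV]]) auto
    have i2: "(\<lambda>z. \<kappa> z *\<^sub>R F x) integrable_on cbox l u"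
      by (intro integrable_continuous continuous_intros ck)
    have "integral (cbox l u) (\<lambda>z. \<kappa> z *\<^sub>R F x) = F x"
      using integral_linear[of \<kappa> "cbox l u" "\<lambda>t. t *\<^sub>R F x"] integrable_continuous[OF ck] \<kappa>1
      by (simp add: o_def bounded_linear_scaleR_left)
    then have "norm (integral (cbox l u) (\<lambda>z. \<kappa> z *\<^sub>R F (x - z)) - F x)
       = norm (integral (cbox l u) (\<lambda>z. \<kappa> z *\<^sub>R F (x - z) - \<kappa> z *\<^sub>R F x))"
      by (simp add: Henstock_Kurzweil_Integration.integral_diff[OF i1 i2])
    also have "\<dots> \<le> integral (cbox l u) (\<lambda>z. \<kappa> z * \<eta>)"
    proof (rule integral_norm_bound_integral)
      show "(\<lambda>z. \<kappa> z *\<^sub>R F (x - z) - \<kappa> z *\<^sub>R F x) integrable_on cbox l u"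
        by (intro integrable_diff i1 i2)
      show "(\<lambda>z. \<kappa> z * \<eta>) integrable_on cbox l u"
        by (intro integrable_continuous continuous_intros ck)
      show "norm (\<kappa> z *\<^sub>R F (x - z) - \<kappa> z *\<^sub>R F x) \<le> \<kappa> z * \<eta>" for z
      proof (cases "norm z < \<delta>")
        case True
        then show ?thesis
          using F(2)[OF True] \<kappa>nn[of z]
          by (simp add: scaleR_diff_right[symmetric] dist_norm mult_left_mono)
      qed (simp add: \<kappa>out)
    qed
    also have "\<dots> = \<eta>" using \<kappa>1 by simp
    finally show ?thesis .
  qed
  show ?thesis
  proof (rule that[of \<phi>])
    show "Ck_on k UNIV \<phi>" for k
      unfolding \<phi>_def by (rule Ck_on_convolution[OF c\<psi> ba])
    show "\<phi> x = 0" if "x \<notin> cball x0 r'" for x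
    proof -
      have "\<psi> (x - z) * \<kappa> z = 0" for z
      proof (cases "norm z < \<delta>")
        case True
        have "dist x0 x \<le> dist x0 (x - z) + dist (x - z) x" by (rule dist_triangle)
        then have "x - z \<notin> cball x0 r" using that True \<delta> by (auto simp: dist_norm)
        then show ?thesis using supp by simp
      qed (simp add: \<kappa>out)
      then have eq: "(\<lambda>z. \<psi> (x - z) * \<kappa> z) = (\<lambda>z. 0)" by (rule ext)
      show ?thesis unfolding \<phi>2 eq by simp
    qed
    show "\<bar>\<phi> x - \<psi> x\<bar> \<le> \<eta>" for x
      using av[of \<psi> x] c\<psi> close[of _ x] by (simp add: \<phi>2 mult.commute)
    show "norm (grad \<phi> x - D x) \<le> \<eta>" for x
      using av[of D x] cD close[of _ x] by (simp add: GDERIV_grad[OF g])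
  qed
qed

section \<open>Covering and chaining\<close>

text \<open>Vitali's selection: the small balls are disjoint, so their
  \<open>\<Gamma>\<close>-masses add up to at most the total mass, while the fivefold balls still
  cover \<open>E\<close>. The radius may depend on the point in an arbitrary way.\<close>

lemma Vitali_emeasure_bound:
  fixes \<nu> \<Gamma> :: "'a::euclidean_space measure"
  assumes sets: "sets borel \<subseteq> sets \<nu>" "sets borel \<subseteq> sets \<Gamma>" and E: "E \<in> sets \<nu>"
    and cov: "\<And>x. x \<in> E \<Longrightarrow> \<exists>r. 0 < r \<and> r \<le> R \<and> emeasure \<nu> (ball x (5 * r)) \<le> K * emeasure \<Gamma> (ball x r)"
  shows "emeasure \<nu> E \<le> K * emeasure \<Gamma> (space \<Gamma>)"
proof -
  obtain r where r: "\<And>x. x \<in> E \<Longrightarrow> 0 < r x \<and> r x \<le> R"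
      "\<And>x. x \<in> E \<Longrightarrow> emeasure \<nu> (ball x (5 * r x)) \<le> K * emeasure \<Gamma> (ball x (r x))"
    using cov by metis
  have "E \<subseteq> (\<Union>x\<in>E. ball x (r x))" using r by force
  note cov' = this
  obtain C where C: "countable C" "C \<subseteq> E"
      "pairwise (\<lambda>i j. disjnt (ball i (r i)) (ball j (r j))) C"
      "E \<subseteq> (\<Union>i\<in>C. ball i (5 * r i))"
    by (rule Vitali_covering_lemma_balls[where a="\<lambda>x. x" and B=R, OF cov' r(1)]) blast+
  \<comment> \<open>The selected centres are reindexed by natural numbers, with the empty set at all
    other indices, in order to use (sub)additivity along sequences.\<close>
  define f where "f = to_nat_on C"
  have inj: "inj_on f C" unfolding f_def by (rule inj_on_to_nat_on[OF C(1)])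
  define g where "g = inv_into C f"
  have g: "g n \<in> C" "f (g n) = n" if "n \<in> f ` C" for n
    using that by (auto simp: g_def inv_into_into f_inv_into_f)
  have gf: "g (f x) = x" if "x \<in> C" for x using inj that by (simp add: g_def)
  define A where "A = (\<lambda>n. if n \<in> f ` C then ball (g n) (5 * r (g n)) else {})"
  define B where "B = (\<lambda>n. if n \<in> f ` C then ball (g n) (r (g n)) else {})"
  have mA: "range A \<subseteq> sets \<nu>" using sets by (auto simp: A_def)
  have mB: "range B \<subseteq> sets \<Gamma>" using sets by (auto simp: B_def)
  have disj: "disjoint_family B"
    unfolding disjoint_family_on_def
  proof (intro ballI impI)
    fix m n :: nat assume "m \<noteq> n"
    show "B m \<inter> B n = {}"
    proof (cases "m \<in> f ` C \<and> n \<in> f ` C")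
      case True
      then have "g m \<noteq> g n" using g \<open>m \<noteq> n\<close> by metis
      then have "disjnt (ball (g m) (r (g m))) (ball (g n) (r (g n)))"
        using C(3) g True unfolding pairwise_def by blast
      then show ?thesis using True by (simp add: B_def disjnt_def)
    qed (auto simp: B_def)
  qed
  have "E \<subseteq> (\<Union>n. A n)"
  proof
    fix x assume "x \<in> E"
    then obtain i where "i \<in> C" "x \<in> ball i (5 * r i)" using C(4) by blast
    then have "x \<in> A (f i)" using gf by (simp add: A_def)
    then show "x \<in> (\<Union>n. A n)" by blast
  qed
  then have "emeasure \<nu> E \<le> emeasure \<nu> (\<Union>n. A n)"
    using mA by (intro emeasure_mono) auto
  also have "\<dots> \<le> (\<Sum>n. emeasure \<nu> (A n))"
    using mA by (rule emeasure_subadditive_countably)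
  also have "\<dots> \<le> (\<Sum>n. K * emeasure \<Gamma> (B n))"
    using r(2) g C(2) by (intro suminf_le) (auto simp: A_def B_def)
  also have "\<dots> = K * emeasure \<Gamma> (\<Union>n. B n)"
    using suminf_emeasure[OF mB disj] by (simp add: ennreal_suminf_cmult)
  also have "\<dots> \<le> K * emeasure \<Gamma> (space \<Gamma>)"
    by (intro mult_left_mono emeasure_space) auto
  finally show ?thesis .
qed

text \<open>The bound depends neither on the peak \<open>j\<close> nor on the length
  \<open>n\<close>; this lets the stopping index vary from point to point.\<close>

lemma two_sided_geometric_sum:
  fixes r s :: real
  assumes "0 < r" "r < 1" "0 < s" "s < 1"
  shows "(\<Sum>i<n. if j \<le> i then r ^ (i - j) else s ^ (j - i)) \<le> 1 / (1 - r) + 1 / (1 - s)"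
proof -
  have geo: "(\<Sum>i<n. x ^ i) \<le> 1 / (1 - x)" if "0 < x" "x < 1" for x :: real and n
    using that by (simp add: sum_gp_strict divide_right_mono)
  let ?f = "\<lambda>i. if j \<le> i then r ^ (i - j) else s ^ (j - i)"
  have "(\<Sum>i<n. ?f i) \<le> (\<Sum>i<j + n. ?f i)"
    using assms by (intro sum_mono2) auto
  also have "\<dots> = (\<Sum>i<j. ?f i) + (\<Sum>i<n. ?f (j + i))"
    by (induction n) (auto simp: add.assoc)
  also have "(\<Sum>i<n. ?f (j + i)) = (\<Sum>i<n. r ^ i)" by simp
  also have "\<dots> \<le> 1 / (1 - r)" using assms by (intro geo) auto
  also have "(\<Sum>i<j. ?f i) \<le> (\<Sum>i<j. s ^ (j - Suc i))"
    using assms by (intro sum_mono) (auto intro!: power_decreasing)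
  also have "\<dots> = (\<Sum>i<j. s ^ i)" by (rule sum.nat_diff_reindex)
  also have "\<dots> \<le> 1 / (1 - s)" using assms by (intro geo) auto
  finally show ?thesis by simp
qed

text \<open>The stopping index \<open>j\<close> is chosen by \<open>W j \<approx> (\<Gamma> powr (1 / p) / \<mu>) powr q\<close>; the weights
  \<open>\<omega>\<close> decay geometrically on both sides of \<open>j\<close>, which excludes the terms before \<open>j\<close>.\<close>

lemma critical_chain:
  fixes p q \<theta> \<gamma> C :: real
  assumes pq: "0 < p" "p < q" and \<theta>: "0 < \<theta>" "\<theta> < 1" and \<gamma>: "1 \<le> \<gamma>" and C: "0 < C"
  obtains K where "0 < K"
    "\<And>(W :: nat \<Rightarrow> real) G a \<Gamma> \<mu> n.
      (\<And>i. 0 < W i) \<Longrightarrow> (\<And>i. W (Suc i) \<le> \<theta> * W i) \<Longrightarrow> (\<And>i. W i \<le> \<gamma> * W (Suc i)) \<Longrightarrow>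
      (\<And>i. 0 \<le> G i) \<Longrightarrow> (\<And>i. G i \<le> \<Gamma>) \<Longrightarrow> 0 < \<mu> \<Longrightarrow>
      (\<And>i. a i \<le> C * W i powr (- 1 / q) * G i powr (1 / p)) \<Longrightarrow> \<mu> < (\<Sum>i<n. a i) \<Longrightarrow>
      \<exists>i. W i \<le> K * \<mu> powr (- q) * \<Gamma> powr ((q - p) / p) * G i"
proof -
  have q: "0 < q" using pq by simp
  \<comment> \<open>Chosen so that \<tau> + 1/q = 1/p: past the stopping index the powers of
    \<open>W i\<close> add up to exactly 1/p.\<close>
  define \<tau> where "\<tau> = 1 / p - 1 / q"
  have \<tau>: "0 < \<tau>" using pq by (simp add: \<tau>_def field_simps)
  have \<tau>p: "\<tau> * p * q = q - p" "q * \<tau> = (q - p) / p" using pq q by (auto simp: \<tau>_def field_simps)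
  define r where "r = \<theta> powr \<tau>"
  define s where "s = \<theta> powr (1 / q)"
  have rs: "0 < r" "r < 1" "0 < s" "s < 1"
    using \<theta> \<tau> q powr_less_mono2[of \<tau> \<theta> 1] powr_less_mono2[of "1 / q" \<theta> 1] by (auto simp: r_def s_def)
  \<comment> \<open>Normalises the weights \<omega> defined below, so that their sum is at most 1
    for all \<open>j\<close> and \<open>n\<close>.\<close>
  define c where "c = 1 / (1 / (1 - r) + 1 / (1 - s))"
  have c: "0 < c" using rs by (simp add: c_def add_pos_pos)
  define K where "K = (C / c) powr q * \<gamma> powr (\<tau> * p)"
  have "0 < K" using C c \<gamma> by (simp add: K_def)
  moreover have "\<exists>i. W i \<le> K * \<mu> powr (- q) * \<Gamma> powr ((q - p) / p) * G i"
    if W: "\<And>i. 0 < W i" "\<And>i. W (Suc i) \<le> \<theta> * W i" "\<And>i. W i \<le> \<gamma> * W (Suc i)"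
      and G: "\<And>i. 0 \<le> G i" "\<And>i. G i \<le> \<Gamma>" and \<mu>: "0 < \<mu>"
      and a: "\<And>i. a i \<le> C * W i powr (- 1 / q) * G i powr (1 / p)"
      and sum: "\<mu> < (\<Sum>i<n. a i)" for W G a :: "nat \<Rightarrow> real" and \<Gamma> \<mu> :: real and n
  proof -
    have \<Gamma>: "0 < \<Gamma>"
    proof (rule ccontr)
      assume "\<not> 0 < \<Gamma>"
      then have "G i = 0" for i using G[of i] by simp
      then have "a i \<le> 0" for i using a[of i] by simp
      then have "(\<Sum>i<n. a i) \<le> 0" by (rule sum_nonpos)
      then show False using sum \<mu> by simp
    qed
    define b where "b = C * \<Gamma> powr (1 / p) / (c * \<mu>)"
    have b: "0 < b" using C \<Gamma> c \<mu> by (simp add: b_def)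
    \<comment> \<open>The factor \<gamma> pays for one doubling step: minimality of \<open>j\<close>
      together with \<open>W (j - 1) \<le> \<gamma> * W j\<close> gives
      \<open>b powr q \<le> W j\<close> when j > 0, besides \<open>W j \<le> t\<close>.\<close>
    define t where "t = \<gamma> * b powr q"
    have t: "0 < t" using b \<gamma> by (simp add: t_def)
    have Wexp: "W (j + m) \<le> \<theta> ^ m * W j" for j m
    proof (induction m)
      case (Suc m)
      have "W (j + Suc m) \<le> \<theta> * W (j + m)" using W(2)[of "j + m"] by simp
      also have "\<dots> \<le> \<theta> * (\<theta> ^ m * W j)" using Suc \<theta> by (intro mult_left_mono) auto
      finally show ?case by simp
    qed simp
    have "\<exists>j. W j \<le> t"
    proof -
      obtain m where m: "\<theta> ^ m < t / W 0"
        using real_arch_pow_inv[of "t / W 0" \<theta>] t W(1)[of 0] \<theta> by auto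
      have "W m \<le> \<theta> ^ m * W 0" using Wexp[of 0 m] by simp
      also have "\<dots> \<le> t" using m W(1)[of 0] by (simp add: field_simps)
      finally show ?thesis by blast
    qed
    then obtain j where j: "W j \<le> t" "\<And>i. i < j \<Longrightarrow> t < W i"
      using exists_least_iff[of "\<lambda>j. W j \<le> t"] by (auto simp: not_le)
    define \<omega> where "\<omega> = (\<lambda>i. if j \<le> i then c * (W i / W j) powr \<tau> else c * (W j / W i) powr (1 / q))"
    have "\<omega> i \<le> c * (if j \<le> i then r ^ (i - j) else s ^ (j - i))" for i
    proof (cases "j \<le> i")
      case True
      have "W i / W j \<le> \<theta> ^ (i - j)"
        using Wexp[of j "i - j"] True W(1)[of j] by (simp add: field_simps)
      then have "(W i / W j) powr \<tau> \<le> (\<theta> ^ (i - j)) powr \<tau>"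
        using W(1) \<tau> by (intro powr_mono2) (auto simp: less_imp_le)
      also have "\<dots> = r ^ (i - j)"
        using \<theta> by (simp add: r_def powr_realpow[symmetric] powr_powr mult.commute)
      finally show ?thesis using True c by (simp add: \<omega>_def)
    next
      case False
      have "W j / W i \<le> \<theta> ^ (j - i)"
        using Wexp[of i "j - i"] False W(1)[of i] by (simp add: field_simps)
      then have "(W j / W i) powr (1 / q) \<le> (\<theta> ^ (j - i)) powr (1 / q)"
        using W(1) q by (intro powr_mono2) (auto simp: less_imp_le)
      also have "\<dots> = s ^ (j - i)"
        using \<theta> by (simp add: s_def powr_realpow[symmetric] powr_powr mult.commute)
      finally show ?thesis using False c by (simp add: \<omega>_def)
    qed
    then have "(\<Sum>i<n. \<omega> i) \<le> (\<Sum>i<n. c * (if j \<le> i then r ^ (i - j) else s ^ (j - i)))"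
      by (rule sum_mono)
    also have "\<dots> \<le> c * (1 / (1 - r) + 1 / (1 - s))"
      using two_sided_geometric_sum[OF rs] c by (simp add: sum_distrib_left[symmetric])
    also have "\<dots> = 1"
    proof -
      have "0 < 1 / (1 - r) + 1 / (1 - s)" using rs by (intro add_pos_pos) auto
      then show ?thesis by (simp add: c_def)
    qed
    finally have "(\<Sum>i<n. \<mu> * \<omega> i) < (\<Sum>i<n. a i)"
      using \<mu> sum by (simp add: sum_distrib_left[symmetric]) (smt (verit) mult_left_le)
    \<comment> \<open>Pigeonhole: the \<open>a i\<close> sum to more than \<mu>, the numbers
      \<open>\<mu> * \<omega> i\<close> to at most \<mu>.\<close>
    then obtain i where i: "\<mu> * \<omega> i < a i"
      by (meson not_le sum_mono)
    then have i': "\<mu> * \<omega> i < C * W i powr (- 1 / q) * G i powr (1 / p)"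
      using a[of i] by simp
    have "j \<le> i"
    proof (rule ccontr)
      \<comment> \<open>Before the stopping index the crude bound \<open>G i \<le> \<Gamma>\<close>
        already contradicts the choice of \<open>b\<close>.\<close>
      assume "\<not> j \<le> i"
      then have ij: "i < j" by simp
      have "\<mu> * (c * (W j / W i) powr (1 / q)) < C * W i powr (- 1 / q) * G i powr (1 / p)"
        using i' ij by (simp add: \<omega>_def)
      also have "\<dots> \<le> C * W i powr (- 1 / q) * \<Gamma> powr (1 / p)"
        using C G pq by (intro mult_left_mono powr_mono2) auto
      finally have "\<mu> * (c * (W j powr (1 / q) / W i powr (1 / q))) < C * (1 / W i powr (1 / q)) * \<Gamma> powr (1 / p)"
        using W(1) by (simp add: powr_divide less_imp_le powr_minus_divide)
      then have "\<mu> * c * W j powr (1 / q) < C * \<Gamma> powr (1 / p)"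
        using W(1)[of i] by (simp add: field_simps)
      then have 1: "W j powr (1 / q) < b"
        using \<mu> c by (simp add: b_def field_simps)
      have "t < W (j - 1)" using j(2)[of "j - 1"] ij by simp
      also have "\<dots> \<le> \<gamma> * W j" using W(3)[of "j - 1"] ij by simp
      finally have "b powr q \<le> W j" using \<gamma> by (simp add: t_def)
      then have "(b powr q) powr (1 / q) \<le> W j powr (1 / q)"
        using q by (intro powr_mono2) auto
      then show False using 1 q b by (simp add: powr_powr)
    qed
    \<comment> \<open>From the stopping index on, the actual \<open>G i\<close> is kept and only
      \<open>W j\<close> is replaced, by its upper bound \<open>t\<close>; solving for
      \<open>W i\<close> produces \<open>K\<close>.\<close>
    then have "\<mu> * (c * (W i / W j) powr \<tau>) < C * W i powr (- 1 / q) * G i powr (1 / p)"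
      using i' by (simp add: \<omega>_def)
    then have "\<mu> * c * W i powr (\<tau> + 1 / q) < C * W j powr \<tau> * G i powr (1 / p)"
      using W(1)[of i] W(1)[of j]
      by (simp add: powr_divide powr_add powr_minus_divide less_imp_le field_simps)
    also have "\<dots> \<le> C * t powr \<tau> * G i powr (1 / p)"
      using C j(1) W(1)[of j] \<tau> by (intro mult_right_mono mult_left_mono powr_mono2) (auto simp: less_imp_le)
    finally have "W i powr (1 / p) \<le> (C / (c * \<mu>)) * t powr \<tau> * G i powr (1 / p)"
      using \<mu> c by (simp add: \<tau>_def field_simps)
    then have "(W i powr (1 / p)) powr p \<le> ((C / (c * \<mu>)) * t powr \<tau> * G i powr (1 / p)) powr p"
      using pq by (intro powr_mono2) auto
    then have "W i \<le> (C / (c * \<mu>)) powr p * t powr (\<tau> * p) * G i"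
      using pq W(1)[of i] G(1)[of i] by (simp only: powr_mult powr_powr) simp
    also have "(C / (c * \<mu>)) powr p * t powr (\<tau> * p) = K * \<mu> powr (- q) * \<Gamma> powr ((q - p) / p)"
    proof -
      have b': "b = (C / c) * inverse \<mu> * \<Gamma> powr (1 / p)"
        by (simp add: b_def divide_inverse mult_ac)
      have "t powr (\<tau> * p) = \<gamma> powr (\<tau> * p) * b powr (q - p)"
        using \<gamma> b \<tau>p by (simp add: t_def powr_mult powr_powr mult_ac)
      also have "b powr (q - p) = (C / c) powr (q - p) * (inverse \<mu>) powr (q - p) * \<Gamma> powr ((q - p) / p)"
        unfolding b' by (simp only: powr_mult powr_powr) simp
      finally have "(C / (c * \<mu>)) powr p * t powr (\<tau> * p)
        = ((C / c) powr p * (inverse \<mu>) powr p) * (\<gamma> powr (\<tau> * p) * ((C / c) powr (q - p) * (inverse \<mu>) powr (q - p) * \<Gamma> powr ((q - p) / p)))"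
        using C c \<mu> powr_mult[of "C / c" "inverse \<mu>" p] by (simp add: divide_inverse mult_ac)
      also have "\<dots> = ((C / c) powr p * (C / c) powr (q - p)) * \<gamma> powr (\<tau> * p)
          * ((inverse \<mu>) powr p * (inverse \<mu>) powr (q - p)) * \<Gamma> powr ((q - p) / p)"
        by (simp only: mult_ac)
      also have "\<dots> = K * (inverse \<mu>) powr q * \<Gamma> powr ((q - p) / p)"
        by (simp add: powr_add[symmetric] K_def)
      also have "(inverse \<mu>) powr q = \<mu> powr (- q)"
        using \<mu> by (simp add: powr_minus inverse_powr)
      finally show ?thesis .
    qed
    finally show ?thesis by blast
  qed
  ultimately show ?thesis by (rule that)
qed

section \<open>Truncated power functions\<close>

lemma ex_antiderivative:
  fixes f :: "real \<Rightarrow> real"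
  assumes "continuous_on UNIV f"
  obtains F where "F 0 = 0" "\<And>x. DERIV F x :> f x"
proof -
  have "\<exists>F. \<forall>x::real. - \<infinity> < ereal x \<longrightarrow> ereal x < \<infinity> \<longrightarrow> (F has_vector_derivative f x) (at x)"
    by (rule einterval_antiderivative) (use assms in \<open>auto simp: continuous_on_eq_continuous_at\<close>)
  then obtain F where F: "\<And>x. DERIV F x :> f x"
    by (auto simp: has_real_derivative_iff_has_vector_derivative)
  have "DERIV (\<lambda>x. F x - F 0) x :> f x" for x
    using DERIV_diff[OF F DERIV_const] by simp
  then show ?thesis using that[of "\<lambda>x. F x - F 0"] by simp
qed

lemma antiderivative_bound:
  fixes F f :: "real \<Rightarrow> real"
  assumes "F 0 = 0" "\<And>x. DERIV F x :> f x" "\<And>s. \<bar>s\<bar> \<le> \<bar>t\<bar> \<Longrightarrow> \<bar>f s\<bar> \<le> B"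
  shows "\<bar>F t\<bar> \<le> \<bar>t\<bar> * B"
proof -
  have "norm (F t - F 0) \<le> B * norm (t - 0)"
    by (rule field_differentiable_bound[where S="{- \<bar>t\<bar>..\<bar>t\<bar>}" and f'=f])
       (use assms in \<open>auto intro: has_field_derivative_at_within\<close>)
  then show ?thesis using assms by (simp add: mult.commute)
qed

text \<open>Here G' = (V')^p, so that testing with \<open>\<eta> powr p * G u\<close> produces the
  p-th power of the gradient part of \<open>\<eta> * V u\<close>. As antiderivatives both are C^1
  although the truncation has corners, and for fixed \<open>l\<close> their derivatives are bounded,
  as the chain rule for Sobolev functions requires. The last two bounds make V interchangeable with
  the explicit W.\<close>

lemma truncated_powers:
  fixes k l \<gamma> p :: real
  assumes k: "0 < k" "k \<le> l" and \<gamma>: "1 \<le> \<gamma>" and p: "0 < p"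
  defines "m \<equiv> \<lambda>t. min (\<bar>t\<bar> + k) l"
  defines "W \<equiv> \<lambda>t. (\<bar>t\<bar> + k) * m t powr (\<gamma> - 1)"
  obtains G V where "\<And>t. DERIV G t :> m t powr ((\<gamma> - 1) * p)" "\<And>t. DERIV V t :> m t powr (\<gamma> - 1)"
    "\<And>t. \<bar>G t\<bar> \<le> (\<bar>t\<bar> + k) * m t powr ((\<gamma> - 1) * p)" "\<And>t. \<bar>V t\<bar> \<le> W t"
    "\<And>t. W t \<le> \<gamma> * \<bar>V t\<bar> + k powr \<gamma>"
proof -
  have m0: "0 < m t" for t using k by (simp add: m_def)
  have mmono: "m s \<le> m t" if "\<bar>s\<bar> \<le> \<bar>t\<bar>" for s t using that by (auto simp: m_def)
  have cont: "continuous_on UNIV (\<lambda>t. m t powr r)" for r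
    unfolding m_def by (intro continuous_on_powr continuous_intros) (use k in \<open>auto simp: min_def\<close>)
  obtain G where G: "G 0 = 0" "\<And>t. DERIV G t :> m t powr ((\<gamma> - 1) * p)"
    using ex_antiderivative[OF cont] by blast
  obtain V where V: "V 0 = 0" "\<And>t. DERIV V t :> m t powr (\<gamma> - 1)"
    using ex_antiderivative[OF cont] by blast
  have G1: "\<bar>G t\<bar> \<le> \<bar>t\<bar> * m t powr ((\<gamma> - 1) * p)" for t
    by (rule antiderivative_bound[OF G])
       (use m0 mmono p \<gamma> in \<open>auto intro!: powr_mono2 simp: less_imp_le\<close>)
  have V1: "\<bar>V t\<bar> \<le> \<bar>t\<bar> * m t powr (\<gamma> - 1)" for t
    by (rule antiderivative_bound[OF V])
       (use m0 mmono p \<gamma> in \<open>auto intro!: powr_mono2 simp: less_imp_le\<close>)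
  \<comment> \<open>Stated for any such antiderivative, because negative arguments are treated by
    the reflection \<open>\<lambda>x. - V (- x)\<close>.\<close>
  have low: "W t \<le> \<gamma> * V t + k powr \<gamma>" if V: "V 0 = 0" "\<And>t. DERIV V t :> m t powr (\<gamma> - 1)" and "0 \<le> t"
    for V t
  proof -
    have cV: "continuous_on A V" for A
      using V(2) DERIV_isCont continuous_at_imp_continuous_on by blast
    \<comment> \<open>Below the truncation level both sides are the same power; above it V is affine
      with slope \<open>l powr (\<gamma> - 1)\<close>.\<close>
    have eq: "\<gamma> * V s + k powr \<gamma> = (s + k) powr \<gamma>" if s: "0 \<le> s" "s + k \<le> l" for s
    proof (cases "s = 0")
      case False
      then have "0 < s" using s by simp
      let ?D = "\<lambda>x. \<gamma> * V x - (x + k) powr \<gamma>"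
      have "?D s = ?D 0"
      proof (rule DERIV_isconst_end[OF \<open>0 < s\<close>])
        show "continuous_on {0..s} ?D"
          using k by (intro continuous_intros cV) auto
        show "DERIV ?D x :> 0" if "0 < x" "x < s" for x
        proof -
          have "DERIV (\<lambda>x. (x + k) powr \<gamma>) x :> \<gamma> * (x + k) powr (\<gamma> - 1) * 1"
            using that k by (auto intro!: derivative_eq_intros)
          moreover have "m x = x + k" using that s by (simp add: m_def)
          ultimately show ?thesis
            using DERIV_diff[OF DERIV_cmult[OF V(2), of \<gamma> x],
                where g="\<lambda>x. (x + k) powr \<gamma>" and E="\<gamma> * (x + k) powr (\<gamma> - 1)"] by simp
        qed
      qed
      then show ?thesis using V by simp
    qed (use V in simp)
    show ?thesis
    proof (cases "t + k \<le> l")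
      case True
      then have "W t = (t + k) * (t + k) powr (\<gamma> - 1)" using \<open>0 \<le> t\<close> k by (simp add: W_def m_def)
      also have "\<dots> = (t + k) powr \<gamma>" using \<open>0 \<le> t\<close> k by (simp add: powr_mult_base)
      finally show ?thesis using eq[OF \<open>0 \<le> t\<close> True] by simp
    next
      case False
      let ?s = "l - k"
      have st: "?s < t" "0 \<le> ?s" using False k by auto
      let ?D = "\<lambda>x. V x - l powr (\<gamma> - 1) * x"
      have "?D t = ?D ?s"
      proof (rule DERIV_isconst_end[OF st(1)])
        show "continuous_on {?s..t} ?D" by (intro continuous_intros cV)
        show "DERIV ?D x :> 0" if "?s < x" "x < t" for x
        proof -
          have "m x = l" using that st by (simp add: m_def)
          then show ?thesis
            using DERIV_diff[OF V(2)[of x] DERIV_cmult[OF DERIV_ident, of "l powr (\<gamma> - 1)"]] by simp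
        qed
      qed
      then have Vt: "V t = V ?s + l powr (\<gamma> - 1) * (t - ?s)" by (simp add: algebra_simps)
      have l1: "l * l powr (\<gamma> - 1) = l powr \<gamma>" using k by (simp add: powr_mult_base)
      have "W t = (t + k) * l powr (\<gamma> - 1)" using False \<open>0 \<le> t\<close> by (simp add: W_def m_def)
      also have "\<dots> = l powr \<gamma> + l powr (\<gamma> - 1) * (t - ?s)"
        using l1 by (simp add: algebra_simps)
      also have "\<dots> \<le> l powr \<gamma> + \<gamma> * (l powr (\<gamma> - 1) * (t - ?s))"
        using mult_right_mono[OF \<gamma>, of "l powr (\<gamma> - 1) * (t - ?s)"] st by simp
      also have "\<dots> = \<gamma> * V t + k powr \<gamma>"
        using eq[of ?s] st by (simp add: Vt algebra_simps)
      finally show ?thesis .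
    qed
  qed
  show ?thesis
  proof (rule that[OF G(2) V(2)])
    show "\<bar>G t\<bar> \<le> (\<bar>t\<bar> + k) * m t powr ((\<gamma> - 1) * p)" for t
      using G1[of t] k by (rule_tac order_trans) (auto intro!: mult_right_mono)
    show "\<bar>V t\<bar> \<le> W t" for t
      unfolding W_def using V1[of t] k by (rule_tac order_trans) (auto intro!: mult_right_mono)
    show "W t \<le> \<gamma> * \<bar>V t\<bar> + k powr \<gamma>" for t
    proof (cases "0 \<le> t")
      case True
      have "\<gamma> * V t \<le> \<gamma> * \<bar>V t\<bar>" using \<gamma> by (intro mult_left_mono) auto
      then show ?thesis using low[OF V True] by simp
    next
      case False
      have "DERIV (\<lambda>x. - V (- x)) x :> m x powr (\<gamma> - 1)" for x
      proof -
        have "DERIV (\<lambda>x. V (- x)) x :> m (- x) powr (\<gamma> - 1) * (- 1)"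
          by (rule DERIV_chain'[of uminus, OF _ V(2)]) (auto intro!: derivative_eq_intros)
        from DERIV_minus[OF this] show ?thesis by (simp add: m_def)
      qed
      then have "W (- t) \<le> \<gamma> * (- V t) + k powr \<gamma>"
        using low[of "\<lambda>x. - V (- x)" "- t"] V(1) False by simp
      moreover have "W (- t) = W t" by (simp add: W_def m_def)
      moreover have "\<gamma> * (- V t) \<le> \<gamma> * \<bar>V t\<bar>" using \<gamma> by (intro mult_left_mono) auto
      ultimately show ?thesis by simp
    qed
  qed
qed

section \<open>Doubling measures\<close>

text \<open>Weights are replaced by measures so that the covering lemma applies. Balls are tested
  only inside \<open>V\<close>, since across its boundary a cut-off weight need not be
  doubling.\<close>

definition doubling_on :: "('a::euclidean_space) set \<Rightarrow> real \<Rightarrow> 'a measure \<Rightarrow> bool"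
  where "doubling_on V \<gamma> M \<longleftrightarrow> finite_measure M \<and> sets M = sets lebesgue \<and> 1 \<le> \<gamma> \<and>
    (\<forall>x r. 0 < r \<and> ball x r \<subseteq> V \<longrightarrow> 0 < measure M (ball x r)) \<and>
    (\<forall>x r. 0 < r \<and> ball x (2 * r) \<subseteq> V \<longrightarrow> measure M (ball x (2 * r)) \<le> \<gamma> * measure M (ball x r))"

lemma doubling_onD:
  assumes "doubling_on V \<gamma> M"
  shows "finite_measure M" "sets M = sets lebesgue" "1 \<le> \<gamma>"
    "\<And>x r. 0 < r \<Longrightarrow> ball x r \<subseteq> V \<Longrightarrow> 0 < measure M (ball x r)"
    "\<And>x r. 0 < r \<Longrightarrow> ball x (2 * r) \<subseteq> V \<Longrightarrow> measure M (ball x (2 * r)) \<le> \<gamma> * measure M (ball x r)"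
  using assms by (auto simp: doubling_on_def)

lemma borel_in_lebesgue_like:
  assumes "sets M = sets lebesgue" "A \<in> sets borel"
  shows "A \<in> sets M"
  using assms by (simp add: sets_completionI_sets)

text \<open>Three doublings. The factor 8 suffices both for the fivefold balls of the covering
  argument and for the annulus argument below.\<close>

lemma doubling_on_ball8:
  assumes d: "doubling_on V \<gamma> M" and r: "0 < r" and sub: "ball x (8 * r) \<subseteq> V"
  shows "measure M (ball x (8 * r)) \<le> \<gamma> ^ 3 * measure M (ball x r)"
proof -
  have g: "1 \<le> \<gamma>" by (rule doubling_onD(3)[OF d])
  have "ball x (4 * r) \<subseteq> ball x (8 * r)" "ball x (2 * r) \<subseteq> ball x (8 * r)"
    using r by (auto intro!: subset_ball)
  then have "measure M (ball x (2 * (4 * r))) \<le> \<gamma> * measure M (ball x (4 * r))"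
    "measure M (ball x (2 * (2 * r))) \<le> \<gamma> * measure M (ball x (2 * r))"
    "measure M (ball x (2 * r)) \<le> \<gamma> * measure M (ball x r)"
    using r sub by (intro doubling_onD(5)[OF d]; auto)+
  then have 1: "measure M (ball x (8 * r)) \<le> \<gamma> * measure M (ball x (4 * r))"
    "measure M (ball x (4 * r)) \<le> \<gamma> * measure M (ball x (2 * r))"
    "measure M (ball x (2 * r)) \<le> \<gamma> * measure M (ball x r)" by simp_all
  have "measure M (ball x (8 * r)) \<le> \<gamma> * (\<gamma> * (\<gamma> * measure M (ball x r)))"
    using 1 g by (meson mult_left_mono order_trans zero_le_one)
  then show ?thesis by (simp add: power3_eq_cube mult.assoc)
qed

text \<open>The annulus around \<open>ball x r\<close> contains a ball of comparable measure.\<close>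

lemma reverse_doubling:
  fixes x :: "'a::euclidean_space"
  assumes d: "doubling_on V \<gamma> M" and r: "0 < r" and sub: "ball x (6 * r) \<subseteq> V"
  shows "measure M (ball x r) \<le> \<gamma> ^ 3 / (1 + \<gamma> ^ 3) * measure M (ball x (2 * r))"
proof -
  interpret finite_measure M by (rule doubling_onD(1)[OF d])
  have sets: "ball y s \<in> sets M" for y s
    by (rule borel_in_lebesgue_like[OF doubling_onD(2)[OF d]]) simp
  have g: "1 \<le> \<gamma>" by (rule doubling_onD(3)[OF d])
  obtain e :: 'a where e: "norm e = 1" using vector_choose_size[of 1] by auto
  \<comment> \<open>The ball of radius r/2 about \<open>y\<close> lies between the spheres of radii
    r and 2r about \<open>x\<close>, and its eightfold dilate contains
    \<open>ball x r\<close>.\<close>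
  define y where "y = x + (3 * r / 2) *\<^sub>R e"
  have dy: "dist x y = 3 * r / 2" using r e by (simp add: y_def dist_norm)
  have a: "ball y (r / 2) \<subseteq> ball x (2 * r)"
  proof
    fix z assume "z \<in> ball y (r / 2)"
    then show "z \<in> ball x (2 * r)" using dist_triangle[of x z y] dy by (simp add: dist_commute)
  qed
  have b: "ball y (r / 2) \<inter> ball x r = {}"
  proof -
    have "z \<notin> ball x r" if "z \<in> ball y (r / 2)" for z
      using dist_triangle[of x y z] dy that by (simp add: dist_commute)
    then show ?thesis by blast
  qed
  have c: "ball x r \<subseteq> ball y (8 * (r / 2))"
  proof
    fix z assume "z \<in> ball x r"
    then show "z \<in> ball y (8 * (r / 2))" using dist_triangle[of y z x] dy r by (simp add: dist_commute)
  qed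
  have "ball y (8 * (r / 2)) \<subseteq> ball x (6 * r)"
  proof
    fix z assume "z \<in> ball y (8 * (r / 2))"
    then show "z \<in> ball x (6 * r)" using dist_triangle[of x z y] dy r by (simp add: dist_commute)
  qed
  then have d8: "measure M (ball y (8 * (r / 2))) \<le> \<gamma> ^ 3 * measure M (ball y (r / 2))"
    using r sub by (intro doubling_on_ball8[OF d]) auto
  have "measure M (ball x r) \<le> measure M (ball y (8 * (r / 2)))"
    using c sets by (intro finite_measure_mono) auto
  then have 1: "measure M (ball x r) \<le> \<gamma> ^ 3 * measure M (ball y (r / 2))"
    using d8 by simp
  have "measure M (ball y (r / 2)) + measure M (ball x r) = measure M (ball y (r / 2) \<union> ball x r)"
    using b sets by (intro finite_measure_Union[symmetric]) auto
  also have "\<dots> \<le> measure M (ball x (2 * r))"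
    using a r sets by (intro finite_measure_mono) (auto intro: subset_ball[THEN subsetD])
  finally have 2: "measure M (ball y (r / 2)) \<le> measure M (ball x (2 * r)) - measure M (ball x r)" by simp
  have g3: "0 < \<gamma> ^ 3" using g by simp
  have "measure M (ball x r) \<le> \<gamma> ^ 3 * (measure M (ball x (2 * r)) - measure M (ball x r))"
    using 1 mult_left_mono[OF 2, of "\<gamma> ^ 3"] g3 by linarith
  then have "measure M (ball x r) * (1 + \<gamma> ^ 3) \<le> \<gamma> ^ 3 * measure M (ball x (2 * r))"
    by (simp add: algebra_simps)
  moreover have "0 < 1 + \<gamma> ^ 3" using g3 by linarith
  ultimately have "measure M (ball x r) \<le> \<gamma> ^ 3 * measure M (ball x (2 * r)) / (1 + \<gamma> ^ 3)"
    by (simp add: pos_le_divide_eq)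
  then show ?thesis by simp
qed

text \<open>By compactness finitely many balls of half the radius cover \<open>K\<close>; every ball
  of radius \<open>s\<close> centred in \<open>K\<close> contains one of them.\<close>

lemma measure_ball_lower_bound:
  fixes K :: "'a::euclidean_space set"
  assumes d: "doubling_on V \<gamma> M" and s: "0 < s" and K: "compact K" "\<And>x. x \<in> K \<Longrightarrow> ball x s \<subseteq> V"
  obtains c where "0 < c" "\<And>x. x \<in> K \<Longrightarrow> c \<le> measure M (ball x s)"
proof -
  interpret finite_measure M by (rule doubling_onD(1)[OF d])
  have sets: "ball y s \<in> sets M" for y s
    by (rule borel_in_lebesgue_like[OF doubling_onD(2)[OF d]]) simp
  have "K \<subseteq> (\<Union>x\<in>K. ball x (s / 2))" using s by force
  then obtain F where F: "F \<subseteq> K" "finite F" "K \<subseteq> (\<Union>x\<in>F. ball x (s / 2))"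
    using compactE_image[OF K(1), of K "\<lambda>x. ball x (s / 2)"] by (metis open_ball)
  define c where "c = Min (insert 1 ((\<lambda>x. measure M (ball x (s / 2))) ` F))"
  have pos: "0 < measure M (ball x (s / 2))" if "x \<in> F" for x
  proof -
    have "ball x (s / 2) \<subseteq> ball x s" using s by (intro subset_ball) auto
    then show ?thesis using K(2)[of x] that F(1) s by (intro doubling_onD(4)[OF d]) auto
  qed
  have "0 < c" unfolding c_def using F(2) pos by (subst Min_gr_iff) auto
  moreover have "c \<le> measure M (ball x s)" if x: "x \<in> K" for x
  proof -
    obtain y where y: "y \<in> F" "x \<in> ball y (s / 2)" using F(3) x by blast
    have "c \<le> measure M (ball y (s / 2))" unfolding c_def using F(2) y by (intro Min_le) auto
    also have "\<dots> \<le> measure M (ball x s)"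
    proof (intro finite_measure_mono sets subsetI)
      fix z assume "z \<in> ball y (s / 2)"
      then show "z \<in> ball x s" using dist_triangle[of x z y] y by (simp add: dist_commute)
    qed
    finally show ?thesis .
  qed
  ultimately show ?thesis by (rule that)
qed

section \<open>The weighted Sobolev inequality\<close>

definition mean :: "'a measure \<Rightarrow> 'a set \<Rightarrow> ('a \<Rightarrow> real) \<Rightarrow> real"
  where "mean M B f = (LINT y:B|M. f y) / measure M B"

lemma continuous_lebesgue_measurable:
  fixes f :: "'a::euclidean_space \<Rightarrow> 'b::topological_space"
  assumes "continuous_on UNIV f" "sets M = sets lebesgue"
  shows "f \<in> borel_measurable M"
proof -
  have "f \<in> borel_measurable borel" using assms(1) by (rule borel_measurable_continuous_onI)
  then have "f \<in> borel_measurable lebesgue" by (simp add: measurable_completion)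
  then show ?thesis using measurable_cong_sets[OF assms(2) refl] by blast
qed

lemma continuous_compact_support_bounded:
  fixes f :: "'a::euclidean_space \<Rightarrow> 'b::real_normed_vector"
  assumes "continuous_on UNIV f" "compact K" "\<And>x. x \<notin> K \<Longrightarrow> f x = 0"
  obtains B where "0 \<le> B" "\<And>x. norm (f x) \<le> B"
proof -
  have "compact (f ` K)" using assms continuous_on_subset by (blast intro: compact_continuous_image)
  then obtain B where B: "\<And>x. x \<in> K \<Longrightarrow> norm (f x) \<le> B"
    by (meson bounded_iff compact_imp_bounded image_eqI)
  have "norm (f x) \<le> max B 0" for x
    using B assms(3)[of x] by (cases "x \<in> K") (auto simp: le_max_iff_disj)
  then show ?thesis using that[of "max B 0"] by simp
qed

text \<open>A C^1 substitute for the piecewise linear truncation between the levels 1 and 2. Its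
  derivative is a tent function, and 1/8 is the integral of the tent over its rising half, from 1 to
  3/2.\<close>

lemma smooth_step:
  obtains S s :: "real \<Rightarrow> real" where "\<And>t. DERIV S t :> s t" "continuous_on UNIV s" "\<And>t. \<bar>s t\<bar> \<le> 1"
    "\<And>t. \<not> (1 < \<bar>t\<bar> \<and> \<bar>t\<bar> < 2) \<Longrightarrow> s t = 0" "\<And>t. \<bar>S t\<bar> \<le> \<bar>t\<bar>" "\<And>t. 2 \<le> \<bar>t\<bar> \<Longrightarrow> 1 / 8 \<le> \<bar>S t\<bar>"
proof -
  define s :: "real \<Rightarrow> real" where "s = (\<lambda>t. max 0 (min (\<bar>t\<bar> - 1) (2 - \<bar>t\<bar>)))"
  have cs: "continuous_on UNIV s" unfolding s_def by (intro continuous_intros)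
  obtain S where S: "S 0 = 0" "\<And>t. DERIV S t :> s t" using ex_antiderivative[OF cs] by blast
  have b: "\<bar>s t\<bar> \<le> 1" for t by (auto simp: s_def)
  have S1: "\<bar>S t\<bar> \<le> \<bar>t\<bar>" for t using antiderivative_bound[OF S, of t 1] b by simp
  have low: "1 / 8 \<le> F t" if F: "F 0 = 0" "\<And>t. DERIV F t :> s t" and t: "2 \<le> t" for F t
  proof -
    have mono: "F x \<le> F y" if "x \<le> y" for x y
    proof (rule DERIV_nonneg_imp_nondecreasing[OF that])
      fix z
      have "DERIV F z :> s z \<and> 0 \<le> s z" using F(2)[of z] by (simp add: s_def)
      then show "\<exists>y. DERIV F z :> y \<and> 0 \<le> y" by blast
    qed
    let ?D = "\<lambda>x. F x - (x - 1)\<^sup>2 / 2"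
    have "?D (3 / 2) = ?D 1"
    proof (rule DERIV_isconst_end[where f="?D"])
      show "continuous_on {1..3 / 2} ?D"
        by (intro continuous_intros continuous_at_imp_continuous_on ballI DERIV_isCont[OF F(2)]) auto
      fix x :: real assume x: "1 < x" "x < 3 / 2"
      have "DERIV (\<lambda>x. (x - 1)\<^sup>2 / 2) x :> x - 1" by (auto intro!: derivative_eq_intros)
      from DERIV_diff[OF F(2) this] show "DERIV ?D x :> 0" using x by (simp add: s_def)
    qed simp
    then have "F (3 / 2) = F 1 + 1 / 8" by (simp add: power2_eq_square)
    moreover have "0 \<le> F 1" using mono[of 0 1] F by simp
    moreover have "F (3 / 2) \<le> F t" using mono t by simp
    ultimately show ?thesis by simp
  qed
  have S8: "1 / 8 \<le> \<bar>S t\<bar>" if t: "2 \<le> \<bar>t\<bar>" for t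
  proof (cases "0 \<le> t")
    case True
    then show ?thesis using low[OF S, of t] t by simp
  next
    case False
    have "DERIV (\<lambda>x. - S (- x)) x :> s x" for x
    proof -
      have "DERIV (\<lambda>x. S (- x)) x :> s (- x) * (- 1)"
        by (rule DERIV_chain'[of uminus, OF _ S(2)]) (auto intro!: derivative_eq_intros)
      from DERIV_minus[OF this] show ?thesis by (simp add: s_def)
    qed
    then show ?thesis using low[of "\<lambda>x. - S (- x)" "- t"] S(1) False t by simp
  qed
  have "s t = 0" if "\<not> (1 < \<bar>t\<bar> \<and> \<bar>t\<bar> < 2)" for t using that by (auto simp: s_def)
  then show ?thesis by (rule that[OF S(2) cs b _ S1 S8])
qed

text \<open>The gradient is measured by \<open>M1\<close> and the function by \<open>M\<close>, and
  both may be the same measure. Only what the chain of averages uses is required: Poincare for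
  centres in \<open>K\<close>, radii up to \<open>R\<close> and functions vanishing off
  \<open>K\<close>, and balance along dyadic concentric balls. The factor 8 in \<open>room\<close>
  leaves space for eightfold balls.\<close>

locale sobolev_data =
  fixes M1 M :: "(real ^ 'n) measure" and V K :: "(real ^ 'n) set" and \<gamma>1 \<gamma> \<rho> R C1 C2 p q :: real
  assumes d1: "doubling_on V \<gamma>1 M1" and d: "doubling_on V \<gamma> M"
    and K: "compact K" and \<rho>: "1 \<le> \<rho>" and R: "0 < R"
    and room: "\<And>x. x \<in> K \<Longrightarrow> ball x (8 * \<rho> * R) \<subseteq> V"
    and pq: "1 < p" "p < q" and C12: "0 < C1" "0 < C2"
    and poincare: "\<And>\<psi> D x r. C1_on UNIV \<psi> D \<Longrightarrow> (\<And>y. y \<notin> K \<Longrightarrow> \<psi> y = 0) \<Longrightarrow> x \<in> K \<Longrightarrow> 0 < r \<Longrightarrow> r \<le> R \<Longrightarrow>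
      (LINT y:ball x r|M1. \<bar>\<psi> y - mean M1 (ball x r) \<psi>\<bar>) \<le> C1 * r * measure M1 (ball x r) *
       (measure (density M1 (\<lambda>y. ennreal (norm (D y) powr p))) (ball x (\<rho> * r)) / measure M1 (ball x (\<rho> * r))) powr (1 / p)"
    and balance: "\<And>x i. x \<in> K \<Longrightarrow> (1 / 2) ^ i *
        (measure M (ball x (\<rho> * (R * (1 / 2) ^ i))) / measure M (ball x (\<rho> * R))) powr (1 / q)
      \<le> C2 * (measure M1 (ball x (\<rho> * (R * (1 / 2) ^ i))) / measure M1 (ball x (\<rho> * R))) powr (1 / p)"
begin

sublocale m1: finite_measure M1 by (rule doubling_onD(1)[OF d1])
sublocale m: finite_measure M by (rule doubling_onD(1)[OF d])

lemma sets_M1: "sets M1 = sets lebesgue" and sets_M: "sets M = sets lebesgue"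
  using doubling_onD(2) d1 d by blast+

lemma borel_sets: "A \<in> sets borel \<Longrightarrow> A \<in> sets M1" "A \<in> sets borel \<Longrightarrow> A \<in> sets M"
  using borel_in_lebesgue_like sets_M1 sets_M by blast+

lemma space_M: "space M1 = UNIV" "space M = UNIV"
  using sets_eq_imp_space_eq[OF sets_M1] sets_eq_imp_space_eq[OF sets_M] by auto

definition rad :: "nat \<Rightarrow> real" where "rad i = R * (1 / 2) ^ i"

lemma rad: "0 < rad i" "rad i \<le> R" "rad (Suc i) = rad i / 2"
  using R by (auto simp: rad_def mult_le_cancel_left1 power_le_one)

lemma rad_0 [simp]: "rad 0 = R"
  by (simp add: rad_def)

lemma ball_sub: "x \<in> K \<Longrightarrow> t \<le> 8 * (\<rho> * R) \<Longrightarrow> ball x t \<subseteq> V"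
  using room subset_ball by (metis mult.assoc order_trans)

lemma rho_rad: "0 < \<rho> * rad i" "rad i \<le> \<rho> * rad i" "\<rho> * rad i \<le> \<rho> * R"
proof -
  show "0 < \<rho> * rad i" using rad(1)[of i] \<rho> by simp
  show "rad i \<le> \<rho> * rad i" using mult_right_mono[OF \<rho>, of "rad i"] rad(1)[of i] by simp
  show "\<rho> * rad i \<le> \<rho> * R" using rad(2) \<rho> by (intro mult_left_mono) auto
qed

lemma R_rho: "R \<le> \<rho> * R" "0 < \<rho> * R"
  using rho_rad(2)[of 0] rho_rad(1)[of 0] by simp_all

lemma ball_sub':
  assumes "x \<in> K"
  shows "ball x (rad i) \<subseteq> V" "ball x (\<rho> * rad i) \<subseteq> V" "s \<le> 8 * (\<rho> * rad i) \<Longrightarrow> ball x s \<subseteq> V"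
    "ball x (\<rho> * R) \<subseteq> V" "ball x R \<subseteq> V"
proof -
  show "ball x (rad i) \<subseteq> V" by (rule ball_sub[OF assms]) (use rho_rad[of i] R_rho in linarith)
  show "ball x (\<rho> * rad i) \<subseteq> V" by (rule ball_sub[OF assms]) (use rho_rad[of i] R_rho in linarith)
  show "ball x s \<subseteq> V" if "s \<le> 8 * (\<rho> * rad i)"
    by (rule ball_sub[OF assms]) (use rho_rad[of i] R_rho that in linarith)
  show "ball x (\<rho> * R) \<subseteq> V" by (rule ball_sub[OF assms]) (use R_rho in linarith)
  show "ball x R \<subseteq> V" by (rule ball_sub[OF assms]) (use R_rho in linarith)
qed

lemma rho_rad_Suc: "2 * (\<rho> * rad (Suc i)) = \<rho> * rad i" "2 * rad (Suc i) = rad i"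
  by (simp_all add: rad(3))

text \<open>A measure, not a number, so that it can be the comparison measure of the covering
  lemma.\<close>

definition energy :: "(real ^ 'n \<Rightarrow> real ^ 'n) \<Rightarrow> (real ^ 'n) measure"
  where "energy D = density M1 (\<lambda>y. ennreal (norm (D y) powr p))"

lemma energy:
  assumes "C1_on UNIV \<psi> D" "\<And>y. y \<notin> K \<Longrightarrow> \<psi> y = 0"
  shows "finite_measure (energy D)" "sets (energy D) = sets lebesgue" "space (energy D) = UNIV"
    "A \<in> sets lebesgue \<Longrightarrow> ennreal (measure (energy D) A) = (\<integral>\<^sup>+y. ennreal (norm (D y) powr p) * indicator A y \<partial>M1)"
proof -
  have cD: "continuous_on UNIV D" using assms(1) by (simp add: C1_on_def)
  have D0: "D y = 0" if "y \<notin> K" for y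
    by (rule C1_on_outside_support[OF assms(1) compact_imp_closed[OF K] assms(2) that])
  obtain B where B: "0 \<le> B" "\<And>x. norm (D x) \<le> B"
    using continuous_compact_support_bounded[OF cD K D0] by metis
  have m[measurable]: "D \<in> borel_measurable M1" by (rule continuous_lebesgue_measurable[OF cD sets_M1])
  have "emeasure (energy D) (space (energy D)) = (\<integral>\<^sup>+y. ennreal (norm (D y) powr p) \<partial>M1)"
    unfolding energy_def by (subst emeasure_density) (auto intro!: nn_integral_cong)
  also have "\<dots> \<le> (\<integral>\<^sup>+y. ennreal (B powr p) \<partial>M1)"
    using B pq by (intro nn_integral_mono ennreal_leI powr_mono2) auto
  also have "\<dots> < \<infinity>" by (simp add: m1.emeasure_eq_measure ennreal_mult[symmetric])
  finally show fin: "finite_measure (energy D)" by (intro finite_measureI) auto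
  show s: "sets (energy D) = sets lebesgue" using sets_M1 by (simp add: energy_def)
  show "space (energy D) = UNIV" using space_M by (simp add: energy_def)
  interpret f: finite_measure "energy D" by (rule fin)
  show "ennreal (measure (energy D) A) = (\<integral>\<^sup>+y. ennreal (norm (D y) powr p) * indicator A y \<partial>M1)"
    if "A \<in> sets lebesgue"
    using that sets_M1 by (subst f.emeasure_eq_measure[symmetric]) (simp add: energy_def emeasure_density)
qed

lemma psi_integrable:
  assumes "C1_on UNIV \<psi> D" "\<And>y. y \<notin> K \<Longrightarrow> \<psi> y = 0"
  shows "\<psi> \<in> borel_measurable M1" "integrable M1 \<psi>"
proof -
  have c: "continuous_on UNIV \<psi>" by (rule C1_on_continuous[OF assms(1)])
  show m: "\<psi> \<in> borel_measurable M1" by (rule continuous_lebesgue_measurable[OF c sets_M1])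
  obtain B where B: "0 \<le> B" "\<And>x. norm (\<psi> x) \<le> B"
    using continuous_compact_support_bounded[OF c K assms(2)] by metis
  show "integrable M1 \<psi>" by (rule m1.integrable_const_bound[where B=B]) (use B m in auto)
qed

lemma mean_diff_le:
  assumes \<psi>: "C1_on UNIV \<psi> D" "\<And>y. y \<notin> K \<Longrightarrow> \<psi> y = 0"
    and A: "A \<in> sets borel" "B \<in> sets borel" "A \<subseteq> B" "0 < measure M1 A"
  shows "\<bar>mean M1 A \<psi> - c\<bar> * measure M1 A \<le> (LINT y:B|M1. \<bar>\<psi> y - c\<bar>)"
proof -
  note [simp] = borel_sets(1)[OF A(1)] borel_sets(1)[OF A(2)]
  have i: "integrable M1 \<psi>" by (rule psi_integrable[OF \<psi>])
  have ic: "integrable M1 (\<lambda>y. \<bar>\<psi> y - c\<bar>)" using i by (intro integrable_abs) auto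
  have siA: "set_integrable M1 A \<psi>" "set_integrable M1 A (\<lambda>y. c)"
    "set_integrable M1 A (\<lambda>y. \<bar>\<psi> y - c\<bar>)" "set_integrable M1 B (\<lambda>y. \<bar>\<psi> y - c\<bar>)"
    using i ic unfolding set_integrable_def by - (rule integrable_mult_indicator; simp)+
  have "(LINT y:A|M1. \<psi> y - c) = (LINT y:A|M1. \<psi> y) - (LINT y:A|M1. c)"
    by (rule set_integral_diff(2)) (use siA in auto)
  also have "(LINT y:A|M1. c) = c * measure M1 A"
    by (simp add: set_lebesgue_integral_def mult.commute)
  finally have "(mean M1 A \<psi> - c) * measure M1 A = (LINT y:A|M1. \<psi> y - c)"
    using A(4) by (simp add: left_diff_distrib) (simp add: mean_def)
  then have "\<bar>mean M1 A \<psi> - c\<bar> * measure M1 A = \<bar>LINT y:A|M1. \<psi> y - c\<bar>"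
    by (metis abs_mult abs_of_nonneg measure_nonneg)
  also have "\<dots> \<le> (LINT y:A|M1. \<bar>\<psi> y - c\<bar>)"
    unfolding set_lebesgue_integral_def
    using integral_norm_bound[of M1 "\<lambda>x. indicator A x *\<^sub>R (\<psi> x - c)"] by (simp add: abs_mult)
  also have "\<dots> \<le> (LINT y:B|M1. \<bar>\<psi> y - c\<bar>)"
    using A(3) siA unfolding set_lebesgue_integral_def set_integrable_def
    by (intro integral_mono) (auto simp: indicator_def)
  finally show ?thesis .
qed

text \<open>Continuity at \<open>x\<close> suffices, so the chain reaches the value of \<psi> at
  every point of \<open>K\<close> and no exceptional set appears.\<close>

lemma mean_tendsto:
  assumes \<psi>: "C1_on UNIV \<psi> D" "\<And>y. y \<notin> K \<Longrightarrow> \<psi> y = 0" and x: "x \<in> K"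
  shows "(\<lambda>i. mean M1 (ball x (rad i)) \<psi>) \<longlonglongrightarrow> \<psi> x"
proof (rule LIMSEQ_I)
  fix e :: real assume e: "0 < e"
  have "isCont \<psi> x" using GDERIV_isCont[OF GDERIV_D[OF \<psi>(1)]] by simp
  then obtain \<delta> where \<delta>: "0 < \<delta>" "\<And>y. dist y x < \<delta> \<Longrightarrow> dist (\<psi> y) (\<psi> x) < e / 2"
    using e unfolding continuous_at_eps_delta by (meson half_gt_zero)
  have "rad \<longlonglongrightarrow> R * 0" unfolding rad_def[abs_def] by (intro tendsto_intros) auto
  then have "\<forall>\<^sub>F i in sequentially. rad i < \<delta>" using \<delta>(1) by (intro order_tendstoD) auto
  then obtain n where n: "\<And>i. i \<ge> n \<Longrightarrow> rad i < \<delta>" by (auto simp: eventually_sequentially)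
  show "\<exists>n. \<forall>i\<ge>n. norm (mean M1 (ball x (rad i)) \<psi> - \<psi> x) < e"
  proof (intro exI allI impI)
    fix i assume i: "n \<le> i"
    let ?B = "ball x (rad i)"
    have pos: "0 < measure M1 ?B"
      by (rule doubling_onD(4)[OF d1 rad(1) ball_sub'(1)[OF x]])
    have "\<bar>mean M1 ?B \<psi> - \<psi> x\<bar> * measure M1 ?B \<le> (LINT y:?B|M1. \<bar>\<psi> y - \<psi> x\<bar>)"
      by (rule mean_diff_le[OF \<psi>]) (use pos in auto)
    also have "\<dots> \<le> (LINT y:?B|M1. e / 2)"
      unfolding set_lebesgue_integral_def
    proof (rule integral_mono)
      show "integrable M1 (\<lambda>y. indicator ?B y *\<^sub>R \<bar>\<psi> y - \<psi> x\<bar>)"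
        using psi_integrable[OF \<psi>] borel_sets(1)[of ?B] by (intro integrable_mult_indicator integrable_abs) auto
      show "integrable M1 (\<lambda>y. indicator ?B y *\<^sub>R (e / 2))"
        using borel_sets(1)[of ?B] by (intro integrable_mult_indicator) auto
      show "indicator ?B y *\<^sub>R \<bar>\<psi> y - \<psi> x\<bar> \<le> indicator ?B y *\<^sub>R (e / 2)" for y
      proof (cases "y \<in> ?B")
        case True
        then have "dist y x < \<delta>" using n[OF i] by (simp add: dist_commute)
        then show ?thesis using \<delta>(2)[of y] True by (simp add: dist_real_def)
      qed simp
    qed
    also have "\<dots> = e / 2 * measure M1 ?B" by (simp add: set_lebesgue_integral_def space_M)
    finally show "norm (mean M1 ?B \<psi> - \<psi> x) < e" using pos e by simp
  qed
qed

text \<open>Consecutive averages differ by at most the mean oscillation on the larger ball, up to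
  one doubling constant; the Poincare inequality bounds that oscillation.\<close>

lemma telescope:
  assumes \<psi>: "C1_on UNIV \<psi> D" "\<And>y. y \<notin> K \<Longrightarrow> \<psi> y = 0" and x: "x \<in> K"
  shows "\<bar>mean M1 (ball x (rad n)) \<psi> - mean M1 (ball x R) \<psi>\<bar> \<le>
    (\<Sum>i<n. \<gamma>1 * C1 * rad i * (measure (energy D) (ball x (\<rho> * rad i)) / measure M1 (ball x (\<rho> * rad i))) powr (1 / p))"
proof (induction n)
  case (Suc n)
  let ?m = "\<lambda>i. mean M1 (ball x (rad i)) \<psi>"
  let ?t = "(measure (energy D) (ball x (\<rho> * rad n)) / measure M1 (ball x (\<rho> * rad n))) powr (1 / p)"
  have pos: "0 < measure M1 (ball x (rad i))" for i
    by (rule doubling_onD(4)[OF d1 rad(1) ball_sub'(1)[OF x]])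
  have sub: "ball x (rad (Suc n)) \<subseteq> ball x (rad n)" using rad(1)[of n] rad(3)[of n] by (intro subset_ball) auto
  have "\<bar>?m (Suc n) - ?m n\<bar> * measure M1 (ball x (rad (Suc n))) \<le> (LINT y:ball x (rad n)|M1. \<bar>\<psi> y - ?m n\<bar>)"
    by (rule mean_diff_le[OF \<psi> _ _ sub pos]) auto
  also have "\<dots> \<le> C1 * rad n * measure M1 (ball x (rad n)) * ?t"
    unfolding energy_def by (rule poincare[OF \<psi> x rad(1,2)])
  also have "\<dots> \<le> C1 * rad n * (\<gamma>1 * measure M1 (ball x (rad (Suc n)))) * ?t"
  proof -
    have "measure M1 (ball x (2 * rad (Suc n))) \<le> \<gamma>1 * measure M1 (ball x (rad (Suc n)))"
      by (rule doubling_onD(5)[OF d1 rad(1)]) (use ball_sub'(1)[OF x] rho_rad_Suc in simp)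
    then have "measure M1 (ball x (rad n)) \<le> \<gamma>1 * measure M1 (ball x (rad (Suc n)))"
      unfolding rho_rad_Suc .
    then show ?thesis using C12 rad(1)[of n] by (intro mult_right_mono mult_left_mono) auto
  qed
  finally have "\<bar>?m (Suc n) - ?m n\<bar> * measure M1 (ball x (rad (Suc n)))
    \<le> (\<gamma>1 * C1 * rad n * ?t) * measure M1 (ball x (rad (Suc n)))"
    by (simp only: mult_ac)
  then have "\<bar>?m (Suc n) - ?m n\<bar> \<le> \<gamma>1 * C1 * rad n * ?t"
    using pos[of "Suc n"] by (rule mult_right_le_imp_le)
  then show ?case using Suc by simp
qed simp

text \<open>Hoelder's inequality, with a lower bound for the masses of balls of radius
  \<open>R\<close> that is uniform over \<open>K\<close>. It tells how high a level must be to
  dominate the first average of every chain.\<close>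

lemma mean_le:
  obtains C where "0 < C" "\<And>\<psi> D N x. C1_on UNIV \<psi> D \<Longrightarrow> (\<And>y. y \<notin> K \<Longrightarrow> \<psi> y = 0) \<Longrightarrow> x \<in> K \<Longrightarrow> 0 < N \<Longrightarrow>
     (\<integral>\<^sup>+y. ennreal (\<bar>\<psi> y\<bar> powr p) \<partial>M1) \<le> ennreal N \<Longrightarrow> (LINT y:ball x R|M1. \<bar>\<psi> y\<bar>) / measure M1 (ball x R) \<le> C * N powr (1 / p)"
proof -
  obtain c where c: "0 < c" "\<And>x. x \<in> K \<Longrightarrow> c \<le> measure M1 (ball x R)"
  proof (rule measure_ball_lower_bound[OF d1 R K])
    show "ball x R \<subseteq> V" if "x \<in> K" for x by (rule ball_sub'(5)[OF that])
  qed blast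
  define m1 where "m1 = measure M1 UNIV + 1"
  have m1: "0 < m1" by (simp add: m1_def add_nonneg_pos)
  define C where "C = m1 powr (1 - 1 / p) / c"
  have "0 < C" using c m1 by (simp add: C_def)
  moreover have "(LINT y:ball x R|M1. \<bar>\<psi> y\<bar>) / measure M1 (ball x R) \<le> C * N powr (1 / p)"
    if \<psi>: "C1_on UNIV \<psi> D" "\<And>y. y \<notin> K \<Longrightarrow> \<psi> y = 0" and x: "x \<in> K" and N: "0 < N"
      and le: "(\<integral>\<^sup>+y. ennreal (\<bar>\<psi> y\<bar> powr p) \<partial>M1) \<le> ennreal N" for \<psi> D N x
  proof -
    have [measurable]: "\<psi> \<in> borel_measurable M1" by (rule psi_integrable[OF \<psi>])
    have i: "integrable M1 (\<lambda>y. \<bar>\<psi> y\<bar>)" using psi_integrable[OF \<psi>] by (intro integrable_abs) auto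
    have "(\<integral>\<^sup>+y. ennreal ((\<bar>\<psi> y\<bar> powr p) powr (1 / p) * 1 powr (1 - 1 / p)) \<partial>M1) \<le> ennreal (N powr (1 / p) * m1 powr (1 - 1 / p))"
    proof (rule nn_integral_Holder2)
      show "(\<integral>\<^sup>+y. ennreal 1 \<partial>M1) \<le> ennreal m1"
        using m1.emeasure_eq_measure[of UNIV] space_M by (simp add: m1_def ennreal_leI)
    qed (use pq m1 N le in auto)
    then have "(\<integral>\<^sup>+y. ennreal \<bar>\<psi> y\<bar> \<partial>M1) \<le> ennreal (N powr (1 / p) * m1 powr (1 - 1 / p))"
      using pq by (simp add: powr_powr)
    then have "ennreal (LINT y|M1. \<bar>\<psi> y\<bar>) \<le> ennreal (N powr (1 / p) * m1 powr (1 - 1 / p))"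
      using i by (simp add: nn_integral_eq_integral)
    then have a: "(LINT y|M1. \<bar>\<psi> y\<bar>) \<le> N powr (1 / p) * m1 powr (1 - 1 / p)"
      by (subst (asm) ennreal_le_iff) auto
    have "(LINT y:ball x R|M1. \<bar>\<psi> y\<bar>) \<le> (LINT y|M1. \<bar>\<psi> y\<bar>)"
      unfolding set_lebesgue_integral_def using i borel_sets(1)[of "ball x R"]
      by (intro integral_mono integrable_mult_indicator) (auto simp: indicator_def)
    then have "(LINT y:ball x R|M1. \<bar>\<psi> y\<bar>) / measure M1 (ball x R) \<le> (N powr (1 / p) * m1 powr (1 - 1 / p)) / c"
      using a c x by (intro frac_le) auto
    then show ?thesis by (simp add: C_def mult.commute)
  qed
  ultimately show ?thesis by (rule that)
qed

text \<open>Where |\<psi>| exceeds 2\<mu>, the chain of averages from radius \<open>R\<close> down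
  to the point climbs by more than \<mu>. The stopping lemma yields a radius at which the M-mass is
  controlled by the energy of the same ball, and the covering lemma adds these balls up. The factor
  \<open>\<Gamma> powr ((q - p) / p)\<close> and one more factor \<Gamma> combine to the power
  q/p.\<close>

lemma weak_type:
  obtains C where "0 < C" "\<And>\<psi> D \<mu>. C1_on UNIV \<psi> D \<Longrightarrow> (\<And>y. y \<notin> K \<Longrightarrow> \<psi> y = 0) \<Longrightarrow> 0 < \<mu> \<Longrightarrow>
    (\<And>x. x \<in> K \<Longrightarrow> \<bar>mean M1 (ball x R) \<psi>\<bar> \<le> \<mu>) \<Longrightarrow>
    measure M {x. 2 * \<mu> < \<bar>\<psi> x\<bar>} \<le> C * \<mu> powr (- q) * measure (energy D) UNIV powr (q / p)"
proof -
  obtain c where c: "0 < c" "\<And>x. x \<in> K \<Longrightarrow> c \<le> measure M1 (ball x (\<rho> * R))"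
  proof (rule measure_ball_lower_bound[OF d1 R_rho(2) K])
    show "ball x (\<rho> * R) \<subseteq> V" if "x \<in> K" for x by (rule ball_sub'(4)[OF that])
  qed blast
  define mM where "mM = measure M UNIV + 1"
  have mM: "0 < mM" by (simp add: mM_def add_nonneg_pos)
  have g1: "1 \<le> \<gamma>1" "1 \<le> \<gamma>" using doubling_onD(3) d1 d by blast+
  \<comment> \<open>Collects the constants of one chain term; \<open>mM\<close> and \<open>c\<close>
    bound the masses of the largest balls uniformly in the centre.\<close>
  define C3 where "C3 = \<gamma>1 * C1 * R * C2 * mM powr (1 / q) * (1 / c) powr (1 / p)"
  have C3: "0 < C3" using g1 C12 R mM c by (simp add: C3_def)
  define \<theta> where "\<theta> = \<gamma> ^ 3 / (1 + \<gamma> ^ 3)"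
  have \<theta>: "0 < \<theta>" "\<theta> < 1" using g1 by (auto simp: \<theta>_def add_pos_pos intro!: divide_pos_pos)
  have pq0: "0 < p" using pq by simp
  obtain K0 where K0: "0 < K0" and chain: "\<And>(W :: nat \<Rightarrow> real) G a \<Gamma> \<mu> n.
      (\<And>i. 0 < W i) \<Longrightarrow> (\<And>i. W (Suc i) \<le> \<theta> * W i) \<Longrightarrow> (\<And>i. W i \<le> \<gamma> * W (Suc i)) \<Longrightarrow>
      (\<And>i. 0 \<le> G i) \<Longrightarrow> (\<And>i. G i \<le> \<Gamma>) \<Longrightarrow> 0 < \<mu> \<Longrightarrow>
      (\<And>i. a i \<le> C3 * W i powr (- 1 / q) * G i powr (1 / p)) \<Longrightarrow> \<mu> < (\<Sum>i<n. a i) \<Longrightarrow>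
      \<exists>i. W i \<le> K0 * \<mu> powr (- q) * \<Gamma> powr ((q - p) / p) * G i"
    by (rule critical_chain[OF pq0 pq(2) \<theta> g1(2) C3]) blast
  have "0 < \<gamma> ^ 3 * K0" using g1 K0 by simp
  moreover have "measure M {x. 2 * \<mu> < \<bar>\<psi> x\<bar>} \<le> (\<gamma> ^ 3 * K0) * \<mu> powr (- q) * measure (energy D) UNIV powr (q / p)"
    if \<psi>: "C1_on UNIV \<psi> D" "\<And>y. y \<notin> K \<Longrightarrow> \<psi> y = 0" and \<mu>: "0 < \<mu>"
      and mean: "\<And>x. x \<in> K \<Longrightarrow> \<bar>mean M1 (ball x R) \<psi>\<bar> \<le> \<mu>" for \<psi> D \<mu>
  proof -
    interpret e: finite_measure "energy D" by (rule energy(1)[OF \<psi>])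
    have esets: "A \<in> sets borel \<Longrightarrow> A \<in> sets (energy D)" for A :: "(real ^ 'n) set"
      by (rule borel_in_lebesgue_like[OF energy(2)[OF \<psi>]])
    let ?E = "{x. 2 * \<mu> < \<bar>\<psi> x\<bar>}"
    define \<Gamma> where "\<Gamma> = measure (energy D) UNIV"
    define Q where "Q = \<gamma> ^ 3 * K0 * \<mu> powr (- q) * \<Gamma> powr ((q - p) / p)"
    have Q0: "0 \<le> Q" using g1 K0 by (simp add: Q_def)
    have E: "?E \<in> sets M"
    proof (rule borel_sets(2))
      have "continuous_on UNIV (\<lambda>x. \<bar>\<psi> x\<bar>)" using C1_on_continuous[OF \<psi>(1)] by (intro continuous_intros)
      then have "open {x. 2 * \<mu> < \<bar>\<psi> x\<bar>}" by (rule open_Collect_less[OF continuous_on_const])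
      then show "?E \<in> sets borel" by simp
    qed
    have "\<exists>r. 0 < r \<and> r \<le> \<rho> * R \<and> emeasure M (ball x (5 * r)) \<le> ennreal Q * emeasure (energy D) (ball x r)"
      if x: "x \<in> ?E" for x
    proof -
      have xK: "x \<in> K" using x \<mu> \<psi>(2)[of x] by force
      define W where "W = (\<lambda>i. measure M (ball x (\<rho> * rad i)))"
      define G where "G = (\<lambda>i. measure (energy D) (ball x (\<rho> * rad i)))"
      define a where "a = (\<lambda>i. \<gamma>1 * C1 * rad i * (G i / measure M1 (ball x (\<rho> * rad i))) powr (1 / p))"
      have W0: "0 < W i" for i
        unfolding W_def by (rule doubling_onD(4)[OF d rho_rad(1) ball_sub'(2)[OF xK]])
      have M10: "0 < measure M1 (ball x (\<rho> * rad i))" for i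
        by (rule doubling_onD(4)[OF d1 rho_rad(1) ball_sub'(2)[OF xK]])
      have W1: "W (Suc i) \<le> \<theta> * W i" for i
      proof -
        have "ball x (6 * (\<rho> * rad (Suc i))) \<subseteq> V"
          by (rule ball_sub'(3)[OF xK, of _ i]) (use rho_rad_Suc(1)[of i] rho_rad(1)[of i] in linarith)
        from reverse_doubling[OF d rho_rad(1) this] show ?thesis
          unfolding rho_rad_Suc W_def \<theta>_def .
      qed
      have W2: "W i \<le> \<gamma> * W (Suc i)" for i
      proof -
        have "ball x (2 * (\<rho> * rad (Suc i))) \<subseteq> V"
          unfolding rho_rad_Suc by (rule ball_sub'(2)[OF xK])
        from doubling_onD(5)[OF d rho_rad(1) this] show ?thesis
          unfolding rho_rad_Suc W_def .
      qed
      have G0: "0 \<le> G i" "G i \<le> \<Gamma>" for i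
        unfolding G_def \<Gamma>_def by (auto intro!: e.finite_measure_mono esets)
      have a: "a i \<le> C3 * W i powr (- 1 / q) * G i powr (1 / p)" for i
      proof -
        define A where "A = measure M1 (ball x (\<rho> * rad i))"
        define Z where "Z = measure M1 (ball x (\<rho> * R))"
        have A0: "0 < A" using M10 by (simp add: A_def)
        have A00: "c \<le> Z" "0 < Z" using c(1) c(2)[OF xK] by (auto simp: Z_def)
        have W00: "W 0 = measure M (ball x (\<rho> * R))" by (simp add: W_def)
        have "W 0 \<le> measure M UNIV"
          unfolding W_def using space_M borel_sets(2)[of UNIV] by (intro m.finite_measure_mono) auto
        then have W0m: "W 0 \<le> mM" by (simp add: mM_def)
        \<comment> \<open>Balance converts \<open>rad i\<close> times the power -1/p of the M1-mass
          into the power -1/q of the M-mass, the form in which the stopping lemma is stated.\<close>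
        have "(1 / 2) ^ i * (W i / W 0) powr (1 / q) \<le> C2 * (A / Z) powr (1 / p)"
          using balance[OF xK, of i] W00 by (simp add: W_def rad_def A_def Z_def)
        then have "(1 / 2) ^ i * (1 / A) powr (1 / p) \<le> C2 * W 0 powr (1 / q) * W i powr (- 1 / q) * (1 / Z) powr (1 / p)"
          using W0[of i] W0[of 0] A00 A0
          by (simp add: powr_divide less_imp_le powr_minus_divide field_simps)
        also have "\<dots> \<le> C2 * mM powr (1 / q) * W i powr (- 1 / q) * (1 / c) powr (1 / p)"
        proof -
          have p1: "W 0 powr (1 / q) \<le> mM powr (1 / q)"
            using W0m W0[of 0] pq by (intro powr_mono2) auto
          have "1 / Z \<le> 1 / c" using A00 c(1) by (intro frac_le) auto
          then have p2: "(1 / Z) powr (1 / p) \<le> (1 / c) powr (1 / p)"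
            using A00 pq by (intro powr_mono2) auto
          show ?thesis using C12 by (intro mult_mono p1 p2) auto
        qed
        finally have 1: "(1 / 2) ^ i * (1 / A) powr (1 / p) \<le> C2 * mM powr (1 / q) * W i powr (- 1 / q) * (1 / c) powr (1 / p)" .
        have "a i = \<gamma>1 * C1 * R * G i powr (1 / p) * ((1 / 2) ^ i * (1 / A) powr (1 / p))"
          using powr_mult[of "G i" "1 / A" "1 / p"] by (simp add: a_def rad_def A_def)
        also have "\<dots> \<le> \<gamma>1 * C1 * R * G i powr (1 / p) * (C2 * mM powr (1 / q) * W i powr (- 1 / q) * (1 / c) powr (1 / p))"
          using g1 C12 R by (intro mult_left_mono 1) auto
        also have "\<dots> = C3 * W i powr (- 1 / q) * G i powr (1 / p)" by (simp add: C3_def mult_ac)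
        finally show ?thesis .
      qed
      have "(\<lambda>n. \<bar>mean M1 (ball x (rad n)) \<psi>\<bar>) \<longlonglongrightarrow> \<bar>\<psi> x\<bar>"
        by (intro tendsto_rabs mean_tendsto[OF \<psi> xK])
      then have "\<forall>\<^sub>F n in sequentially. 2 * \<mu> < \<bar>mean M1 (ball x (rad n)) \<psi>\<bar>"
        using x by (intro order_tendstoD) auto
      then obtain n where n: "2 * \<mu> < \<bar>mean M1 (ball x (rad n)) \<psi>\<bar>"
        by (auto simp: eventually_sequentially)
      have "\<mu> < \<bar>mean M1 (ball x (rad n)) \<psi> - mean M1 (ball x R) \<psi>\<bar>"
        using n mean[OF xK] by linarith
      also have "\<dots> \<le> (\<Sum>i<n. a i)" using telescope[OF \<psi> xK, of n] by (simp add: a_def G_def)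
      finally have "\<mu> < (\<Sum>i<n. a i)" .
      from chain[OF W0 W1 W2 G0 \<mu> a this]
      obtain i where i: "W i \<le> K0 * \<mu> powr (- q) * \<Gamma> powr ((q - p) / p) * G i" by blast
      let ?r = "\<rho> * rad i"
      have "measure M (ball x (5 * ?r)) \<le> measure M (ball x (8 * ?r))"
        using rho_rad(1)[of i] borel_sets(2) by (intro m.finite_measure_mono subset_ball) auto
      also have "\<dots> \<le> \<gamma> ^ 3 * W i"
        unfolding W_def by (rule doubling_on_ball8[OF d rho_rad(1) ball_sub'(3)[OF xK order_refl]])
      also have "\<dots> \<le> \<gamma> ^ 3 * (K0 * \<mu> powr (- q) * \<Gamma> powr ((q - p) / p) * G i)"
        using i g1 by (intro mult_left_mono) auto
      also have "\<dots> = Q * G i" by (simp add: Q_def)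
      finally have "emeasure M (ball x (5 * ?r)) \<le> ennreal Q * emeasure (energy D) (ball x ?r)"
        using Q0 by (simp add: m.emeasure_eq_measure e.emeasure_eq_measure G_def ennreal_mult[symmetric] ennreal_leI)
      then show ?thesis using rho_rad[of i] by blast
    qed
    then have "emeasure M ?E \<le> ennreal Q * emeasure (energy D) (space (energy D))"
      by (intro Vitali_emeasure_bound[where R="\<rho> * R"] E) (auto intro!: borel_sets esets)
    then have "measure M ?E \<le> Q * \<Gamma>"
      using Q0 by (simp add: m.emeasure_eq_measure e.emeasure_eq_measure energy(3)[OF \<psi>] \<Gamma>_def ennreal_mult[symmetric])
    also have "Q * \<Gamma> = (\<gamma> ^ 3 * K0) * \<mu> powr (- q) * \<Gamma> powr (q / p)"
    proof -
      have "\<Gamma> powr ((q - p) / p) * \<Gamma> = \<Gamma> powr (q / p)"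
        using pq by (cases "\<Gamma> = 0") (auto simp: \<Gamma>_def powr_mult_base mult.commute diff_divide_distrib)
      then show ?thesis by (simp add: Q_def mult_ac)
    qed
    finally show ?thesis by (simp add: \<Gamma>_def)
  qed
  ultimately show ?thesis by (rule that)
qed

end

lemma ennreal_le_suminf: "f j \<le> (\<Sum>j. f j)" for f :: "nat \<Rightarrow> ennreal"
  using sum_le_suminf[of f "{j}"] by simp

context sobolev_data
begin

text \<open>Maz'ya's truncation: the weak type estimate is applied to the truncations of \<open>\<psi>\<close> between
  the levels \<open>2 ^ j * L\<close> and \<open>2 ^ Suc j * L\<close>, whose gradients have disjoint supports.\<close>

lemma sobolev:
  obtains C where "0 < C" "\<And>\<psi> D N. C1_on UNIV \<psi> D \<Longrightarrow> (\<And>y. y \<notin> K \<Longrightarrow> \<psi> y = 0) \<Longrightarrow> 0 < N \<Longrightarrow>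
    (\<integral>\<^sup>+y. ennreal (norm (D y) powr p + \<bar>\<psi> y\<bar> powr p) \<partial>M1) \<le> ennreal N \<Longrightarrow>
    (\<integral>\<^sup>+y. ennreal (\<bar>\<psi> y\<bar> powr q) \<partial>M) \<le> ennreal (C * N powr (q / p))"
proof -
  obtain Cm where Cm: "0 < Cm" and mean: "\<And>\<psi> D N x. C1_on UNIV \<psi> D \<Longrightarrow> (\<And>y. y \<notin> K \<Longrightarrow> \<psi> y = 0) \<Longrightarrow> x \<in> K \<Longrightarrow> 0 < N \<Longrightarrow>
     (\<integral>\<^sup>+y. ennreal (\<bar>\<psi> y\<bar> powr p) \<partial>M1) \<le> ennreal N \<Longrightarrow> (LINT y:ball x R|M1. \<bar>\<psi> y\<bar>) / measure M1 (ball x R) \<le> Cm * N powr (1 / p)"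
    by (rule mean_le) blast
  obtain Cw where Cw: "0 < Cw" and weak: "\<And>\<psi> D \<mu>. C1_on UNIV \<psi> D \<Longrightarrow> (\<And>y. y \<notin> K \<Longrightarrow> \<psi> y = 0) \<Longrightarrow> 0 < \<mu> \<Longrightarrow>
    (\<And>x. x \<in> K \<Longrightarrow> \<bar>mean M1 (ball x R) \<psi>\<bar> \<le> \<mu>) \<Longrightarrow>
    measure M {x. 2 * \<mu> < \<bar>\<psi> x\<bar>} \<le> Cw * \<mu> powr (- q) * measure (energy D) UNIV powr (q / p)"
    by (rule weak_type) blast
  obtain S s :: "real \<Rightarrow> real" where S: "\<And>t. DERIV S t :> s t" "continuous_on UNIV s" "\<And>t. \<bar>s t\<bar> \<le> 1"
    "\<And>t. \<not> (1 < \<bar>t\<bar> \<and> \<bar>t\<bar> < 2) \<Longrightarrow> s t = 0" "\<And>t. \<bar>S t\<bar> \<le> \<bar>t\<bar>" "\<And>t. 2 \<le> \<bar>t\<bar> \<Longrightarrow> 1 / 8 \<le> \<bar>S t\<bar>"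
    using smooth_step by blast
  define mM where "mM = measure M UNIV"
  define C where "C = (64 * Cm) powr q * mM + 128 powr q * Cw"
  have "0 < C" using Cm Cw by (simp add: C_def mM_def add_nonneg_pos)
  moreover have "(\<integral>\<^sup>+y. ennreal (\<bar>\<psi> y\<bar> powr q) \<partial>M) \<le> ennreal (C * N powr (q / p))"
    if \<psi>: "C1_on UNIV \<psi> D" "\<And>y. y \<notin> K \<Longrightarrow> \<psi> y = 0" and N: "0 < N"
      and en: "(\<integral>\<^sup>+y. ennreal (norm (D y) powr p + \<bar>\<psi> y\<bar> powr p) \<partial>M1) \<le> ennreal N" for \<psi> D N
  proof -
    interpret e: finite_measure "energy D" by (rule energy(1)[OF \<psi>])
    have c\<psi>: "continuous_on UNIV \<psi>" by (rule C1_on_continuous[OF \<psi>(1)])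
    have cD: "continuous_on UNIV D" using \<psi>(1) by (simp add: C1_on_def)
    have [measurable]: "\<psi> \<in> borel_measurable M1" "\<psi> \<in> borel_measurable M" "D \<in> borel_measurable M1"
      using c\<psi> cD sets_M1 sets_M by (auto intro: continuous_lebesgue_measurable)
    have enD: "(\<integral>\<^sup>+y. ennreal (norm (D y) powr p) \<partial>M1) \<le> ennreal N"
      using en by (rule order_trans[rotated]) (auto intro!: nn_integral_mono ennreal_leI)
    have en\<psi>: "(\<integral>\<^sup>+y. ennreal (\<bar>\<psi> y\<bar> powr p) \<partial>M1) \<le> ennreal N"
      using en by (rule order_trans[rotated]) (auto intro!: nn_integral_mono ennreal_leI)
    \<comment> \<open>With the factor 32 every truncation has averages at most \<mu> = l j / 32,
      whereas it is at least l j / 8, more than 2\<mu>, where |\<psi>| is at least 2 l j.\<close>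
    define L where "L = 32 * Cm * N powr (1 / p)"
    have L: "0 < L" using Cm N by (simp add: L_def)
    define l where "l = (\<lambda>j::nat. 2 ^ j * L)"
    have l: "0 < l j" "L \<le> l j" for j using L by (auto simp: l_def)
    define T where "T = (\<lambda>j. {x. l j < \<bar>\<psi> x\<bar> \<and> \<bar>\<psi> x\<bar> < 2 * l j})"
    define ee where "ee = (\<lambda>j. measure (energy D) (T j))"
    have oT: "open (T j)" for j
      unfolding T_def Collect_conj_eq
      by (intro open_Int open_Collect_less continuous_intros c\<psi>)
    have sT: "T j \<in> sets (energy D)" "T j \<in> sets lebesgue" for j
      using borel_in_lebesgue_like[OF energy(2)[OF \<psi>]] borel_in_lebesgue_like[of lebesgue] oT by (auto intro: borel_open)
    have disj: "disjoint_family T"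
      unfolding disjoint_family_on_def
    proof (intro ballI impI)
      have *: "T m \<inter> T n = {}" if "m < n" for m n
      proof -
        have "(2::real) ^ Suc m \<le> 2 ^ n" using that by (intro power_increasing) auto
        then have "2 * l m \<le> l n" using L by (simp add: l_def)
        then show ?thesis by (auto simp: T_def)
      qed
      fix m n :: nat assume "m \<noteq> n"
      then show "T m \<inter> T n = {}" using *[of m n] *[of n m] by (cases m n rule: linorder_cases) auto
    qed
    have "(\<Sum>j. emeasure (energy D) (T j)) = emeasure (energy D) (\<Union>j. T j)"
      by (rule suminf_emeasure) (use sT disj in auto)
    also have "\<dots> \<le> emeasure (energy D) (space (energy D))" by (rule emeasure_space)
    also have "\<dots> = (\<integral>\<^sup>+y. ennreal (norm (D y) powr p) \<partial>M1)"
      using energy(4)[OF \<psi>, of UNIV] energy(3)[OF \<psi>] by (simp add: e.emeasure_eq_measure)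
    also have "\<dots> \<le> ennreal N" by (rule enD)
    finally have sumee: "(\<Sum>j. ennreal (ee j)) \<le> ennreal N"
      by (simp add: ee_def e.emeasure_eq_measure)
    have eeT: "ennreal (ee j) = (\<integral>\<^sup>+y. ennreal (norm (D y) powr p) * indicator (T j) y \<partial>M1)" for j
      unfolding ee_def by (rule energy(4)[OF \<psi> sT(2)])
    have ee: "0 \<le> ee j" "ee j \<le> N" for j
    proof -
      show "0 \<le> ee j" by (simp add: ee_def)
      have "ennreal (ee j) \<le> (\<integral>\<^sup>+y. ennreal (norm (D y) powr p) \<partial>M1)"
        unfolding eeT
        by (intro nn_integral_mono) (auto simp: indicator_def)
      then have "ennreal (ee j) \<le> ennreal N" using enD by (rule order_trans)
      then show "ee j \<le> N" using N by (subst (asm) ennreal_le_iff) auto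
    qed
    have level: "measure M {x. 2 * l j \<le> \<bar>\<psi> x\<bar>} \<le> Cw * (l j / 32) powr (- q) * (ee j * N powr ((q - p) / p))" for j
    proof -
      let ?\<psi> = "\<lambda>x. l j * S (\<psi> x * (1 / l j))" and ?D = "\<lambda>x. s (\<psi> x * (1 / l j)) *\<^sub>R D x"
      have g: "GDERIV ?\<psi> x :> ?D x" for x
      proof -
        have "GDERIV (\<lambda>x. \<psi> x * (1 / l j)) x :> (1 / l j) *\<^sub>R D x"
          by (rule GDERIV_subst[OF GDERIV_mult[OF GDERIV_D[OF \<psi>(1)] GDERIV_const]]) auto
        from GDERIV_mult[OF GDERIV_const[of "l j"] GDERIV_DERIV_compose[OF this S(1)]]
        show ?thesis by (rule GDERIV_subst) (use l(1)[of j] in simp)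
      qed
      have "continuous_on UNIV ?D"
        by (intro continuous_intros cD continuous_on_compose2[OF S(2)] c\<psi>) auto
      then have C1: "C1_on UNIV ?\<psi> ?D" using g by (simp add: C1_on_def)
      have le: "\<bar>?\<psi> x\<bar> \<le> \<bar>\<psi> x\<bar>" for x
        using mult_left_mono[OF S(5)[of "\<psi> x * (1 / l j)"], of "l j"] l(1)[of j]
        by (simp add: abs_mult)
      have supp: "?\<psi> y = 0" if "y \<notin> K" for y using le[of y] \<psi>(2)[OF that] by simp
      have mn: "\<bar>mean M1 (ball x R) ?\<psi>\<bar> \<le> l j / 32" if x: "x \<in> K" for x
      proof -
        have sets: "ball x R \<in> sets M1" by (rule borel_sets) simp
        have i1: "integrable M1 (\<lambda>y. indicator (ball x R) y *\<^sub>R \<bar>\<psi> y\<bar>)"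
          using psi_integrable[OF \<psi>] sets by (intro integrable_mult_indicator integrable_abs) auto
        have i2: "integrable M1 (\<lambda>y. indicator (ball x R) y *\<^sub>R ?\<psi> y)"
          using psi_integrable[OF C1 supp] sets by (intro integrable_mult_indicator) auto
        have "\<bar>LINT y:ball x R|M1. ?\<psi> y\<bar> \<le> (LINT y:ball x R|M1. \<bar>\<psi> y\<bar>)"
        proof -
          have "norm (LINT y|M1. indicator (ball x R) y *\<^sub>R ?\<psi> y) \<le> (LINT y|M1. indicator (ball x R) y *\<^sub>R \<bar>\<psi> y\<bar>)"
            by (rule Bochner_Integration.integral_norm_bound_integral[OF i2 i1]) (use le in \<open>auto simp: indicator_def\<close>)
          then show ?thesis unfolding set_lebesgue_integral_def by simp
        qed
        then have "\<bar>mean M1 (ball x R) ?\<psi>\<bar> \<le> (LINT y:ball x R|M1. \<bar>\<psi> y\<bar>) / measure M1 (ball x R)"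
          by (simp add: mean_def abs_divide divide_right_mono)
        also have "\<dots> \<le> Cm * N powr (1 / p)" by (rule mean[OF \<psi> x N en\<psi>])
        also have "\<dots> = L / 32" by (simp add: L_def)
        finally show ?thesis using l(2)[of j] by simp
      qed
      have meas: "{x. 2 * (l j / 32) < \<bar>?\<psi> x\<bar>} \<in> sets M"
      proof (rule borel_sets(2))
        have "open {x. 2 * (l j / 32) < \<bar>?\<psi> x\<bar>}"
          by (rule open_Collect_less[OF continuous_on_const]) (intro continuous_on_rabs C1_on_continuous[OF C1])
        then show "{x. 2 * (l j / 32) < \<bar>?\<psi> x\<bar>} \<in> sets borel" by (rule borel_open)
      qed
      have "measure M {x. 2 * l j \<le> \<bar>\<psi> x\<bar>} \<le> measure M {x. 2 * (l j / 32) < \<bar>?\<psi> x\<bar>}"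
      proof (rule m.finite_measure_mono[OF _ meas], intro subsetI CollectI)
        fix x assume "x \<in> {x. 2 * l j \<le> \<bar>\<psi> x\<bar>}"
        then have "2 \<le> \<bar>\<psi> x * (1 / l j)\<bar>" using l(1)[of j] by (simp add: abs_mult field_simps)
        then have "1 / 8 \<le> \<bar>S (\<psi> x * (1 / l j))\<bar>" by (rule S(6))
        then have "l j * (1 / 8) \<le> l j * \<bar>S (\<psi> x * (1 / l j))\<bar>" using l(1)[of j] by (intro mult_left_mono) auto
        then have "l j / 8 \<le> \<bar>?\<psi> x\<bar>" using l(1)[of j] by (simp add: abs_mult)
        then show "2 * (l j / 32) < \<bar>?\<psi> x\<bar>" using l(1)[of j] by linarith
      qed
      also have "\<dots> \<le> Cw * (l j / 32) powr (- q) * measure (energy ?D) UNIV powr (q / p)"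
        by (rule weak[OF C1 supp _ mn]) (use l(1)[of j] in auto)
      also have "\<dots> \<le> Cw * (l j / 32) powr (- q) * (ee j * N powr ((q - p) / p))"
      proof (intro mult_left_mono)
        have "ennreal (measure (energy ?D) UNIV) \<le> ennreal (ee j)"
          unfolding eeT using energy(4)[OF C1 supp, of UNIV]
        proof simp
          show "(\<integral>\<^sup>+y. ennreal ((\<bar>s (\<psi> y / l j)\<bar> * norm (D y)) powr p) \<partial>M1)
              \<le> (\<integral>\<^sup>+y. ennreal (norm (D y) powr p) * indicator (T j) y \<partial>M1)"
          proof (intro nn_integral_mono)
            fix y
            show "ennreal ((\<bar>s (\<psi> y / l j)\<bar> * norm (D y)) powr p) \<le> ennreal (norm (D y) powr p) * indicator (T j) y"
            proof (cases "y \<in> T j")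
              case True
              then show ?thesis
                using S(3)[of "\<psi> y / l j"] pq by (auto intro!: ennreal_leI powr_mono2 mult_left_le_one_le)
            next
              case False
              then have "s (\<psi> y / l j) = 0"
                using l(1)[of j] by (intro S(4)) (auto simp: T_def field_simps)
              then show ?thesis by simp
            qed
          qed
        qed
        then have "measure (energy ?D) UNIV \<le> ee j" using ee by (subst (asm) ennreal_le_iff) auto
        \<comment> \<open>Since q > p, one factor \<open>ee j\<close> is kept and the excess power
          is bounded by the total \<open>N\<close>; the level estimates can then be summed over the
          disjoint sets \<open>T j\<close>.\<close>
        then have "measure (energy ?D) UNIV powr (q / p) \<le> ee j powr (q / p)"
          using pq by (intro powr_mono2) auto
        also have "\<dots> = ee j * ee j powr ((q - p) / p)"
          using ee(1)[of j] pq by (simp add: powr_mult_base diff_divide_distrib)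
        also have "\<dots> \<le> ee j * N powr ((q - p) / p)"
          using ee[of j] pq by (intro mult_left_mono powr_mono2) auto
        finally show "measure (energy ?D) UNIV powr (q / p) \<le> ee j * N powr ((q - p) / p)" .
      qed (use Cw in auto)
      finally show ?thesis .
    qed
    let ?A = "\<lambda>j. {x. 2 * l j \<le> \<bar>\<psi> x\<bar>}"
    have sA: "?A j \<in> sets M" for j
      by (rule borel_sets(2), rule borel_closed, rule closed_Collect_le) (intro continuous_intros c\<psi>)+
    \<comment> \<open>Above 2L some j satisfies 2 l j \<le> |\<psi> x| < 4 l j, and this single term
      of the series is enough.\<close>
    have pt: "ennreal (\<bar>\<psi> x\<bar> powr q) \<le> ennreal ((2 * L) powr q) + (\<Sum>j. ennreal ((4 * l j) powr q) * indicator (?A j) x)" for x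
    proof (cases "\<bar>\<psi> x\<bar> \<le> 2 * L")
      case True
      then have "ennreal (\<bar>\<psi> x\<bar> powr q) \<le> ennreal ((2 * L) powr q)"
        using pq by (intro ennreal_leI powr_mono2) auto
      then show ?thesis by (rule add_increasing2[rotated]) simp
    next
      case False
      obtain n where n: "\<bar>\<psi> x\<bar> / (2 * L) < 2 ^ n" using real_arch_pow[of 2] by auto
      define n0 where "n0 = (LEAST n. \<bar>\<psi> x\<bar> / (2 * L) < 2 ^ n)"
      have n0: "\<bar>\<psi> x\<bar> / (2 * L) < 2 ^ n0" unfolding n0_def using n by (rule LeastI)
      have "n0 \<noteq> 0"
      proof
        assume "n0 = 0"
        then show False using n0 False L by (simp add: field_simps)
      qed
      then obtain j where j: "n0 = Suc j" by (cases n0) auto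
      have "\<not> \<bar>\<psi> x\<bar> / (2 * L) < 2 ^ j" by (rule not_less_Least) (use j in \<open>simp add: n0_def\<close>)
      then have xA: "x \<in> ?A j" using L by (simp add: l_def field_simps)
      have "\<bar>\<psi> x\<bar> \<le> 4 * l j" using n0 L unfolding j by (simp add: l_def field_simps)
      then have "ennreal (\<bar>\<psi> x\<bar> powr q) \<le> ennreal ((4 * l j) powr q) * indicator (?A j) x"
        using xA pq by (auto intro!: ennreal_leI powr_mono2)
      also have "\<dots> \<le> (\<Sum>j. ennreal ((4 * l j) powr q) * indicator (?A j) x)"
        by (rule ennreal_le_suminf)
      finally show ?thesis by (rule add_increasing[rotated]) simp
    qed
    have "(\<integral>\<^sup>+y. ennreal (\<bar>\<psi> y\<bar> powr q) \<partial>M)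
      \<le> (\<integral>\<^sup>+x. ennreal ((2 * L) powr q) + (\<Sum>j. ennreal ((4 * l j) powr q) * indicator (?A j) x) \<partial>M)"
      by (intro nn_integral_mono pt)
    also have "\<dots> = ennreal ((2 * L) powr q) * emeasure M UNIV + (\<Sum>j. ennreal ((4 * l j) powr q) * emeasure M (?A j))"
      using sA by (simp add: nn_integral_add nn_integral_suminf nn_integral_cmult_indicator space_M)
    also have "\<dots> \<le> ennreal ((2 * L) powr q * mM) + (\<Sum>j. ennreal (128 powr q * Cw * N powr ((q - p) / p)) * ennreal (ee j))"
    proof (intro add_mono suminf_le)
      show "ennreal ((2 * L) powr q) * emeasure M UNIV \<le> ennreal ((2 * L) powr q * mM)"
        by (simp add: m.emeasure_eq_measure mM_def ennreal_mult)
      fix j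
      have "(4 * l j) powr q * measure M (?A j) \<le> (4 * l j) powr q * (Cw * (l j / 32) powr (- q) * (ee j * N powr ((q - p) / p)))"
        by (intro mult_left_mono level) auto
      also have "\<dots> = ((4 * l j) powr q * (l j / 32) powr (- q)) * (Cw * N powr ((q - p) / p) * ee j)"
        by (simp only: mult_ac)
      also have "(4 * l j) powr q * (l j / 32) powr (- q) = 128 powr q"
      proof -
        have "(4 * l j) powr q = 128 powr q * (l j / 32) powr q"
          using powr_mult[of 128 "l j / 32" q] by simp
        then show ?thesis using l(1)[of j] by (simp only: powr_minus) simp
      qed
      finally have "(4 * l j) powr q * measure M (?A j) \<le> 128 powr q * Cw * N powr ((q - p) / p) * ee j"
        by (simp only: mult_ac)
      then show "ennreal ((4 * l j) powr q) * emeasure M (?A j) \<le> ennreal (128 powr q * Cw * N powr ((q - p) / p)) * ennreal (ee j)"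
        using Cw ee(1)[of j] by (simp add: m.emeasure_eq_measure ennreal_mult[symmetric] ennreal_leI)
    qed auto
    also have "\<dots> \<le> ennreal ((2 * L) powr q * mM) + ennreal (128 powr q * Cw * N powr ((q - p) / p)) * ennreal N"
      using sumee by (simp add: ennreal_suminf_cmult mult_left_mono)
    also have "\<dots> = ennreal ((2 * L) powr q * mM + 128 powr q * Cw * N powr ((q - p) / p) * N)"
      using Cw N by (simp add: mM_def ennreal_mult[symmetric] ennreal_plus[symmetric] del: ennreal_plus)
    also have "(2 * L) powr q * mM + 128 powr q * Cw * N powr ((q - p) / p) * N = C * N powr (q / p)"
    proof -
      have 1: "(2 * L) powr q = (64 * Cm) powr q * N powr (q / p)"
      proof -
        have "2 * L = (64 * Cm) * N powr (1 / p)" by (simp add: L_def)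
        then show ?thesis by (simp only: powr_mult powr_powr) simp
      qed
      have 2: "N powr ((q - p) / p) * N = N powr (q / p)"
        using powr_mult_base[of N "(q - p) / p"] N pq by (simp add: diff_divide_distrib mult.commute)
      have "128 powr q * Cw * N powr ((q - p) / p) * N = 128 powr q * Cw * (N powr ((q - p) / p) * N)"
        by (simp only: mult.assoc)
      then show ?thesis unfolding 1 2 C_def by (simp add: algebra_simps)
    qed
    finally show ?thesis .
  qed
  ultimately show ?thesis by (rule that)
qed

end

section \<open>From weights to measures\<close>

text \<open>A solution belongs to the Sobolev space only locally in \<open>ball x0 2\<close>, hence the cutoff of the
  weights to a smaller ball.\<close>

definition wt :: "real ^ 'n \<Rightarrow> (real ^ 'n \<Rightarrow> real) \<Rightarrow> real ^ 'n \<Rightarrow> real"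
  where "wt x0 w x = indicat_real (ball x0 (7 / 4)) x * w x"

definition wmeasure :: "real ^ 'n \<Rightarrow> (real ^ 'n \<Rightarrow> real) \<Rightarrow> (real ^ 'n) measure"
  where "wmeasure x0 w = density lebesgue (\<lambda>x. ennreal (wt x0 w x))"

lemma epowr_ennreal: "0 \<le> a \<Longrightarrow> epowr (ennreal a) r = ennreal (a powr r)"
  by (simp add: epowr_def)

lemma ball_lebesgue [measurable]: "ball x r \<in> sets lebesgue" for x :: "'a::euclidean_space"
  by simp

lemma cball_lebesgue [measurable]: "cball x r \<in> sets lebesgue" for x :: "'a::euclidean_space"
  by simp

locale local_weight =
  fixes \<Omega> :: "(real ^ 'n) set" and x0 :: "real ^ 'n" and w :: "real ^ 'n \<Rightarrow> real"
  assumes sub: "ball x0 2 \<subseteq> \<Omega>" and op: "open \<Omega>"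
    and loc: "loc_integrable_weight \<Omega> w" and dbl: "doubling_weight \<Omega> w"
begin

abbreviation "B74 \<equiv> ball x0 (7 / 4)"

lemma B74: "B74 \<subseteq> \<Omega>" "cball x0 (7 / 4) \<subseteq> \<Omega>"
  using sub by (auto simp: subset_iff)

lemma wt_nonneg: "0 \<le> wt x0 w x"
  using loc B74(1) by (auto simp: wt_def loc_integrable_weight_def indicator_def)

lemma wt_integrable: "integrable lebesgue (wt x0 w)"
proof -
  have "set_integrable lebesgue (cball x0 (7 / 4)) w"
    using loc B74 by (auto simp: loc_integrable_weight_def)
  then have h: "integrable lebesgue (\<lambda>x. indicator (cball x0 (7 / 4)) x *\<^sub>R w x)"
    unfolding set_integrable_def .
  have "integrable lebesgue (\<lambda>x. indicator B74 x *\<^sub>R (indicator (cball x0 (7 / 4)) x *\<^sub>R w x))"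
    by (rule integrable_mult_indicator[OF _ h]) simp
  moreover have "(\<lambda>x. indicator B74 x *\<^sub>R (indicator (cball x0 (7 / 4)) x *\<^sub>R w x)) = wt x0 w"
    by (auto simp: wt_def indicator_def fun_eq_iff)
  ultimately show ?thesis by simp
qed

lemma wt_measurable [measurable]: "wt x0 w \<in> borel_measurable lebesgue"
  using wt_integrable by simp

lemma wt_pos: "AE x in lebesgue. x \<in> B74 \<longrightarrow> 0 < wt x0 w x"
proof -
  have "AE x in lebesgue_on \<Omega>. 0 < w x" using dbl by (simp add: doubling_weight_def)
  moreover have "\<Omega> \<in> sets lebesgue" using op by simp
  ultimately have "AE x in lebesgue. x \<in> \<Omega> \<longrightarrow> 0 < w x"
    by (simp add: AE_restrict_space_iff)
  then show ?thesis by eventually_elim (use B74 in \<open>auto simp: wt_def\<close>)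
qed

abbreviation "M \<equiv> wmeasure x0 w"

lemma sets_wm [simp]: "sets M = sets lebesgue" and space_wm [simp]: "space M = UNIV"
  by (simp_all add: wmeasure_def)

lemma measurable_wm [simp]: "borel_measurable M = borel_measurable lebesgue"
  by (rule measurable_cong_sets) simp_all

lemma finite_wm: "finite_measure M"
proof (rule finite_measureI)
  have "emeasure M (space M) = (\<integral>\<^sup>+x. ennreal (wt x0 w x) \<partial>lebesgue)"
    unfolding wmeasure_def by (subst emeasure_density) auto
  also have "\<dots> = ennreal (\<integral>x. wt x0 w x \<partial>lebesgue)"
    by (rule nn_integral_eq_integral[OF wt_integrable]) (simp add: wt_nonneg)
  finally show "emeasure M (space M) \<noteq> \<infinity>" by simp
qed

lemma nn_integral_wm:
  "f \<in> borel_measurable lebesgue \<Longrightarrow> (\<integral>\<^sup>+x. ennreal (f x) \<partial>M) = (\<integral>\<^sup>+x. ennreal (f x * wt x0 w x) \<partial>lebesgue)"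
  unfolding wmeasure_def
  by (subst nn_integral_density) (auto intro!: nn_integral_cong simp: ennreal_mult'' wt_nonneg mult.commute)

lemma wmeas_eq:
  assumes "S \<in> sets lebesgue" "S \<subseteq> B74"
  shows "wmeas w S = emeasure M S"
proof -
  have "emeasure M S = (\<integral>\<^sup>+x. ennreal (wt x0 w x) * indicator S x \<partial>lebesgue)"
    unfolding wmeasure_def by (rule emeasure_density) (use assms in auto)
  also have "\<dots> = wmeas w S"
    unfolding wmeas_def using assms(2) by (intro nn_integral_cong) (auto simp: wt_def indicator_def)
  finally show ?thesis by simp
qed

lemma wmeas_ball: "ball x r \<subseteq> B74 \<Longrightarrow> wmeas w (ball x r) = ennreal (measure M (ball x r))"
  using wmeas_eq[of "ball x r"] finite_measure.emeasure_eq_measure[OF finite_wm] by simp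

lemma ball_pos:
  assumes "0 < r" "ball x r \<subseteq> B74"
  shows "0 < measure M (ball x r)"
proof (rule ccontr)
  interpret finite_measure M by (rule finite_wm)
  assume "\<not> 0 < measure M (ball x r)"
  then have "emeasure M (ball x r) = 0"
    by (simp add: emeasure_eq_measure not_less ennreal_eq_0_iff)
  then have "(\<integral>\<^sup>+x'. ennreal (wt x0 w x') * indicator (ball x r) x' \<partial>lebesgue) = 0"
    unfolding wmeasure_def by (subst (asm) emeasure_density) auto
  then have "AE x' in lebesgue. ennreal (wt x0 w x') * indicator (ball x r) x' = 0"
    by (subst (asm) nn_integral_0_iff_AE) measurable
  then have "AE x' in lebesgue. x' \<notin> ball x r"
    using wt_pos by eventually_elim (use assms in \<open>auto simp: indicator_def ennreal_eq_0_iff split: if_splits\<close>)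
  then have "ball x r \<in> null_sets lebesgue"
    by (subst (asm) AE_iff_null_sets[symmetric]) auto
  then have "negligible (ball x r)" by (simp add: negligible_iff_null_sets)
  then show False using open_not_negligible[of "ball x r"] assms by auto
qed

lemma doubling_ball:
  assumes "doubling_with \<Omega> w \<gamma>" "0 < r" "ball x (2 * r) \<subseteq> B74"
  shows "measure M (ball x (2 * r)) \<le> \<gamma> * measure M (ball x r)"
proof -
  have s: "ball x r \<subseteq> B74" using assms subset_ball[of r "2 * r" x] by auto
  have \<gamma>: "0 < \<gamma>" using assms(1) by (simp add: doubling_with_def)
  have "wmeas w (ball x (2 * r)) \<le> ennreal \<gamma> * wmeas w (ball x r)"
    using assms B74 by (auto simp: doubling_with_def)
  then have "ennreal (measure M (ball x (2 * r))) \<le> ennreal (\<gamma> * measure M (ball x r))"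
    using \<gamma> by (simp add: wmeas_ball[OF s] wmeas_ball[OF assms(3)] ennreal_mult)
  then show ?thesis using \<gamma> by (subst (asm) ennreal_le_iff) auto
qed

lemma doubling_onI:
  assumes "1 \<le> \<gamma>" "\<And>x r. 0 < r \<Longrightarrow> ball x (2 * r) \<subseteq> B74 \<Longrightarrow> measure M (ball x (2 * r)) \<le> \<gamma> * measure M (ball x r)"
  shows "doubling_on B74 \<gamma> M"
  using assms finite_wm ball_pos by (auto simp: doubling_on_def)

lemma ex_doubling_on: "\<exists>\<gamma>. doubling_on B74 \<gamma> M"
proof -
  obtain \<gamma> where \<gamma>: "doubling_with \<Omega> w \<gamma>" using dbl by (auto simp: doubling_weight_def)
  have "doubling_on B74 (max 1 \<gamma>) M"
  proof (rule doubling_onI)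
    fix x r assume "0 < (r::real)" "ball x (2 * r) \<subseteq> B74"
    from doubling_ball[OF \<gamma> this] show "measure M (ball x (2 * r)) \<le> max 1 \<gamma> * measure M (ball x r)"
      by (rule order_trans) (intro mult_right_mono, auto)
  qed simp
  then show ?thesis by blast
qed

text \<open>The optimal constant must itself be admissible, because D1 is read off from it. Each
  quotient of masses is a lower bound of the set of doubling constants and hence at most its
  infimum.\<close>

lemma doubling_on_const:
  assumes "1 < log 2 (doubling_const \<Omega> w)"
  shows "doubling_on B74 (doubling_const \<Omega> w) M" "doubling_const \<Omega> w = 2 powr log 2 (doubling_const \<Omega> w)"
proof -
  let ?S = "{\<gamma>. doubling_with \<Omega> w \<gamma>}" and ?g = "doubling_const \<Omega> w"
  have ne: "?S \<noteq> {}" using dbl by (auto simp: doubling_weight_def)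
  have "0 \<le> ?g" unfolding doubling_const_def
    by (rule cInf_greatest[OF ne]) (auto simp: doubling_with_def)
  \<comment> \<open>In HOL the logarithm of 0 is 0, a value which the hypothesis excludes.\<close>
  moreover have "?g \<noteq> 0" using assms by (auto simp: log_def)
  ultimately have g0: "0 < ?g" by simp
  then show g: "?g = 2 powr log 2 ?g" by simp
  have "(2::real) powr 1 \<le> 2 powr log 2 ?g" using assms by (intro powr_mono) auto
  then have g1: "1 \<le> ?g" using g by simp
  show "doubling_on B74 ?g M"
  proof (rule doubling_onI[OF g1])
    fix x r assume r: "0 < (r::real)" "ball x (2 * r) \<subseteq> B74"
    have s: "ball x r \<subseteq> B74" using r subset_ball[of r "2 * r" x] by auto
    have pos: "0 < measure M (ball x r)" by (rule ball_pos[OF r(1) s])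
    have "measure M (ball x (2 * r)) / measure M (ball x r) \<le> ?g"
      unfolding doubling_const_def
    proof (rule cInf_greatest[OF ne])
      fix \<gamma> assume "\<gamma> \<in> ?S"
      then show "measure M (ball x (2 * r)) / measure M (ball x r) \<le> \<gamma>"
        using doubling_ball[OF _ r, of \<gamma>] pos by (simp add: field_simps)
    qed
    then show "measure M (ball x (2 * r)) \<le> ?g * measure M (ball x r)"
      using pos by (simp add: field_simps)
  qed
qed

text \<open>The given inequality is one between extended nonnegative averages. Since \<psi> and its
  gradient are bounded, all of these are finite, and it becomes an inequality between real
  integrals.\<close>

lemma poincare_measure:
  fixes D :: "real ^ 'n \<Rightarrow> real ^ 'n"
  assumes P: "\<And>u x r. Ck_on 1 \<Omega> u \<Longrightarrow> 0 < r \<Longrightarrow> ball x (\<rho> * r) \<subseteq> \<Omega> \<Longrightarrow>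
         wavg w (ball x r) (\<lambda>y. ennreal \<bar>u y - wmean w (ball x r) u\<bar>)
         \<le> ennreal (C1 * r) * epowr (wavg w (ball x (\<rho> * r)) (\<lambda>y. ennreal (norm (grad u y) powr p))) (1 / p)"
    and p: "0 < p" and c: "1 \<le> \<rho>" "0 < C1" "0 < r" "ball x (\<rho> * r) \<subseteq> B74"
    and \<psi>: "C1_on UNIV \<psi> D" "compact K" "\<And>y. y \<notin> K \<Longrightarrow> \<psi> y = 0"
  shows "(LINT y:ball x r|M. \<bar>\<psi> y - mean M (ball x r) \<psi>\<bar>) \<le> C1 * r * measure M (ball x r) *
       (measure (density M (\<lambda>y. ennreal (norm (D y) powr p))) (ball x (\<rho> * r)) / measure M (ball x (\<rho> * r))) powr (1 / p)"
proof -
  interpret finite_measure M by (rule finite_wm)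
  let ?B = "ball x r" and ?B' = "ball x (\<rho> * r)"
  have "r \<le> \<rho> * r" using c mult_right_mono[of 1 \<rho> r] by simp
  then have B: "?B \<subseteq> B74" using c(4) subset_ball[of r "\<rho> * r" x] by blast
  have r': "0 < \<rho> * r" using c by simp
  have pos: "0 < measure M ?B" "0 < measure M ?B'"
    using ball_pos[OF c(3) B] ball_pos[OF r' c(4)] .
  have ck: "Ck_on 1 \<Omega> \<psi>" by (rule C1_on_Ck_on_1[OF C1_on_subset[OF \<psi>(1)]]) simp
  have gr: "grad \<psi> y = D y" for y by (rule GDERIV_grad[OF GDERIV_D[OF \<psi>(1)]]) simp
  have c\<psi>: "continuous_on UNIV \<psi>" by (rule C1_on_continuous[OF \<psi>(1)])
  have cD: "continuous_on UNIV D" using \<psi>(1) by (simp add: C1_on_def)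
  have m[measurable]: "\<psi> \<in> borel_measurable lebesgue" "D \<in> borel_measurable lebesgue"
    using c\<psi> cD by (auto intro: continuous_lebesgue_measurable)
  obtain b where b: "0 \<le> b" "\<And>x. norm (\<psi> x) \<le> b"
    using continuous_compact_support_bounded[OF c\<psi> \<psi>(2,3)] by metis
  have sB: "?B \<in> sets lebesgue" "?B' \<in> sets lebesgue" by auto
  have mean: "wmean w ?B \<psi> = mean M ?B \<psi>"
  proof -
    have "(LINT y:?B|M. \<psi> y) = (LINT y|lebesgue. wt x0 w y *\<^sub>R (indicator ?B y *\<^sub>R \<psi> y))"
      unfolding set_lebesgue_integral_def wmeasure_def
      by (rule integral_density) (measurable, simp add: wt_nonneg)
    also have "\<dots> = (LINT y:?B|lebesgue. \<psi> y * w y)"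
      unfolding set_lebesgue_integral_def using B
      by (intro Bochner_Integration.integral_cong) (auto simp: wt_def indicator_def)
    finally show ?thesis by (simp add: wmean_def mean_def wmeas_ball[OF B])
  qed
  define h where "h = (\<lambda>y. \<bar>\<psi> y - mean M ?B \<psi>\<bar>)"
  have hm[measurable]: "h \<in> borel_measurable lebesgue" unfolding h_def by measurable
  have hi: "integrable M (\<lambda>y. indicator ?B y *\<^sub>R h y)"
  proof (rule integrable_const_bound[where B="b + \<bar>mean M ?B \<psi>\<bar>"])
    have "h y \<le> b + \<bar>mean M ?B \<psi>\<bar>" for y using b(2)[of y] unfolding h_def real_norm_def by linarith
    then show "AE y in M. norm (indicator ?B y *\<^sub>R h y) \<le> b + \<bar>mean M ?B \<psi>\<bar>"
      using b by (intro AE_I2) (auto simp: indicator_def h_def)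
  qed (unfold measurable_wm, measurable)
  have L: "wavg w ?B (\<lambda>y. ennreal (h y)) = ennreal ((LINT y:?B|M. h y) / measure M ?B)"
  proof -
    have "(\<integral>\<^sup>+y\<in>?B. (ennreal (h y) * ennreal (w y)) \<partial>lebesgue) = (\<integral>\<^sup>+y. ennreal (indicator ?B y *\<^sub>R h y * wt x0 w y) \<partial>lebesgue)"
      using B by (intro nn_integral_cong) (auto simp: wt_def indicator_def ennreal_mult' h_def)
    also have "\<dots> = (\<integral>\<^sup>+y. ennreal (indicator ?B y *\<^sub>R h y) \<partial>M)"
      by (rule nn_integral_wm[symmetric]) measurable
    also have "\<dots> = ennreal (LINT y:?B|M. h y)"
      unfolding set_lebesgue_integral_def
      by (rule nn_integral_eq_integral[OF hi]) (simp add: h_def)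
    finally show ?thesis
      using pos by (simp add: wavg_def wmeas_ball[OF B] divide_ennreal set_lebesgue_integral_def h_def)
  qed
  have R: "wavg w ?B' (\<lambda>y. ennreal (norm (D y) powr p)) = ennreal (measure (density M (\<lambda>y. ennreal (norm (D y) powr p))) ?B' / measure M ?B')"
  proof -
    obtain b' where b': "0 \<le> b'" "\<And>x. norm (D x) powr p \<le> b'"
    proof -
      have D0: "D y = 0" if "y \<notin> K" for y
        by (rule C1_on_outside_support[OF \<psi>(1) compact_imp_closed[OF \<psi>(2)] \<psi>(3) that])
      obtain b'' where b'': "0 \<le> b''" "\<And>x. norm (D x) \<le> b''"
        using continuous_compact_support_bounded[OF cD \<psi>(2) D0] by metis
      show thesis by (rule that[of "b'' powr p"]) (use p b'' in \<open>auto intro: powr_mono2\<close>)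
    qed
    have "(\<integral>\<^sup>+y\<in>?B'. (ennreal (norm (D y) powr p) * ennreal (w y)) \<partial>lebesgue)
       = (\<integral>\<^sup>+y. ennreal (norm (D y) powr p * indicator ?B' y * wt x0 w y) \<partial>lebesgue)"
      using c(4) by (intro nn_integral_cong) (auto simp: wt_def indicator_def ennreal_mult')
    also have "\<dots> = (\<integral>\<^sup>+y. ennreal (norm (D y) powr p * indicator ?B' y) \<partial>M)"
      by (rule nn_integral_wm[symmetric]) measurable
    also have "\<dots> = emeasure (density M (\<lambda>y. ennreal (norm (D y) powr p))) ?B'"
      by (subst emeasure_density) (auto intro!: nn_integral_cong simp: indicator_def measurable_wm)
    finally have e: "(\<integral>\<^sup>+y\<in>?B'. (ennreal (norm (D y) powr p) * ennreal (w y)) \<partial>lebesgue) = emeasure (density M (\<lambda>y. ennreal (norm (D y) powr p))) ?B'" .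
    have "emeasure (density M (\<lambda>y. ennreal (norm (D y) powr p))) ?B' = (\<integral>\<^sup>+y. ennreal (norm (D y) powr p) * indicator ?B' y \<partial>M)"
      by (subst emeasure_density) (auto simp: measurable_wm)
    also have "\<dots> \<le> (\<integral>\<^sup>+y. ennreal b' \<partial>M)"
      using b' by (intro nn_integral_mono) (auto simp: indicator_def intro: ennreal_leI)
    also have "\<dots> < \<infinity>" by (simp add: emeasure_eq_measure ennreal_mult[symmetric] b')
    finally have "emeasure (density M (\<lambda>y. ennreal (norm (D y) powr p))) ?B' = ennreal (measure (density M (\<lambda>y. ennreal (norm (D y) powr p))) ?B')"
      by (intro emeasure_eq_ennreal_measure) auto
    then show ?thesis using pos e by (simp add: wavg_def wmeas_ball[OF c(4)] divide_ennreal)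
  qed
  have "wavg w ?B (\<lambda>y. ennreal (h y)) \<le> ennreal (C1 * r) * epowr (wavg w ?B' (\<lambda>y. ennreal (norm (D y) powr p))) (1 / p)"
    using P[OF ck c(3), of x] c(4) B74 unfolding mean gr h_def by auto
  then have "ennreal ((LINT y:?B|M. h y) / measure M ?B) \<le> ennreal (C1 * r * (measure (density M (\<lambda>y. ennreal (norm (D y) powr p))) ?B' / measure M ?B') powr (1 / p))"
    unfolding L R using c by (simp add: epowr_ennreal ennreal_mult)
  then have "(LINT y:?B|M. h y) / measure M ?B \<le> C1 * r * (measure (density M (\<lambda>y. ennreal (norm (D y) powr p))) ?B' / measure M ?B') powr (1 / p)"
    using c by (subst (asm) ennreal_le_iff) auto
  then show ?thesis using pos(1) by (simp add: h_def field_simps)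
qed

end

text \<open>The critical exponent of the pair \<open>(w1, w1)\<close> is \<open>p * D1 / (D1 - p)\<close>: its balance condition
  is the doubling inequality itself.\<close>

lemma weighted_sobolev:
  fixes \<Omega> :: "(real ^ 'n) set"
  assumes \<Omega>: "open \<Omega>" "ball x0 2 \<subseteq> \<Omega>"
    and w1: "loc_integrable_weight \<Omega> w1" "doubling_weight \<Omega> w1" "poincare_weight \<Omega> p w1"
    and w2: "loc_integrable_weight \<Omega> w2" "doubling_weight \<Omega> w2"
    and bal: "balanced_weights \<Omega> p q w1 w2"
    and D1: "D1 = log 2 (doubling_const \<Omega> w1)" and p: "1 < p" "p < D1" "p < q"
  obtains C where "0 < C"
    "\<And>\<psi> D N. C1_on UNIV \<psi> D \<Longrightarrow> (\<And>y. y \<notin> cball x0 (3 / 2) \<Longrightarrow> \<psi> y = 0) \<Longrightarrow> 0 < N \<Longrightarrow>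
      (\<integral>\<^sup>+y. ennreal ((norm (D y) powr p + \<bar>\<psi> y\<bar> powr p) * wt x0 w1 y) \<partial>lebesgue) \<le> ennreal N \<Longrightarrow>
      (\<integral>\<^sup>+y. ennreal (\<bar>\<psi> y\<bar> powr (p * D1 / (D1 - p)) * wt x0 w1 y) \<partial>lebesgue) \<le> ennreal (C * N powr (D1 / (D1 - p)))"
    "\<And>\<psi> D N. C1_on UNIV \<psi> D \<Longrightarrow> (\<And>y. y \<notin> cball x0 (3 / 2) \<Longrightarrow> \<psi> y = 0) \<Longrightarrow> 0 < N \<Longrightarrow>
      (\<integral>\<^sup>+y. ennreal ((norm (D y) powr p + \<bar>\<psi> y\<bar> powr p) * wt x0 w1 y) \<partial>lebesgue) \<le> ennreal N \<Longrightarrow>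
      (\<integral>\<^sup>+y. ennreal (\<bar>\<psi> y\<bar> powr q * wt x0 w2 y) \<partial>lebesgue) \<le> ennreal (C * N powr (q / p))"
proof -
  interpret w1: local_weight \<Omega> x0 w1 by unfold_locales (use \<Omega> w1 in auto)
  interpret w2: local_weight \<Omega> x0 w2 by unfold_locales (use \<Omega> w2 in auto)
  let ?V = "ball x0 (7 / 4)" and ?K = "cball x0 (3 / 2)"
  let ?g = "doubling_const \<Omega> w1" and ?Q = "p * D1 / (D1 - p)"
  have dc: "doubling_on ?V ?g w1.M" "?g = 2 powr D1"
    using w1.doubling_on_const p unfolding D1 by auto
  obtain \<gamma>2 where dc2: "doubling_on ?V \<gamma>2 w2.M" using w2.ex_doubling_on by blast
  obtain \<rho> C1 where P: "1 \<le> \<rho>" "0 < C1"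
    "\<And>u x r. Ck_on 1 \<Omega> u \<Longrightarrow> 0 < r \<Longrightarrow> ball x (\<rho> * r) \<subseteq> \<Omega> \<Longrightarrow>
         wavg w1 (ball x r) (\<lambda>y. ennreal \<bar>u y - wmean w1 (ball x r) u\<bar>)
         \<le> ennreal (C1 * r) * epowr (wavg w1 (ball x (\<rho> * r)) (\<lambda>y. ennreal (norm (grad u y) powr p))) (1 / p)"
    using w1(3) unfolding poincare_weight_def by blast
  obtain C2 where C2: "0 < C2" "\<And>x y r R. 0 < r \<Longrightarrow> 0 < R \<Longrightarrow> ball x r \<subseteq> ball y R \<Longrightarrow> ball y R \<subseteq> \<Omega> \<Longrightarrow>
       ennreal (r / R) * epowr (wmeas w2 (ball x r) / wmeas w2 (ball y R)) (1 / q)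
       \<le> ennreal C2 * epowr (wmeas w1 (ball x r) / wmeas w1 (ball y R)) (1 / p)"
    using bal unfolding balanced_weights_def by blast
  \<comment> \<open>The product 8 \<rho> R = 1/4 is the gap between the radii 3/2 and 7/4.\<close>
  define R where "R = 1 / (32 * \<rho>)"
  have R: "0 < R" "8 * \<rho> * R = 1 / 4" "\<rho> * R = 1 / 32" using P(1) by (auto simp: R_def)
  have rm: "ball x t \<subseteq> ?V" if "x \<in> ?K" "t \<le> 1 / 4" for x t
  proof
    fix z assume "z \<in> ball x t"
    then show "z \<in> ?V" using dist_triangle[of x0 z x] that by simp
  qed
  have room: "ball x (8 * \<rho> * R) \<subseteq> ?V" if "x \<in> ?K" for x
    using rm[OF that] R(2) by simp
  have pc: "(LINT y:ball x r|w1.M. \<bar>\<psi> y - mean w1.M (ball x r) \<psi>\<bar>) \<le> C1 * r * measure w1.M (ball x r) *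
       (measure (density w1.M (\<lambda>y. ennreal (norm (D y) powr p))) (ball x (\<rho> * r)) / measure w1.M (ball x (\<rho> * r))) powr (1 / p)"
    if h: "C1_on UNIV \<psi> D" "\<And>y. y \<notin> ?K \<Longrightarrow> \<psi> y = 0" "x \<in> ?K" "0 < r" "r \<le> R" for \<psi> D x r
  proof (rule w1.poincare_measure[where K="?K", OF P(3) _ P(1,2) h(4) _ h(1) _ h(2)])
    have "\<rho> * r \<le> \<rho> * R" using h P by (intro mult_left_mono) auto
    then show "ball x (\<rho> * r) \<subseteq> ?V" using R by (intro rm h) auto
  qed (use p in auto)
  have half: "0 < \<rho> * (R * (1 / 2) ^ i)" "\<rho> * (R * (1 / 2) ^ i) \<le> \<rho> * R" for i
    using P R by (auto simp: mult_le_cancel_left1 power_le_one)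
  have subi: "ball x (\<rho> * (R * (1 / 2) ^ i)) \<subseteq> ?V" "ball x (\<rho> * R) \<subseteq> ?V" if "x \<in> ?K" for x i
    by (rule rm[OF that], use half[of i] R in simp)+
  have posi: "0 < measure w1.M (ball x (\<rho> * (R * (1 / 2) ^ i)))" "0 < measure w2.M (ball x (\<rho> * (R * (1 / 2) ^ i)))"
      "0 < measure w1.M (ball x (\<rho> * R))" "0 < measure w2.M (ball x (\<rho> * R))" if "x \<in> ?K" for x i
    by (rule w1.ball_pos w2.ball_pos, use half[of i] half[of 0] subi[OF that] in simp, rule subi[OF that])+
  have balance2: "(1 / 2) ^ i *
        (measure w2.M (ball x (\<rho> * (R * (1 / 2) ^ i))) / measure w2.M (ball x (\<rho> * R))) powr (1 / q)
      \<le> C2 * (measure w1.M (ball x (\<rho> * (R * (1 / 2) ^ i))) / measure w1.M (ball x (\<rho> * R))) powr (1 / p)"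
    if x: "x \<in> ?K" for x i
  proof -
    let ?r = "\<rho> * (R * (1 / 2) ^ i)"
    have r: "?r / (\<rho> * R) = (1 / 2) ^ i" using P R by simp
    have "ennreal (?r / (\<rho> * R)) * epowr (wmeas w2 (ball x ?r) / wmeas w2 (ball x (\<rho> * R))) (1 / q)
       \<le> ennreal C2 * epowr (wmeas w1 (ball x ?r) / wmeas w1 (ball x (\<rho> * R))) (1 / p)"
    proof (rule C2(2))
      show "ball x (\<rho> * R) \<subseteq> \<Omega>" using subi(2)[OF x] w1.B74(1) by (rule order_trans)
      show "ball x ?r \<subseteq> ball x (\<rho> * R)" by (rule subset_ball[OF half(2)])
    qed (use half[of i] half[of 0] in simp_all)
    then have "ennreal ((1 / 2) ^ i * (measure w2.M (ball x ?r) / measure w2.M (ball x (\<rho> * R))) powr (1 / q))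
       \<le> ennreal (C2 * (measure w1.M (ball x ?r) / measure w1.M (ball x (\<rho> * R))) powr (1 / p))"
      unfolding r w1.wmeas_ball[OF subi(1)[OF x]] w1.wmeas_ball[OF subi(2)[OF x]]
        w2.wmeas_ball[OF subi(1)[OF x]] w2.wmeas_ball[OF subi(2)[OF x]]
      using posi(1,2)[OF x, of i] posi(3,4)[OF x] C2(1)
      by (simp add: divide_ennreal epowr_ennreal ennreal_mult)
    then show ?thesis using C2(1) by (subst (asm) ennreal_le_iff) auto
  qed
  have D1p: "0 < D1" "0 < D1 - p" using p by auto
  have pQ: "p < ?Q" using p D1p by (simp add: field_simps)
  have invQ: "1 / p - 1 / ?Q = 1 / D1" using p D1p by (simp add: field_simps)
  have balance1: "(1 / 2) ^ i *
        (measure w1.M (ball x (\<rho> * (R * (1 / 2) ^ i))) / measure w1.M (ball x (\<rho> * R))) powr (1 / ?Q)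
      \<le> 1 * (measure w1.M (ball x (\<rho> * (R * (1 / 2) ^ i))) / measure w1.M (ball x (\<rho> * R))) powr (1 / p)"
    if x: "x \<in> ?K" for x i
  proof -
    define t where "t = (\<lambda>i. measure w1.M (ball x (\<rho> * (R * (1 / 2) ^ i))) / measure w1.M (ball x (\<rho> * R)))"
    have t0: "0 < t i" for i using posi(1,2)[OF x, of i] posi(3,4)[OF x] by (simp add: t_def)
    \<comment> \<open>Halving the radius costs at most a factor 2^D1 of the mass, hence a factor 2
      after taking the power 1/D1. As 1/p - 1/Q = 1/D1, this is the balance condition of w1 with
      itself.\<close>
    have tl: "(1 / 2) ^ i \<le> t i powr (1 / D1)" for i
    proof (induction i)
      case 0
      then show ?case using posi(1,2)[OF x, of 0] posi(3,4)[OF x] by (simp add: t_def)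
    next
      case (Suc i)
      let ?r = "\<rho> * (R * (1 / 2) ^ Suc i)"
      have e: "2 * ?r = \<rho> * (R * (1 / 2) ^ i)" by simp
      have "measure w1.M (ball x (2 * ?r)) \<le> ?g * measure w1.M (ball x ?r)"
        by (rule doubling_onD(5)[OF dc(1) half(1)]) (unfold e, rule subi(1)[OF x])
      then have "t i \<le> ?g * t (Suc i)"
        unfolding e t_def using posi(1,2)[OF x, of 0] posi(3,4)[OF x] by (simp add: divide_right_mono)
      then have "t i powr (1 / D1) \<le> (?g * t (Suc i)) powr (1 / D1)"
        using t0[of i] D1p by (intro powr_mono2) auto
      also have "\<dots> = 2 * t (Suc i) powr (1 / D1)"
        unfolding dc(2) powr_mult powr_powr using D1p by simp
      finally show ?case using Suc by simp
    qed
    have "(1 / 2) ^ i * t i powr (1 / ?Q) \<le> t i powr (1 / D1) * t i powr (1 / ?Q)"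
      by (intro mult_right_mono tl) auto
    also have "\<dots> = t i powr (1 / p)"
      unfolding powr_add[symmetric] invQ[symmetric] by simp
    finally show ?thesis by (simp add: t_def)
  qed
  interpret s1: sobolev_data w1.M w1.M ?V ?K ?g ?g \<rho> R C1 1 p ?Q
    by unfold_locales (use dc P R room p pQ pc balance1 in \<open>simp_all\<close>)
  interpret s2: sobolev_data w1.M w2.M ?V ?K ?g \<gamma>2 \<rho> R C1 C2 p q
    by unfold_locales (use dc dc2 P R room p C2 pc balance2 in \<open>simp_all\<close>)
  obtain Ca where Ca: "0 < Ca" "\<And>\<psi> D N. C1_on UNIV \<psi> D \<Longrightarrow> (\<And>y. y \<notin> ?K \<Longrightarrow> \<psi> y = 0) \<Longrightarrow> 0 < N \<Longrightarrow>
    (\<integral>\<^sup>+y. ennreal (norm (D y) powr p + \<bar>\<psi> y\<bar> powr p) \<partial>w1.M) \<le> ennreal N \<Longrightarrow>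
    (\<integral>\<^sup>+y. ennreal (\<bar>\<psi> y\<bar> powr ?Q) \<partial>w1.M) \<le> ennreal (Ca * N powr (?Q / p))"
    by (rule s1.sobolev) blast
  obtain Cb where Cb: "0 < Cb" "\<And>\<psi> D N. C1_on UNIV \<psi> D \<Longrightarrow> (\<And>y. y \<notin> ?K \<Longrightarrow> \<psi> y = 0) \<Longrightarrow> 0 < N \<Longrightarrow>
    (\<integral>\<^sup>+y. ennreal (norm (D y) powr p + \<bar>\<psi> y\<bar> powr p) \<partial>w1.M) \<le> ennreal N \<Longrightarrow>
    (\<integral>\<^sup>+y. ennreal (\<bar>\<psi> y\<bar> powr q) \<partial>w2.M) \<le> ennreal (Cb * N powr (q / p))"
    by (rule s2.sobolev) blast
  have meas: "\<psi> \<in> borel_measurable lebesgue" "D \<in> borel_measurable lebesgue" if "C1_on UNIV \<psi> D"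
    for \<psi> :: "real ^ 'n \<Rightarrow> real" and D
    using that C1_on_continuous[OF that] by (auto simp: C1_on_def intro: continuous_lebesgue_measurable)
  have Qp: "?Q / p = D1 / (D1 - p)" using p by simp
  show ?thesis
  proof (rule that[of "max Ca Cb"])
    show "0 < max Ca Cb" using Ca by simp
  next
    fix \<psi> D N
    assume h: "C1_on UNIV \<psi> D" "\<And>y. y \<notin> ?K \<Longrightarrow> \<psi> y = 0" "0 < N"
      "(\<integral>\<^sup>+y. ennreal ((norm (D y) powr p + \<bar>\<psi> y\<bar> powr p) * wt x0 w1 y) \<partial>lebesgue) \<le> ennreal N"
    note [measurable] = meas[OF h(1)]
    have h4: "(\<integral>\<^sup>+y. ennreal (norm (D y) powr p + \<bar>\<psi> y\<bar> powr p) \<partial>w1.M) \<le> ennreal N"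
      using h(4) by (subst w1.nn_integral_wm) measurable
    have "(\<integral>\<^sup>+y. ennreal (\<bar>\<psi> y\<bar> powr ?Q * wt x0 w1 y) \<partial>lebesgue) \<le> ennreal (Ca * N powr (?Q / p))"
      using Ca(2)[OF h(1,2,3) h4] by (subst w1.nn_integral_wm[symmetric]) measurable
    also have "\<dots> \<le> ennreal (max Ca Cb * N powr (D1 / (D1 - p)))"
      unfolding Qp by (intro ennreal_leI mult_right_mono) auto
    finally show "(\<integral>\<^sup>+y. ennreal (\<bar>\<psi> y\<bar> powr ?Q * wt x0 w1 y) \<partial>lebesgue) \<le> ennreal (max Ca Cb * N powr (D1 / (D1 - p)))" .
    have "(\<integral>\<^sup>+y. ennreal (\<bar>\<psi> y\<bar> powr q * wt x0 w2 y) \<partial>lebesgue) \<le> ennreal (Cb * N powr (q / p))"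
      using Cb(2)[OF h(1,2,3) h4] by (subst w2.nn_integral_wm[symmetric]) measurable
    also have "\<dots> \<le> ennreal (max Ca Cb * N powr (q / p))"
      by (intro ennreal_leI mult_right_mono) auto
    finally show "(\<integral>\<^sup>+y. ennreal (\<bar>\<psi> y\<bar> powr q * wt x0 w2 y) \<partial>lebesgue) \<le> ennreal (max Ca Cb * N powr (q / p))" .
  qed
qed

section \<open>Elementary estimates\<close>

lemma powr_sum2:
  assumes "0 \<le> x" "0 \<le> y" "0 \<le> p"
  shows "(x + y) powr p \<le> 2 powr p * (x powr p + y powr p :: real)"
proof -
  have "(x + y) powr p \<le> (2 * max x y) powr p"
    using assms by (intro powr_mono2) auto
  also have "\<dots> = 2 powr p * max x y powr p" by (rule powr_mult)
  also have "\<dots> \<le> 2 powr p * (x powr p + y powr p)"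
    by (intro mult_left_mono) (auto simp: max_def)
  finally show ?thesis .
qed

lemma powr_sum3:
  assumes "0 \<le> x" "0 \<le> y" "0 \<le> z" "0 \<le> p"
  shows "(x + y + z) powr p \<le> 3 powr p * (x powr p + y powr p + z powr p :: real)"
proof -
  have "(x + y + z) powr p \<le> (3 * max x (max y z)) powr p"
    using assms by (intro powr_mono2) auto
  also have "\<dots> = 3 powr p * max x (max y z) powr p" by (rule powr_mult)
  also have "\<dots> \<le> 3 powr p * (x powr p + y powr p + z powr p)"
    by (intro mult_left_mono) (auto simp: max_def)
  finally show ?thesis .
qed

text \<open>When the L^1 norms are summable the whole sequence converges almost everywhere;
  approximants are later chosen with rate 2^-n, so that no subsequence has to be extracted.\<close>

lemma AE_tendsto_0:
  fixes f :: "nat \<Rightarrow> 'a \<Rightarrow> real"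
  assumes m[measurable]: "\<And>n. f n \<in> borel_measurable M" and nn: "\<And>n x. 0 \<le> f n x"
    and le: "\<And>n. (\<integral>\<^sup>+x. ennreal (f n x) \<partial>M) \<le> ennreal ((1 / 2) ^ n)"
  shows "AE x in M. (\<lambda>n. f n x) \<longlonglongrightarrow> 0"
proof -
  have "(\<integral>\<^sup>+x. (\<Sum>n. ennreal (f n x)) \<partial>M) = (\<Sum>n. \<integral>\<^sup>+x. ennreal (f n x) \<partial>M)"
    by (rule nn_integral_suminf) measurable
  also have "\<dots> \<le> (\<Sum>n. ennreal ((1 / 2) ^ n))" by (intro suminf_le le) auto
  also have "\<dots> = ennreal (\<Sum>n. (1 / 2) ^ n)" by (rule suminf_ennreal2) (auto intro: summable_geometric)
  also have "\<dots> < \<infinity>" by simp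
  finally have "(\<integral>\<^sup>+x. (\<Sum>n. ennreal (f n x)) \<partial>M) \<noteq> \<infinity>" by simp
  then have "AE x in M. (\<Sum>n. ennreal (f n x)) \<noteq> \<infinity>"
    by (intro nn_integral_PInf_AE) measurable
  then show ?thesis
  proof eventually_elim
    case (elim x)
    then have "summable (\<lambda>n. f n x)" using nn by (intro summable_suminf_not_top) auto
    then show ?case by (rule summable_LIMSEQ_zero)
  qed
qed

text \<open>The test function contains \<open>\<eta> powr p\<close> with \<eta> vanishing outside a
  ball. The extension by \<open>max 0\<close> is differentiable on the whole line because p > 1, so
  the chain rule needs no case distinction.\<close>

lemma max0_powr_DERIV:
  fixes p :: real
  assumes p: "1 < p"
  shows "DERIV (\<lambda>t. max 0 t powr p) t :> p * max 0 t powr (p - 1)"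
proof -
  consider "t > 0" | "t < 0" | "t = 0" by linarith
  then show ?thesis
  proof cases
    case 1
    have "DERIV (\<lambda>t. t powr p) t :> p * t powr (p - 1)"
      using 1 by (rule has_real_derivative_powr)
    then have "DERIV (\<lambda>t. max 0 t powr p) t :> p * t powr (p - 1)"
      by (rule has_field_derivative_transform_within_open[where S="{0<..}"]) (use 1 in \<open>auto simp: max_def\<close>)
    then show ?thesis using 1 by (simp add: max_def)
  next
    case 2
    have "DERIV (\<lambda>t. max 0 t powr p) t :> 0"
      by (rule has_field_derivative_transform_within_open[where S="{..<0}" and f="\<lambda>_. 0"]) (use 2 in \<open>auto simp: max_def\<close>)
    then show ?thesis using 2 p by (simp add: max_def)
  next
    case 3
    have "((\<lambda>h. (max 0 (0 + h) powr p - max 0 0 powr p) / h) \<longlongrightarrow> 0) (at (0::real))"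
    proof (rule Lim_null_comparison)
      show "\<forall>\<^sub>F h in at (0::real). norm ((max 0 (0 + h) powr p - max 0 0 powr p) / h) \<le> \<bar>h\<bar> powr (p - 1)"
        unfolding eventually_at_filter
      proof (intro always_eventually allI impI)
        fix h :: real assume "h \<noteq> 0"
        have "max 0 h powr p \<le> \<bar>h\<bar> powr p" using p by (intro powr_mono2) auto
        also have "\<dots> = \<bar>h\<bar> * \<bar>h\<bar> powr (p - 1)" by (simp add: powr_mult_base)
        finally show "norm ((max 0 (0 + h) powr p - max 0 0 powr p) / h) \<le> \<bar>h\<bar> powr (p - 1)"
          using \<open>h \<noteq> 0\<close> by (simp add: divide_le_eq mult.commute)
      qed
      have "((\<lambda>h. \<bar>h\<bar> powr (p - 1)) \<longlongrightarrow> \<bar>0\<bar> powr (p - 1)) (at (0::real))"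
        using p by (intro tendsto_intros) (auto intro!: always_eventually)
      then show "((\<lambda>h. \<bar>h\<bar> powr (p - 1)) \<longlongrightarrow> 0) (at (0::real))" by simp
    qed
    then show ?thesis using 3 p by (simp add: DERIV_def)
  qed
qed

lemma cutoff_profile:
  obtains \<sigma> s :: "real \<Rightarrow> real" and B where "0 < B" "\<And>t. DERIV \<sigma> t :> s t" "continuous_on UNIV s"
    "\<And>t. \<bar>s t\<bar> \<le> B" "\<And>t. t \<le> 0 \<Longrightarrow> s t = 0" "\<And>t. t \<le> 0 \<Longrightarrow> \<sigma> t = 0" "\<And>t. 1 \<le> t \<Longrightarrow> \<sigma> t = 1"
    "\<And>t. 0 \<le> \<sigma> t" "\<And>t. \<sigma> t \<le> 1"
proof -
  define s0 :: "real \<Rightarrow> real" where "s0 = (\<lambda>t. max 0 (min t (1 - t)))"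
  have cs: "continuous_on UNIV s0" unfolding s0_def by (intro continuous_intros)
  obtain F where F: "F 0 = 0" "\<And>t. DERIV F t :> s0 t" using ex_antiderivative[OF cs] by blast
  have mono: "F x \<le> F y" if "x \<le> y" for x y
  proof (rule DERIV_nonneg_imp_nondecreasing[OF that])
    fix z
    have "DERIV F z :> s0 z \<and> 0 \<le> s0 z" using F(2)[of z] by (simp add: s0_def)
    then show "\<exists>y. DERIV F z :> y \<and> 0 \<le> y" by blast
  qed
  have cF: "continuous_on A F" for A
    by (intro continuous_at_imp_continuous_on ballI DERIV_isCont[OF F(2)])
  have neg: "F t = 0" if "t \<le> 0" for t
  proof (cases "t = 0")
    case False
    then have "F 0 = F t"
    proof (intro DERIV_isconst_end[where f=F] cF)
      fix x assume "t < x" "x < 0"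
      then show "DERIV F x :> 0" using F(2)[of x] by (simp add: s0_def)
    qed (use that in auto)
    then show ?thesis using F by simp
  qed (use F in simp)
  have pos: "F t = F 1" if "1 \<le> t" for t
  proof (cases "t = 1")
    case False
    then show "F t = F 1"
    proof (intro DERIV_isconst_end[where f=F] cF)
      fix x assume "1 < x" "x < t"
      then show "DERIV F x :> 0" using F(2)[of x] by (simp add: s0_def)
    qed (use that in auto)
  qed simp
  have F1: "0 < F 1"
  proof (rule ccontr)
    assume "\<not> 0 < F 1"
    then have z: "F x = 0" if "0 < x" "x < 1" for x using mono[of 0 x] mono[of x 1] that F by simp
    have "DERIV F (1 / 2) :> 0"
      by (rule has_field_derivative_transform_within_open[where S="{0<..<1}" and f="\<lambda>_. 0"]) (use z in auto)
    then have "s0 (1 / 2) = 0" using F(2)[of "1 / 2"] DERIV_unique by blast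
    then show False by (simp add: s0_def)
  qed
  show ?thesis
  proof (rule that[of "1 / F 1" "\<lambda>t. F t / F 1" "\<lambda>t. s0 t / F 1"])
    show "DERIV (\<lambda>t. F t / F 1) t :> s0 t / F 1" for t by (rule DERIV_cdivide[OF F(2)])
    show "continuous_on UNIV (\<lambda>t. s0 t / F 1)" using F1 by (intro continuous_intros cs) auto
    show "\<bar>s0 t / F 1\<bar> \<le> 1 / F 1" for t using F1 by (auto simp: s0_def intro!: divide_right_mono)
    show "0 \<le> F t / F 1" for t using F1 mono[of 0 t] neg[of t] F by (cases "t \<le> 0") auto
    show "F t / F 1 \<le> 1" for t using F1 mono[of t 1] pos[of t] by (cases "t \<le> 1") auto
    show "F t / F 1 = 1" if "1 \<le> t" for t using pos[OF that] F1 by simp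
    show "F t / F 1 = 0" if "t \<le> 0" for t using neg[OF that] by simp
    show "s0 t / F 1 = 0" if "t \<le> 0" for t using that by (simp add: s0_def)
  qed (use F1 in simp)
qed

text \<open>The profile is applied to the squared distance, which unlike the distance is smooth at
  the centre. The radii lie between 1 and 3/2, so that r'^2 - r^2 is comparable to r' - r and one
  constant \<open>L\<close> serves all cutoffs of the iteration.\<close>

lemma cutoff:
  fixes x0 :: "'a::euclidean_space"
  obtains L where "0 < L" "\<And>r r'. 1 \<le> r \<Longrightarrow> r < r' \<Longrightarrow> r' \<le> 3 / 2 \<Longrightarrow>
    \<exists>\<eta> D. C1_on UNIV \<eta> D \<and> (\<forall>x. 0 \<le> \<eta> x \<and> \<eta> x \<le> 1) \<and> (\<forall>x\<in>cball x0 r. \<eta> x = 1) \<and>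
      (\<forall>x. x \<notin> cball x0 r' \<longrightarrow> \<eta> x = 0) \<and> (\<forall>x. x \<notin> cball x0 r' \<longrightarrow> D x = 0) \<and> (\<forall>x. norm (D x) \<le> L / (r' - r))"
proof -
  obtain \<sigma> s B where S: "0 < (B::real)" "\<And>t. DERIV \<sigma> t :> s t" "continuous_on UNIV s"
    "\<And>t. \<bar>s t\<bar> \<le> B" "\<And>t. t \<le> 0 \<Longrightarrow> s t = 0" "\<And>t. t \<le> 0 \<Longrightarrow> \<sigma> t = 0" "\<And>t. 1 \<le> t \<Longrightarrow> \<sigma> t = 1"
    "\<And>t. 0 \<le> \<sigma> t" "\<And>t. \<sigma> t \<le> 1"
    by (rule cutoff_profile) blast
  have "\<exists>\<eta> D. C1_on UNIV \<eta> D \<and> (\<forall>x. 0 \<le> \<eta> x \<and> \<eta> x \<le> 1) \<and> (\<forall>x\<in>cball x0 r. \<eta> x = 1) \<and>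
      (\<forall>x. x \<notin> cball x0 r' \<longrightarrow> \<eta> x = 0) \<and> (\<forall>x. x \<notin> cball x0 r' \<longrightarrow> D x = 0) \<and> (\<forall>x. norm (D x) \<le> (2 * B) / (r' - r))"
    if r: "1 \<le> r" "r < r'" "r' \<le> 3 / 2" for r r'
  proof -
    define c where "c = r'\<^sup>2 - r\<^sup>2"
    have cf: "c = (r' - r) * (r' + r)" by (simp add: c_def power2_eq_square algebra_simps)
    have c: "2 * (r' - r) \<le> c" "0 < c"
      using mult_left_mono[of 2 "r' + r" "r' - r"] mult_pos_pos[of "r' - r" "r' + r"] r unfolding cf by auto
    define \<tau> where "\<tau> = (\<lambda>x. (r'\<^sup>2 - inner (x - x0) (x - x0)) * (1 / c))"
    have sq: "inner (x - x0) (x - x0) = (dist x0 x)\<^sup>2" for x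
      by (simp add: dot_square_norm dist_norm norm_minus_commute)
    define \<eta> where "\<eta> = (\<lambda>x. \<sigma> (\<tau> x))"
    define D where "D = (\<lambda>x. s (\<tau> x) *\<^sub>R ((1 / c) *\<^sub>R ((-2) *\<^sub>R (x - x0))))"
    have ct: "continuous_on UNIV \<tau>" unfolding \<tau>_def by (intro continuous_intros)
    have g: "GDERIV \<eta> x :> D x" for x
    proof -
      have "GDERIV (\<lambda>x. r'\<^sup>2 - inner (x - x0) (x - x0)) x :> (-2) *\<^sub>R (x - x0)"
        by (rule GDERIV_shift[where f="\<lambda>x. r'\<^sup>2 - inner x x", OF GDERIV_inner_self])
      then have "GDERIV \<tau> x :> (1 / c) *\<^sub>R ((-2) *\<^sub>R (x - x0))"
        unfolding \<tau>_def by (rule GDERIV_subst[OF GDERIV_mult[OF _ GDERIV_const]]) simp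
      then show ?thesis unfolding \<eta>_def D_def by (rule GDERIV_DERIV_compose[OF _ S(2)])
    qed
    have "continuous_on UNIV D"
      unfolding D_def by (intro continuous_intros continuous_on_compose2[OF S(3) ct]) auto
    then have C1: "C1_on UNIV \<eta> D" using g by (simp add: C1_on_def)
    have out: "\<tau> x \<le> 0" if "x \<notin> cball x0 r'" for x
    proof -
      have "r'\<^sup>2 \<le> (dist x0 x)\<^sup>2" using that r by (intro power_mono) auto
      then show ?thesis using c by (simp add: \<tau>_def sq divide_le_0_iff)
    qed
    have inn: "1 \<le> \<tau> x" if "x \<in> cball x0 r" for x
    proof -
      have "(dist x0 x)\<^sup>2 \<le> r\<^sup>2" using that r by (intro power_mono) auto
      then have "c \<le> r'\<^sup>2 - (dist x0 x)\<^sup>2" by (simp add: c_def)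
      then show ?thesis using c(2) by (simp add: \<tau>_def sq)
    qed
    have "norm (D x) \<le> 2 * B / (r' - r)" for x
    proof (cases "x \<in> cball x0 r'")
      case True
      then have n: "norm (x - x0) \<le> 3 / 2" using r by (simp add: dist_norm norm_minus_commute)
      have "norm (D x) = \<bar>s (\<tau> x)\<bar> * (2 * norm (x - x0)) / c"
        using c(2) by (simp add: D_def abs_mult)
      also have "\<dots> \<le> B * 3 / (2 * (r' - r))"
        using S(1,4) n c r by (intro frac_le mult_mono) auto
      also have "\<dots> \<le> 2 * B / (r' - r)" using S(1) r by (simp add: field_simps)
      finally show ?thesis .
    next
      case False
      then show ?thesis using S(1,5) out r by (simp add: D_def)
    qed
    then show ?thesis
      using C1 S(5-9) out inn by (intro exI[of _ \<eta>] exI[of _ D]) (simp add: \<eta>_def D_def)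
  qed
  then show ?thesis using that[of "2 * B"] S(1) by auto
qed

section \<open>The closure of the test functions\<close>

text \<open>Only the weights, already cut off to radius 7/4, and the exponents enter. Constants
  defined in this context are therefore independent of the solution, and data of the equation appear
  in them as explicit arguments.\<close>

locale moser_data =
  fixes x0 :: "real ^ 'n" and \<omega>1 \<omega>2 :: "real ^ 'n \<Rightarrow> real" and p q D1 D \<epsilon> Cs :: real
  assumes m\<omega>[measurable]: "\<omega>1 \<in> borel_measurable lebesgue" "\<omega>2 \<in> borel_measurable lebesgue"
    and \<omega>0: "\<And>x. 0 \<le> \<omega>1 x" "\<And>x. 0 \<le> \<omega>2 x"
    and \<omega>out: "\<And>x. x \<notin> ball x0 (7 / 4) \<Longrightarrow> \<omega>1 x = 0" "\<And>x. x \<notin> ball x0 (7 / 4) \<Longrightarrow> \<omega>2 x = 0"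
    and \<omega>int: "integrable lebesgue \<omega>1" "integrable lebesgue \<omega>2"
    and \<omega>pos: "AE x in lebesgue. x \<in> ball x0 (7 / 4) \<longrightarrow> 0 < \<omega>1 x"
    and p: "1 < p" "p < D1" "p < q" and D: "D = q * p / (q - p)" and \<epsilon>: "0 < \<epsilon>" "\<epsilon> < 1"
    and Cs: "0 < Cs"
    and sob1: "\<And>\<psi> E N. C1_on UNIV \<psi> E \<Longrightarrow> (\<And>y. y \<notin> cball x0 (3 / 2) \<Longrightarrow> \<psi> y = 0) \<Longrightarrow> 0 < N \<Longrightarrow>
      (\<integral>\<^sup>+y. ennreal ((norm (E y) powr p + \<bar>\<psi> y\<bar> powr p) * \<omega>1 y) \<partial>lebesgue) \<le> ennreal N \<Longrightarrow>
      (\<integral>\<^sup>+y. ennreal (\<bar>\<psi> y\<bar> powr (p * D1 / (D1 - p)) * \<omega>1 y) \<partial>lebesgue) \<le> ennreal (Cs * N powr (D1 / (D1 - p)))"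
    and sob2: "\<And>\<psi> E N. C1_on UNIV \<psi> E \<Longrightarrow> (\<And>y. y \<notin> cball x0 (3 / 2) \<Longrightarrow> \<psi> y = 0) \<Longrightarrow> 0 < N \<Longrightarrow>
      (\<integral>\<^sup>+y. ennreal ((norm (E y) powr p + \<bar>\<psi> y\<bar> powr p) * \<omega>1 y) \<partial>lebesgue) \<le> ennreal N \<Longrightarrow>
      (\<integral>\<^sup>+y. ennreal (\<bar>\<psi> y\<bar> powr q * \<omega>2 y) \<partial>lebesgue) \<le> ennreal (Cs * N powr (q / p))"
begin

text \<open>The Sobolev conjugate of p in dimension D1. Likewise q is the conjugate of p in
  dimension D, since 1/D + 1/q = 1/p.\<close>

definition Q1 :: real where "Q1 = p * D1 / (D1 - p)"

lemma Q1: "p < Q1" "Q1 / p = D1 / (D1 - p)" "1 / D1 + 1 / Q1 = 1 / p" "0 < Q1" "0 < D1"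
  using p by (auto simp: Q1_def field_simps)

lemma Dq: "0 < D" "1 / D + 1 / q = 1 / p" "0 < q"
  using p by (auto simp: D field_simps)

text \<open>The p-th power of the Sobolev norm rather than the norm: integrals add up directly, at
  the price of a factor 2^p in the triangle inequality.\<close>

definition En :: "(real ^ 'n \<Rightarrow> real) \<Rightarrow> (real ^ 'n \<Rightarrow> real ^ 'n) \<Rightarrow> ennreal"
  where "En \<psi> \<Psi> = (\<integral>\<^sup>+y. ennreal ((norm (\<Psi> y) powr p + \<bar>\<psi> y\<bar> powr p) * \<omega>1 y) \<partial>lebesgue)"

text \<open>The closure of C^1 functions supported in a fixed closed ball, as pairs with the weak
  gradient. Since \<omega>1 vanishes beyond radius 7/4, closeness in energy says nothing about
  \<psi> there; later statements add support hypotheses for this reason.\<close>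

definition H0 :: "real \<Rightarrow> (real ^ 'n \<Rightarrow> real) \<Rightarrow> (real ^ 'n \<Rightarrow> real ^ 'n) \<Rightarrow> bool"
  where "H0 r \<psi> \<Psi> \<longleftrightarrow> \<psi> \<in> borel_measurable lebesgue \<and> \<Psi> \<in> borel_measurable lebesgue \<and>
    (\<forall>e>0. \<exists>\<phi> E. C1_on UNIV \<phi> E \<and> (\<forall>y. y \<notin> cball x0 r \<longrightarrow> \<phi> y = 0) \<and>
       En (\<lambda>y. \<phi> y - \<psi> y) (\<lambda>y. E y - \<Psi> y) \<le> ennreal e)"

lemma H0E:
  assumes "H0 r \<psi> \<Psi>" "0 < e"
  obtains \<phi> E where "C1_on UNIV \<phi> E" "\<And>y. y \<notin> cball x0 r \<Longrightarrow> \<phi> y = 0"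
    "En (\<lambda>y. \<phi> y - \<psi> y) (\<lambda>y. E y - \<Psi> y) \<le> ennreal e"
proof -
  have "\<exists>\<phi> E. C1_on UNIV \<phi> E \<and> (\<forall>y. y \<notin> cball x0 r \<longrightarrow> \<phi> y = 0) \<and>
       En (\<lambda>y. \<phi> y - \<psi> y) (\<lambda>y. E y - \<Psi> y) \<le> ennreal e"
    using assms by (simp only: H0_def)
  then obtain \<phi> E where "C1_on UNIV \<phi> E" "\<forall>y. y \<notin> cball x0 r \<longrightarrow> \<phi> y = 0"
    "En (\<lambda>y. \<phi> y - \<psi> y) (\<lambda>y. E y - \<Psi> y) \<le> ennreal e" by (elim exE conjE)
  then show ?thesis by (intro that[of \<phi> E]) auto
qed

lemma H0_measurable:
  assumes "H0 r \<psi> \<Psi>"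
  shows "\<psi> \<in> borel_measurable lebesgue" "\<Psi> \<in> borel_measurable lebesgue"
  using assms by (simp_all add: H0_def)

lemma C1_measurable:
  assumes "C1_on UNIV \<phi> E"
  shows "\<phi> \<in> borel_measurable lebesgue" "E \<in> borel_measurable lebesgue"
  using assms C1_on_continuous[OF assms] by (auto simp: C1_on_def intro: continuous_lebesgue_measurable)

lemma En_add:
  assumes [measurable]: "\<psi> \<in> borel_measurable lebesgue" "\<Psi> \<in> borel_measurable lebesgue"
    "\<psi>' \<in> borel_measurable lebesgue" "\<Psi>' \<in> borel_measurable lebesgue"
  shows "En (\<lambda>y. \<psi> y + \<psi>' y) (\<lambda>y. \<Psi> y + \<Psi>' y) \<le> ennreal (2 powr p) * (En \<psi> \<Psi> + En \<psi>' \<Psi>')"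
proof -
  have "(norm (\<Psi> y + \<Psi>' y) powr p + \<bar>\<psi> y + \<psi>' y\<bar> powr p) * \<omega>1 y
    \<le> 2 powr p * ((norm (\<Psi> y) powr p + \<bar>\<psi> y\<bar> powr p) * \<omega>1 y + (norm (\<Psi>' y) powr p + \<bar>\<psi>' y\<bar> powr p) * \<omega>1 y)" for y
  proof -
    have "norm (\<Psi> y + \<Psi>' y) powr p \<le> (norm (\<Psi> y) + norm (\<Psi>' y)) powr p"
      using p by (intro powr_mono2 norm_triangle_ineq) auto
    also have "\<dots> \<le> 2 powr p * (norm (\<Psi> y) powr p + norm (\<Psi>' y) powr p)"
      using p by (intro powr_sum2) auto
    finally have 1: "norm (\<Psi> y + \<Psi>' y) powr p \<le> 2 powr p * (norm (\<Psi> y) powr p + norm (\<Psi>' y) powr p)" .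
    have "\<bar>\<psi> y + \<psi>' y\<bar> powr p \<le> (\<bar>\<psi> y\<bar> + \<bar>\<psi>' y\<bar>) powr p"
      using p by (intro powr_mono2) auto
    also have "\<dots> \<le> 2 powr p * (\<bar>\<psi> y\<bar> powr p + \<bar>\<psi>' y\<bar> powr p)"
      using p by (intro powr_sum2) auto
    finally have "norm (\<Psi> y + \<Psi>' y) powr p + \<bar>\<psi> y + \<psi>' y\<bar> powr p
      \<le> 2 powr p * (norm (\<Psi> y) powr p + norm (\<Psi>' y) powr p) + 2 powr p * (\<bar>\<psi> y\<bar> powr p + \<bar>\<psi>' y\<bar> powr p)"
      using 1 by linarith
    from mult_right_mono[OF this \<omega>0(1)[of y]] show ?thesis by (simp add: algebra_simps)
  qed
  then have "En (\<lambda>y. \<psi> y + \<psi>' y) (\<lambda>y. \<Psi> y + \<Psi>' y) \<le> (\<integral>\<^sup>+y. ennreal (2 powr p) *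
     (ennreal ((norm (\<Psi> y) powr p + \<bar>\<psi> y\<bar> powr p) * \<omega>1 y) + ennreal ((norm (\<Psi>' y) powr p + \<bar>\<psi>' y\<bar> powr p) * \<omega>1 y)) \<partial>lebesgue)"
    unfolding En_def using \<omega>0
    by (intro nn_integral_mono) (simp add: ennreal_mult[symmetric] ennreal_plus[symmetric] ennreal_leI del: ennreal_plus)
  also have "\<dots> = ennreal (2 powr p) * (En \<psi> \<Psi> + En \<psi>' \<Psi>')"
    unfolding En_def by (subst nn_integral_cmult) (simp_all add: nn_integral_add)
  finally show ?thesis .
qed

lemma En_minus_commute: "En (\<lambda>y. \<psi> y - \<phi> y) (\<lambda>y. \<Psi> y - E y) = En (\<lambda>y. \<phi> y - \<psi> y) (\<lambda>y. E y - \<Psi> y)"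
  unfolding En_def by (simp add: norm_minus_commute abs_minus_commute)

lemma En_triangle:
  assumes [measurable]: "\<psi> \<in> borel_measurable lebesgue" "\<Psi> \<in> borel_measurable lebesgue"
    "\<phi> \<in> borel_measurable lebesgue" "E \<in> borel_measurable lebesgue"
    "\<xi> \<in> borel_measurable lebesgue" "X \<in> borel_measurable lebesgue"
  assumes "0 \<le> a" "0 \<le> b" "En (\<lambda>y. \<phi> y - \<psi> y) (\<lambda>y. E y - \<Psi> y) \<le> ennreal a" "En (\<lambda>y. \<psi> y - \<xi> y) (\<lambda>y. \<Psi> y - X y) \<le> ennreal b"
  shows "En (\<lambda>y. \<phi> y - \<xi> y) (\<lambda>y. E y - X y) \<le> ennreal (2 powr p * (a + b))"
proof -
  have "En (\<lambda>y. \<phi> y - \<xi> y) (\<lambda>y. E y - X y) = En (\<lambda>y. (\<phi> y - \<psi> y) + (\<psi> y - \<xi> y)) (\<lambda>y. (E y - \<Psi> y) + (\<Psi> y - X y))"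
    by simp
  also have "\<dots> \<le> ennreal (2 powr p) * (En (\<lambda>y. \<phi> y - \<psi> y) (\<lambda>y. E y - \<Psi> y) + En (\<lambda>y. \<psi> y - \<xi> y) (\<lambda>y. \<Psi> y - X y))"
    by (rule En_add) measurable
  also have "\<dots> \<le> ennreal (2 powr p) * (ennreal a + ennreal b)"
    using assms by (intro mult_left_mono add_mono) auto
  finally show ?thesis using assms by (simp add: ennreal_mult)
qed

text \<open>Convergence holds at Lebesgue almost every point of the ball because \<omega>1 is
  positive there. This is what carries limits over to integrals with the other weight.\<close>

lemma En_AE_tendsto:
  assumes [measurable]: "\<psi> \<in> borel_measurable lebesgue" "\<And>n. \<phi> n \<in> borel_measurable lebesgue"
    and le: "\<And>n. En (\<lambda>y. \<phi> n y - \<psi> y) (\<lambda>y. E n y - \<Psi> y) \<le> ennreal ((1 / 2) ^ n)"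
  shows "AE y in lebesgue. y \<in> ball x0 (7 / 4) \<longrightarrow> (\<lambda>n. \<phi> n y) \<longlonglongrightarrow> \<psi> y"
proof -
  have "AE y in lebesgue. (\<lambda>n. \<bar>\<phi> n y - \<psi> y\<bar> powr p * \<omega>1 y) \<longlonglongrightarrow> 0"
  proof (rule AE_tendsto_0)
    show "(\<integral>\<^sup>+y. ennreal (\<bar>\<phi> n y - \<psi> y\<bar> powr p * \<omega>1 y) \<partial>lebesgue) \<le> ennreal ((1 / 2) ^ n)" for n
    proof -
      have "(\<integral>\<^sup>+y. ennreal (\<bar>\<phi> n y - \<psi> y\<bar> powr p * \<omega>1 y) \<partial>lebesgue) \<le> En (\<lambda>y. \<phi> n y - \<psi> y) (\<lambda>y. E n y - \<Psi> y)"
        unfolding En_def using \<omega>0 by (intro nn_integral_mono ennreal_leI mult_right_mono) auto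
      also have "\<dots> \<le> ennreal ((1 / 2) ^ n)" by (rule le)
      finally show ?thesis .
    qed
  qed (use \<omega>0 in auto)
  then show "AE y in lebesgue. y \<in> ball x0 (7 / 4) \<longrightarrow> (\<lambda>n. \<phi> n y) \<longlonglongrightarrow> \<psi> y"
    using \<omega>pos
  proof eventually_elim
    case (elim y)
    show ?case
    proof
      assume "y \<in> ball x0 (7 / 4)"
      then have pos: "0 < \<omega>1 y" using elim by simp
      have "(\<lambda>n. (\<bar>\<phi> n y - \<psi> y\<bar> powr p * \<omega>1 y) / \<omega>1 y) \<longlonglongrightarrow> 0 / \<omega>1 y"
        using elim pos by (intro tendsto_divide) auto
      then have "(\<lambda>n. \<bar>\<phi> n y - \<psi> y\<bar> powr p) \<longlonglongrightarrow> 0" using pos by simp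
      then have "(\<lambda>n. (\<bar>\<phi> n y - \<psi> y\<bar> powr p) powr (1 / p)) \<longlonglongrightarrow> 0 powr (1 / p)"
        using p by (intro tendsto_powr') auto
      then have "(\<lambda>n. \<bar>\<phi> n y - \<psi> y\<bar>) \<longlonglongrightarrow> 0" using p by (simp add: powr_powr)
      then have "(\<lambda>n. \<phi> n y - \<psi> y) \<longlonglongrightarrow> 0" by (simp add: tendsto_rabs_zero_iff)
      then show "(\<lambda>n. \<phi> n y) \<longlonglongrightarrow> \<psi> y" by (simp add: LIM_zero_iff)
    qed
  qed
qed

text \<open>The Sobolev inequality passes to the closure by Fatou's lemma. The approximants are 2^-n
  close, for convergence almost everywhere, and also N close, for a uniform energy bound.\<close>

lemma H0_sobolev_aux:
  fixes \<omega> :: "real ^ 'n \<Rightarrow> real"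
  assumes H: "H0 r \<psi> \<Psi>" and r: "r \<le> 3 / 2" and N: "0 < N" "En \<psi> \<Psi> \<le> ennreal N"
    and m[measurable]: "\<omega> \<in> borel_measurable lebesgue" and \<omega>: "\<And>x. 0 \<le> \<omega> x" "\<And>x. x \<notin> ball x0 (7 / 4) \<Longrightarrow> \<omega> x = 0"
    and Q: "0 < Q"
    and sob: "\<And>\<psi> E N. C1_on UNIV \<psi> E \<Longrightarrow> (\<And>y. y \<notin> cball x0 (3 / 2) \<Longrightarrow> \<psi> y = 0) \<Longrightarrow> 0 < N \<Longrightarrow>
      En \<psi> E \<le> ennreal N \<Longrightarrow> (\<integral>\<^sup>+y. ennreal (\<bar>\<psi> y\<bar> powr Q * \<omega> y) \<partial>lebesgue) \<le> ennreal (Cs * N powr t)"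
  shows "(\<integral>\<^sup>+y. ennreal (\<bar>\<psi> y\<bar> powr Q * \<omega> y) \<partial>lebesgue) \<le> ennreal (Cs * (2 powr p * (2 * N)) powr t)"
proof -
  note [measurable] = H0_measurable[OF H]
  define P where "P = (\<lambda>(n::nat) F. C1_on UNIV (fst F) (snd F) \<and> (\<forall>y. y \<notin> cball x0 r \<longrightarrow> fst F y = 0) \<and>
       En (\<lambda>y. fst F y - \<psi> y) (\<lambda>y. snd F y - \<Psi> y) \<le> ennreal (min ((1 / 2) ^ n) N))"
  have ex: "\<exists>F. P n F" for n
  proof -
    have pos: "0 < min ((1 / 2) ^ n) N" using N by simp
    obtain \<phi> E where "C1_on UNIV \<phi> E" "\<And>y. y \<notin> cball x0 r \<Longrightarrow> \<phi> y = 0"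
      "En (\<lambda>y. \<phi> y - \<psi> y) (\<lambda>y. E y - \<Psi> y) \<le> ennreal (min ((1 / 2) ^ n) N)"
      by (rule H0E[OF H pos]) blast
    then have "P n (\<phi>, E)" by (simp add: P_def)
    then show ?thesis by (rule exI)
  qed
  define F where "F = (\<lambda>n. SOME F. P n F)"
  have F: "P n (F n)" for n unfolding F_def by (rule someI_ex[OF ex])
  define \<phi> where "\<phi> = (\<lambda>n. fst (F n))"
  define E where "E = (\<lambda>n. snd (F n))"
  have \<phi>: "C1_on UNIV (\<phi> n) (E n)" "y \<notin> cball x0 r \<Longrightarrow> \<phi> n y = 0"
    "En (\<lambda>y. \<phi> n y - \<psi> y) (\<lambda>y. E n y - \<Psi> y) \<le> ennreal (min ((1 / 2) ^ n) N)" for n y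
    using F[of n] by (simp_all add: \<phi>_def E_def P_def)
  note [measurable] = C1_measurable[OF \<phi>(1)]
  have le: "(\<integral>\<^sup>+y. ennreal (\<bar>\<phi> n y\<bar> powr Q * \<omega> y) \<partial>lebesgue) \<le> ennreal (Cs * (2 powr p * (2 * N)) powr t)" for n
  proof (rule sob[OF \<phi>(1)])
    show "\<phi> n y = 0" if "y \<notin> cball x0 (3 / 2)" for y using \<phi>(2)[of y n] that r by auto
    show "0 < 2 powr p * (2 * N)" using N by simp
    have "En (\<lambda>y. \<phi> n y - 0) (\<lambda>y. E n y - 0) \<le> ennreal (2 powr p * (min ((1 / 2) ^ n) N + N))"
      by (rule En_triangle[where \<psi>=\<psi> and \<Psi>=\<Psi>]) (use N \<phi>(3) in auto)
    also have "\<dots> \<le> ennreal (2 powr p * (2 * N))" by (intro ennreal_leI mult_left_mono) auto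
    finally show "En (\<phi> n) (E n) \<le> ennreal (2 powr p * (2 * N))" by simp
  qed
  have conv: "AE y in lebesgue. y \<in> ball x0 (7 / 4) \<longrightarrow> (\<lambda>n. \<phi> n y) \<longlonglongrightarrow> \<psi> y"
  proof (rule En_AE_tendsto)
    show "En (\<lambda>y. \<phi> n y - \<psi> y) (\<lambda>y. E n y - \<Psi> y) \<le> ennreal ((1 / 2) ^ n)" for n
      using \<phi>(3)[of n] by (rule order_trans) (intro ennreal_leI, simp)
  qed measurable
  have "(\<integral>\<^sup>+y. ennreal (\<bar>\<psi> y\<bar> powr Q * \<omega> y) \<partial>lebesgue) = (\<integral>\<^sup>+y. liminf (\<lambda>n. ennreal (\<bar>\<phi> n y\<bar> powr Q * \<omega> y)) \<partial>lebesgue)"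
  proof (rule nn_integral_cong_AE, use conv in eventually_elim)
    case (elim y)
    show ?case
    proof (cases "y \<in> ball x0 (7 / 4)")
      case True
      then have "(\<lambda>n. \<phi> n y) \<longlonglongrightarrow> \<psi> y" using elim by simp
      then have "(\<lambda>n. ennreal (\<bar>\<phi> n y\<bar> powr Q * \<omega> y)) \<longlonglongrightarrow> ennreal (\<bar>\<psi> y\<bar> powr Q * \<omega> y)"
        using Q by (intro tendsto_ennrealI tendsto_mult tendsto_powr' tendsto_rabs tendsto_const) auto
      then show ?thesis by (simp add: lim_imp_Liminf)
    next
      case False
      then show ?thesis using \<omega>(2)[of y] lim_imp_Liminf[OF _ tendsto_const, of sequentially "0 :: ennreal"] by simp
    qed
  qed
  also have "\<dots> \<le> liminf (\<lambda>n. \<integral>\<^sup>+y. ennreal (\<bar>\<phi> n y\<bar> powr Q * \<omega> y) \<partial>lebesgue)"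
    by (rule nn_integral_liminf) measurable
  also have "\<dots> \<le> limsup (\<lambda>n. \<integral>\<^sup>+y. ennreal (\<bar>\<phi> n y\<bar> powr Q * \<omega> y) \<partial>lebesgue)"
    by (intro Liminf_le_Limsup) simp
  also have "\<dots> \<le> ennreal (Cs * (2 powr p * (2 * N)) powr t)"
    by (rule Limsup_bounded) (use le in auto)
  finally show ?thesis .
qed

definition Csob :: real
  where "Csob = max (Cs * (2 powr p * 2) powr (Q1 / p)) (Cs * (2 powr p * 2) powr (q / p))"

lemma Csob: "0 < Csob"
  using Cs by (simp add: Csob_def less_max_iff_disj)

lemma H0_sobolev:
  assumes h: "H0 r \<psi> \<Psi>" "r \<le> 3 / 2" "0 < N" "En \<psi> \<Psi> \<le> ennreal N"
  shows "(\<integral>\<^sup>+y. ennreal (\<bar>\<psi> y\<bar> powr Q1 * \<omega>1 y) \<partial>lebesgue) \<le> ennreal (Csob * N powr (Q1 / p))"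
    "(\<integral>\<^sup>+y. ennreal (\<bar>\<psi> y\<bar> powr q * \<omega>2 y) \<partial>lebesgue) \<le> ennreal (Csob * N powr (q / p))"
proof -
  have scale: "Cs * (2 powr p * (2 * N)) powr t = Cs * (2 powr p * 2) powr t * N powr t" for N t
    using powr_mult[of "2 powr p * 2" N t] by (simp add: mult.assoc)
  have "(\<integral>\<^sup>+y. ennreal (\<bar>\<psi> y\<bar> powr Q1 * \<omega>1 y) \<partial>lebesgue) \<le> ennreal (Cs * (2 powr p * (2 * N)) powr (Q1 / p))"
    by (rule H0_sobolev_aux[OF h m\<omega>(1) \<omega>0(1) \<omega>out(1) Q1(4)], assumption)
       (use sob1 in \<open>unfold En_def Q1(2), unfold Q1_def, blast\<close>)
  also have "\<dots> \<le> ennreal (Csob * N powr (Q1 / p))"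
    unfolding scale by (intro ennreal_leI mult_right_mono) (auto simp: Csob_def)
  finally show "(\<integral>\<^sup>+y. ennreal (\<bar>\<psi> y\<bar> powr Q1 * \<omega>1 y) \<partial>lebesgue) \<le> ennreal (Csob * N powr (Q1 / p))" .
  have "(\<integral>\<^sup>+y. ennreal (\<bar>\<psi> y\<bar> powr q * \<omega>2 y) \<partial>lebesgue) \<le> ennreal (Cs * (2 powr p * (2 * N)) powr (q / p))"
    by (rule H0_sobolev_aux[OF h m\<omega>(2) \<omega>0(2) \<omega>out(2) Dq(3)], assumption)
       (use sob2 in \<open>unfold En_def, blast\<close>)
  also have "\<dots> \<le> ennreal (Csob * N powr (q / p))"
    unfolding scale by (intro ennreal_leI mult_right_mono) (auto simp: Csob_def)
  finally show "(\<integral>\<^sup>+y. ennreal (\<bar>\<psi> y\<bar> powr q * \<omega>2 y) \<partial>lebesgue) \<le> ennreal (Csob * N powr (q / p))" .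
qed

lemma H0_diff_C1:
  assumes H: "H0 r \<psi> \<Psi>" and \<phi>: "C1_on UNIV \<phi> E" "\<And>y. y \<notin> cball x0 r' \<Longrightarrow> \<phi> y = 0" and r: "r \<le> r'"
  shows "H0 r' (\<lambda>y. \<psi> y - \<phi> y) (\<lambda>y. \<Psi> y - E y)"
  unfolding H0_def
proof (intro conjI allI impI)
  note [measurable] = C1_measurable[OF \<phi>(1)]
  note [measurable] = H0_measurable[OF H]
  show "(\<lambda>y. \<psi> y - \<phi> y) \<in> borel_measurable lebesgue" "(\<lambda>y. \<Psi> y - E y) \<in> borel_measurable lebesgue"
    by measurable
  fix e :: real assume "0 < e"
  note e = this
  obtain \<phi>' E' where h: "C1_on UNIV \<phi>' E'" "\<And>y. y \<notin> cball x0 r \<Longrightarrow> \<phi>' y = 0"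
      "En (\<lambda>y. \<phi>' y - \<psi> y) (\<lambda>y. E' y - \<Psi> y) \<le> ennreal e"
    by (rule H0E[OF H e]) blast
  have "C1_on UNIV (\<lambda>y. \<phi>' y - \<phi> y) (\<lambda>y. E' y - E y)"
    using h(1) \<phi>(1) unfolding C1_on_def by (auto intro!: GDERIV_diff continuous_intros)
  moreover have "\<forall>y. y \<notin> cball x0 r' \<longrightarrow> \<phi>' y - \<phi> y = 0" using h(2) \<phi>(2) r by auto
  ultimately show "\<exists>\<phi>'' E''. C1_on UNIV \<phi>'' E'' \<and> (\<forall>y. y \<notin> cball x0 r' \<longrightarrow> \<phi>'' y = 0) \<and>
     En (\<lambda>y. \<phi>'' y - (\<psi> y - \<phi> y)) (\<lambda>y. E'' y - (\<Psi> y - E y)) \<le> ennreal e"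
    using h(3) by (intro exI[of _ "\<lambda>y. \<phi>' y - \<phi> y"] exI[of _ "\<lambda>y. E' y - E y"]) simp
qed

definition mass :: real where "mass = integral\<^sup>L lebesgue \<omega>1 + integral\<^sup>L lebesgue \<omega>2 + 1"

lemma mass: "0 < mass" "(\<integral>\<^sup>+y. ennreal (\<omega>1 y) \<partial>lebesgue) \<le> ennreal mass" "(\<integral>\<^sup>+y. ennreal (\<omega>2 y) \<partial>lebesgue) \<le> ennreal mass"
proof -
  have "0 \<le> integral\<^sup>L lebesgue \<omega>1" "0 \<le> integral\<^sup>L lebesgue \<omega>2" using \<omega>0 by (auto intro: integral_nonneg_AE)
  note nn = this
  show "0 < mass" using nn by (simp add: mass_def add_nonneg_pos)
  show "(\<integral>\<^sup>+y. ennreal (\<omega>1 y) \<partial>lebesgue) \<le> ennreal mass"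
    using nn nn_integral_eq_integral[OF \<omega>int(1)] \<omega>0 by (simp add: mass_def ennreal_leI)
  show "(\<integral>\<^sup>+y. ennreal (\<omega>2 y) \<partial>lebesgue) \<le> ennreal mass"
    using nn nn_integral_eq_integral[OF \<omega>int(2)] \<omega>0 by (simp add: mass_def ennreal_leI)
qed

text \<open>The C^1 approximant is mollified; a uniform error \<eta> of function and gradient costs
  at most 2 \<eta>^p times the finite mass of \<omega>1. The radius grows from r to r' because
  mollification spreads the support.\<close>

lemma H0_test:
  assumes H: "H0 r \<psi> \<Psi>" and r: "0 < r" "r < r'" and e: "0 < e"
  obtains \<phi> where "\<And>k. Ck_on k UNIV \<phi>" "\<And>y. y \<notin> cball x0 r' \<Longrightarrow> \<phi> y = 0"
    "En (\<lambda>y. \<phi> y - \<psi> y) (\<lambda>y. grad \<phi> y - \<Psi> y) \<le> ennreal e"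
proof -
  note [measurable] = H0_measurable[OF H]
  define d where "d = e / (2 * 2 powr p)"
  have d: "0 < d" using e by (simp add: d_def)
  obtain \<phi>' E where h: "C1_on UNIV \<phi>' E" "\<And>y. y \<notin> cball x0 r \<Longrightarrow> \<phi>' y = 0"
      "En (\<lambda>y. \<phi>' y - \<psi> y) (\<lambda>y. E y - \<Psi> y) \<le> ennreal d"
    by (rule H0E[OF H d]) blast
  define \<eta> where "\<eta> = (d / (2 * mass)) powr (1 / p)"
  have \<eta>: "0 < \<eta>" "\<eta> powr p = d / (2 * mass)" using d mass p by (auto simp: \<eta>_def powr_powr)
  obtain \<phi> where \<phi>: "\<And>k. Ck_on k UNIV \<phi>" "\<And>x. x \<notin> cball x0 r' \<Longrightarrow> \<phi> x = 0"
    "\<And>x. \<bar>\<phi> x - \<phi>' x\<bar> \<le> \<eta>" "\<And>x. norm (grad \<phi> x - E x) \<le> \<eta>"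
    by (rule mollification[OF h(1,2) r(2,1) \<eta>(1)]) (assumption | blast)+
  have C1: "C1_on UNIV \<phi> (grad \<phi>)" by (rule Ck_on_1_C1_on[OF \<phi>(1)])
  note [measurable] = C1_measurable[OF C1] C1_measurable[OF h(1)]
  have "En (\<lambda>y. \<phi> y - \<phi>' y) (\<lambda>y. grad \<phi> y - E y) \<le> (\<integral>\<^sup>+y. ennreal (d / mass) * ennreal (\<omega>1 y) \<partial>lebesgue)"
    unfolding En_def
  proof (intro nn_integral_mono)
    fix y
    have "norm (grad \<phi> y - E y) powr p \<le> \<eta> powr p" "\<bar>\<phi> y - \<phi>' y\<bar> powr p \<le> \<eta> powr p"
      using \<phi>(3,4) p by (auto intro!: powr_mono2)
    then have "norm (grad \<phi> y - E y) powr p + \<bar>\<phi> y - \<phi>' y\<bar> powr p \<le> d / mass"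
      using \<eta>(2) by (simp add: field_simps)
    from mult_right_mono[OF this \<omega>0(1)[of y]]
    show "ennreal ((norm (grad \<phi> y - E y) powr p + \<bar>\<phi> y - \<phi>' y\<bar> powr p) * \<omega>1 y) \<le> ennreal (d / mass) * ennreal (\<omega>1 y)"
      using d mass \<omega>0 by (simp add: ennreal_mult[symmetric] ennreal_leI)
  qed
  also have "\<dots> = ennreal (d / mass) * (\<integral>\<^sup>+y. ennreal (\<omega>1 y) \<partial>lebesgue)" by (rule nn_integral_cmult) measurable
  also have "\<dots> \<le> ennreal (d / mass) * ennreal mass" by (intro mult_left_mono mass) auto
  also have "\<dots> = ennreal d" using d mass by (simp add: ennreal_mult[symmetric])
  finally have "En (\<lambda>y. \<phi> y - \<phi>' y) (\<lambda>y. grad \<phi> y - E y) \<le> ennreal d" .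
  then have "En (\<lambda>y. \<phi> y - \<psi> y) (\<lambda>y. grad \<phi> y - \<Psi> y) \<le> ennreal (2 powr p * (d + d))"
    using d h(3) by (intro En_triangle[where \<psi>=\<phi>' and \<Psi>=E]) auto
  also have "2 powr p * (d + d) = e" by (simp add: d_def)
  finally show ?thesis using that \<phi> by blast
qed

lemma H0_finite:
  assumes H: "H0 r \<psi> \<Psi>"
  obtains N where "0 < N" "En \<psi> \<Psi> \<le> ennreal N"
proof -
  note [measurable] = H0_measurable[OF H]
  obtain \<phi> E where h: "C1_on UNIV \<phi> E" "\<And>y. y \<notin> cball x0 r \<Longrightarrow> \<phi> y = 0"
      "En (\<lambda>y. \<phi> y - \<psi> y) (\<lambda>y. E y - \<Psi> y) \<le> ennreal 1"
    by (rule H0E[OF H zero_less_one]) blast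
  note [measurable] = C1_measurable[OF h(1)]
  have c: "continuous_on UNIV \<phi>" "continuous_on UNIV E"
    using h(1) C1_on_continuous[OF h(1)] by (auto simp: C1_on_def)
  have E0: "E y = 0" if "y \<notin> cball x0 r" for y
    by (rule C1_on_outside_support[OF h(1) closed_cball h(2) that])
  obtain B1 where B1: "0 \<le> B1" "\<And>x. norm (\<phi> x) \<le> B1"
    by (rule continuous_compact_support_bounded[OF c(1) compact_cball h(2)]) auto
  obtain B2 where B2: "0 \<le> B2" "\<And>x. norm (E x) \<le> B2"
    by (rule continuous_compact_support_bounded[OF c(2) compact_cball E0]) auto
  define N where "N = (B2 powr p + B1 powr p) * mass"
  have N: "0 \<le> N" using mass by (simp add: N_def)
  have "En \<phi> E \<le> (\<integral>\<^sup>+y. ennreal (B2 powr p + B1 powr p) * ennreal (\<omega>1 y) \<partial>lebesgue)"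
    unfolding En_def
  proof (intro nn_integral_mono)
    fix y
    have "norm (E y) powr p + \<bar>\<phi> y\<bar> powr p \<le> B2 powr p + B1 powr p"
      using B1(2)[of y] B2(2)[of y] p by (intro add_mono powr_mono2) auto
    from mult_right_mono[OF this \<omega>0(1)[of y]]
    show "ennreal ((norm (E y) powr p + \<bar>\<phi> y\<bar> powr p) * \<omega>1 y) \<le> ennreal (B2 powr p + B1 powr p) * ennreal (\<omega>1 y)"
      using \<omega>0 by (simp add: ennreal_mult[symmetric] ennreal_leI del: ennreal_plus)
  qed
  also have "\<dots> = ennreal (B2 powr p + B1 powr p) * (\<integral>\<^sup>+y. ennreal (\<omega>1 y) \<partial>lebesgue)"
    by (rule nn_integral_cmult) measurable
  also have "\<dots> \<le> ennreal (B2 powr p + B1 powr p) * ennreal mass" by (intro mult_left_mono mass) auto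
  also have "\<dots> = ennreal N" using mass by (simp add: N_def ennreal_mult del: ennreal_plus)
  finally have "En (\<lambda>y. \<phi> y - 0) (\<lambda>y. E y - 0) \<le> ennreal N" by simp
  then have "En (\<lambda>y. \<psi> y - 0) (\<lambda>y. \<Psi> y - 0) \<le> ennreal (2 powr p * (1 + N))"
    using h(3) N by (intro En_triangle[where \<psi>=\<phi> and \<Psi>=E]) (auto simp: En_minus_commute[of \<psi> \<phi>])
  moreover have "0 < 2 powr p * (1 + N)" using N by simp
  ultimately show ?thesis by (intro that[of "2 powr p * (1 + N)"]) simp_all
qed

end

context moser_data
begin

section \<open>Hoelder estimates for the lower order terms\<close>

lemma hoelder_A:
  assumes [measurable]: "g \<in> borel_measurable lebesgue" "h \<in> borel_measurable lebesgue"
    and nn: "\<And>x. 0 \<le> g x" "\<And>x. 0 \<le> h x" "0 \<le> G" "0 \<le> H"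
    and G: "(\<integral>\<^sup>+x. ennreal (g x powr p * \<omega>1 x) \<partial>lebesgue) \<le> ennreal G"
    and H: "(\<integral>\<^sup>+x. ennreal (h x powr p * \<omega>1 x) \<partial>lebesgue) \<le> ennreal H"
  shows "(\<integral>\<^sup>+x. ennreal (g x powr (p - 1) * h x * \<omega>1 x) \<partial>lebesgue) \<le> ennreal (G powr ((p - 1) / p) * H powr (1 / p))"
proof -
  have "(\<integral>\<^sup>+x. ennreal ((g x powr p * \<omega>1 x) powr ((p - 1) / p) * (h x powr p * \<omega>1 x) powr (1 / p)) \<partial>lebesgue)
    \<le> ennreal (G powr ((p - 1) / p) * H powr (1 / p))"
    by (rule nn_integral_Holder2) (use nn \<omega>0 G H p in \<open>auto simp: add_divide_distrib[symmetric]\<close>)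
  moreover have "(g x powr p * \<omega>1 x) powr ((p - 1) / p) * (h x powr p * \<omega>1 x) powr (1 / p) = g x powr (p - 1) * h x * \<omega>1 x" for x
  proof -
    have "\<omega>1 x powr ((p - 1) / p) * \<omega>1 x powr (1 / p) = \<omega>1 x"
      unfolding powr_add[symmetric] using \<omega>0(1)[of x] p by (simp add: add_divide_distrib[symmetric])
    moreover have "(g x powr p) powr ((p - 1) / p) = g x powr (p - 1)" "(h x powr p) powr (1 / p) = h x"
      using p nn by (auto simp: powr_powr)
    ultimately show ?thesis
      unfolding powr_mult by (metis mult.assoc mult.left_commute)
  qed
  ultimately show ?thesis by simp
qed

text \<open>The exponent D1/(p - 1) is exactly critical: (p - 1)/D1 + (p - 1)/Q1 + 1/p = 1. The
  third factor carries the derivative of the cutoff in the energy estimate.\<close>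

lemma hoelder_b:
  assumes [measurable]: "b \<in> borel_measurable lebesgue" "f \<in> borel_measurable lebesgue" "h \<in> borel_measurable lebesgue"
    and nn: "\<And>x. 0 \<le> b x" "\<And>x. 0 \<le> f x" "\<And>x. 0 \<le> h x" "0 \<le> P" "0 \<le> S" "0 \<le> H"
    and P: "(\<integral>\<^sup>+x. ennreal (b x powr (D1 / (p - 1)) * \<omega>1 x) \<partial>lebesgue) \<le> ennreal P"
    and S: "(\<integral>\<^sup>+x. ennreal (f x powr Q1 * \<omega>1 x) \<partial>lebesgue) \<le> ennreal S"
    and H: "(\<integral>\<^sup>+x. ennreal (h x powr p * \<omega>1 x) \<partial>lebesgue) \<le> ennreal H"
  shows "(\<integral>\<^sup>+x. ennreal (b x * f x powr (p - 1) * h x * \<omega>1 x) \<partial>lebesgue)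
    \<le> ennreal (P powr ((p - 1) / D1) * S powr ((p - 1) / Q1) * H powr (1 / p))"
proof -
  have sum1: "(p - 1) / D1 + (p - 1) / Q1 + 1 / p = 1"
  proof -
    have "(p - 1) / D1 + (p - 1) / Q1 = (p - 1) * (1 / D1 + 1 / Q1)" by (simp add: algebra_simps)
    then show ?thesis unfolding Q1(3) using p by (simp add: field_simps)
  qed
  have "(\<integral>\<^sup>+x. ennreal ((b x powr (D1 / (p - 1)) * \<omega>1 x) powr ((p - 1) / D1) * (f x powr Q1 * \<omega>1 x) powr ((p - 1) / Q1)
      * (h x powr p * \<omega>1 x) powr (1 / p)) \<partial>lebesgue)
    \<le> ennreal (P powr ((p - 1) / D1) * S powr ((p - 1) / Q1) * H powr (1 / p))"
    by (rule nn_integral_Holder3) (use nn \<omega>0 P S H p Q1 sum1 in auto)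
  moreover have "(b x powr (D1 / (p - 1)) * \<omega>1 x) powr ((p - 1) / D1) * (f x powr Q1 * \<omega>1 x) powr ((p - 1) / Q1)
      * (h x powr p * \<omega>1 x) powr (1 / p) = b x * f x powr (p - 1) * h x * \<omega>1 x" for x
  proof -
    have w: "\<omega>1 x powr ((p - 1) / D1) * \<omega>1 x powr ((p - 1) / Q1) * \<omega>1 x powr (1 / p) = \<omega>1 x"
      unfolding powr_add[symmetric] sum1 using \<omega>0(1)[of x] by simp
    have "(b x powr (D1 / (p - 1))) powr ((p - 1) / D1) = b x" "(f x powr Q1) powr ((p - 1) / Q1) = f x powr (p - 1)"
      "(h x powr p) powr (1 / p) = h x"
      using p nn Q1 by (auto simp: powr_powr)
    then have "(b x powr (D1 / (p - 1)) * \<omega>1 x) powr ((p - 1) / D1) * (f x powr Q1 * \<omega>1 x) powr ((p - 1) / Q1)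
      * (h x powr p * \<omega>1 x) powr (1 / p) = b x * f x powr (p - 1) * h x *
      (\<omega>1 x powr ((p - 1) / D1) * \<omega>1 x powr ((p - 1) / Q1) * \<omega>1 x powr (1 / p))"
      unfolding powr_mult by (simp only: mult_ac)
    then show ?thesis unfolding w .
  qed
  ultimately show ?thesis by simp
qed

text \<open>The factor f^p is split as f^(p - \<epsilon>) f^\<epsilon>: the first part is taken at
  the Sobolev exponent Q, the second at exponent p, where the integral is already known. The power
  \<epsilon>/p of \<open>Z\<close> is what makes absorption possible. The lemma serves both pairs
  (D1, Q1) and (D, q).\<close>

lemma hoelder_d:
  assumes [measurable]: "\<omega> \<in> borel_measurable lebesgue" "d \<in> borel_measurable lebesgue" "f \<in> borel_measurable lebesgue"
    and nn: "\<And>x. 0 \<le> \<omega> x" "\<And>x. 0 \<le> d x" "\<And>x. 0 \<le> f x" "0 \<le> P" "0 \<le> S" "0 \<le> Z"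
    and DQ: "0 < \<Delta>" "0 < Q" "1 / \<Delta> + 1 / Q = 1 / p"
    and P: "(\<integral>\<^sup>+x. ennreal (d x powr (\<Delta> / (p - \<epsilon>)) * \<omega> x) \<partial>lebesgue) \<le> ennreal P"
    and S: "(\<integral>\<^sup>+x. ennreal (f x powr Q * \<omega> x) \<partial>lebesgue) \<le> ennreal S"
    and Z: "(\<integral>\<^sup>+x. ennreal (f x powr p * \<omega> x) \<partial>lebesgue) \<le> ennreal Z"
  shows "(\<integral>\<^sup>+x. ennreal (d x * f x powr p * \<omega> x) \<partial>lebesgue)
    \<le> ennreal (P powr ((p - \<epsilon>) / \<Delta>) * S powr ((p - \<epsilon>) / Q) * Z powr (\<epsilon> / p))"
proof -
  have sum1: "(p - \<epsilon>) / \<Delta> + (p - \<epsilon>) / Q + \<epsilon> / p = 1"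
  proof -
    have "(p - \<epsilon>) / \<Delta> + (p - \<epsilon>) / Q = (p - \<epsilon>) * (1 / \<Delta> + 1 / Q)" by (simp add: algebra_simps)
    then show ?thesis unfolding DQ(3) using p by (simp add: field_simps)
  qed
  have "(\<integral>\<^sup>+x. ennreal ((d x powr (\<Delta> / (p - \<epsilon>)) * \<omega> x) powr ((p - \<epsilon>) / \<Delta>) * (f x powr Q * \<omega> x) powr ((p - \<epsilon>) / Q)
      * (f x powr p * \<omega> x) powr (\<epsilon> / p)) \<partial>lebesgue)
    \<le> ennreal (P powr ((p - \<epsilon>) / \<Delta>) * S powr ((p - \<epsilon>) / Q) * Z powr (\<epsilon> / p))"
    by (rule nn_integral_Holder3) (use nn P S Z p DQ \<epsilon> sum1 in auto)
  moreover have "(d x powr (\<Delta> / (p - \<epsilon>)) * \<omega> x) powr ((p - \<epsilon>) / \<Delta>) * (f x powr Q * \<omega> x) powr ((p - \<epsilon>) / Q)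
      * (f x powr p * \<omega> x) powr (\<epsilon> / p) = d x * f x powr p * \<omega> x" for x
  proof -
    have w: "\<omega> x powr ((p - \<epsilon>) / \<Delta>) * \<omega> x powr ((p - \<epsilon>) / Q) * \<omega> x powr (\<epsilon> / p) = \<omega> x"
      unfolding powr_add[symmetric] sum1 using nn(1)[of x] by simp
    have f: "f x powr (p - \<epsilon>) * f x powr \<epsilon> = f x powr p"
      unfolding powr_add[symmetric] by simp
    have "(d x powr (\<Delta> / (p - \<epsilon>))) powr ((p - \<epsilon>) / \<Delta>) = d x" "(f x powr Q) powr ((p - \<epsilon>) / Q) = f x powr (p - \<epsilon>)"
      "(f x powr p) powr (\<epsilon> / p) = f x powr \<epsilon>"
      using p nn DQ \<epsilon> by (auto simp: powr_powr)
    then have "(d x powr (\<Delta> / (p - \<epsilon>)) * \<omega> x) powr ((p - \<epsilon>) / \<Delta>) * (f x powr Q * \<omega> x) powr ((p - \<epsilon>) / Q)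
      * (f x powr p * \<omega> x) powr (\<epsilon> / p) = d x * (f x powr (p - \<epsilon>) * f x powr \<epsilon>) *
      (\<omega> x powr ((p - \<epsilon>) / \<Delta>) * \<omega> x powr ((p - \<epsilon>) / Q) * \<omega> x powr (\<epsilon> / p))"
      unfolding powr_mult by (simp only: mult_ac)
    then show ?thesis unfolding w f .
  qed
  ultimately show ?thesis by simp
qed

text \<open>The gradient is integrated against \<omega>1 and the other factors against \<omega>2;
  the quotient in the norm of \<open>c\<close> is the conversion factor between the two. Cancelling
  \<omega>1 needs its positivity, so the pointwise identity is proved only almost
  everywhere.\<close>

lemma hoelder_c:
  assumes [measurable]: "c \<in> borel_measurable lebesgue" "g \<in> borel_measurable lebesgue" "f \<in> borel_measurable lebesgue"
    and nn: "\<And>x. 0 \<le> c x" "\<And>x. 0 \<le> g x" "\<And>x. 0 \<le> f x" "0 \<le> P" "0 \<le> G" "0 \<le> S" "0 \<le> Z"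
    and P: "(\<integral>\<^sup>+x. ennreal ((c x * (\<omega>2 x / \<omega>1 x) powr (1 - 1 / p)) powr (D / (1 - \<epsilon>)) * \<omega>2 x) \<partial>lebesgue) \<le> ennreal P"
    and G: "(\<integral>\<^sup>+x. ennreal (g x powr p * \<omega>1 x) \<partial>lebesgue) \<le> ennreal G"
    and S: "(\<integral>\<^sup>+x. ennreal (f x powr q * \<omega>2 x) \<partial>lebesgue) \<le> ennreal S"
    and Z: "(\<integral>\<^sup>+x. ennreal (f x powr p * \<omega>2 x) \<partial>lebesgue) \<le> ennreal Z"
  shows "(\<integral>\<^sup>+x. ennreal (c x * g x powr (p - 1) * f x * \<omega>2 x) \<partial>lebesgue)
    \<le> ennreal (P powr ((1 - \<epsilon>) / D) * G powr ((p - 1) / p) * S powr ((1 - \<epsilon>) / q) * Z powr (\<epsilon> / p))"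
proof -
  have s0: "(1 - \<epsilon>) / D + (1 - \<epsilon>) / q + \<epsilon> / p = 1 / p"
  proof -
    have "(1 - \<epsilon>) / D + (1 - \<epsilon>) / q = (1 - \<epsilon>) * (1 / D + 1 / q)" by (simp add: algebra_simps)
    also have "\<dots> = (1 - \<epsilon>) / p" unfolding Dq(2) by simp
    finally show ?thesis by (simp add: add_divide_distrib[symmetric])
  qed
  have p1: "(p - 1) / p = 1 - 1 / p" using p by (simp add: field_simps)
  have sum1: "(1 - \<epsilon>) / D + (p - 1) / p + (1 - \<epsilon>) / q + \<epsilon> / p = 1"
    using s0 p1 by linarith
  let ?c = "\<lambda>x. c x * (\<omega>2 x / \<omega>1 x) powr (1 - 1 / p)"
  have "(\<integral>\<^sup>+x. ennreal ((?c x powr (D / (1 - \<epsilon>)) * \<omega>2 x) powr ((1 - \<epsilon>) / D) * (g x powr p * \<omega>1 x) powr ((p - 1) / p)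
      * (f x powr q * \<omega>2 x) powr ((1 - \<epsilon>) / q) * (f x powr p * \<omega>2 x) powr (\<epsilon> / p)) \<partial>lebesgue)
    \<le> ennreal (P powr ((1 - \<epsilon>) / D) * G powr ((p - 1) / p) * S powr ((1 - \<epsilon>) / q) * Z powr (\<epsilon> / p))"
    by (rule nn_integral_Holder4) (use nn \<omega>0 P G S Z p Dq \<epsilon> sum1 in auto)
  moreover have "AE x in lebesgue. (?c x powr (D / (1 - \<epsilon>)) * \<omega>2 x) powr ((1 - \<epsilon>) / D) * (g x powr p * \<omega>1 x) powr ((p - 1) / p)
      * (f x powr q * \<omega>2 x) powr ((1 - \<epsilon>) / q) * (f x powr p * \<omega>2 x) powr (\<epsilon> / p) = c x * g x powr (p - 1) * f x * \<omega>2 x"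
    using \<omega>pos
  proof eventually_elim
    case (elim x)
    show ?case
    proof (cases "x \<in> ball x0 (7 / 4)")
      case False
      then show ?thesis using \<omega>out(2)[of x] by simp
    next
      case True
      then have w1: "0 < \<omega>1 x" using elim by simp
      have w: "\<omega>2 x powr ((1 - \<epsilon>) / D) * \<omega>2 x powr ((1 - \<epsilon>) / q) * \<omega>2 x powr (\<epsilon> / p) = \<omega>2 x powr (1 / p)"
        unfolding powr_add[symmetric] s0 by simp
      have f: "f x powr (1 - \<epsilon>) * f x powr \<epsilon> = f x"
        unfolding powr_add[symmetric] using nn by simp
      have ww: "(\<omega>2 x / \<omega>1 x) powr (1 - 1 / p) * \<omega>1 x powr ((p - 1) / p) * \<omega>2 x powr (1 / p) = \<omega>2 x"
      proof -
        have "(\<omega>2 x / \<omega>1 x) powr (1 - 1 / p) * \<omega>1 x powr ((p - 1) / p) = \<omega>2 x powr (1 - 1 / p)"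
          unfolding p1 powr_mult[symmetric] using w1 by simp
        then have "(\<omega>2 x / \<omega>1 x) powr (1 - 1 / p) * \<omega>1 x powr ((p - 1) / p) * \<omega>2 x powr (1 / p) = \<omega>2 x powr (1 - 1 / p) * \<omega>2 x powr (1 / p)"
          by simp
        also have "\<dots> = \<omega>2 x" unfolding powr_add[symmetric] using \<omega>0(2)[of x] by simp
        finally show ?thesis .
      qed
      have "(?c x powr (D / (1 - \<epsilon>))) powr ((1 - \<epsilon>) / D) = ?c x" "(g x powr p) powr ((p - 1) / p) = g x powr (p - 1)"
        "(f x powr q) powr ((1 - \<epsilon>) / q) = f x powr (1 - \<epsilon>)" "(f x powr p) powr (\<epsilon> / p) = f x powr \<epsilon>"
        using p nn Dq \<epsilon> by (auto simp: powr_powr)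
      then have "(?c x powr (D / (1 - \<epsilon>)) * \<omega>2 x) powr ((1 - \<epsilon>) / D) * (g x powr p * \<omega>1 x) powr ((p - 1) / p)
        * (f x powr q * \<omega>2 x) powr ((1 - \<epsilon>) / q) * (f x powr p * \<omega>2 x) powr (\<epsilon> / p)
        = ?c x * \<omega>2 x powr ((1 - \<epsilon>) / D) * (g x powr (p - 1) * \<omega>1 x powr ((p - 1) / p))
          * (f x powr (1 - \<epsilon>) * \<omega>2 x powr ((1 - \<epsilon>) / q)) * (f x powr \<epsilon> * \<omega>2 x powr (\<epsilon> / p))"
        by (simp only: powr_mult[of "?c x powr (D / (1 - \<epsilon>))"] powr_mult[of "g x powr p"] powr_mult[of "f x powr q"] powr_mult[of "f x powr p"])
      also have "\<dots> = c x * g x powr (p - 1) * (f x powr (1 - \<epsilon>) * f x powr \<epsilon>) *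
        ((\<omega>2 x / \<omega>1 x) powr (1 - 1 / p) * \<omega>1 x powr ((p - 1) / p) *
         (\<omega>2 x powr ((1 - \<epsilon>) / D) * \<omega>2 x powr ((1 - \<epsilon>) / q) * \<omega>2 x powr (\<epsilon> / p)))"
        by (simp only: mult_ac)
      finally show ?thesis unfolding w f ww .
    qed
  qed
  then have "(\<integral>\<^sup>+x. ennreal ((?c x powr (D / (1 - \<epsilon>)) * \<omega>2 x) powr ((1 - \<epsilon>) / D) * (g x powr p * \<omega>1 x) powr ((p - 1) / p)
      * (f x powr q * \<omega>2 x) powr ((1 - \<epsilon>) / q) * (f x powr p * \<omega>2 x) powr (\<epsilon> / p)) \<partial>lebesgue)
    = (\<integral>\<^sup>+x. ennreal (c x * g x powr (p - 1) * f x * \<omega>2 x) \<partial>lebesgue)"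
    by (intro nn_integral_cong_AE) auto
  ultimately show ?thesis by simp
qed

lemma hoelder_mass:
  assumes [measurable]: "\<omega> \<in> borel_measurable lebesgue" "f \<in> borel_measurable lebesgue"
    and nn: "\<And>x. 0 \<le> \<omega> x" "\<And>x. 0 \<le> f x" "0 \<le> S"
    and m: "(\<integral>\<^sup>+x. ennreal (\<omega> x) \<partial>lebesgue) \<le> ennreal mass" and t: "0 < t" "t \<le> Q"
    and S: "(\<integral>\<^sup>+x. ennreal (f x powr Q * \<omega> x) \<partial>lebesgue) \<le> ennreal S"
  shows "(\<integral>\<^sup>+x. ennreal (f x powr t * \<omega> x) \<partial>lebesgue) \<le> ennreal (S powr (t / Q) * mass powr (1 - t / Q))"
proof (cases "t = Q")
  case True
  then show ?thesis using S t nn mass by simp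
next
  case False
  have "(\<integral>\<^sup>+x. ennreal ((f x powr Q * \<omega> x) powr (t / Q) * \<omega> x powr (1 - t / Q)) \<partial>lebesgue)
    \<le> ennreal (S powr (t / Q) * mass powr (1 - t / Q))"
    by (rule nn_integral_Holder2) (use nn S m t mass False in auto)
  moreover have "(f x powr Q * \<omega> x) powr (t / Q) * \<omega> x powr (1 - t / Q) = f x powr t * \<omega> x" for x
  proof -
    have w: "\<omega> x powr (t / Q) * \<omega> x powr (1 - t / Q) = \<omega> x"
      unfolding powr_add[symmetric] using nn by simp
    have "(f x powr Q) powr (t / Q) = f x powr t" using t by (simp add: powr_powr)
    then show ?thesis unfolding powr_mult mult.assoc w by simp
  qed
  ultimately show ?thesis by simp
qed

end

section \<open>Compositions with a Sobolev function\<close>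

text \<open>The function \<open>u\<close> is approximated only on the open ball of radius 7/4 and
  need not vanish near its boundary; membership in \<open>H0\<close> arises after multiplication by
  a cutoff.\<close>

locale approximated = moser_data x0 \<omega>1 \<omega>2 p q D1 D \<epsilon> Cs
  for x0 :: "real ^ 'n" and \<omega>1 \<omega>2 and p q D1 D \<epsilon> Cs :: real +
  fixes u :: "real ^ 'n \<Rightarrow> real" and v :: "real ^ 'n \<Rightarrow> real ^ 'n"
    and \<phi> :: "nat \<Rightarrow> real ^ 'n \<Rightarrow> real" and E :: "nat \<Rightarrow> real ^ 'n \<Rightarrow> real ^ 'n" and N0 :: real
  assumes muv[measurable]: "u \<in> borel_measurable lebesgue" "v \<in> borel_measurable lebesgue"
    and m\<phi>[measurable]: "\<And>n. \<phi> n \<in> borel_measurable lebesgue" "\<And>n. E n \<in> borel_measurable lebesgue"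
    and C1\<phi>: "\<And>n. C1_on (ball x0 (7 / 4)) (\<phi> n) (E n)"
    and conv: "\<And>n. En (\<lambda>y. \<phi> n y - u y) (\<lambda>y. E n y - v y) \<le> ennreal ((1 / 2) ^ n)"
    and N0: "0 \<le> N0" "En u v \<le> ennreal N0"
begin

lemma v_energy: "(\<integral>\<^sup>+y. ennreal (norm (v y) powr p * \<omega>1 y) \<partial>lebesgue) \<le> ennreal N0"
proof -
  have "(\<integral>\<^sup>+y. ennreal (norm (v y) powr p * \<omega>1 y) \<partial>lebesgue) \<le> En u v"
    unfolding En_def using \<omega>0 by (intro nn_integral_mono ennreal_leI mult_right_mono) auto
  then show ?thesis using N0(2) by (rule order_trans)
qed

text \<open>The approximants are \<open>\<eta> * T (\<phi> n)\<close>. In the difference of the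
  gradients two terms are controlled by the bound \<open>L\<close> on T' and inherit the rate 2^-n.
  The third, T'(\<phi> n) - T'(u) times the fixed \<open>v\<close>, tends to 0 by dominated
  convergence, without a rate.\<close>

lemma chain_H0:
  assumes \<eta>: "C1_on UNIV \<eta> D\<eta>" "\<And>y. y \<notin> cball x0 r \<Longrightarrow> \<eta> y = 0" and r: "r \<le> 3 / 2"
    and T: "\<And>t. DERIV T t :> T' t" "continuous_on UNIV T'" "\<And>t. \<bar>T' t\<bar> \<le> L"
  shows "H0 r (\<lambda>y. \<eta> y * T (u y)) (\<lambda>y. T (u y) *\<^sub>R D\<eta> y + (\<eta> y * T' (u y)) *\<^sub>R v y)"
proof -
  let ?V = "ball x0 (7 / 4)"
  let ?\<psi> = "\<lambda>y. \<eta> y * T (u y)" and ?\<Psi> = "\<lambda>y. T (u y) *\<^sub>R D\<eta> y + (\<eta> y * T' (u y)) *\<^sub>R v y"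
  let ?\<psi>n = "\<lambda>n y. \<eta> y * T (\<phi> n y)" and ?\<Psi>n = "\<lambda>n y. T (\<phi> n y) *\<^sub>R D\<eta> y + (\<eta> y * T' (\<phi> n y)) *\<^sub>R E n y"
  have cT: "continuous_on UNIV T"
    by (intro continuous_at_imp_continuous_on ballI DERIV_isCont[OF T(1)])
  have mT[measurable]: "T \<in> borel_measurable borel" "T' \<in> borel_measurable borel"
    using cT T(2) by (auto intro: borel_measurable_continuous_onI)
  note [measurable] = C1_measurable[OF \<eta>(1)]
  have cD: "continuous_on UNIV D\<eta>" using \<eta>(1) by (simp add: C1_on_def)
  have c\<eta>: "continuous_on UNIV \<eta>" by (rule C1_on_continuous[OF \<eta>(1)])
  have D0: "D\<eta> y = 0" if "y \<notin> cball x0 r" for y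
    by (rule C1_on_outside_support[OF \<eta>(1) closed_cball \<eta>(2) that])
  obtain B1 where B1: "0 \<le> B1" "\<And>x. norm (\<eta> x) \<le> B1"
    by (rule continuous_compact_support_bounded[OF c\<eta> compact_cball \<eta>(2)]) auto
  obtain B2 where B2: "0 \<le> B2" "\<And>x. norm (D\<eta> x) \<le> B2"
    by (rule continuous_compact_support_bounded[OF cD compact_cball D0]) auto
  define B where "B = max B1 B2"
  have B: "0 \<le> B" "\<bar>\<eta> x\<bar> \<le> B" "norm (D\<eta> x) \<le> B" for x
    using B1(1) B1(2)[of x] B2(2)[of x] by (auto simp: B_def)
  have L0: "0 \<le> L" using T(3)[of 0] by linarith
  have lip: "\<bar>T s - T t\<bar> \<le> L * \<bar>s - t\<bar>" for s t
    using field_differentiable_bound[of UNIV T T' L s t] T(1,3) by auto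
  \<comment> \<open>\<open>\<phi> n\<close> is C^1 only on \<open>?V\<close>; off the smaller closed
    ball everything vanishes, and these two open sets cover the space.\<close>
  have cov: "?V \<union> - cball x0 r = UNIV" using r by auto
  have C1n: "C1_on UNIV (?\<psi>n n) (?\<Psi>n n)" for n
    unfolding C1_on_def
  proof (intro conjI ballI)
    fix x :: "real ^ 'n"
    show "GDERIV (?\<psi>n n) x :> ?\<Psi>n n x"
    proof (cases "x \<in> ?V")
      case True
      show ?thesis
        by (rule GDERIV_subst[OF GDERIV_mult[OF GDERIV_D[OF \<eta>(1)] GDERIV_DERIV_compose[OF GDERIV_D[OF C1\<phi> True] T(1)]]]) auto
    next
      case False
      then have x: "x \<notin> cball x0 r" using r by auto
      have "GDERIV (?\<psi>n n) x :> 0"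
        unfolding gderiv_def
        by (rule has_derivative_transform_within_open[where s="- cball x0 r" and f="\<lambda>_. 0"]) (use x \<eta>(2) in auto)
      then show ?thesis using D0[OF x] \<eta>(2)[OF x] by simp
    qed
  next
    have cE: "continuous_on ?V (E n)" using C1\<phi>[of n] by (simp add: C1_on_def)
    have c\<phi>: "continuous_on ?V (\<phi> n)" by (rule C1_on_continuous[OF C1\<phi>])
    have 1: "continuous_on ?V (?\<Psi>n n)"
      by (intro continuous_intros cE continuous_on_compose2[OF cT c\<phi>] continuous_on_compose2[OF T(2) c\<phi>]
            continuous_on_subset[OF cD] continuous_on_subset[OF c\<eta>]) auto
    have 2: "continuous_on (- cball x0 r) (?\<Psi>n n)"
      by (rule continuous_on_eq[of _ "\<lambda>_. 0"]) (use D0 \<eta>(2) in auto)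
    have "continuous_on (?V \<union> - cball x0 r) (?\<Psi>n n)"
      by (rule continuous_on_open_Un[OF _ _ 1 2]) auto
    then show "continuous_on UNIV (?\<Psi>n n)" unfolding cov .
  qed
  define h where "h = (\<lambda>n y. (\<bar>T' (\<phi> n y) - T' (u y)\<bar> * norm (v y)) powr p * \<omega>1 y)"
  have mh[measurable]: "h n \<in> borel_measurable lebesgue" for n unfolding h_def by measurable
  have AEc: "AE y in lebesgue. y \<in> ?V \<longrightarrow> (\<lambda>n. \<phi> n y) \<longlonglongrightarrow> u y"
    by (rule En_AE_tendsto[OF _ _ conv]) measurable
  have hconv: "(\<lambda>n. \<integral>\<^sup>+y. ennreal (h n y) \<partial>lebesgue) \<longlonglongrightarrow> (\<integral>\<^sup>+y. 0 \<partial>(lebesgue :: (real ^ 'n) measure))"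
  proof (rule nn_integral_dominated_convergence[where w="\<lambda>y. ennreal ((2 * L) powr p) * ennreal (norm (v y) powr p * \<omega>1 y)"])
    have "(\<integral>\<^sup>+y. ennreal ((2 * L) powr p) * ennreal (norm (v y) powr p * \<omega>1 y) \<partial>lebesgue)
      = ennreal ((2 * L) powr p) * (\<integral>\<^sup>+y. ennreal (norm (v y) powr p * \<omega>1 y) \<partial>lebesgue)"
      by (rule nn_integral_cmult) measurable
    also have "\<dots> \<le> ennreal ((2 * L) powr p) * ennreal N0" by (intro mult_left_mono v_energy) auto
    also have "\<dots> < \<infinity>" using N0 by (simp add: ennreal_mult[symmetric])
    finally show "(\<integral>\<^sup>+y. ennreal ((2 * L) powr p) * ennreal (norm (v y) powr p * \<omega>1 y) \<partial>lebesgue) < \<infinity>" .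
    show "AE y in lebesgue. ennreal (h n y) \<le> ennreal ((2 * L) powr p) * ennreal (norm (v y) powr p * \<omega>1 y)" for n
    proof (rule AE_I2)
      fix y
      have "\<bar>T' (\<phi> n y) - T' (u y)\<bar> \<le> 2 * L" using T(3)[of "\<phi> n y"] T(3)[of "u y"] by linarith
      then have "(\<bar>T' (\<phi> n y) - T' (u y)\<bar> * norm (v y)) powr p \<le> (2 * L * norm (v y)) powr p"
        using p by (intro powr_mono2 mult_right_mono) auto
      also have "\<dots> = (2 * L) powr p * norm (v y) powr p" by (rule powr_mult)
      finally have "h n y \<le> (2 * L) powr p * norm (v y) powr p * \<omega>1 y"
        unfolding h_def by (intro mult_right_mono \<omega>0)
      then show "ennreal (h n y) \<le> ennreal ((2 * L) powr p) * ennreal (norm (v y) powr p * \<omega>1 y)"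
        using \<omega>0 by (simp add: ennreal_mult[symmetric] mult.assoc ennreal_leI)
    qed
    show "AE y in lebesgue. (\<lambda>n. ennreal (h n y)) \<longlonglongrightarrow> 0"
      using AEc
    proof eventually_elim
      case (elim y)
      show ?case
      proof (cases "y \<in> ?V")
        case True
        have "isCont T' (u y)" using T(2) by (simp add: continuous_on_eq_continuous_at)
        then have "(\<lambda>n. T' (\<phi> n y)) \<longlonglongrightarrow> T' (u y)"
          by (rule isCont_tendsto_compose) (use elim True in simp)
        then have "(\<lambda>n. \<bar>T' (\<phi> n y) - T' (u y)\<bar> * norm (v y)) \<longlonglongrightarrow> 0 * norm (v y)"
          by (intro tendsto_mult tendsto_const tendsto_rabs_zero) (simp add: LIM_zero)
        then have "(\<lambda>n. (\<bar>T' (\<phi> n y) - T' (u y)\<bar> * norm (v y)) powr p) \<longlonglongrightarrow> (0 * norm (v y)) powr p"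
          using p by (intro tendsto_powr' tendsto_const) auto
        then have "(\<lambda>n. h n y) \<longlonglongrightarrow> (0 * norm (v y)) powr p * \<omega>1 y"
          unfolding h_def by (intro tendsto_mult tendsto_const)
        then have "(\<lambda>n. h n y) \<longlonglongrightarrow> 0" using p by simp
        then show ?thesis using tendsto_ennrealI by fastforce
      next
        case False
        then show ?thesis using \<omega>out(1)[of y] by (simp add: h_def)
      qed
    qed
  qed measurable
  define C where "C = (3 powr p + 1) * (B * L) powr p"
  have C0: "0 \<le> C" by (simp add: C_def)
  have le: "En (\<lambda>y. ?\<psi>n n y - ?\<psi> y) (\<lambda>y. ?\<Psi>n n y - ?\<Psi> y)
    \<le> ennreal (C * (1 / 2) ^ n) + ennreal (3 powr p * B powr p) * (\<integral>\<^sup>+y. ennreal (h n y) \<partial>lebesgue)" for n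
  proof -
    let ?d = "\<lambda>y. norm (E n y - v y) powr p + \<bar>\<phi> n y - u y\<bar> powr p"
    have pt: "(norm (?\<Psi>n n y - ?\<Psi> y) powr p + \<bar>?\<psi>n n y - ?\<psi> y\<bar> powr p) * \<omega>1 y
      \<le> C * (?d y * \<omega>1 y) + 3 powr p * B powr p * h n y" for y
    proof -
      define a b c where "a = (B * L) * \<bar>\<phi> n y - u y\<bar>" and "b = (B * L) * norm (E n y - v y)"
        and "c = B * (\<bar>T' (\<phi> n y) - T' (u y)\<bar> * norm (v y))"
      have abc: "0 \<le> a" "0 \<le> b" "0 \<le> c" using B L0 by (auto simp: a_def b_def c_def)
      have eq: "?\<Psi>n n y - ?\<Psi> y = (T (\<phi> n y) - T (u y)) *\<^sub>R D\<eta> y + (\<eta> y * T' (\<phi> n y)) *\<^sub>R (E n y - v y)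
         + (\<eta> y * (T' (\<phi> n y) - T' (u y))) *\<^sub>R v y"
        by (simp add: algebra_simps)
      have "norm (?\<Psi>n n y - ?\<Psi> y) \<le> norm ((T (\<phi> n y) - T (u y)) *\<^sub>R D\<eta> y) + norm ((\<eta> y * T' (\<phi> n y)) *\<^sub>R (E n y - v y))
         + norm ((\<eta> y * (T' (\<phi> n y) - T' (u y))) *\<^sub>R v y)"
        unfolding eq by (rule order_trans[OF norm_triangle_ineq add_right_mono[OF norm_triangle_ineq]])
      also have "norm ((T (\<phi> n y) - T (u y)) *\<^sub>R D\<eta> y) \<le> a"
      proof -
        have "\<bar>T (\<phi> n y) - T (u y)\<bar> * norm (D\<eta> y) \<le> (L * \<bar>\<phi> n y - u y\<bar>) * B"
          using lip B L0 by (intro mult_mono) auto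
        then show ?thesis by (simp add: a_def mult_ac)
      qed
      also have "norm ((\<eta> y * T' (\<phi> n y)) *\<^sub>R (E n y - v y)) \<le> b"
      proof -
        have "\<bar>\<eta> y\<bar> * \<bar>T' (\<phi> n y)\<bar> * norm (E n y - v y) \<le> (B * L) * norm (E n y - v y)"
          using T(3) B L0 by (intro mult_right_mono mult_mono) auto
        then show ?thesis by (simp add: b_def abs_mult)
      qed
      also have "norm ((\<eta> y * (T' (\<phi> n y) - T' (u y))) *\<^sub>R v y) \<le> c"
      proof -
        have "\<bar>\<eta> y\<bar> * (\<bar>T' (\<phi> n y) - T' (u y)\<bar> * norm (v y)) \<le> c"
          unfolding c_def using B by (intro mult_right_mono) auto
        then show ?thesis by (simp add: abs_mult mult.assoc)
      qed
      finally have "norm (?\<Psi>n n y - ?\<Psi> y) \<le> a + b + c" by simp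
      then have "norm (?\<Psi>n n y - ?\<Psi> y) powr p \<le> (a + b + c) powr p" using p by (intro powr_mono2) auto
      also have "\<dots> \<le> 3 powr p * (a powr p + b powr p + c powr p)" using abc p by (intro powr_sum3) auto
      finally have 1: "norm (?\<Psi>n n y - ?\<Psi> y) powr p \<le> 3 powr p * (a powr p + b powr p + c powr p)" .
      have "\<bar>?\<psi>n n y - ?\<psi> y\<bar> \<le> a"
      proof -
        have "\<bar>\<eta> y\<bar> * \<bar>T (\<phi> n y) - T (u y)\<bar> \<le> B * (L * \<bar>\<phi> n y - u y\<bar>)"
          using lip B L0 by (intro mult_mono) auto
        then show ?thesis by (simp add: a_def abs_mult[symmetric] right_diff_distrib mult.assoc)
      qed
      then have 2: "\<bar>?\<psi>n n y - ?\<psi> y\<bar> powr p \<le> a powr p" using p by (intro powr_mono2) auto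
      have abp: "a powr p + b powr p = (B * L) powr p * ?d y" "c powr p = B powr p * (\<bar>T' (\<phi> n y) - T' (u y)\<bar> * norm (v y)) powr p"
        unfolding a_def b_def c_def powr_mult by (auto simp: algebra_simps)
      have "norm (?\<Psi>n n y - ?\<Psi> y) powr p + \<bar>?\<psi>n n y - ?\<psi> y\<bar> powr p
        \<le> 3 powr p * (a powr p + b powr p + c powr p) + a powr p"
        using 1 2 by (rule add_mono)
      also have "\<dots> \<le> (3 powr p + 1) * (a powr p + b powr p) + 3 powr p * c powr p"
        using powr_ge_zero[of b p] by (simp add: algebra_simps)
      also have "\<dots> = C * ?d y + 3 powr p * B powr p * (\<bar>T' (\<phi> n y) - T' (u y)\<bar> * norm (v y)) powr p"
        unfolding abp C_def by (simp add: mult.assoc)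
      finally have "(norm (?\<Psi>n n y - ?\<Psi> y) powr p + \<bar>?\<psi>n n y - ?\<psi> y\<bar> powr p) * \<omega>1 y
        \<le> (C * ?d y + 3 powr p * B powr p * (\<bar>T' (\<phi> n y) - T' (u y)\<bar> * norm (v y)) powr p) * \<omega>1 y"
        by (rule mult_right_mono[OF _ \<omega>0(1)])
      then show ?thesis unfolding h_def by (simp only: distrib_right mult.assoc)
    qed
    have "En (\<lambda>y. ?\<psi>n n y - ?\<psi> y) (\<lambda>y. ?\<Psi>n n y - ?\<Psi> y)
      \<le> (\<integral>\<^sup>+y. ennreal C * ennreal (?d y * \<omega>1 y) + ennreal (3 powr p * B powr p) * ennreal (h n y) \<partial>lebesgue)"
      unfolding En_def
    proof (intro nn_integral_mono)
      fix y
      show "ennreal ((norm (?\<Psi>n n y - ?\<Psi> y) powr p + \<bar>?\<psi>n n y - ?\<psi> y\<bar> powr p) * \<omega>1 y)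
        \<le> ennreal C * ennreal (?d y * \<omega>1 y) + ennreal (3 powr p * B powr p) * ennreal (h n y)"
        using ennreal_leI[OF pt[of y]] C0 \<omega>0(1)[of y]
        by (simp add: ennreal_mult h_def ennreal_plus)
    qed
    also have "\<dots> = ennreal C * En (\<lambda>y. \<phi> n y - u y) (\<lambda>y. E n y - v y) + ennreal (3 powr p * B powr p) * (\<integral>\<^sup>+y. ennreal (h n y) \<partial>lebesgue)"
      unfolding En_def by (simp add: nn_integral_add nn_integral_cmult)
    also have "\<dots> \<le> ennreal C * ennreal ((1 / 2) ^ n) + ennreal (3 powr p * B powr p) * (\<integral>\<^sup>+y. ennreal (h n y) \<partial>lebesgue)"
      by (intro add_mono mult_left_mono conv) auto
    also have "ennreal C * ennreal ((1 / 2) ^ n) = ennreal (C * (1 / 2) ^ n)" using C0 by (simp add: ennreal_mult)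
    finally show ?thesis .
  qed
  have lim: "(\<lambda>n. ennreal (C * (1 / 2) ^ n) + ennreal (3 powr p * B powr p) * (\<integral>\<^sup>+y. ennreal (h n y) \<partial>lebesgue)) \<longlonglongrightarrow> ennreal (C * 0) + ennreal (3 powr p * B powr p) * 0"
  proof (intro tendsto_add tendsto_ennrealI tendsto_mult tendsto_const)
    show "(\<lambda>n. (1 / 2) ^ n) \<longlonglongrightarrow> (0::real)" by (rule LIMSEQ_power_zero) simp
    show "(\<lambda>n. ennreal (3 powr p * B powr p) * (\<integral>\<^sup>+y. ennreal (h n y) \<partial>lebesgue)) \<longlonglongrightarrow> ennreal (3 powr p * B powr p) * 0"
      by (rule ennreal_tendsto_cmult) (use hconv in auto)
  qed
  show ?thesis
    unfolding H0_def
  proof (intro conjI allI impI)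
    show "?\<psi> \<in> borel_measurable lebesgue" "?\<Psi> \<in> borel_measurable lebesgue" by measurable
    fix e :: real assume "0 < e"
    then have "\<forall>\<^sub>F n in sequentially. ennreal (C * (1 / 2) ^ n) + ennreal (3 powr p * B powr p) * (\<integral>\<^sup>+y. ennreal (h n y) \<partial>lebesgue) < ennreal e"
      by (intro order_tendstoD[OF lim]) auto
    then obtain n where "ennreal (C * (1 / 2) ^ n) + ennreal (3 powr p * B powr p) * (\<integral>\<^sup>+y. ennreal (h n y) \<partial>lebesgue) < ennreal e"
      by (auto simp: eventually_sequentially)
    then have "En (\<lambda>y. ?\<psi>n n y - ?\<psi> y) (\<lambda>y. ?\<Psi>n n y - ?\<Psi> y) \<le> ennreal e"
      using le[of n] by simp
    then show "\<exists>\<phi>' E'. C1_on UNIV \<phi>' E' \<and> (\<forall>y. y \<notin> cball x0 r \<longrightarrow> \<phi>' y = 0) \<and>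
       En (\<lambda>y. \<phi>' y - ?\<psi> y) (\<lambda>y. E' y - ?\<Psi> y) \<le> ennreal e"
      using C1n[of n] \<eta>(2) by (intro exI[of _ "?\<psi>n n"] exI[of _ "?\<Psi>n n"]) simp
  qed
qed

end

section \<open>The weak formulation for Sobolev test functions\<close>

text \<open>A cutoff of \<open>u\<close> lies in \<open>H0\<close>, so the Sobolev inequality raises
  its integrability. The bound \<open>S\<close> depends on the solution; its purpose is to enlarge
  the class of test functions.\<close>

lemma (in approximated) u_higher:
  assumes k: "0 < k"
  obtains S where "0 < S"
    "(\<integral>\<^sup>+y. ennreal ((indicat_real (cball x0 (11 / 8)) y * (\<bar>u y\<bar> + k)) powr Q1 * \<omega>1 y) \<partial>lebesgue) \<le> ennreal S"
    "(\<integral>\<^sup>+y. ennreal ((indicat_real (cball x0 (11 / 8)) y * (\<bar>u y\<bar> + k)) powr q * \<omega>2 y) \<partial>lebesgue) \<le> ennreal S"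
proof -
  let ?K = "cball x0 (11 / 8)"
  obtain L where L: "0 < L" "\<And>r r'. 1 \<le> r \<Longrightarrow> r < r' \<Longrightarrow> r' \<le> 3 / 2 \<Longrightarrow>
    \<exists>\<eta> D. C1_on UNIV \<eta> D \<and> (\<forall>x. 0 \<le> \<eta> x \<and> \<eta> x \<le> 1) \<and> (\<forall>x\<in>cball x0 r. \<eta> x = 1) \<and>
      (\<forall>x. x \<notin> cball x0 r' \<longrightarrow> \<eta> x = 0) \<and> (\<forall>x. x \<notin> cball x0 r' \<longrightarrow> D x = 0) \<and> (\<forall>x. norm (D x) \<le> L / (r' - r))"
    by (rule cutoff[of x0]) blast
  have "\<exists>\<eta> D. C1_on UNIV \<eta> D \<and> (\<forall>x. 0 \<le> \<eta> x \<and> \<eta> x \<le> 1) \<and> (\<forall>x\<in>?K. \<eta> x = 1) \<and>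
      (\<forall>x. x \<notin> cball x0 (3 / 2) \<longrightarrow> \<eta> x = 0) \<and> (\<forall>x. x \<notin> cball x0 (3 / 2) \<longrightarrow> D x = 0) \<and> (\<forall>x. norm (D x) \<le> L / (3 / 2 - 11 / 8))"
    by (rule L(2)) auto
  then obtain \<eta> D\<eta> where \<eta>: "C1_on UNIV \<eta> D\<eta>" "\<forall>x\<in>?K. \<eta> x = 1" "\<forall>x. x \<notin> cball x0 (3 / 2) \<longrightarrow> \<eta> x = 0"
    by (elim exE conjE)
  have H: "H0 (3 / 2) (\<lambda>y. \<eta> y * u y) (\<lambda>y. u y *\<^sub>R D\<eta> y + (\<eta> y * 1) *\<^sub>R v y)"
    by (rule chain_H0[where T="\<lambda>t. t" and T'="\<lambda>_. 1" and L=1, OF \<eta>(1)]) (use \<eta>(3) in auto)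
  obtain N where N: "0 < N" "En (\<lambda>y. \<eta> y * u y) (\<lambda>y. u y *\<^sub>R D\<eta> y + (\<eta> y * 1) *\<^sub>R v y) \<le> ennreal N"
    by (rule H0_finite[OF H])
  note [measurable] = C1_measurable[OF \<eta>(1)]
  have key: "(\<integral>\<^sup>+y. ennreal ((indicat_real ?K y * (\<bar>u y\<bar> + k)) powr Q * \<omega> y) \<partial>lebesgue)
      \<le> ennreal (2 powr Q * (S' + k powr Q * mass))"
    if [measurable]: "\<omega> \<in> borel_measurable lebesgue" and \<omega>: "\<And>x. 0 \<le> \<omega> x" "(\<integral>\<^sup>+y. ennreal (\<omega> y) \<partial>lebesgue) \<le> ennreal mass"
      and S': "0 \<le> S'" "(\<integral>\<^sup>+y. ennreal (\<bar>\<eta> y * u y\<bar> powr Q * \<omega> y) \<partial>lebesgue) \<le> ennreal S'" and Q: "0 < Q" for \<omega> Q S'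
  proof -
    have "(\<integral>\<^sup>+y. ennreal ((indicat_real ?K y * (\<bar>u y\<bar> + k)) powr Q * \<omega> y) \<partial>lebesgue)
      \<le> (\<integral>\<^sup>+y. ennreal (2 powr Q) * (ennreal (\<bar>\<eta> y * u y\<bar> powr Q * \<omega> y) + ennreal (k powr Q) * ennreal (\<omega> y)) \<partial>lebesgue)"
    proof (intro nn_integral_mono)
      fix y
      have "(indicat_real ?K y * (\<bar>u y\<bar> + k)) powr Q \<le> 2 powr Q * (\<bar>\<eta> y * u y\<bar> powr Q + k powr Q)"
      proof (cases "y \<in> ?K")
        case True
        then have "(indicat_real ?K y * (\<bar>u y\<bar> + k)) powr Q = (\<bar>\<eta> y * u y\<bar> + k) powr Q" using \<eta>(2) by simp
        also have "\<dots> \<le> 2 powr Q * (\<bar>\<eta> y * u y\<bar> powr Q + k powr Q)" using k Q by (intro powr_sum2) auto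
        finally show ?thesis .
      qed simp
      from mult_right_mono[OF this \<omega>(1)[of y]]
      have "ennreal ((indicat_real ?K y * (\<bar>u y\<bar> + k)) powr Q * \<omega> y) \<le> ennreal (2 powr Q * (\<bar>\<eta> y * u y\<bar> powr Q * \<omega> y + k powr Q * \<omega> y))"
        by (intro ennreal_leI) (simp add: algebra_simps)
      also have "\<dots> = ennreal (2 powr Q) * (ennreal (\<bar>\<eta> y * u y\<bar> powr Q * \<omega> y) + ennreal (k powr Q) * ennreal (\<omega> y))"
        using \<omega>(1)[of y] by (simp add: ennreal_mult ennreal_plus)
      finally show "ennreal ((indicat_real ?K y * (\<bar>u y\<bar> + k)) powr Q * \<omega> y)
        \<le> ennreal (2 powr Q) * (ennreal (\<bar>\<eta> y * u y\<bar> powr Q * \<omega> y) + ennreal (k powr Q) * ennreal (\<omega> y))" .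
    qed
    also have "\<dots> = ennreal (2 powr Q) * ((\<integral>\<^sup>+y. ennreal (\<bar>\<eta> y * u y\<bar> powr Q * \<omega> y) \<partial>lebesgue) + ennreal (k powr Q) * (\<integral>\<^sup>+y. ennreal (\<omega> y) \<partial>lebesgue))"
      by (simp add: nn_integral_cmult nn_integral_add)
    also have "\<dots> \<le> ennreal (2 powr Q) * (ennreal S' + ennreal (k powr Q) * ennreal mass)"
      by (intro mult_left_mono add_mono S' \<omega>) auto
    also have "\<dots> = ennreal (2 powr Q * (S' + k powr Q * mass))"
      using S' mass by (simp add: ennreal_mult ennreal_plus)
    finally show ?thesis .
  qed
  define Sa where "Sa = 2 powr Q1 * (Csob * N powr (Q1 / p) + k powr Q1 * mass)"
  define Sb where "Sb = 2 powr q * (Csob * N powr (q / p) + k powr q * mass)"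
  have Sab: "0 \<le> Sa" "0 \<le> Sb" using Csob mass by (auto simp: Sa_def Sb_def)
  have a: "(\<integral>\<^sup>+y. ennreal ((indicat_real ?K y * (\<bar>u y\<bar> + k)) powr Q1 * \<omega>1 y) \<partial>lebesgue) \<le> ennreal Sa"
    unfolding Sa_def by (rule key) (use H0_sobolev(1)[OF H _ N] \<omega>0 mass Csob Q1 in auto)
  have b: "(\<integral>\<^sup>+y. ennreal ((indicat_real ?K y * (\<bar>u y\<bar> + k)) powr q * \<omega>2 y) \<partial>lebesgue) \<le> ennreal Sb"
    unfolding Sb_def by (rule key) (use H0_sobolev(2)[OF H _ N] \<omega>0 mass Csob Dq in auto)
  show ?thesis
  proof (rule that[of "Sa + Sb + 1"])
    show "0 < Sa + Sb + 1" using Sab by simp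
    show "(\<integral>\<^sup>+y. ennreal ((indicat_real ?K y * (\<bar>u y\<bar> + k)) powr Q1 * \<omega>1 y) \<partial>lebesgue) \<le> ennreal (Sa + Sb + 1)"
      using a by (rule order_trans) (intro ennreal_leI, use Sab in simp)
    show "(\<integral>\<^sup>+y. ennreal ((indicat_real ?K y * (\<bar>u y\<bar> + k)) powr q * \<omega>2 y) \<partial>lebesgue) \<le> ennreal (Sa + Sb + 1)"
      using b by (rule order_trans) (intro ennreal_leI, use Sab in simp)
  qed
qed

text \<open>\<open>A\<close> and \<open>B\<close> are the compositions with \<open>u\<close> and its
  gradient, hence functions of \<open>x\<close> alone. The structure conditions are in homogeneous
  form: the inhomogeneous terms are already part of \<open>b\<close>, \<open>d1\<close>,
  \<open>d2\<close>, and |u| is replaced by |u| + k with k > 0. Later constants see the coefficients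
  only through \<open>Pb\<close>, \<open>Pc\<close>, \<open>Pd1\<close>, \<open>Pd2\<close>.\<close>

locale weak_data = approximated x0 \<omega>1 \<omega>2 p q D1 D \<epsilon> Cs u v \<phi> E N0
  for x0 :: "real ^ 'n" and \<omega>1 \<omega>2 and p q D1 D \<epsilon> Cs :: real and u v \<phi> E N0 +
  fixes A :: "real ^ 'n \<Rightarrow> real ^ 'n" and B b c d1 d2 :: "real ^ 'n \<Rightarrow> real" and a k Pb Pc Pd1 Pd2 :: real
  assumes mAB[measurable]: "A \<in> borel_measurable lebesgue" "B \<in> borel_measurable lebesgue"
    and mco[measurable]: "b \<in> borel_measurable lebesgue" "c \<in> borel_measurable lebesgue"
      "d1 \<in> borel_measurable lebesgue" "d2 \<in> borel_measurable lebesgue"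
    and co0: "\<And>x. 0 \<le> b x" "\<And>x. 0 \<le> c x" "\<And>x. 0 \<le> d1 x" "\<And>x. 0 \<le> d2 x"
    and ak: "0 < a" "0 < k" and P0: "0 \<le> Pb" "0 \<le> Pc" "0 \<le> Pd1" "0 \<le> Pd2"
    and Pb: "(\<integral>\<^sup>+x. ennreal (b x powr (D1 / (p - 1)) * \<omega>1 x) \<partial>lebesgue) \<le> ennreal Pb"
    and Pc: "(\<integral>\<^sup>+x. ennreal ((c x * (\<omega>2 x / \<omega>1 x) powr (1 - 1 / p)) powr (D / (1 - \<epsilon>)) * \<omega>2 x) \<partial>lebesgue) \<le> ennreal Pc"
    and Pd1: "(\<integral>\<^sup>+x. ennreal (d1 x powr (D1 / (p - \<epsilon>)) * \<omega>1 x) \<partial>lebesgue) \<le> ennreal Pd1"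
    and Pd2: "(\<integral>\<^sup>+x. ennreal (d2 x powr (D / (p - \<epsilon>)) * \<omega>2 x) \<partial>lebesgue) \<le> ennreal Pd2"
    and A_ge: "\<And>x. \<omega>1 x * (inverse a * norm (v x) powr p - d1 x * (\<bar>u x\<bar> + k) powr p) \<le> A x \<bullet> v x"
    and A_le: "\<And>x. norm (A x) \<le> \<omega>1 x * (a * norm (v x) powr (p - 1) + b x * (\<bar>u x\<bar> + k) powr (p - 1))"
    and B_le: "\<And>x. \<bar>B x\<bar> \<le> \<omega>2 x * (c x * norm (v x) powr (p - 1) + d2 x * (\<bar>u x\<bar> + k) powr (p - 1))"
    and weak: "\<And>\<psi>. (\<And>k. Ck_on k UNIV \<psi>) \<Longrightarrow> (\<And>y. y \<notin> cball x0 (3 / 2) \<Longrightarrow> \<psi> y = 0) \<Longrightarrow>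
      integrable lebesgue (\<lambda>x. A x \<bullet> grad \<psi> x + B x * \<psi> x) \<and> (\<integral>x. A x \<bullet> grad \<psi> x + B x * \<psi> x \<partial>lebesgue) = 0"
begin

text \<open>Continuity of one half of the weak formulation in the energy norm. The constant depends
  on the solution through \<open>N0\<close> and \<open>S\<close>, which is harmless in a density
  argument.\<close>

lemma A_bound:
  obtains C where "0 \<le> C" "\<And>(\<Psi> :: real ^ 'n \<Rightarrow> real ^ 'n) N. \<Psi> \<in> borel_measurable lebesgue \<Longrightarrow> (\<And>y. y \<notin> cball x0 (11 / 8) \<Longrightarrow> \<Psi> y = 0) \<Longrightarrow> 0 \<le> N \<Longrightarrow>
    (\<integral>\<^sup>+y. ennreal (norm (\<Psi> y) powr p * \<omega>1 y) \<partial>lebesgue) \<le> ennreal N \<Longrightarrow>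
    (\<integral>\<^sup>+y. ennreal (norm (A y) * norm (\<Psi> y)) \<partial>lebesgue) \<le> ennreal (C * N powr (1 / p))"
proof -
  let ?I = "\<lambda>y. indicat_real (cball x0 (11 / 8)) y * (\<bar>u y\<bar> + k)"
  obtain S where S: "0 < S" "(\<integral>\<^sup>+y. ennreal (?I y powr Q1 * \<omega>1 y) \<partial>lebesgue) \<le> ennreal S"
    by (rule u_higher[OF ak(2)])
  define C where "C = a * N0 powr ((p - 1) / p) + Pb powr ((p - 1) / D1) * S powr ((p - 1) / Q1)"
  have C: "0 \<le> C" using ak by (simp add: C_def)
  show ?thesis
  proof (rule that[OF C])
    fix \<Psi> :: "real ^ 'n \<Rightarrow> real ^ 'n" and N assume [measurable]: "\<Psi> \<in> borel_measurable lebesgue" and out: "\<And>y. y \<notin> cball x0 (11 / 8) \<Longrightarrow> \<Psi> y = 0"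
      and N: "0 \<le> N" "(\<integral>\<^sup>+y. ennreal (norm (\<Psi> y) powr p * \<omega>1 y) \<partial>lebesgue) \<le> ennreal N"
    have 1: "(\<integral>\<^sup>+y. ennreal (norm (v y) powr (p - 1) * norm (\<Psi> y) * \<omega>1 y) \<partial>lebesgue) \<le> ennreal (N0 powr ((p - 1) / p) * N powr (1 / p))"
      by (rule hoelder_A) (use N N0 v_energy in auto)
    have 2: "(\<integral>\<^sup>+y. ennreal (b y * ?I y powr (p - 1) * norm (\<Psi> y) * \<omega>1 y) \<partial>lebesgue)
        \<le> ennreal (Pb powr ((p - 1) / D1) * S powr ((p - 1) / Q1) * N powr (1 / p))"
      by (rule hoelder_b) (use N S Pb P0 co0 ak in auto)
    have pt: "norm (A y) * norm (\<Psi> y) \<le> a * (norm (v y) powr (p - 1) * norm (\<Psi> y) * \<omega>1 y) + b y * ?I y powr (p - 1) * norm (\<Psi> y) * \<omega>1 y" for y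
    proof (cases "y \<in> cball x0 (11 / 8)")
      case True
      then have "?I y = \<bar>u y\<bar> + k" by simp
      then show ?thesis using mult_right_mono[OF A_le[of y] norm_ge_zero[of "\<Psi> y"]] by (simp add: algebra_simps)
    qed (simp add: out)
    have "(\<integral>\<^sup>+y. ennreal (norm (A y) * norm (\<Psi> y)) \<partial>lebesgue)
      \<le> (\<integral>\<^sup>+y. ennreal a * ennreal (norm (v y) powr (p - 1) * norm (\<Psi> y) * \<omega>1 y) + ennreal (b y * ?I y powr (p - 1) * norm (\<Psi> y) * \<omega>1 y) \<partial>lebesgue)"
    proof (intro nn_integral_mono)
      fix y
      show "ennreal (norm (A y) * norm (\<Psi> y)) \<le> ennreal a * ennreal (norm (v y) powr (p - 1) * norm (\<Psi> y) * \<omega>1 y) + ennreal (b y * ?I y powr (p - 1) * norm (\<Psi> y) * \<omega>1 y)"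
        using ennreal_leI[OF pt[of y]] ak co0 \<omega>0 by (simp add: ennreal_mult ennreal_plus)
    qed
    also have "\<dots> = ennreal a * (\<integral>\<^sup>+y. ennreal (norm (v y) powr (p - 1) * norm (\<Psi> y) * \<omega>1 y) \<partial>lebesgue) + (\<integral>\<^sup>+y. ennreal (b y * ?I y powr (p - 1) * norm (\<Psi> y) * \<omega>1 y) \<partial>lebesgue)"
      by (simp add: nn_integral_add nn_integral_cmult)
    also have "\<dots> \<le> ennreal a * ennreal (N0 powr ((p - 1) / p) * N powr (1 / p)) + ennreal (Pb powr ((p - 1) / D1) * S powr ((p - 1) / Q1) * N powr (1 / p))"
      by (intro add_mono mult_left_mono 1 2) auto
    also have "\<dots> = ennreal (C * N powr (1 / p))"
      using ak by (simp add: ennreal_mult[symmetric] ennreal_plus[symmetric] C_def algebra_simps del: ennreal_plus)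
    finally show "(\<integral>\<^sup>+y. ennreal (norm (A y) * norm (\<Psi> y)) \<partial>lebesgue) \<le> ennreal (C * N powr (1 / p))" .
  qed
qed

lemma B_bound:
  obtains C where "0 \<le> C" "\<And>\<psi> N. \<psi> \<in> borel_measurable lebesgue \<Longrightarrow> (\<And>y. y \<notin> cball x0 (11 / 8) \<Longrightarrow> \<psi> y = 0) \<Longrightarrow> 0 < N \<Longrightarrow>
    (\<integral>\<^sup>+y. ennreal (\<bar>\<psi> y\<bar> powr q * \<omega>2 y) \<partial>lebesgue) \<le> ennreal N \<Longrightarrow>
    (\<integral>\<^sup>+y. ennreal (\<bar>B y\<bar> * \<bar>\<psi> y\<bar>) \<partial>lebesgue) \<le> ennreal (C * N powr (1 / q))"
proof -
  let ?I = "\<lambda>y. indicat_real (cball x0 (11 / 8)) y * (\<bar>u y\<bar> + k)"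
  obtain S where S: "0 < S" "(\<integral>\<^sup>+y. ennreal (?I y powr q * \<omega>2 y) \<partial>lebesgue) \<le> ennreal S"
    by (rule u_higher[OF ak(2)])
  define m where "m = mass powr (1 - p / q)"
  define X where "X = Pd2 powr ((p - \<epsilon>) / D) * S powr ((p - \<epsilon>) / q) * (S powr (p / q) * m) powr (\<epsilon> / p)"
  define Y where "Y = Pd2 powr ((p - \<epsilon>) / D) * m powr (\<epsilon> / p)"
  define Cc where "Cc = Pc powr ((1 - \<epsilon>) / D) * N0 powr ((p - 1) / p) * m powr (\<epsilon> / p)"
  define C where "C = Cc + X powr ((p - 1) / p) * Y powr (1 / p)"
  have nn: "0 \<le> m" "0 \<le> X" "0 \<le> Y" "0 \<le> Cc" by (auto simp: m_def X_def Y_def Cc_def)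
  have C: "0 \<le> C" using nn by (simp add: C_def)
  have pq: "0 < p" "p \<le> q" using p by auto
  show ?thesis
  proof (rule that[OF C])
    fix \<psi> N assume [measurable]: "\<psi> \<in> borel_measurable lebesgue" and out: "\<And>y. y \<notin> cball x0 (11 / 8) \<Longrightarrow> \<psi> y = 0"
      and N: "0 < N" "(\<integral>\<^sup>+y. ennreal (\<bar>\<psi> y\<bar> powr q * \<omega>2 y) \<partial>lebesgue) \<le> ennreal N"
    have Zp: "(\<integral>\<^sup>+y. ennreal (\<bar>\<psi> y\<bar> powr p * \<omega>2 y) \<partial>lebesgue) \<le> ennreal (N powr (p / q) * m)"
      unfolding m_def by (rule hoelder_mass) (use \<omega>0 N mass pq in auto)
    have ZI: "(\<integral>\<^sup>+y. ennreal (?I y powr p * \<omega>2 y) \<partial>lebesgue) \<le> ennreal (S powr (p / q) * m)"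
      unfolding m_def by (rule hoelder_mass) (use \<omega>0 S mass pq ak in auto)
    have Npow: "N powr ((1 - \<epsilon>) / q) * (N powr (p / q) * m) powr (\<epsilon> / p) = N powr (1 / q) * m powr (\<epsilon> / p)"
    proof -
      have "N powr ((1 - \<epsilon>) / q) * (N powr (p / q)) powr (\<epsilon> / p) = N powr (1 / q)"
        unfolding powr_powr powr_add[symmetric] using p by (simp add: add_divide_distrib[symmetric])
      then show ?thesis unfolding powr_mult by (simp only: mult.assoc[symmetric])
    qed
    have Npow2: "N powr ((p - \<epsilon>) / q) * (N powr (p / q) * m) powr (\<epsilon> / p) = N powr (p / q) * m powr (\<epsilon> / p)"
    proof -
      have "N powr ((p - \<epsilon>) / q) * (N powr (p / q)) powr (\<epsilon> / p) = N powr (p / q)"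
        unfolding powr_powr powr_add[symmetric] using p by (simp add: add_divide_distrib[symmetric])
      then show ?thesis unfolding powr_mult by (simp only: mult.assoc[symmetric])
    qed
    have 1: "(\<integral>\<^sup>+y. ennreal (c y * norm (v y) powr (p - 1) * \<bar>\<psi> y\<bar> * \<omega>2 y) \<partial>lebesgue) \<le> ennreal (Cc * N powr (1 / q))"
    proof -
      have "(\<integral>\<^sup>+y. ennreal (c y * norm (v y) powr (p - 1) * \<bar>\<psi> y\<bar> * \<omega>2 y) \<partial>lebesgue)
        \<le> ennreal (Pc powr ((1 - \<epsilon>) / D) * N0 powr ((p - 1) / p) * N powr ((1 - \<epsilon>) / q) * (N powr (p / q) * m) powr (\<epsilon> / p))"
        by (rule hoelder_c) (use N nn N0 v_energy Zp Pc P0 co0 in auto)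
      also have "Pc powr ((1 - \<epsilon>) / D) * N0 powr ((p - 1) / p) * N powr ((1 - \<epsilon>) / q) * (N powr (p / q) * m) powr (\<epsilon> / p) = Cc * N powr (1 / q)"
        unfolding mult.assoc Npow Cc_def by (simp only: mult_ac)
      finally show ?thesis .
    qed
    have 2: "(\<integral>\<^sup>+y. ennreal (d2 y * ?I y powr p * \<omega>2 y) \<partial>lebesgue) \<le> ennreal X"
      unfolding X_def by (rule hoelder_d) (use \<omega>0 co0 P0 nn S ZI Dq Pd2 ak in auto)
    have 3: "(\<integral>\<^sup>+y. ennreal (d2 y * \<bar>\<psi> y\<bar> powr p * \<omega>2 y) \<partial>lebesgue) \<le> ennreal (Y * N powr (p / q))"
    proof -
      have "(\<integral>\<^sup>+y. ennreal (d2 y * \<bar>\<psi> y\<bar> powr p * \<omega>2 y) \<partial>lebesgue)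
        \<le> ennreal (Pd2 powr ((p - \<epsilon>) / D) * N powr ((p - \<epsilon>) / q) * (N powr (p / q) * m) powr (\<epsilon> / p))"
        by (rule hoelder_d) (use \<omega>0 co0 P0 nn N Zp Dq Pd2 in auto)
      also have "Pd2 powr ((p - \<epsilon>) / D) * N powr ((p - \<epsilon>) / q) * (N powr (p / q) * m) powr (\<epsilon> / p) = Y * N powr (p / q)"
        unfolding mult.assoc Npow2 Y_def by (simp only: mult_ac)
      finally show ?thesis .
    qed
    \<comment> \<open>Hoelder with respect to the density \<open>d2 * \<omega>2\<close>, which
      reduces the mixed term to the two p-th power integrals just bounded.\<close>
    have 4: "(\<integral>\<^sup>+y. ennreal (d2 y * ?I y powr (p - 1) * \<bar>\<psi> y\<bar> * \<omega>2 y) \<partial>lebesgue) \<le> ennreal (X powr ((p - 1) / p) * Y powr (1 / p) * N powr (1 / q))"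
    proof -
      have "(\<integral>\<^sup>+y. ennreal ((d2 y * ?I y powr p * \<omega>2 y) powr ((p - 1) / p) * (d2 y * \<bar>\<psi> y\<bar> powr p * \<omega>2 y) powr (1 / p)) \<partial>lebesgue)
        \<le> ennreal (X powr ((p - 1) / p) * (Y * N powr (p / q)) powr (1 / p))"
        by (rule nn_integral_Holder2) (use \<omega>0 co0 nn N 2 3 p ak in \<open>auto simp: add_divide_distrib[symmetric]\<close>)
      moreover have "(d2 y * ?I y powr p * \<omega>2 y) powr ((p - 1) / p) * (d2 y * \<bar>\<psi> y\<bar> powr p * \<omega>2 y) powr (1 / p)
         = d2 y * ?I y powr (p - 1) * \<bar>\<psi> y\<bar> * \<omega>2 y" for y
      proof -
        have j: "x powr ((p - 1) / p) * x powr (1 / p) = x" if "0 \<le> x" for x :: real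
          unfolding powr_add[symmetric] using that p by (simp add: add_divide_distrib[symmetric])
        have "(?I y powr p) powr ((p - 1) / p) = ?I y powr (p - 1)" "(\<bar>\<psi> y\<bar> powr p) powr (1 / p) = \<bar>\<psi> y\<bar>"
          using p by (auto simp: powr_powr)
        then have "(d2 y * ?I y powr p * \<omega>2 y) powr ((p - 1) / p) * (d2 y * \<bar>\<psi> y\<bar> powr p * \<omega>2 y) powr (1 / p)
          = (d2 y powr ((p - 1) / p) * d2 y powr (1 / p)) * ?I y powr (p - 1) * \<bar>\<psi> y\<bar> * (\<omega>2 y powr ((p - 1) / p) * \<omega>2 y powr (1 / p))"
          unfolding powr_mult[of "d2 y * _"] powr_mult[of "d2 y"] by (simp only: mult_ac)
        then show ?thesis unfolding j[OF co0(4)] j[OF \<omega>0(2)] .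
      qed
      moreover have "X powr ((p - 1) / p) * (Y * N powr (p / q)) powr (1 / p) = X powr ((p - 1) / p) * Y powr (1 / p) * N powr (1 / q)"
        unfolding powr_mult powr_powr using p by (simp add: mult.assoc)
      ultimately show ?thesis by simp
    qed
    have pt: "\<bar>B y\<bar> * \<bar>\<psi> y\<bar> \<le> c y * norm (v y) powr (p - 1) * \<bar>\<psi> y\<bar> * \<omega>2 y + d2 y * ?I y powr (p - 1) * \<bar>\<psi> y\<bar> * \<omega>2 y" for y
    proof (cases "y \<in> cball x0 (11 / 8)")
      case True
      then have "?I y = \<bar>u y\<bar> + k" by simp
      then show ?thesis using mult_right_mono[OF B_le[of y] abs_ge_zero[of "\<psi> y"]] by (simp add: algebra_simps)
    qed (simp add: out)
    have "(\<integral>\<^sup>+y. ennreal (\<bar>B y\<bar> * \<bar>\<psi> y\<bar>) \<partial>lebesgue)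
      \<le> (\<integral>\<^sup>+y. ennreal (c y * norm (v y) powr (p - 1) * \<bar>\<psi> y\<bar> * \<omega>2 y) + ennreal (d2 y * ?I y powr (p - 1) * \<bar>\<psi> y\<bar> * \<omega>2 y) \<partial>lebesgue)"
    proof (intro nn_integral_mono)
      fix y
      show "ennreal (\<bar>B y\<bar> * \<bar>\<psi> y\<bar>) \<le> ennreal (c y * norm (v y) powr (p - 1) * \<bar>\<psi> y\<bar> * \<omega>2 y) + ennreal (d2 y * ?I y powr (p - 1) * \<bar>\<psi> y\<bar> * \<omega>2 y)"
        using ennreal_leI[OF pt[of y]] co0 \<omega>0 by (simp add: ennreal_plus)
    qed
    also have "\<dots> = (\<integral>\<^sup>+y. ennreal (c y * norm (v y) powr (p - 1) * \<bar>\<psi> y\<bar> * \<omega>2 y) \<partial>lebesgue) + (\<integral>\<^sup>+y. ennreal (d2 y * ?I y powr (p - 1) * \<bar>\<psi> y\<bar> * \<omega>2 y) \<partial>lebesgue)"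
      by (simp add: nn_integral_add)
    also have "\<dots> \<le> ennreal (Cc * N powr (1 / q)) + ennreal (X powr ((p - 1) / p) * Y powr (1 / p) * N powr (1 / q))"
      by (intro add_mono 1 4)
    also have "\<dots> = ennreal (C * N powr (1 / q))"
      using nn by (simp add: ennreal_plus[symmetric] C_def algebra_simps del: ennreal_plus)
    finally show "(\<integral>\<^sup>+y. ennreal (\<bar>B y\<bar> * \<bar>\<psi> y\<bar>) \<partial>lebesgue) \<le> ennreal (C * N powr (1 / q))" .
  qed
qed

lemma AB_bound:
  obtains C where "0 \<le> C" "\<And>\<psi> \<Psi> N. H0 (11 / 8) \<psi> \<Psi> \<Longrightarrow> (\<And>y. y \<notin> cball x0 (11 / 8) \<Longrightarrow> \<psi> y = 0) \<Longrightarrow>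
    (\<And>y. y \<notin> cball x0 (11 / 8) \<Longrightarrow> \<Psi> y = 0) \<Longrightarrow> 0 < N \<Longrightarrow> En \<psi> \<Psi> \<le> ennreal N \<Longrightarrow>
    (\<integral>\<^sup>+y. ennreal (norm (A y) * norm (\<Psi> y)) + ennreal (\<bar>B y\<bar> * \<bar>\<psi> y\<bar>) \<partial>lebesgue) \<le> ennreal (C * N powr (1 / p))"
proof -
  obtain CA where CA: "0 \<le> CA" "\<And>(\<Psi> :: real ^ 'n \<Rightarrow> real ^ 'n) N. \<Psi> \<in> borel_measurable lebesgue \<Longrightarrow> (\<And>y. y \<notin> cball x0 (11 / 8) \<Longrightarrow> \<Psi> y = 0) \<Longrightarrow> 0 \<le> N \<Longrightarrow>
    (\<integral>\<^sup>+y. ennreal (norm (\<Psi> y) powr p * \<omega>1 y) \<partial>lebesgue) \<le> ennreal N \<Longrightarrow>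
    (\<integral>\<^sup>+y. ennreal (norm (A y) * norm (\<Psi> y)) \<partial>lebesgue) \<le> ennreal (CA * N powr (1 / p))"
    by (rule A_bound) blast
  obtain CB where CB: "0 \<le> CB" "\<And>\<psi> N. \<psi> \<in> borel_measurable lebesgue \<Longrightarrow> (\<And>y. y \<notin> cball x0 (11 / 8) \<Longrightarrow> \<psi> y = 0) \<Longrightarrow> 0 < N \<Longrightarrow>
    (\<integral>\<^sup>+y. ennreal (\<bar>\<psi> y\<bar> powr q * \<omega>2 y) \<partial>lebesgue) \<le> ennreal N \<Longrightarrow>
    (\<integral>\<^sup>+y. ennreal (\<bar>B y\<bar> * \<bar>\<psi> y\<bar>) \<partial>lebesgue) \<le> ennreal (CB * N powr (1 / q))"
    by (rule B_bound) blast
  define C where "C = CA + CB * Csob powr (1 / q)"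
  have C: "0 \<le> C" using CA CB by (simp add: C_def)
  show ?thesis
  proof (rule that[OF C])
    fix \<psi> \<Psi> N assume H: "H0 (11 / 8) \<psi> \<Psi>" and out: "\<And>y. y \<notin> cball x0 (11 / 8) \<Longrightarrow> \<psi> y = 0"
      "\<And>y. y \<notin> cball x0 (11 / 8) \<Longrightarrow> \<Psi> y = 0" and N: "0 < N" "En \<psi> \<Psi> \<le> ennreal N"
    note m[measurable] = H0_measurable[OF H]
    have "(\<integral>\<^sup>+y. ennreal (norm (\<Psi> y) powr p * \<omega>1 y) \<partial>lebesgue) \<le> En \<psi> \<Psi>"
      unfolding En_def using \<omega>0 by (intro nn_integral_mono ennreal_leI mult_right_mono) auto
    then have 0: "(\<integral>\<^sup>+y. ennreal (norm (\<Psi> y) powr p * \<omega>1 y) \<partial>lebesgue) \<le> ennreal N" using N(2) by (rule order_trans)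
    have 1: "(\<integral>\<^sup>+y. ennreal (norm (A y) * norm (\<Psi> y)) \<partial>lebesgue) \<le> ennreal (CA * N powr (1 / p))"
      by (rule CA(2)[OF m(2) out(2) less_imp_le[OF N(1)] 0])
    have sb: "(\<integral>\<^sup>+y. ennreal (\<bar>\<psi> y\<bar> powr q * \<omega>2 y) \<partial>lebesgue) \<le> ennreal (Csob * N powr (q / p))"
      by (rule H0_sobolev(2)[OF H _ N]) simp
    have pos: "0 < Csob * N powr (q / p)" using Csob N by simp
    have "(\<integral>\<^sup>+y. ennreal (\<bar>B y\<bar> * \<bar>\<psi> y\<bar>) \<partial>lebesgue) \<le> ennreal (CB * (Csob * N powr (q / p)) powr (1 / q))"
      by (rule CB(2)[OF m(1) out(1) pos sb])
    also have "(Csob * N powr (q / p)) powr (1 / q) = Csob powr (1 / q) * N powr (1 / p)"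
      unfolding powr_mult powr_powr using p by simp
    finally have 2: "(\<integral>\<^sup>+y. ennreal (\<bar>B y\<bar> * \<bar>\<psi> y\<bar>) \<partial>lebesgue) \<le> ennreal (CB * (Csob powr (1 / q) * N powr (1 / p)))" .
    have "(\<integral>\<^sup>+y. ennreal (norm (A y) * norm (\<Psi> y)) + ennreal (\<bar>B y\<bar> * \<bar>\<psi> y\<bar>) \<partial>lebesgue)
      = (\<integral>\<^sup>+y. ennreal (norm (A y) * norm (\<Psi> y)) \<partial>lebesgue) + (\<integral>\<^sup>+y. ennreal (\<bar>B y\<bar> * \<bar>\<psi> y\<bar>) \<partial>lebesgue)"
      by (rule nn_integral_add) measurable
    also have "\<dots> \<le> ennreal (CA * N powr (1 / p)) + ennreal (CB * (Csob powr (1 / q) * N powr (1 / p)))"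
      by (intro add_mono 1 2)
    also have "\<dots> = ennreal (C * N powr (1 / p))"
      using CA CB by (simp add: ennreal_plus[symmetric] C_def algebra_simps del: ennreal_plus)
    finally show "(\<integral>\<^sup>+y. ennreal (norm (A y) * norm (\<Psi> y)) + ennreal (\<bar>B y\<bar> * \<bar>\<psi> y\<bar>) \<partial>lebesgue) \<le> ennreal (C * N powr (1 / p))" .
  qed
qed

text \<open>The weak formulation is linear and continuous in the energy norm, and it vanishes on
  smooth functions. The smooth approximants may reach radius 11/8, slightly beyond r, because of
  mollification.\<close>

lemma weak_H0:
  assumes H: "H0 r \<psi> \<Psi>" and r: "0 < r" "r < 11 / 8"
    and out: "\<And>y. y \<notin> cball x0 r \<Longrightarrow> \<psi> y = 0" "\<And>y. y \<notin> cball x0 r \<Longrightarrow> \<Psi> y = 0"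
  shows "integrable lebesgue (\<lambda>x. A x \<bullet> \<Psi> x + B x * \<psi> x)" "(\<integral>x. A x \<bullet> \<Psi> x + B x * \<psi> x \<partial>lebesgue) = 0"
proof -
  note m[measurable] = H0_measurable[OF H]
  obtain C where C: "0 \<le> C" "\<And>\<psi> \<Psi> N. H0 (11 / 8) \<psi> \<Psi> \<Longrightarrow> (\<And>y. y \<notin> cball x0 (11 / 8) \<Longrightarrow> \<psi> y = 0) \<Longrightarrow>
    (\<And>y. y \<notin> cball x0 (11 / 8) \<Longrightarrow> \<Psi> y = 0) \<Longrightarrow> 0 < N \<Longrightarrow> En \<psi> \<Psi> \<le> ennreal N \<Longrightarrow>
    (\<integral>\<^sup>+y. ennreal (norm (A y) * norm (\<Psi> y)) + ennreal (\<bar>B y\<bar> * \<bar>\<psi> y\<bar>) \<partial>lebesgue) \<le> ennreal (C * N powr (1 / p))"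
    by (rule AB_bound) blast
  have small: "integrable lebesgue (\<lambda>x. A x \<bullet> X x + B x * \<xi> x) \<and> \<bar>\<integral>x. A x \<bullet> X x + B x * \<xi> x \<partial>lebesgue\<bar> \<le> C * N powr (1 / p)"
    if h: "H0 (11 / 8) \<xi> X" "\<And>y. y \<notin> cball x0 (11 / 8) \<Longrightarrow> \<xi> y = 0" "\<And>y. y \<notin> cball x0 (11 / 8) \<Longrightarrow> X y = 0" "0 < N" "En \<xi> X \<le> ennreal N"
    for \<xi> X N
  proof -
    note [measurable] = H0_measurable[OF h(1)]
    have "(\<integral>\<^sup>+x. ennreal (norm (A x \<bullet> X x + B x * \<xi> x)) \<partial>lebesgue)
      \<le> (\<integral>\<^sup>+y. ennreal (norm (A y) * norm (X y)) + ennreal (\<bar>B y\<bar> * \<bar>\<xi> y\<bar>) \<partial>lebesgue)"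
    proof (intro nn_integral_mono)
      fix x
      have "\<bar>A x \<bullet> X x + B x * \<xi> x\<bar> \<le> \<bar>A x \<bullet> X x\<bar> + \<bar>B x * \<xi> x\<bar>" by (rule abs_triangle_ineq)
      also have "\<dots> \<le> norm (A x) * norm (X x) + \<bar>B x\<bar> * \<bar>\<xi> x\<bar>"
        using Cauchy_Schwarz_ineq2[of "A x" "X x"] by (simp add: abs_mult)
      finally show "ennreal (norm (A x \<bullet> X x + B x * \<xi> x)) \<le> ennreal (norm (A x) * norm (X x)) + ennreal (\<bar>B x\<bar> * \<bar>\<xi> x\<bar>)"
        by (simp add: ennreal_plus[symmetric] ennreal_leI del: ennreal_plus)
    qed
    also have "\<dots> \<le> ennreal (C * N powr (1 / p))" by (rule C(2)[OF h])
    finally have le: "(\<integral>\<^sup>+x. ennreal (norm (A x \<bullet> X x + B x * \<xi> x)) \<partial>lebesgue) \<le> ennreal (C * N powr (1 / p))" .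
    have int: "integrable lebesgue (\<lambda>x. A x \<bullet> X x + B x * \<xi> x)"
      by (rule integrableI_bounded) (measurable, use le in \<open>auto intro: le_less_trans\<close>)
    have "ennreal \<bar>\<integral>x. A x \<bullet> X x + B x * \<xi> x \<partial>lebesgue\<bar> \<le> (\<integral>\<^sup>+x. ennreal (norm (A x \<bullet> X x + B x * \<xi> x)) \<partial>lebesgue)"
      using integral_norm_bound_ennreal[OF int] by simp
    then have "ennreal \<bar>\<integral>x. A x \<bullet> X x + B x * \<xi> x \<partial>lebesgue\<bar> \<le> ennreal (C * N powr (1 / p))" using le by (rule order_trans)
    then have "\<bar>\<integral>x. A x \<bullet> X x + B x * \<xi> x \<partial>lebesgue\<bar> \<le> C * N powr (1 / p)"
      using C(1) by (subst (asm) ennreal_le_iff) auto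
    then show ?thesis using int by simp
  qed
  have H': "H0 (11 / 8) \<psi> \<Psi>"
  proof -
    have "H0 (11 / 8) (\<lambda>y. \<psi> y - 0) (\<lambda>y. \<Psi> y - 0)"
      by (rule H0_diff_C1[OF H, where r'="11 / 8"]) (use r in \<open>auto simp: C1_on_def intro: GDERIV_const\<close>)
    then show ?thesis by simp
  qed
  have sub: "y \<notin> cball x0 (11 / 8) \<Longrightarrow> y \<notin> cball x0 r" for y using r by auto
  obtain N where N: "0 < N" "En \<psi> \<Psi> \<le> ennreal N" by (rule H0_finite[OF H])
  show int: "integrable lebesgue (\<lambda>x. A x \<bullet> \<Psi> x + B x * \<psi> x)"
    using small[OF H' _ _ N] out sub by blast
  \<comment> \<open>Subtracting a smooth test function within energy e of \<psi> leaves the integral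
    unchanged, and e is arbitrary.\<close>
  have e: "\<bar>\<integral>x. A x \<bullet> \<Psi> x + B x * \<psi> x \<partial>lebesgue\<bar> \<le> C * e powr (1 / p)" if e0: "0 < e" for e
  proof -
    obtain \<phi>' where \<phi>': "\<And>k. Ck_on k UNIV \<phi>'" "\<And>y. y \<notin> cball x0 (11 / 8) \<Longrightarrow> \<phi>' y = 0"
      "En (\<lambda>y. \<phi>' y - \<psi> y) (\<lambda>y. grad \<phi>' y - \<Psi> y) \<le> ennreal e"
      by (rule H0_test[OF H r e0]) blast
    have C1: "C1_on UNIV \<phi>' (grad \<phi>')" by (rule Ck_on_1_C1_on[OF \<phi>'(1)])
    have g0: "grad \<phi>' y = 0" if "y \<notin> cball x0 (11 / 8)" for y
      by (rule C1_on_outside_support[OF C1 closed_cball \<phi>'(2) that])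
    have w: "integrable lebesgue (\<lambda>x. A x \<bullet> grad \<phi>' x + B x * \<phi>' x)" "(\<integral>x. A x \<bullet> grad \<phi>' x + B x * \<phi>' x \<partial>lebesgue) = 0"
      using weak[OF \<phi>'(1)] \<phi>'(2) by auto
    have Hd: "H0 (11 / 8) (\<lambda>y. \<psi> y - \<phi>' y) (\<lambda>y. \<Psi> y - grad \<phi>' y)"
      by (rule H0_diff_C1[OF H C1 \<phi>'(2)]) (use r in auto)
    have "\<bar>\<integral>x. A x \<bullet> (\<Psi> x - grad \<phi>' x) + B x * (\<psi> x - \<phi>' x) \<partial>lebesgue\<bar> \<le> C * e powr (1 / p)"
      using small[OF Hd _ _ e0] \<phi>'(2,3) g0 out sub by (simp add: En_minus_commute[of \<psi> \<phi>'])
    moreover have "(\<integral>x. A x \<bullet> (\<Psi> x - grad \<phi>' x) + B x * (\<psi> x - \<phi>' x) \<partial>lebesgue)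
      = (\<integral>x. (A x \<bullet> \<Psi> x + B x * \<psi> x) - (A x \<bullet> grad \<phi>' x + B x * \<phi>' x) \<partial>lebesgue)"
      by (intro Bochner_Integration.integral_cong) (auto simp: inner_diff_right algebra_simps)
    moreover have "\<dots> = (\<integral>x. A x \<bullet> \<Psi> x + B x * \<psi> x \<partial>lebesgue)"
      using int w by simp
    ultimately show ?thesis by simp
  qed
  have "((\<lambda>e. C * e powr (1 / p)) \<longlongrightarrow> C * 0 powr (1 / p)) (at_right 0)"
    using p by (intro tendsto_mult tendsto_const tendsto_powr' tendsto_ident_at) (auto simp: eventually_at_filter)
  then have lim: "((\<lambda>e. C * e powr (1 / p)) \<longlongrightarrow> 0) (at_right 0)" by simp
  have "\<bar>\<integral>x. A x \<bullet> \<Psi> x + B x * \<psi> x \<partial>lebesgue\<bar> \<le> 0"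
    by (rule tendsto_lowerbound[OF lim]) (use e in \<open>auto simp: eventually_at_filter\<close>)
  then show "(\<integral>x. A x \<bullet> \<Psi> x + B x * \<psi> x \<partial>lebesgue) = 0" by simp
qed

end

section \<open>The energy estimate\<close>

text \<open>Passes from the signed identity to an estimate of nonnegative integrals: domination of
  the nonnegative F by F0 + R first gives integrability of F, after which the real integrals can be
  compared and F0 drops out.\<close>

lemma nn_integral_le_of_weak:
  fixes F0 R F :: "'a \<Rightarrow> real"
  assumes F0: "integrable M F0" "integral\<^sup>L M F0 = 0"
    and m[measurable]: "R \<in> borel_measurable M" "F \<in> borel_measurable M"
    and nn: "\<And>x. 0 \<le> R x" "\<And>x. 0 \<le> F x" "0 \<le> r"
    and R: "(\<integral>\<^sup>+x. ennreal (R x) \<partial>M) \<le> ennreal r"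
    and le: "\<And>x. F x \<le> F0 x + R x"
  shows "(\<integral>\<^sup>+x. ennreal (F x) \<partial>M) \<le> ennreal r"
proof -
  have Ri: "integrable M R"
  proof (rule integrableI_nonneg)
    show "(\<integral>\<^sup>+x. ennreal (R x) \<partial>M) < \<infinity>" using R by (rule le_less_trans) simp
  qed (use nn in auto)
  have Fi: "integrable M F"
    by (rule Bochner_Integration.integrable_bound[OF Bochner_Integration.integrable_add[OF F0(1) Ri]])
       (use nn le in \<open>auto intro!: AE_I2 order_trans[OF le abs_ge_self]\<close>)
  have "ennreal (integral\<^sup>L M R) \<le> ennreal r"
    using R nn_integral_eq_integral[OF Ri] nn by simp
  then have Rr: "integral\<^sup>L M R \<le> r" using nn by (subst (asm) ennreal_le_iff) auto
  have "integral\<^sup>L M F \<le> integral\<^sup>L M (\<lambda>x. F0 x + R x)"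
    by (rule integral_mono[OF Fi Bochner_Integration.integrable_add[OF F0(1) Ri] le])
  also have "\<dots> = integral\<^sup>L M R" using F0 Ri by simp
  finally have "integral\<^sup>L M F \<le> r" using Rr by simp
  then show ?thesis using nn_integral_eq_integral[OF Fi] nn by (simp add: ennreal_leI)
qed

text \<open>Because \<zeta> \<le> Y, exponent may be shifted from \<zeta> to Y. This brings a term
  with power 1/p of \<zeta> into the form of those with power \<epsilon>/p.\<close>

lemma interpolation_absorb:
  fixes Y \<zeta> :: real
  assumes "0 < \<zeta>" "\<zeta> \<le> Y" "\<alpha> \<le> \<beta>"
  shows "Y powr (1 - \<beta>) * \<zeta> powr \<beta> \<le> Y powr (1 - \<alpha>) * \<zeta> powr \<alpha>"
proof -
  have "\<zeta> powr \<beta> = \<zeta> powr (\<beta> - \<alpha>) * \<zeta> powr \<alpha>" by (simp add: powr_add[symmetric])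
  also have "\<dots> \<le> Y powr (\<beta> - \<alpha>) * \<zeta> powr \<alpha>"
    using assms by (intro mult_right_mono powr_mono2) auto
  finally have "Y powr (1 - \<beta>) * \<zeta> powr \<beta> \<le> Y powr (1 - \<beta>) * (Y powr (\<beta> - \<alpha>) * \<zeta> powr \<alpha>)"
    by (intro mult_left_mono) auto
  also have "\<dots> = Y powr (1 - \<alpha>) * \<zeta> powr \<alpha>"
    unfolding mult.assoc[symmetric] powr_add[symmetric] by simp
  finally show ?thesis .
qed

section \<open>Absorption of the lower order terms\<close>

context moser_data
begin

text \<open>As |u| + k \<ge> k, the integral of a power of |u| + k over a ball containing the unit
  ball is at least the same power of k times \<open>mu1\<close>; this converts the constant k into a
  known integral.\<close>

definition mu1 :: real where "mu1 = (\<integral>x. indicat_real (ball x0 1) x * \<omega>1 x \<partial>lebesgue)"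

lemma ball1_integrable: "integrable lebesgue (\<lambda>x. indicat_real (ball x0 1) x * \<omega>1 x)"
  using integrable_mult_indicator[OF _ \<omega>int(1), of "ball x0 1"] by simp

lemma mu1: "0 < mu1" "(\<integral>\<^sup>+x. ennreal (indicat_real (ball x0 1) x * \<omega>1 x) \<partial>lebesgue) = ennreal mu1"
proof -
  show e: "(\<integral>\<^sup>+x. ennreal (indicat_real (ball x0 1) x * \<omega>1 x) \<partial>lebesgue) = ennreal mu1"
    unfolding mu1_def by (rule nn_integral_eq_integral[OF ball1_integrable]) (use \<omega>0 in auto)
  show "0 < mu1"
  proof (rule ccontr)
    assume "\<not> 0 < mu1"
    then have "(\<integral>\<^sup>+x. ennreal (indicat_real (ball x0 1) x * \<omega>1 x) \<partial>lebesgue) = 0"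
      using e by (simp add: ennreal_eq_0_iff)
    then have "AE x in lebesgue. ennreal (indicat_real (ball x0 1) x * \<omega>1 x) = 0"
      by (subst (asm) nn_integral_0_iff_AE) measurable
    then have "AE x in lebesgue. x \<notin> ball x0 1"
      using \<omega>pos by eventually_elim (auto simp: ennreal_eq_0_iff indicator_def split: if_splits)
    then have "ball x0 1 \<in> null_sets lebesgue" by (subst (asm) AE_iff_null_sets[symmetric]) auto
    then have "negligible (ball x0 1)" by (simp add: negligible_iff_null_sets)
    then show False using open_not_negligible[of "ball x0 1"] by auto
  qed
qed

text \<open>The first summand comes from the Sobolev inequality for the truncated power V, the
  second from the error k^\<gamma> in the comparison of W with \<gamma> |V|.\<close>

definition CS :: "real \<Rightarrow> real"
  where "CS Q = 2 powr Q * (Csob * (2 powr (p + 1)) powr (Q / p) + mass * (1 / mu1) powr (Q / p))"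

lemma CS: "0 < CS Q"
  using Csob mass by (simp add: CS_def add_pos_nonneg)

text \<open>One summand for each of the five terms of the tested equation, once each has been
  reduced to the common form of \<open>energy_absorb\<close>.\<close>

definition KK :: "real \<Rightarrow> real \<Rightarrow> real \<Rightarrow> real \<Rightarrow> real \<Rightarrow> real"
  where "KK a Pb Pc Pd1 Pd2 = p * a + p * (Pb powr ((p - 1) / D1) * CS Q1 powr ((p - 1) / Q1))
    + Pc powr ((1 - \<epsilon>) / D) * CS q powr ((1 - \<epsilon>) / q)
    + Pd2 powr ((p - \<epsilon>) / D) * CS q powr ((p - \<epsilon>) / q)
    + Pd1 powr ((p - \<epsilon>) / D1) * CS Q1 powr ((p - \<epsilon>) / Q1)"

definition K2 :: "real \<Rightarrow> real \<Rightarrow> real \<Rightarrow> real \<Rightarrow> real \<Rightarrow> real"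
  where "K2 a Pb Pc Pd1 Pd2 = (a * KK a Pb Pc Pd1 Pd2 + 1) powr (p / \<epsilon>)"

text \<open>Every term on the right of \<open>main\<close> is at most a constant times \<gamma>^p
  Y^(1 - \<epsilon>/p) \<zeta>^(\<epsilon>/p), and \<zeta> obeys the same bound, so Y itself may
  stand on the left. Dividing by Y and raising to the power p/\<epsilon> gives the exponents in
  \<open>K2\<close> and of \<gamma>.\<close>

lemma energy_absorb:
  assumes a: "0 < a" and \<gamma>: "1 \<le> \<gamma>" and X: "0 \<le> X" and \<zeta>: "0 < \<zeta>" "0 \<le> Z" "Z \<le> \<zeta>" "0 \<le> H" "H \<le> \<zeta>"
    and Y: "Y = X + \<zeta>"
    and S: "S1 = CS Q1 * \<gamma> powr Q1 * Y powr (Q1 / p)" "S2 = CS q * \<gamma> powr q * Y powr (q / p)"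
    and main: "inverse a * X \<le> p * a * (X powr ((p - 1) / p) * H powr (1 / p))
      + p * (Pb powr ((p - 1) / D1) * S1 powr ((p - 1) / Q1) * H powr (1 / p))
      + Pc powr ((1 - \<epsilon>) / D) * X powr ((p - 1) / p) * S2 powr ((1 - \<epsilon>) / q) * Z powr (\<epsilon> / p)
      + Pd2 powr ((p - \<epsilon>) / D) * S2 powr ((p - \<epsilon>) / q) * Z powr (\<epsilon> / p)
      + Pd1 powr ((p - \<epsilon>) / D1) * S1 powr ((p - \<epsilon>) / Q1) * Z powr (\<epsilon> / p)"
  shows "Y \<le> K2 a Pb Pc Pd1 Pd2 * \<gamma> powr (p * p / \<epsilon>) * \<zeta>"
proof -
  have Y0: "0 < Y" "X \<le> Y" "\<zeta> \<le> Y" using X \<zeta> Y by auto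
  define U where "U = Y powr (1 - \<epsilon> / p) * \<zeta> powr (\<epsilon> / p)"
  have U0: "0 < U" using Y0 \<zeta> by (simp add: U_def)
  have g1: "1 \<le> \<gamma> powr p" using \<gamma> p by (simp add: ge_one_powr_ge_zero)
  have gle: "\<gamma> powr t \<le> \<gamma> powr p" if "t \<le> p" for t using \<gamma> that by (intro powr_mono) auto
  have ex1: "(p - 1) / p = 1 - 1 / p" "(p - \<epsilon>) / p = 1 - \<epsilon> / p"
    using p by (auto simp: field_simps)
  have crit: "Y powr ((p - 1) / p) * \<zeta> powr (1 / p) \<le> U"
    unfolding U_def ex1 using Y0 \<zeta> \<epsilon> p by (intro interpolation_absorb) (auto simp: divide_right_mono)
  have Hz: "H powr (1 / p) \<le> \<zeta> powr (1 / p)" "Z powr (\<epsilon> / p) \<le> \<zeta> powr (\<epsilon> / p)"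
    using \<zeta> p \<epsilon> by (auto intro!: powr_mono2)
  have Xy: "X powr ((p - 1) / p) \<le> Y powr ((p - 1) / p)" using X Y0 p by (intro powr_mono2) auto
  have Spow: "(CS Q * \<gamma> powr Q * Y powr (Q / p)) powr (t / Q) = CS Q powr (t / Q) * (\<gamma> powr t * Y powr (t / p))" if "0 < Q" for Q t
    using that p unfolding powr_mult powr_powr by simp
  note Q0 = Q1(4) Dq(3)
  have t2: "X powr ((p - 1) / p) * H powr (1 / p) \<le> \<gamma> powr p * U"
  proof -
    have "X powr ((p - 1) / p) * H powr (1 / p) \<le> Y powr ((p - 1) / p) * \<zeta> powr (1 / p)"
      using Xy Hz by (intro mult_mono) auto
    also have "\<dots> \<le> U" by (rule crit)
    also have "\<dots> \<le> \<gamma> powr p * U" using g1 U0 by (simp add: mult_le_cancel_right1)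
    finally show ?thesis .
  qed
  have t3: "S1 powr ((p - 1) / Q1) * H powr (1 / p) \<le> CS Q1 powr ((p - 1) / Q1) * (\<gamma> powr p * U)"
  proof -
    have "S1 powr ((p - 1) / Q1) * H powr (1 / p) = CS Q1 powr ((p - 1) / Q1) * (\<gamma> powr (p - 1) * (Y powr ((p - 1) / p) * H powr (1 / p)))"
      unfolding S Spow[OF Q0(1)] by (simp only: mult_ac)
    also have "\<dots> \<le> CS Q1 powr ((p - 1) / Q1) * (\<gamma> powr p * (Y powr ((p - 1) / p) * \<zeta> powr (1 / p)))"
      using Hz by (intro mult_left_mono mult_mono gle) auto
    also have "\<dots> \<le> CS Q1 powr ((p - 1) / Q1) * (\<gamma> powr p * U)"
      by (intro mult_left_mono crit) auto
    finally show ?thesis .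
  qed
  have t15: "(CS Q * \<gamma> powr Q * Y powr (Q / p)) powr ((p - \<epsilon>) / Q) * Z powr (\<epsilon> / p) \<le> CS Q powr ((p - \<epsilon>) / Q) * (\<gamma> powr p * U)" if "0 < Q" for Q
  proof -
    have "(CS Q * \<gamma> powr Q * Y powr (Q / p)) powr ((p - \<epsilon>) / Q) * Z powr (\<epsilon> / p)
      = CS Q powr ((p - \<epsilon>) / Q) * (\<gamma> powr (p - \<epsilon>) * (Y powr ((p - \<epsilon>) / p) * Z powr (\<epsilon> / p)))"
      unfolding Spow[OF that] by (simp only: mult_ac)
    also have "\<dots> \<le> CS Q powr ((p - \<epsilon>) / Q) * (\<gamma> powr p * (Y powr ((p - \<epsilon>) / p) * \<zeta> powr (\<epsilon> / p)))"
      using Hz \<epsilon> by (intro mult_left_mono mult_mono gle) auto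
    finally show ?thesis unfolding ex1 U_def .
  qed
  have t4: "X powr ((p - 1) / p) * S2 powr ((1 - \<epsilon>) / q) * Z powr (\<epsilon> / p) \<le> CS q powr ((1 - \<epsilon>) / q) * (\<gamma> powr p * U)"
  proof -
    \<comment> \<open>The gradient contributes (p - 1)/p and the Sobolev norm (1 - \<epsilon>)/p,
      together 1 - \<epsilon>/p, the same power of Y as in the other terms.\<close>
    have e: "Y powr ((p - 1) / p) * Y powr ((1 - \<epsilon>) / p) = Y powr (1 - \<epsilon> / p)"
      unfolding powr_add[symmetric] ex1(2)[symmetric] by (simp add: add_divide_distrib[symmetric])
    have "X powr ((p - 1) / p) * S2 powr ((1 - \<epsilon>) / q) * Z powr (\<epsilon> / p)
      = CS q powr ((1 - \<epsilon>) / q) * (\<gamma> powr (1 - \<epsilon>) * ((X powr ((p - 1) / p) * Y powr ((1 - \<epsilon>) / p)) * Z powr (\<epsilon> / p)))"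
      unfolding S Spow[OF Q0(2)] by (simp only: mult_ac)
    also have "\<dots> \<le> CS q powr ((1 - \<epsilon>) / q) * (\<gamma> powr p * ((Y powr ((p - 1) / p) * Y powr ((1 - \<epsilon>) / p)) * \<zeta> powr (\<epsilon> / p)))"
      using Hz Xy p \<epsilon> by (intro mult_left_mono mult_mono gle) auto
    finally show ?thesis unfolding e U_def .
  qed
  have "inverse a * X \<le> p * a * (\<gamma> powr p * U)
      + p * (Pb powr ((p - 1) / D1) * (CS Q1 powr ((p - 1) / Q1) * (\<gamma> powr p * U)))
      + Pc powr ((1 - \<epsilon>) / D) * (CS q powr ((1 - \<epsilon>) / q) * (\<gamma> powr p * U))
      + Pd2 powr ((p - \<epsilon>) / D) * (CS q powr ((p - \<epsilon>) / q) * (\<gamma> powr p * U))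
      + Pd1 powr ((p - \<epsilon>) / D1) * (CS Q1 powr ((p - \<epsilon>) / Q1) * (\<gamma> powr p * U))"
    using main unfolding mult.assoc
  proof (rule order_trans, intro add_mono)
    show "p * (a * (X powr ((p - 1) / p) * H powr (1 / p))) \<le> p * (a * (\<gamma> powr p * U))"
      using p a t2 by (intro mult_left_mono) auto
    show "p * (Pb powr ((p - 1) / D1) * (S1 powr ((p - 1) / Q1) * H powr (1 / p))) \<le> p * (Pb powr ((p - 1) / D1) * (CS Q1 powr ((p - 1) / Q1) * (\<gamma> powr p * U)))"
      using p t3 by (intro mult_left_mono) auto
    show "Pc powr ((1 - \<epsilon>) / D) * (X powr ((p - 1) / p) * (S2 powr ((1 - \<epsilon>) / q) * Z powr (\<epsilon> / p))) \<le> Pc powr ((1 - \<epsilon>) / D) * (CS q powr ((1 - \<epsilon>) / q) * (\<gamma> powr p * U))"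
      using t4 unfolding mult.assoc by (intro mult_left_mono) auto
    show "Pd2 powr ((p - \<epsilon>) / D) * (S2 powr ((p - \<epsilon>) / q) * Z powr (\<epsilon> / p)) \<le> Pd2 powr ((p - \<epsilon>) / D) * (CS q powr ((p - \<epsilon>) / q) * (\<gamma> powr p * U))"
      using t15[OF Q0(2)] unfolding S by (intro mult_left_mono) auto
    show "Pd1 powr ((p - \<epsilon>) / D1) * (S1 powr ((p - \<epsilon>) / Q1) * Z powr (\<epsilon> / p)) \<le> Pd1 powr ((p - \<epsilon>) / D1) * (CS Q1 powr ((p - \<epsilon>) / Q1) * (\<gamma> powr p * U))"
      using t15[OF Q0(1)] unfolding S by (intro mult_left_mono) auto
  qed
  also have "\<dots> = KK a Pb Pc Pd1 Pd2 * (\<gamma> powr p * U)"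
    unfolding KK_def by (simp only: distrib_right mult.assoc)
  finally have "a * (inverse a * X) \<le> a * (KK a Pb Pc Pd1 Pd2 * (\<gamma> powr p * U))" using a by (intro mult_left_mono) auto
  then have X': "X \<le> a * KK a Pb Pc Pd1 Pd2 * (\<gamma> powr p * U)" using a by (simp add: mult.assoc[symmetric])
  have KK0: "0 \<le> KK a Pb Pc Pd1 Pd2" using p a by (simp add: KK_def)
  have "\<zeta> = \<zeta> powr (1 - \<epsilon> / p) * \<zeta> powr (\<epsilon> / p)" unfolding powr_add[symmetric] using \<zeta> by simp
  also have "\<dots> \<le> U" unfolding U_def using Y0 \<zeta> p \<epsilon> by (intro mult_right_mono powr_mono2) auto
  also have "\<dots> \<le> \<gamma> powr p * U" using g1 U0 by (simp add: mult_le_cancel_right1)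
  finally have "Y \<le> (a * KK a Pb Pc Pd1 Pd2 + 1) * (\<gamma> powr p * U)" using X' Y by (simp add: algebra_simps)
  also have "U = Y * (\<zeta> / Y) powr (\<epsilon> / p)"
    unfolding U_def using Y0 \<zeta> by (simp add: powr_diff powr_divide)
  finally have "Y * 1 \<le> Y * ((a * KK a Pb Pc Pd1 Pd2 + 1) * \<gamma> powr p * (\<zeta> / Y) powr (\<epsilon> / p))" by (simp add: mult_ac)
  then have "1 \<le> (a * KK a Pb Pc Pd1 Pd2 + 1) * \<gamma> powr p * (\<zeta> / Y) powr (\<epsilon> / p)" using Y0 by simp
  then have "(Y / \<zeta>) powr (\<epsilon> / p) \<le> (a * KK a Pb Pc Pd1 Pd2 + 1) * \<gamma> powr p"
    using Y0 \<zeta> by (simp add: powr_divide field_simps)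
  then have "((Y / \<zeta>) powr (\<epsilon> / p)) powr (p / \<epsilon>) \<le> ((a * KK a Pb Pc Pd1 Pd2 + 1) * \<gamma> powr p) powr (p / \<epsilon>)"
    using p \<epsilon> by (intro powr_mono2) auto
  then have "Y / \<zeta> \<le> K2 a Pb Pc Pd1 Pd2 * \<gamma> powr (p * p / \<epsilon>)"
    using Y0 \<zeta> p \<epsilon> unfolding powr_mult powr_powr by (simp add: K2_def)
  then show ?thesis using \<zeta> by (simp add: field_simps)
qed

end

context weak_data
begin

text \<open>Testing with \<open>\<eta> powr p * G u\<close>, where \<open>G\<close> and \<open>V\<close> are the truncated powers.\<close>

lemma caccioppoli:
  fixes \<eta> :: "real ^ 'n \<Rightarrow> real" and D\<eta> :: "real ^ 'n \<Rightarrow> real ^ 'n" and \<gamma> l r :: real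
  defines "m \<equiv> \<lambda>y. min (\<bar>u y\<bar> + k) l"
  defines "W \<equiv> \<lambda>y. (\<bar>u y\<bar> + k) * m y powr (\<gamma> - 1)"
  defines "f \<equiv> \<lambda>y. \<eta> y * W y"
  defines "h \<equiv> \<lambda>y. norm (D\<eta> y) * W y"
  defines "g \<equiv> \<lambda>y. \<eta> y * m y powr (\<gamma> - 1) * norm (v y)"
  assumes \<gamma>: "1 \<le> \<gamma>" and l: "k \<le> l"
    and \<eta>: "C1_on UNIV \<eta> D\<eta>" "\<And>y. 0 \<le> \<eta> y" "\<And>y. y \<notin> cball x0 r \<Longrightarrow> \<eta> y = 0"
    and r: "0 < r" "r \<le> 5 / 4"
    and nn: "0 \<le> X" "0 \<le> H" "0 \<le> Z" "0 \<le> S1" "0 \<le> S2"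
    and X: "(\<integral>\<^sup>+y. ennreal (g y powr p * \<omega>1 y) \<partial>lebesgue) = ennreal X"
    and H: "(\<integral>\<^sup>+y. ennreal (h y powr p * \<omega>1 y) \<partial>lebesgue) \<le> ennreal H"
    and Z: "(\<integral>\<^sup>+y. ennreal (f y powr p * \<omega>1 y) \<partial>lebesgue) \<le> ennreal Z"
      "(\<integral>\<^sup>+y. ennreal (f y powr p * \<omega>2 y) \<partial>lebesgue) \<le> ennreal Z"
    and S: "(\<integral>\<^sup>+y. ennreal (f y powr Q1 * \<omega>1 y) \<partial>lebesgue) \<le> ennreal S1"
      "(\<integral>\<^sup>+y. ennreal (f y powr q * \<omega>2 y) \<partial>lebesgue) \<le> ennreal S2"
  shows "inverse a * X \<le> p * a * (X powr ((p - 1) / p) * H powr (1 / p))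
      + p * (Pb powr ((p - 1) / D1) * S1 powr ((p - 1) / Q1) * H powr (1 / p))
      + Pc powr ((1 - \<epsilon>) / D) * X powr ((p - 1) / p) * S2 powr ((1 - \<epsilon>) / q) * Z powr (\<epsilon> / p)
      + Pd2 powr ((p - \<epsilon>) / D) * S2 powr ((p - \<epsilon>) / q) * Z powr (\<epsilon> / p)
      + Pd1 powr ((p - \<epsilon>) / D1) * S1 powr ((p - \<epsilon>) / Q1) * Z powr (\<epsilon> / p)"
proof -
  have p0: "0 < p" using p by simp
  obtain G V where G: "\<And>t. DERIV G t :> min (\<bar>t\<bar> + k) l powr ((\<gamma> - 1) * p)"
    "\<And>t. \<bar>G t\<bar> \<le> (\<bar>t\<bar> + k) * min (\<bar>t\<bar> + k) l powr ((\<gamma> - 1) * p)"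
    by (rule truncated_powers[OF ak(2) l \<gamma> p0]) blast
  have l0: "0 < l" using ak l by simp
  have cG': "continuous_on UNIV (\<lambda>t. min (\<bar>t\<bar> + k) l powr ((\<gamma> - 1) * p))"
    by (intro continuous_on_powr continuous_intros) (use ak l0 in \<open>auto simp: min_def\<close>)
  have G'b: "\<bar>min (\<bar>t\<bar> + k) l powr ((\<gamma> - 1) * p)\<bar> \<le> l powr ((\<gamma> - 1) * p)" for t
    using ak \<gamma> p l0 by (auto intro!: powr_mono2)
  define \<eta>p where "\<eta>p = (\<lambda>y. \<eta> y powr p)"
  define Dp where "Dp = (\<lambda>y. (p * \<eta> y powr (p - 1)) *\<^sub>R D\<eta> y)"
  have cD: "continuous_on UNIV D\<eta>" using \<eta>(1) by (simp add: C1_on_def)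
  have c\<eta>: "continuous_on UNIV \<eta>" by (rule C1_on_continuous[OF \<eta>(1)])
  have C1p: "C1_on UNIV \<eta>p Dp"
    unfolding C1_on_def
  proof (intro conjI ballI)
    fix y :: "real ^ 'n"
    have "GDERIV (\<lambda>y. max 0 (\<eta> y) powr p) y :> (p * max 0 (\<eta> y) powr (p - 1)) *\<^sub>R D\<eta> y"
      by (rule GDERIV_DERIV_compose[OF GDERIV_D[OF \<eta>(1)] max0_powr_DERIV[OF p(1)]]) simp
    then show "GDERIV \<eta>p y :> Dp y" using \<eta>(2) by (simp add: \<eta>p_def Dp_def max_absorb2)
    show "continuous_on UNIV Dp"
      unfolding Dp_def using p \<eta>(2) by (intro continuous_intros continuous_on_powr' c\<eta> cD) auto
  qed
  have out: "\<eta>p y = 0" "Dp y = 0" if "y \<notin> cball x0 r" for y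
    using \<eta>(3)[OF that] p by (auto simp: \<eta>p_def Dp_def)
  let ?G' = "\<lambda>y. m y powr ((\<gamma> - 1) * p)"
  let ?\<psi> = "\<lambda>y. \<eta>p y * G (u y)" and ?\<Psi> = "\<lambda>y. G (u y) *\<^sub>R Dp y + (\<eta>p y * ?G' y) *\<^sub>R v y"
  have H0: "H0 r ?\<psi> ?\<Psi>"
    unfolding m_def by (rule chain_H0[OF C1p out(1) _ G(1) cG' G'b]) (use r in auto)
  note [measurable] = C1_measurable[OF \<eta>(1)]
  have [measurable]: "m \<in> borel_measurable lebesgue" unfolding m_def by measurable
  have [measurable]: "W \<in> borel_measurable lebesgue" unfolding W_def by measurable
  have [measurable]: "f \<in> borel_measurable lebesgue" unfolding f_def by measurable
  have [measurable]: "h \<in> borel_measurable lebesgue" unfolding h_def by measurable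
  have [measurable]: "g \<in> borel_measurable lebesgue" unfolding g_def by measurable
  have w: "integrable lebesgue (\<lambda>y. A y \<bullet> ?\<Psi> y + B y * ?\<psi> y)" "(\<integral>y. A y \<bullet> ?\<Psi> y + B y * ?\<psi> y \<partial>lebesgue) = 0"
    by (rule weak_H0[OF H0 r(1)], use r out in auto)+
  have W0: "0 \<le> W y" for y using ak by (simp add: W_def)
  have fgh: "0 \<le> f y" "0 \<le> g y" "0 \<le> h y" for y using W0 \<eta>(2) by (auto simp: f_def g_def h_def)
  define R where "R = (\<lambda>y. p * a * (g y powr (p - 1) * h y * \<omega>1 y) + p * (b y * f y powr (p - 1) * h y * \<omega>1 y)
     + c y * g y powr (p - 1) * f y * \<omega>2 y + d2 y * f y powr p * \<omega>2 y + d1 y * f y powr p * \<omega>1 y)"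
  \<comment> \<open>Coercivity bounds the part of \<open>A\<close> along \<open>v\<close> from
    below; the parts with \<open>D\<eta>\<close> and \<open>B\<close> go into \<open>R\<close>. With
    M the truncated power, G' = M^p and |G| \<le> s M^p, so all products regroup into powers of
    \<open>f\<close>, \<open>g\<close>, \<open>h\<close>.\<close>
  have pt: "inverse a * (g y powr p * \<omega>1 y) \<le> (A y \<bullet> ?\<Psi> y + B y * ?\<psi> y) + R y" for y
  proof -
    define s M e n where "s = \<bar>u y\<bar> + k" and "M = m y powr (\<gamma> - 1)" and "e = \<eta> y" and "n = norm (v y)"
    have s0: "0 < s" using ak by (simp add: s_def)
    have M0: "0 \<le> M" "0 \<le> e" "0 \<le> n" using \<eta>(2) by (auto simp: M_def e_def n_def)
    have Mp: "?G' y = M powr p" by (simp add: M_def powr_powr)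
    have j: "x powr (p - 1) * x = x powr p" if "0 \<le> x" for x :: real
      using powr_mult_base[OF that, of "p - 1"] by (simp add: mult.commute)
    have fe: "f y = e * s * M" "g y = e * M * n" "h y = norm (D\<eta> y) * s * M"
      by (auto simp: f_def g_def h_def W_def e_def s_def M_def n_def)
    have Gs: "\<bar>G (u y)\<bar> \<le> s * M powr p" using G(2)[of "u y"] Mp by (simp add: s_def m_def)
    have 1: "inverse a * (g y powr p * \<omega>1 y) - d1 y * f y powr p * \<omega>1 y \<le> e powr p * M powr p * (A y \<bullet> v y)"
    proof -
      have "e powr p * M powr p * (\<omega>1 y * (inverse a * n powr p - d1 y * s powr p)) \<le> e powr p * M powr p * (A y \<bullet> v y)"
        using A_ge[of y] by (intro mult_left_mono) (auto simp: n_def s_def)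
      moreover have "e powr p * M powr p * (\<omega>1 y * (inverse a * n powr p - d1 y * s powr p))
        = inverse a * (g y powr p * \<omega>1 y) - d1 y * f y powr p * \<omega>1 y"
        unfolding fe powr_mult by (simp add: algebra_simps)
      ultimately show ?thesis by simp
    qed
    have 2: "\<bar>G (u y) * (A y \<bullet> Dp y)\<bar> \<le> p * a * (g y powr (p - 1) * h y * \<omega>1 y) + p * (b y * f y powr (p - 1) * h y * \<omega>1 y)"
    proof -
      have "\<bar>A y \<bullet> Dp y\<bar> \<le> norm (A y) * norm (Dp y)" by (rule Cauchy_Schwarz_ineq2)
      also have "norm (Dp y) = p * e powr (p - 1) * norm (D\<eta> y)" using p by (simp add: Dp_def e_def abs_mult)
      also have "norm (A y) * (p * e powr (p - 1) * norm (D\<eta> y))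
        \<le> (\<omega>1 y * (a * n powr (p - 1) + b y * s powr (p - 1))) * (p * e powr (p - 1) * norm (D\<eta> y))"
        using A_le[of y] p by (intro mult_right_mono) (auto simp: n_def s_def)
      finally have "\<bar>G (u y)\<bar> * \<bar>A y \<bullet> Dp y\<bar> \<le> (s * M powr p) *
        ((\<omega>1 y * (a * n powr (p - 1) + b y * s powr (p - 1))) * (p * e powr (p - 1) * norm (D\<eta> y)))"
        using Gs s0 by (intro mult_mono) auto
      also have "\<dots> = p * a * (g y powr (p - 1) * h y * \<omega>1 y) + p * (b y * f y powr (p - 1) * h y * \<omega>1 y)"
        unfolding fe powr_mult j[OF M0(1), symmetric] by (simp add: algebra_simps)
      finally show ?thesis by (simp add: abs_mult)
    qed
    have 3: "\<bar>B y * ?\<psi> y\<bar> \<le> c y * g y powr (p - 1) * f y * \<omega>2 y + d2 y * f y powr p * \<omega>2 y"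
    proof -
      have "\<bar>B y\<bar> * \<bar>?\<psi> y\<bar> = \<bar>B y\<bar> * (e powr p * \<bar>G (u y)\<bar>)" by (simp add: \<eta>p_def e_def abs_mult)
      also have "\<dots> \<le> (\<omega>2 y * (c y * n powr (p - 1) + d2 y * s powr (p - 1))) * (e powr p * (s * M powr p))"
        using B_le[of y] Gs \<omega>0 co0 M0 by (intro mult_mono) (auto simp: n_def s_def)
      also have "\<dots> = c y * g y powr (p - 1) * f y * \<omega>2 y + d2 y * f y powr p * \<omega>2 y"
        unfolding fe powr_mult j[OF M0(1), symmetric] j[OF M0(2), symmetric] j[OF less_imp_le[OF s0], symmetric] by (simp add: algebra_simps)
      finally show ?thesis by (simp add: abs_mult)
    qed
    have "A y \<bullet> ?\<Psi> y = G (u y) * (A y \<bullet> Dp y) + e powr p * M powr p * (A y \<bullet> v y)"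
      unfolding Mp by (simp add: inner_add_right \<eta>p_def e_def)
    then show ?thesis using 1 2 3 unfolding R_def by linarith
  qed
  have R0: "0 \<le> R y" for y
    unfolding R_def using fgh[of y] \<omega>0 co0 p ak by (intro add_nonneg_nonneg mult_nonneg_nonneg) auto
  have q0: "0 < q" using p by simp
  have b1: "(\<integral>\<^sup>+y. ennreal (g y powr (p - 1) * h y * \<omega>1 y) \<partial>lebesgue) \<le> ennreal (X powr ((p - 1) / p) * H powr (1 / p))"
    by (rule hoelder_A) (use fgh nn X H in auto)
  have b2: "(\<integral>\<^sup>+y. ennreal (b y * f y powr (p - 1) * h y * \<omega>1 y) \<partial>lebesgue) \<le> ennreal (Pb powr ((p - 1) / D1) * S1 powr ((p - 1) / Q1) * H powr (1 / p))"
    by (rule hoelder_b) (use fgh nn H S co0 P0 Pb in auto)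
  have b3: "(\<integral>\<^sup>+y. ennreal (c y * g y powr (p - 1) * f y * \<omega>2 y) \<partial>lebesgue) \<le> ennreal (Pc powr ((1 - \<epsilon>) / D) * X powr ((p - 1) / p) * S2 powr ((1 - \<epsilon>) / q) * Z powr (\<epsilon> / p))"
    by (rule hoelder_c) (use fgh nn X S Z co0 P0 Pc in auto)
  have b4: "(\<integral>\<^sup>+y. ennreal (d2 y * f y powr p * \<omega>2 y) \<partial>lebesgue) \<le> ennreal (Pd2 powr ((p - \<epsilon>) / D) * S2 powr ((p - \<epsilon>) / q) * Z powr (\<epsilon> / p))"
    by (rule hoelder_d) (use fgh nn S Z co0 P0 Pd2 \<omega>0 Dq in auto)
  have b5: "(\<integral>\<^sup>+y. ennreal (d1 y * f y powr p * \<omega>1 y) \<partial>lebesgue) \<le> ennreal (Pd1 powr ((p - \<epsilon>) / D1) * S1 powr ((p - \<epsilon>) / Q1) * Z powr (\<epsilon> / p))"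
    by (rule hoelder_d) (use fgh nn S Z co0 P0 Pd1 \<omega>0 Q1 in auto)
  let ?r = "p * a * (X powr ((p - 1) / p) * H powr (1 / p))
      + p * (Pb powr ((p - 1) / D1) * S1 powr ((p - 1) / Q1) * H powr (1 / p))
      + Pc powr ((1 - \<epsilon>) / D) * X powr ((p - 1) / p) * S2 powr ((1 - \<epsilon>) / q) * Z powr (\<epsilon> / p)
      + Pd2 powr ((p - \<epsilon>) / D) * S2 powr ((p - \<epsilon>) / q) * Z powr (\<epsilon> / p)
      + Pd1 powr ((p - \<epsilon>) / D1) * S1 powr ((p - \<epsilon>) / Q1) * Z powr (\<epsilon> / p)"
  have r0: "0 \<le> ?r" using p ak by (intro add_nonneg_nonneg mult_nonneg_nonneg) auto
  have Rle: "(\<integral>\<^sup>+y. ennreal (R y) \<partial>lebesgue) \<le> ennreal ?r"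
  proof -
    have "(\<integral>\<^sup>+y. ennreal (R y) \<partial>lebesgue) = (\<integral>\<^sup>+y. ennreal (p * a) * ennreal (g y powr (p - 1) * h y * \<omega>1 y)
       + ennreal p * ennreal (b y * f y powr (p - 1) * h y * \<omega>1 y)
       + ennreal (c y * g y powr (p - 1) * f y * \<omega>2 y) + ennreal (d2 y * f y powr p * \<omega>2 y) + ennreal (d1 y * f y powr p * \<omega>1 y) \<partial>lebesgue)"
    proof (rule nn_integral_cong)
      fix y
      show "ennreal (R y) = ennreal (p * a) * ennreal (g y powr (p - 1) * h y * \<omega>1 y)
       + ennreal p * ennreal (b y * f y powr (p - 1) * h y * \<omega>1 y)
       + ennreal (c y * g y powr (p - 1) * f y * \<omega>2 y) + ennreal (d2 y * f y powr p * \<omega>2 y) + ennreal (d1 y * f y powr p * \<omega>1 y)"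
        unfolding R_def using fgh[of y] \<omega>0 co0 p ak
        by (simp add: ennreal_mult'[symmetric] ennreal_plus[symmetric] del: ennreal_plus)
    qed
    also have "\<dots> = ennreal (p * a) * (\<integral>\<^sup>+y. ennreal (g y powr (p - 1) * h y * \<omega>1 y) \<partial>lebesgue)
       + ennreal p * (\<integral>\<^sup>+y. ennreal (b y * f y powr (p - 1) * h y * \<omega>1 y) \<partial>lebesgue)
       + (\<integral>\<^sup>+y. ennreal (c y * g y powr (p - 1) * f y * \<omega>2 y) \<partial>lebesgue)
       + (\<integral>\<^sup>+y. ennreal (d2 y * f y powr p * \<omega>2 y) \<partial>lebesgue) + (\<integral>\<^sup>+y. ennreal (d1 y * f y powr p * \<omega>1 y) \<partial>lebesgue)"
      by (simp add: nn_integral_add nn_integral_cmult)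
    also have "\<dots> \<le> ennreal (p * a) * ennreal (X powr ((p - 1) / p) * H powr (1 / p))
      + ennreal p * ennreal (Pb powr ((p - 1) / D1) * S1 powr ((p - 1) / Q1) * H powr (1 / p))
      + ennreal (Pc powr ((1 - \<epsilon>) / D) * X powr ((p - 1) / p) * S2 powr ((1 - \<epsilon>) / q) * Z powr (\<epsilon> / p))
      + ennreal (Pd2 powr ((p - \<epsilon>) / D) * S2 powr ((p - \<epsilon>) / q) * Z powr (\<epsilon> / p))
      + ennreal (Pd1 powr ((p - \<epsilon>) / D1) * S1 powr ((p - \<epsilon>) / Q1) * Z powr (\<epsilon> / p))"
      by (intro add_mono mult_left_mono b1 b2 b3 b4 b5) auto
    also have "\<dots> = ennreal ?r"
      using p ak by (simp add: ennreal_mult'[symmetric] ennreal_plus[symmetric] del: ennreal_plus)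
    finally show ?thesis .
  qed
  have "(\<integral>\<^sup>+y. ennreal (inverse a * (g y powr p * \<omega>1 y)) \<partial>lebesgue) \<le> ennreal ?r"
  proof (rule nn_integral_le_of_weak[OF w _ _ R0 _ r0 Rle pt])
    show "R \<in> borel_measurable lebesgue" unfolding R_def by measurable
  qed (use \<omega>0 ak in auto)
  moreover have "(\<integral>\<^sup>+y. ennreal (inverse a * (g y powr p * \<omega>1 y)) \<partial>lebesgue) = ennreal (inverse a * X)"
  proof -
    have "(\<integral>\<^sup>+y. ennreal (inverse a * (g y powr p * \<omega>1 y)) \<partial>lebesgue) = (\<integral>\<^sup>+y. ennreal (inverse a) * ennreal (g y powr p * \<omega>1 y) \<partial>lebesgue)"
      using ak \<omega>0 by (intro nn_integral_cong) (simp add: ennreal_mult)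
    also have "\<dots> = ennreal (inverse a) * ennreal X" by (subst nn_integral_cmult) (simp_all add: X)
    finally show ?thesis using ak nn by (simp add: ennreal_mult)
  qed
  ultimately have "ennreal (inverse a * X) \<le> ennreal ?r" by simp
  then show ?thesis using r0 by (subst (asm) ennreal_le_iff) auto
qed

end

section \<open>Moser iteration\<close>

text \<open>The Sobolev inequality is applied to \<open>\<eta> * V u\<close>, whose energy is at
  most 2^(p + 1) (X + \<zeta>). Returning from V to W costs a factor \<gamma> and the constant
  k^\<gamma>, which the bound of k by \<zeta> / mu1 turns into a power of X + \<zeta>.\<close>

lemma (in approximated) truncated_sobolev:
  fixes \<eta> :: "real ^ 'n \<Rightarrow> real" and D\<eta> :: "real ^ 'n \<Rightarrow> real ^ 'n" and \<gamma> l r k X I \<Lambda> :: real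
  defines "m \<equiv> \<lambda>y. min (\<bar>u y\<bar> + k) l"
  defines "W \<equiv> \<lambda>y. (\<bar>u y\<bar> + k) * m y powr (\<gamma> - 1)"
  defines "f \<equiv> \<lambda>y. \<eta> y * W y"
  defines "h \<equiv> \<lambda>y. norm (D\<eta> y) * W y"
  defines "g \<equiv> \<lambda>y. \<eta> y * m y powr (\<gamma> - 1) * norm (v y)"
  assumes k: "0 < k" and \<gamma>: "1 \<le> \<gamma>" and l: "k \<le> l"
    and \<eta>: "C1_on UNIV \<eta> D\<eta>" "\<And>y. 0 \<le> \<eta> y" "\<And>y. \<eta> y \<le> 1" "\<And>y. y \<notin> cball x0 r \<Longrightarrow> \<eta> y = 0"
    and r: "r \<le> 3 / 2"
    and nn: "0 \<le> X" "0 < \<zeta>" "k powr (\<gamma> * p) \<le> \<zeta> / mu1"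
    and X: "(\<integral>\<^sup>+y. ennreal (g y powr p * \<omega>1 y) \<partial>lebesgue) \<le> ennreal X"
    and H: "(\<integral>\<^sup>+y. ennreal (h y powr p * \<omega>1 y) \<partial>lebesgue) \<le> ennreal \<zeta>"
    and Z: "(\<integral>\<^sup>+y. ennreal (f y powr p * \<omega>1 y) \<partial>lebesgue) \<le> ennreal \<zeta>"
  shows "(\<integral>\<^sup>+y. ennreal (f y powr Q1 * \<omega>1 y) \<partial>lebesgue) \<le> ennreal (CS Q1 * \<gamma> powr Q1 * (X + \<zeta>) powr (Q1 / p))"
    "(\<integral>\<^sup>+y. ennreal (f y powr q * \<omega>2 y) \<partial>lebesgue) \<le> ennreal (CS q * \<gamma> powr q * (X + \<zeta>) powr (q / p))"
proof -
  have p0: "0 < p" using p by simp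
  obtain G V where V: "\<And>t. DERIV V t :> min (\<bar>t\<bar> + k) l powr (\<gamma> - 1)"
    "\<And>t. \<bar>V t\<bar> \<le> (\<bar>t\<bar> + k) * min (\<bar>t\<bar> + k) l powr (\<gamma> - 1)"
    "\<And>t. (\<bar>t\<bar> + k) * min (\<bar>t\<bar> + k) l powr (\<gamma> - 1) \<le> \<gamma> * \<bar>V t\<bar> + k powr \<gamma>"
    by (rule truncated_powers[OF k l \<gamma> p0]) blast
  have l0: "0 < l" using k l by simp
  have cV': "continuous_on UNIV (\<lambda>t. min (\<bar>t\<bar> + k) l powr (\<gamma> - 1))"
    by (intro continuous_on_powr continuous_intros) (use k l0 in \<open>auto simp: min_def\<close>)
  have V'b: "\<bar>min (\<bar>t\<bar> + k) l powr (\<gamma> - 1)\<bar> \<le> l powr (\<gamma> - 1)" for t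
    using k \<gamma> l0 by (auto intro!: powr_mono2)
  let ?\<psi> = "\<lambda>y. \<eta> y * V (u y)" and ?\<Psi> = "\<lambda>y. V (u y) *\<^sub>R D\<eta> y + (\<eta> y * m y powr (\<gamma> - 1)) *\<^sub>R v y"
  have H0: "H0 r ?\<psi> ?\<Psi>"
    unfolding m_def by (rule chain_H0[OF \<eta>(1) \<eta>(4) r V(1) cV' V'b])
  note [measurable] = C1_measurable[OF \<eta>(1)]
  have [measurable]: "m \<in> borel_measurable lebesgue" unfolding m_def by measurable
  have [measurable]: "W \<in> borel_measurable lebesgue" unfolding W_def by measurable
  have [measurable]: "f \<in> borel_measurable lebesgue" unfolding f_def by measurable
  have [measurable]: "h \<in> borel_measurable lebesgue" unfolding h_def by measurable
  have [measurable]: "g \<in> borel_measurable lebesgue" unfolding g_def by measurable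
  have [measurable]: "?\<psi> \<in> borel_measurable lebesgue" by (rule H0_measurable[OF H0])
  have W0: "0 \<le> W y" for y using k by (simp add: W_def)
  have fgh: "0 \<le> f y" "0 \<le> g y" "0 \<le> h y" for y using W0 \<eta>(2) by (auto simp: f_def g_def h_def)
  have VW: "\<bar>V (u y)\<bar> \<le> W y" "W y \<le> \<gamma> * \<bar>V (u y)\<bar> + k powr \<gamma>" for y
    using V(2,3) by (auto simp: W_def m_def)
  define Y where "Y = X + \<zeta>"
  have Y: "0 < Y" "\<zeta> \<le> Y" using nn by (auto simp: Y_def)
  have En: "En ?\<psi> ?\<Psi> \<le> ennreal (2 powr (p + 1) * Y)"
  proof -
    have pt: "(norm (?\<Psi> y) powr p + \<bar>?\<psi> y\<bar> powr p) * \<omega>1 y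
      \<le> 2 powr p * (h y powr p * \<omega>1 y + g y powr p * \<omega>1 y) + f y powr p * \<omega>1 y" for y
    proof -
      have "norm (?\<Psi> y) \<le> norm (V (u y) *\<^sub>R D\<eta> y) + norm ((\<eta> y * m y powr (\<gamma> - 1)) *\<^sub>R v y)" by (rule norm_triangle_ineq)
      also have "norm (V (u y) *\<^sub>R D\<eta> y) \<le> h y" using mult_left_mono[OF VW(1)[of y] norm_ge_zero[of "D\<eta> y"]] by (simp add: h_def mult.commute)
      also have "norm ((\<eta> y * m y powr (\<gamma> - 1)) *\<^sub>R v y) = g y" using \<eta>(2) by (simp add: g_def abs_mult)
      finally have "norm (?\<Psi> y) \<le> h y + g y" by simp
      then have "norm (?\<Psi> y) powr p \<le> (h y + g y) powr p" using p0 by (intro powr_mono2) auto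
      also have "\<dots> \<le> 2 powr p * (h y powr p + g y powr p)" using fgh p0 by (intro powr_sum2) auto
      finally have 1: "norm (?\<Psi> y) powr p \<le> 2 powr p * (h y powr p + g y powr p)" .
      have "\<bar>?\<psi> y\<bar> \<le> f y" using VW(1)[of y] \<eta>(2)[of y] by (simp add: f_def abs_mult mult_left_mono)
      then have 2: "\<bar>?\<psi> y\<bar> powr p \<le> f y powr p" using p0 by (intro powr_mono2) auto
      have "(norm (?\<Psi> y) powr p + \<bar>?\<psi> y\<bar> powr p) * \<omega>1 y \<le> (2 powr p * (h y powr p + g y powr p) + f y powr p) * \<omega>1 y"
        by (intro mult_right_mono add_mono 1 2 \<omega>0)
      then show ?thesis by (simp only: distrib_right distrib_left mult.assoc)
    qed
    have "En ?\<psi> ?\<Psi> \<le> (\<integral>\<^sup>+y. ennreal (2 powr p) * (ennreal (h y powr p * \<omega>1 y) + ennreal (g y powr p * \<omega>1 y)) + ennreal (f y powr p * \<omega>1 y) \<partial>lebesgue)"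
      unfolding En_def
    proof (intro nn_integral_mono)
      fix y
      show "ennreal ((norm (?\<Psi> y) powr p + \<bar>?\<psi> y\<bar> powr p) * \<omega>1 y) \<le> ennreal (2 powr p) * (ennreal (h y powr p * \<omega>1 y) + ennreal (g y powr p * \<omega>1 y)) + ennreal (f y powr p * \<omega>1 y)"
        using ennreal_leI[OF pt[of y]] \<omega>0(1)[of y] by (simp add: ennreal_mult ennreal_plus)
    qed
    also have "\<dots> = ennreal (2 powr p) * ((\<integral>\<^sup>+y. ennreal (h y powr p * \<omega>1 y) \<partial>lebesgue) + (\<integral>\<^sup>+y. ennreal (g y powr p * \<omega>1 y) \<partial>lebesgue)) + (\<integral>\<^sup>+y. ennreal (f y powr p * \<omega>1 y) \<partial>lebesgue)"
      by (simp add: nn_integral_add nn_integral_cmult)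
    also have "\<dots> \<le> ennreal (2 powr p) * (ennreal \<zeta> + ennreal X) + ennreal \<zeta>"
      by (intro add_mono mult_left_mono X H Z) auto
    also have "\<dots> = ennreal (2 powr p * (\<zeta> + X) + \<zeta>)"
      using nn by (simp add: ennreal_mult[symmetric] ennreal_plus[symmetric] del: ennreal_plus)
    also have "\<dots> \<le> ennreal (2 powr (p + 1) * Y)"
    proof (rule ennreal_leI)
      have "(1::real) \<le> 2 powr p" using p0 by (simp add: ge_one_powr_ge_zero)
      then have "1 * Y \<le> 2 powr p * Y" using Y by (intro mult_right_mono) auto
      then have "\<zeta> \<le> 2 powr p * Y" using Y by linarith
      then show "2 powr p * (\<zeta> + X) + \<zeta> \<le> 2 powr (p + 1) * Y" by (simp add: Y_def powr_add algebra_simps)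
    qed
    finally show ?thesis .
  qed
  have N0: "0 < 2 powr (p + 1) * Y" using Y by simp
  have key: "(\<integral>\<^sup>+y. ennreal (f y powr Q * \<omega> y) \<partial>lebesgue) \<le> ennreal (CS Q * \<gamma> powr Q * Y powr (Q / p))"
    if [measurable]: "\<omega> \<in> borel_measurable lebesgue" and \<omega>: "\<And>x. 0 \<le> \<omega> x" "(\<integral>\<^sup>+y. ennreal (\<omega> y) \<partial>lebesgue) \<le> ennreal mass"
      and S': "(\<integral>\<^sup>+y. ennreal (\<bar>?\<psi> y\<bar> powr Q * \<omega> y) \<partial>lebesgue) \<le> ennreal (Csob * (2 powr (p + 1) * Y) powr (Q / p))" and Q: "0 < Q" for \<omega> Q
  proof -
    let ?kq = "(1 / mu1) powr (Q / p) * Y powr (Q / p)"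
    have kq: "(k powr \<gamma>) powr Q \<le> ?kq"
    proof -
      have "(k powr \<gamma>) powr Q = (k powr (\<gamma> * p)) powr (Q / p)" using p0 by (simp add: powr_powr)
      also have "\<dots> \<le> ((1 / mu1) * Y) powr (Q / p)"
      proof (intro powr_mono2)
        have "k powr (\<gamma> * p) \<le> \<zeta> / mu1" by (rule nn)
        also have "\<dots> \<le> (1 / mu1) * Y" using Y mu1 by (simp add: divide_right_mono)
        finally show "k powr (\<gamma> * p) \<le> (1 / mu1) * Y" .
      qed (use Q p0 in auto)
      finally show ?thesis by (simp only: powr_mult)
    qed
    have "(\<integral>\<^sup>+y. ennreal (f y powr Q * \<omega> y) \<partial>lebesgue)
      \<le> (\<integral>\<^sup>+y. ennreal (2 powr Q * \<gamma> powr Q) * (ennreal (\<bar>?\<psi> y\<bar> powr Q * \<omega> y) + ennreal ?kq * ennreal (\<omega> y)) \<partial>lebesgue)"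
    proof (intro nn_integral_mono)
      fix y
      have "f y \<le> \<eta> y * (\<gamma> * \<bar>V (u y)\<bar> + k powr \<gamma>)" unfolding f_def using VW(2) \<eta>(2) by (intro mult_left_mono) auto
      also have "\<dots> = \<gamma> * \<bar>?\<psi> y\<bar> + \<eta> y * k powr \<gamma>" using \<eta>(2)[of y] by (simp add: abs_mult algebra_simps)
      also have "\<dots> \<le> \<gamma> * \<bar>?\<psi> y\<bar> + k powr \<gamma>" using \<eta>(3)[of y] \<eta>(2)[of y] by (simp add: mult_left_le_one_le)
      finally have "f y powr Q \<le> (\<gamma> * \<bar>?\<psi> y\<bar> + k powr \<gamma>) powr Q" using fgh Q by (intro powr_mono2) auto
      also have "\<dots> \<le> 2 powr Q * ((\<gamma> * \<bar>?\<psi> y\<bar>) powr Q + (k powr \<gamma>) powr Q)" using \<gamma> Q by (intro powr_sum2) auto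
      also have "\<dots> \<le> 2 powr Q * (\<gamma> powr Q * \<bar>?\<psi> y\<bar> powr Q + \<gamma> powr Q * ?kq)"
      proof (intro mult_left_mono add_mono)
        have "1 \<le> \<gamma> powr Q" using \<gamma> Q by (simp add: ge_one_powr_ge_zero)
        then have "1 * ?kq \<le> \<gamma> powr Q * ?kq" by (intro mult_right_mono) auto
        then show "(k powr \<gamma>) powr Q \<le> \<gamma> powr Q * ?kq" using kq by simp
      qed (simp_all add: powr_mult)
      finally have "f y powr Q \<le> (2 powr Q * \<gamma> powr Q) * (\<bar>?\<psi> y\<bar> powr Q + ?kq)" by (simp only: distrib_left mult.assoc)
      from mult_right_mono[OF this \<omega>(1)[of y]]
      have "ennreal (f y powr Q * \<omega> y) \<le> ennreal ((2 powr Q * \<gamma> powr Q) * (\<bar>?\<psi> y\<bar> powr Q * \<omega> y + ?kq * \<omega> y))"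
        by (intro ennreal_leI) (simp only: distrib_left distrib_right mult.assoc)
      also have "\<dots> = ennreal (2 powr Q * \<gamma> powr Q) * (ennreal (\<bar>?\<psi> y\<bar> powr Q * \<omega> y) + ennreal ?kq * ennreal (\<omega> y))"
        using \<omega>(1)[of y] by (simp add: ennreal_mult'[symmetric] ennreal_plus[symmetric] del: ennreal_plus)
      finally show "ennreal (f y powr Q * \<omega> y) \<le> ennreal (2 powr Q * \<gamma> powr Q) * (ennreal (\<bar>?\<psi> y\<bar> powr Q * \<omega> y) + ennreal ?kq * ennreal (\<omega> y))" .
    qed
    also have "\<dots> = ennreal (2 powr Q * \<gamma> powr Q) * ((\<integral>\<^sup>+y. ennreal (\<bar>?\<psi> y\<bar> powr Q * \<omega> y) \<partial>lebesgue) + ennreal ?kq * (\<integral>\<^sup>+y. ennreal (\<omega> y) \<partial>lebesgue))"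
      by (simp add: nn_integral_cmult nn_integral_add)
    also have "\<dots> \<le> ennreal (2 powr Q * \<gamma> powr Q) * (ennreal (Csob * (2 powr (p + 1) * Y) powr (Q / p)) + ennreal ?kq * ennreal mass)"
      by (intro mult_left_mono add_mono S' \<omega>) auto
    also have "\<dots> = ennreal ((2 powr Q * \<gamma> powr Q) * (Csob * (2 powr (p + 1) * Y) powr (Q / p) + ?kq * mass))"
      using mass Csob by (simp add: ennreal_mult'[symmetric] ennreal_plus[symmetric] del: ennreal_plus)
    also have "(2 powr Q * \<gamma> powr Q) * (Csob * (2 powr (p + 1) * Y) powr (Q / p) + ?kq * mass) = CS Q * \<gamma> powr Q * Y powr (Q / p)"
      unfolding CS_def powr_mult[of "2 powr (p + 1)" Y] by (simp only: distrib_left distrib_right mult_ac)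
    finally show ?thesis .
  qed
  show "(\<integral>\<^sup>+y. ennreal (f y powr Q1 * \<omega>1 y) \<partial>lebesgue) \<le> ennreal (CS Q1 * \<gamma> powr Q1 * (X + \<zeta>) powr (Q1 / p))"
    unfolding Y_def[symmetric] by (rule key) (use H0_sobolev(1)[OF H0 r N0 En] \<omega>0 mass Q1 in auto)
  show "(\<integral>\<^sup>+y. ennreal (f y powr q * \<omega>2 y) \<partial>lebesgue) \<le> ennreal (CS q * \<gamma> powr q * (X + \<zeta>) powr (q / p))"
    unfolding Y_def[symmetric] by (rule key) (use H0_sobolev(2)[OF H0 r N0 En] \<omega>0 mass Dq in auto)
qed

context weak_data
begin

text \<open>For each truncation level the energy X is finite and can be absorbed. The resulting
  bound \<open>T\<close> does not contain the level, so Fatou's lemma removes the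
  truncation.\<close>

lemma moser_step:
  assumes \<gamma>: "1 \<le> \<gamma>"
    and \<eta>: "C1_on UNIV \<eta> D\<eta>" "\<And>y. 0 \<le> \<eta> y" "\<And>y. \<eta> y \<le> 1" "\<And>y. y \<notin> cball x0 r \<Longrightarrow> \<eta> y = 0" "\<And>y. norm (D\<eta> y) \<le> \<Lambda>"
    and r: "1 \<le> r" "r \<le> 5 / 4" and \<Lambda>: "1 \<le> \<Lambda>" and I: "0 < I"
    and I1: "(\<integral>\<^sup>+y. ennreal (indicat_real (cball x0 r) y * (\<bar>u y\<bar> + k) powr (\<gamma> * p) * \<omega>1 y) \<partial>lebesgue) \<le> ennreal I"
    and I2: "(\<integral>\<^sup>+y. ennreal (indicat_real (cball x0 r) y * (\<bar>u y\<bar> + k) powr (\<gamma> * p) * \<omega>2 y) \<partial>lebesgue) \<le> ennreal I"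
  defines "T \<equiv> K2 a Pb Pc Pd1 Pd2 * \<gamma> powr (p * p / \<epsilon>) * (\<Lambda> powr p * I)"
  shows "(\<integral>\<^sup>+y. ennreal ((\<eta> y * (\<bar>u y\<bar> + k) powr \<gamma>) powr Q1 * \<omega>1 y) \<partial>lebesgue) \<le> ennreal (CS Q1 * \<gamma> powr Q1 * T powr (Q1 / p))"
    "(\<integral>\<^sup>+y. ennreal ((\<eta> y * (\<bar>u y\<bar> + k) powr \<gamma>) powr q * \<omega>2 y) \<partial>lebesgue) \<le> ennreal (CS q * \<gamma> powr q * T powr (q / p))"
proof -
  have p0: "0 < p" using p by simp
  have D0: "D\<eta> y = 0" if "y \<notin> cball x0 r" for y
    by (rule C1_on_outside_support[OF \<eta>(1) closed_cball \<eta>(4) that])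
  note [measurable] = C1_measurable[OF \<eta>(1)]
  define \<zeta> where "\<zeta> = \<Lambda> powr p * I"
  have L1: "1 \<le> \<Lambda> powr p" using \<Lambda> p0 by (simp add: ge_one_powr_ge_zero)
  have \<zeta>: "0 < \<zeta>" "I \<le> \<zeta>" using \<Lambda> L1 I mult_right_mono[of 1 "\<Lambda> powr p" I] by (auto simp: \<zeta>_def)
  have kI: "k powr (\<gamma> * p) \<le> \<zeta> / mu1"
  proof -
    have "ennreal (k powr (\<gamma> * p) * mu1) = ennreal (k powr (\<gamma> * p)) * (\<integral>\<^sup>+x. ennreal (indicat_real (ball x0 1) x * \<omega>1 x) \<partial>lebesgue)"
      using mu1 by (simp add: ennreal_mult')
    also have "\<dots> = (\<integral>\<^sup>+x. ennreal (k powr (\<gamma> * p)) * ennreal (indicat_real (ball x0 1) x * \<omega>1 x) \<partial>lebesgue)"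
      by (rule nn_integral_cmult[symmetric]) measurable
    also have "\<dots> \<le> (\<integral>\<^sup>+y. ennreal (indicat_real (cball x0 r) y * (\<bar>u y\<bar> + k) powr (\<gamma> * p) * \<omega>1 y) \<partial>lebesgue)"
    proof (intro nn_integral_mono)
      fix y
      have "k powr (\<gamma> * p) \<le> (\<bar>u y\<bar> + k) powr (\<gamma> * p)" using ak \<gamma> p0 by (intro powr_mono2) auto
      then have "k powr (\<gamma> * p) * (indicat_real (ball x0 1) y * \<omega>1 y) \<le> indicat_real (cball x0 r) y * (\<bar>u y\<bar> + k) powr (\<gamma> * p) * \<omega>1 y"
        using \<omega>0(1)[of y] r by (auto simp: indicator_def mult_right_mono)
      then show "ennreal (k powr (\<gamma> * p)) * ennreal (indicat_real (ball x0 1) y * \<omega>1 y) \<le> ennreal (indicat_real (cball x0 r) y * (\<bar>u y\<bar> + k) powr (\<gamma> * p) * \<omega>1 y)"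
        using \<omega>0 by (simp add: ennreal_mult'[symmetric] ennreal_leI)
    qed
    also have "\<dots> \<le> ennreal \<zeta>" using I1 by (rule order_trans) (rule ennreal_leI[OF \<zeta>(2)])
    finally have "k powr (\<gamma> * p) * mu1 \<le> \<zeta>" using \<zeta> by (subst (asm) ennreal_le_iff) auto
    then show ?thesis using mu1 by (simp add: field_simps)
  qed
  define m where "m = (\<lambda>l y. min (\<bar>u y\<bar> + k) l)"
  define W where "W = (\<lambda>l y. (\<bar>u y\<bar> + k) * m l y powr (\<gamma> - 1))"
  have mW[measurable]: "W l \<in> borel_measurable lebesgue" "m l \<in> borel_measurable lebesgue" for l
    unfolding W_def m_def by measurable
  have trunc: "(\<integral>\<^sup>+y. ennreal ((\<eta> y * W l y) powr Q1 * \<omega>1 y) \<partial>lebesgue) \<le> ennreal (CS Q1 * \<gamma> powr Q1 * T powr (Q1 / p)) \<and>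
     (\<integral>\<^sup>+y. ennreal ((\<eta> y * W l y) powr q * \<omega>2 y) \<partial>lebesgue) \<le> ennreal (CS q * \<gamma> powr q * T powr (q / p))" if l: "k \<le> l" for l
  proof -
    have l0: "0 < l" using ak l by simp
    let ?f = "\<lambda>y. \<eta> y * W l y" and ?h = "\<lambda>y. norm (D\<eta> y) * W l y" and ?g = "\<lambda>y. \<eta> y * m l y powr (\<gamma> - 1) * norm (v y)"
    let ?s = "\<lambda>y. indicat_real (cball x0 r) y * (\<bar>u y\<bar> + k) powr (\<gamma> * p)"
    have Ws: "0 \<le> W l y" "W l y powr p \<le> (\<bar>u y\<bar> + k) powr (\<gamma> * p)" for y
    proof -
      show 0: "0 \<le> W l y" using ak by (simp add: W_def)
      have "m l y powr (\<gamma> - 1) \<le> (\<bar>u y\<bar> + k) powr (\<gamma> - 1)"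
        using ak \<gamma> l0 by (intro powr_mono2) (auto simp: m_def)
      then have "W l y \<le> (\<bar>u y\<bar> + k) * (\<bar>u y\<bar> + k) powr (\<gamma> - 1)"
        unfolding W_def using ak by (intro mult_left_mono) auto
      also have "\<dots> = (\<bar>u y\<bar> + k) powr \<gamma>" using ak by (simp add: powr_mult_base)
      finally have "W l y powr p \<le> ((\<bar>u y\<bar> + k) powr \<gamma>) powr p" using 0 p0 by (intro powr_mono2) auto
      then show "W l y powr p \<le> (\<bar>u y\<bar> + k) powr (\<gamma> * p)" by (simp add: powr_powr)
    qed
    have fle: "?f y powr p \<le> ?s y" for y
    proof (cases "y \<in> cball x0 r")
      case True
      have "?f y powr p \<le> (1 * W l y) powr p" using \<eta>(2,3) Ws(1) p0 by (intro powr_mono2 mult_right_mono) auto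
      then show ?thesis using True Ws(2)[of y] by simp
    qed (simp add: \<eta>(4))
    have hle: "?h y powr p \<le> \<Lambda> powr p * ?s y" for y
    proof (cases "y \<in> cball x0 r")
      case True
      have "?h y powr p \<le> (\<Lambda> * W l y) powr p" using \<eta>(5) Ws(1) p0 by (intro powr_mono2 mult_right_mono) auto
      also have "\<dots> = \<Lambda> powr p * W l y powr p" by (rule powr_mult)
      also have "\<dots> \<le> \<Lambda> powr p * (\<bar>u y\<bar> + k) powr (\<gamma> * p)" by (intro mult_left_mono Ws) auto
      finally show ?thesis using True by simp
    qed (simp add: D0)
    have Z: "(\<integral>\<^sup>+y. ennreal (?f y powr p * \<omega> y) \<partial>lebesgue) \<le> ennreal I"
      if "\<And>y. 0 \<le> \<omega> y" "(\<integral>\<^sup>+y. ennreal (?s y * \<omega> y) \<partial>lebesgue) \<le> ennreal I" for \<omega>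
      using that(2) by (rule order_trans[rotated]) (intro nn_integral_mono ennreal_leI mult_right_mono fle that(1))
    have H: "(\<integral>\<^sup>+y. ennreal (?h y powr p * \<omega>1 y) \<partial>lebesgue) \<le> ennreal \<zeta>"
    proof -
      have "(\<integral>\<^sup>+y. ennreal (?h y powr p * \<omega>1 y) \<partial>lebesgue) \<le> (\<integral>\<^sup>+y. ennreal (\<Lambda> powr p) * ennreal (?s y * \<omega>1 y) \<partial>lebesgue)"
      proof (intro nn_integral_mono)
        fix y
        show "ennreal (?h y powr p * \<omega>1 y) \<le> ennreal (\<Lambda> powr p) * ennreal (?s y * \<omega>1 y)"
          using mult_right_mono[OF hle[of y] \<omega>0(1)[of y]] \<omega>0(1)[of y]
          by (simp add: ennreal_mult'[symmetric] ennreal_leI mult.assoc)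
      qed
      also have "\<dots> = ennreal (\<Lambda> powr p) * (\<integral>\<^sup>+y. ennreal (?s y * \<omega>1 y) \<partial>lebesgue)" by (rule nn_integral_cmult) measurable
      also have "\<dots> \<le> ennreal (\<Lambda> powr p) * ennreal I" by (intro mult_left_mono I1) auto
      also have "\<dots> = ennreal \<zeta>" by (simp add: \<zeta>_def ennreal_mult')
      finally show ?thesis .
    qed
    \<comment> \<open>This bound contains \<open>l\<close> and \<open>N0\<close>; it serves to make
      X a real number, and its size is then forgotten.\<close>
    have "(\<integral>\<^sup>+y. ennreal (?g y powr p * \<omega>1 y) \<partial>lebesgue) \<le> (\<integral>\<^sup>+y. ennreal (l powr ((\<gamma> - 1) * p)) * ennreal (norm (v y) powr p * \<omega>1 y) \<partial>lebesgue)"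
    proof (intro nn_integral_mono)
      fix y
      have "?g y \<le> 1 * l powr (\<gamma> - 1) * norm (v y)"
        using \<eta>(2,3) ak \<gamma> l0 by (intro mult_right_mono mult_mono powr_mono2) (auto simp: m_def)
      then have "?g y powr p \<le> (l powr (\<gamma> - 1) * norm (v y)) powr p" using \<eta>(2) p0 by (intro powr_mono2) auto
      also have "\<dots> = l powr ((\<gamma> - 1) * p) * norm (v y) powr p" by (simp add: powr_mult powr_powr)
      finally show "ennreal (?g y powr p * \<omega>1 y) \<le> ennreal (l powr ((\<gamma> - 1) * p)) * ennreal (norm (v y) powr p * \<omega>1 y)"
        using mult_right_mono[OF _ \<omega>0(1)[of y]] \<omega>0(1)[of y]
        by (simp add: ennreal_mult'[symmetric] ennreal_leI mult.assoc[symmetric])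
    qed
    also have "\<dots> = ennreal (l powr ((\<gamma> - 1) * p)) * (\<integral>\<^sup>+y. ennreal (norm (v y) powr p * \<omega>1 y) \<partial>lebesgue)" by (rule nn_integral_cmult) measurable
    also have "\<dots> \<le> ennreal (l powr ((\<gamma> - 1) * p)) * ennreal N0" by (intro mult_left_mono v_energy) auto
    also have "\<dots> < \<infinity>" by (simp add: ennreal_mult'[symmetric])
    finally have fin: "(\<integral>\<^sup>+y. ennreal (?g y powr p * \<omega>1 y) \<partial>lebesgue) < \<infinity>" .
    define X where "X = enn2real (\<integral>\<^sup>+y. ennreal (?g y powr p * \<omega>1 y) \<partial>lebesgue)"
    have X: "0 \<le> X" "(\<integral>\<^sup>+y. ennreal (?g y powr p * \<omega>1 y) \<partial>lebesgue) = ennreal X"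
      using fin by (auto simp: X_def)
    have Zz: "(\<integral>\<^sup>+y. ennreal (?f y powr p * \<omega>1 y) \<partial>lebesgue) \<le> ennreal \<zeta>"
      using Z[OF \<omega>0(1) I1] by (rule order_trans) (rule ennreal_leI[OF \<zeta>(2)])
    have r': "r \<le> 3 / 2" "0 < r" using r by auto
    note X' = eq_refl[OF X(2), unfolded W_def m_def]
    note H' = H[unfolded W_def m_def]
    note Z' = Zz[unfolded W_def m_def]
    have S: "(\<integral>\<^sup>+y. ennreal (?f y powr Q1 * \<omega>1 y) \<partial>lebesgue) \<le> ennreal (CS Q1 * \<gamma> powr Q1 * (X + \<zeta>) powr (Q1 / p))"
      "(\<integral>\<^sup>+y. ennreal (?f y powr q * \<omega>2 y) \<partial>lebesgue) \<le> ennreal (CS q * \<gamma> powr q * (X + \<zeta>) powr (q / p))"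
      unfolding W_def m_def
      by (rule truncated_sobolev[OF ak(2) \<gamma> l \<eta>(1,2,3) _ r'(1) X(1) \<zeta>(1) kI X' H' Z'], rule \<eta>(4), assumption)+
    have S0: "0 \<le> CS Q1 * \<gamma> powr Q1 * (X + \<zeta>) powr (Q1 / p)" "0 \<le> CS q * \<gamma> powr q * (X + \<zeta>) powr (q / p)"
      by (auto intro!: mult_nonneg_nonneg less_imp_le[OF CS])
    \<comment> \<open>The Sobolev bounds inserted on the right contain X + \<zeta> themselves; the
      absorption lemma resolves this circularity.\<close>
    have main: "X + \<zeta> \<le> K2 a Pb Pc Pd1 Pd2 * \<gamma> powr (p * p / \<epsilon>) * \<zeta>"
    proof (rule energy_absorb[OF ak(1) \<gamma> X(1) \<zeta>(1) less_imp_le[OF I] \<zeta>(2) less_imp_le[OF \<zeta>(1)] order_refl refl refl refl])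
      show "inverse a * X \<le> p * a * (X powr ((p - 1) / p) * \<zeta> powr (1 / p))
        + p * (Pb powr ((p - 1) / D1) * (CS Q1 * \<gamma> powr Q1 * (X + \<zeta>) powr (Q1 / p)) powr ((p - 1) / Q1) * \<zeta> powr (1 / p))
        + Pc powr ((1 - \<epsilon>) / D) * X powr ((p - 1) / p) * (CS q * \<gamma> powr q * (X + \<zeta>) powr (q / p)) powr ((1 - \<epsilon>) / q) * I powr (\<epsilon> / p)
        + Pd2 powr ((p - \<epsilon>) / D) * (CS q * \<gamma> powr q * (X + \<zeta>) powr (q / p)) powr ((p - \<epsilon>) / q) * I powr (\<epsilon> / p)
        + Pd1 powr ((p - \<epsilon>) / D1) * (CS Q1 * \<gamma> powr Q1 * (X + \<zeta>) powr (Q1 / p)) powr ((p - \<epsilon>) / Q1) * I powr (\<epsilon> / p)"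
        by (rule caccioppoli[OF \<gamma> l \<eta>(1,2) _ r'(2) r(2) X(1) less_imp_le[OF \<zeta>(1)] less_imp_le[OF I] S0
            X(2)[unfolded W_def m_def] H' Z[OF \<omega>0(1) I1, unfolded W_def m_def] Z[OF \<omega>0(2) I2, unfolded W_def m_def]
            S[unfolded W_def m_def]]) (rule \<eta>(4), assumption)
    qed
    have T: "X + \<zeta> \<le> T" using main by (simp add: T_def \<zeta>_def)
    have "CS Q * \<gamma> powr Q * (X + \<zeta>) powr (Q / p) \<le> CS Q * \<gamma> powr Q * T powr (Q / p)" if "0 < Q" for Q
      using that T X \<zeta> p0 less_imp_le[OF CS[of Q]] by (intro mult_left_mono powr_mono2) auto
    from this[OF Q1(4)] this[OF Dq(3)] S show ?thesis by (meson ennreal_leI order_trans)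
  qed
  have Fatou: "(\<integral>\<^sup>+y. ennreal ((\<eta> y * (\<bar>u y\<bar> + k) powr \<gamma>) powr Q * \<omega> y) \<partial>lebesgue) \<le> ennreal S"
    if [measurable]: "\<omega> \<in> borel_measurable lebesgue" and tr: "\<And>l. k \<le> l \<Longrightarrow> (\<integral>\<^sup>+y. ennreal ((\<eta> y * W l y) powr Q * \<omega> y) \<partial>lebesgue) \<le> ennreal S" for Q \<omega> S
  proof -
    let ?w = "\<lambda>n y. ennreal ((\<eta> y * W (k + real n) y) powr Q * \<omega> y)"
    have lim: "(\<lambda>n. ?w n y) \<longlonglongrightarrow> ennreal ((\<eta> y * (\<bar>u y\<bar> + k) powr \<gamma>) powr Q * \<omega> y)" for y
    \<comment> \<open>At a fixed point the truncation is inactive once n \<ge> |u y|, so the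
      sequence is eventually constant.\<close>
    proof (rule tendsto_eventually)
      obtain n0 where n0: "\<bar>u y\<bar> \<le> real n0" using real_arch_simple by blast
      have "W (k + real n) y = (\<bar>u y\<bar> + k) powr \<gamma>" if "n0 \<le> n" for n
      proof -
        have "m (k + real n) y = \<bar>u y\<bar> + k" using n0 that by (simp add: m_def)
        then show ?thesis using ak by (simp add: W_def powr_mult_base)
      qed
      then show "\<forall>\<^sub>F n in sequentially. ?w n y = ennreal ((\<eta> y * (\<bar>u y\<bar> + k) powr \<gamma>) powr Q * \<omega> y)"
        unfolding eventually_sequentially by (intro exI[of _ n0] allI impI) simp
    qed
    have "(\<integral>\<^sup>+y. ennreal ((\<eta> y * (\<bar>u y\<bar> + k) powr \<gamma>) powr Q * \<omega> y) \<partial>lebesgue) = (\<integral>\<^sup>+y. liminf (\<lambda>n. ?w n y) \<partial>lebesgue)"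
      by (intro nn_integral_cong lim_imp_Liminf[OF _ lim, symmetric]) simp
    also have "\<dots> \<le> liminf (\<lambda>n. \<integral>\<^sup>+y. ?w n y \<partial>lebesgue)" by (rule nn_integral_liminf) measurable
    also have "\<dots> \<le> limsup (\<lambda>n. \<integral>\<^sup>+y. ?w n y \<partial>lebesgue)" by (intro Liminf_le_Limsup) simp
    also have "\<dots> \<le> ennreal S" by (rule Limsup_bounded) (use tr in auto)
    finally show ?thesis .
  qed
  show "(\<integral>\<^sup>+y. ennreal ((\<eta> y * (\<bar>u y\<bar> + k) powr \<gamma>) powr Q1 * \<omega>1 y) \<partial>lebesgue) \<le> ennreal (CS Q1 * \<gamma> powr Q1 * T powr (Q1 / p))"
    by (rule Fatou) (use trunc in auto)
  show "(\<integral>\<^sup>+y. ennreal ((\<eta> y * (\<bar>u y\<bar> + k) powr \<gamma>) powr q * \<omega>2 y) \<partial>lebesgue) \<le> ennreal (CS q * \<gamma> powr q * T powr (q / p))"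
    by (rule Fatou) (use trunc in auto)
qed

end

text \<open>The solution of the recursion \<open>b (Suc j) = (C * A ^ j * b j) powr \<theta>\<close>.\<close>

lemma moser_recursion:
  fixes \<theta> C A :: real
  assumes \<theta>: "1 < \<theta>" and C: "0 < C" and A: "1 \<le> A"
  obtains e A1 where "0 < e" "1 \<le> A1"
    "\<And>J j. 0 < J \<Longrightarrow> (C * A ^ j * ((e * J) powr (\<theta> ^ j) / (e * A1 ^ j))) powr \<theta> = (e * J) powr (\<theta> ^ Suc j) / (e * A1 ^ Suc j)"
proof -
  \<comment> \<open>With the ansatz b j = (e J)^(\<theta>^j) / (e A1^j), normalised by b 0 = J, the
    recursion forces A1^(\<theta> - 1) = A^\<theta> and e^(\<theta> - 1) = C^\<theta> A1.\<close>
  define A1 where "A1 = A powr (\<theta> / (\<theta> - 1))"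
  define e where "e = (C powr \<theta> * A1) powr (1 / (\<theta> - 1))"
  have t0: "0 < \<theta> - 1" "0 < \<theta>" using \<theta> by auto
  have A1: "1 \<le> A1" using A t0 by (simp add: A1_def ge_one_powr_ge_zero)
  have e: "0 < e" using C A1 by (simp add: e_def)
  have eA: "A powr \<theta> = A1 powr \<theta> / A1"
  proof -
    have "A1 powr (\<theta> - 1) = A powr \<theta>" unfolding A1_def powr_powr using t0 by simp
    then show ?thesis using A1 by (simp add: powr_diff)
  qed
  have eC: "C powr \<theta> = e powr \<theta> / (e * A1)"
  proof -
    have "e powr (\<theta> - 1) = C powr \<theta> * A1" unfolding e_def powr_powr using t0 C A1 by simp
    then show ?thesis using e A1 by (simp add: powr_diff field_simps)
  qed
  have swap: "(x ^ j) powr \<theta> = (x powr \<theta>) ^ j" if "0 < x" for x :: real and j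
    using that by (simp add: powr_realpow[symmetric] powr_powr mult.commute)
  show ?thesis
  proof (rule that[OF e A1])
    fix J :: real and j :: nat assume J: "0 < J"
    have "(C * A ^ j * ((e * J) powr (\<theta> ^ j) / (e * A1 ^ j))) powr \<theta>
      = C powr \<theta> * (A powr \<theta>) ^ j * ((e * J) powr (\<theta> ^ Suc j) / (e powr \<theta> * (A1 powr \<theta>) ^ j))"
      using C A A1 e by (simp add: powr_mult powr_divide powr_powr swap mult.commute)
    also have "\<dots> = (e powr \<theta> / (e * A1)) * ((A1 powr \<theta>) ^ j / A1 ^ j) * ((e * J) powr (\<theta> ^ Suc j) / (e powr \<theta> * (A1 powr \<theta>) ^ j))"
      unfolding eC eA power_divide ..
    also have "\<dots> = (e * J) powr (\<theta> ^ Suc j) / (e * A1 ^ Suc j)"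
    proof -
      have "0 < e powr \<theta>" "0 < (A1 powr \<theta>) ^ j" using e A1 by auto
      then show ?thesis using e A1 by (simp add: field_simps)
    qed
    finally show "(C * A ^ j * ((e * J) powr (\<theta> ^ j) / (e * A1 ^ j))) powr \<theta> = (e * J) powr (\<theta> ^ Suc j) / (e * A1 ^ Suc j)" .
  qed
qed

context moser_data
begin

text \<open>The next step needs both weighted integrals at the same exponent, so the weaker of the
  two Sobolev improvements decides.\<close>

definition gain :: real where "gain = min Q1 q / p"

lemma gain: "1 < gain" "gain * p \<le> Q1" "gain * p \<le> q" "0 < gain * p"
  using p Q1 by (auto simp: gain_def)

definition C6 :: real
  where "C6 = CS Q1 powr (gain * p / Q1) * mass powr (1 - gain * p / Q1) + CS q powr (gain * p / q) * mass powr (1 - gain * p / q)"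

lemma C6: "0 < C6"
  using CS[of Q1] mass by (simp add: C6_def add_pos_nonneg)

end

context weak_data
begin

text \<open>Hoelder with the finite mass lowers the exponents Q1 and q to the common
  \<open>gain * p\<close>, and \<eta> is 1 on the smaller ball. The output has the shape of the
  input with \<gamma> multiplied by \<open>gain\<close>, ready to be iterated.\<close>

lemma moser_step_ball:
  assumes \<gamma>: "1 \<le> \<gamma>"
    and \<eta>: "C1_on UNIV \<eta> D\<eta>" "\<And>y. 0 \<le> \<eta> y" "\<And>y. \<eta> y \<le> 1" "\<And>y. y \<notin> cball x0 r \<Longrightarrow> \<eta> y = 0" "\<And>y. norm (D\<eta> y) \<le> \<Lambda>"
    and one: "\<And>y. y \<in> cball x0 r' \<Longrightarrow> \<eta> y = 1"
    and r: "1 \<le> r" "r \<le> 5 / 4" and \<Lambda>: "1 \<le> \<Lambda>" and I: "0 < I"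
    and I1: "(\<integral>\<^sup>+y. ennreal (indicat_real (cball x0 r) y * (\<bar>u y\<bar> + k) powr (\<gamma> * p) * \<omega>1 y) \<partial>lebesgue) \<le> ennreal I"
    and I2: "(\<integral>\<^sup>+y. ennreal (indicat_real (cball x0 r) y * (\<bar>u y\<bar> + k) powr (\<gamma> * p) * \<omega>2 y) \<partial>lebesgue) \<le> ennreal I"
  defines "Bd \<equiv> C6 * (\<gamma> powr p * (K2 a Pb Pc Pd1 Pd2 * \<gamma> powr (p * p / \<epsilon>) * (\<Lambda> powr p * I))) powr gain"
  shows "(\<integral>\<^sup>+y. ennreal (indicat_real (cball x0 r') y * (\<bar>u y\<bar> + k) powr (\<gamma> * gain * p) * \<omega>1 y) \<partial>lebesgue) \<le> ennreal Bd"
    "(\<integral>\<^sup>+y. ennreal (indicat_real (cball x0 r') y * (\<bar>u y\<bar> + k) powr (\<gamma> * gain * p) * \<omega>2 y) \<partial>lebesgue) \<le> ennreal Bd"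
proof -
  note [measurable] = C1_measurable[OF \<eta>(1)]
  have p0: "0 < p" using p by simp
  define T where "T = K2 a Pb Pc Pd1 Pd2 * \<gamma> powr (p * p / \<epsilon>) * (\<Lambda> powr p * I)"
  note st = moser_step[OF \<gamma> \<eta> r \<Lambda> I I1 I2, folded T_def]
  have key: "(\<integral>\<^sup>+y. ennreal (indicat_real (cball x0 r') y * (\<bar>u y\<bar> + k) powr (\<gamma> * gain * p) * \<omega> y) \<partial>lebesgue) \<le> ennreal Bd"
    if [measurable]: "\<omega> \<in> borel_measurable lebesgue" and \<omega>: "\<And>x. 0 \<le> \<omega> x" "(\<integral>\<^sup>+y. ennreal (\<omega> y) \<partial>lebesgue) \<le> ennreal mass"
      and Q: "0 < Q" "gain * p \<le> Q"
      and S: "(\<integral>\<^sup>+y. ennreal ((\<eta> y * (\<bar>u y\<bar> + k) powr \<gamma>) powr Q * \<omega> y) \<partial>lebesgue) \<le> ennreal (CS Q * \<gamma> powr Q * T powr (Q / p))"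
      and c: "CS Q powr (gain * p / Q) * mass powr (1 - gain * p / Q) \<le> C6" for \<omega> Q
  proof -
    have S0: "0 \<le> CS Q * \<gamma> powr Q * T powr (Q / p)" by (auto intro!: mult_nonneg_nonneg less_imp_le[OF CS])
    have "(\<integral>\<^sup>+y. ennreal (indicat_real (cball x0 r') y * (\<bar>u y\<bar> + k) powr (\<gamma> * gain * p) * \<omega> y) \<partial>lebesgue)
      \<le> (\<integral>\<^sup>+y. ennreal ((\<eta> y * (\<bar>u y\<bar> + k) powr \<gamma>) powr (gain * p) * \<omega> y) \<partial>lebesgue)"
    proof (intro nn_integral_mono ennreal_leI mult_right_mono \<omega>(1))
      fix y
      show "indicat_real (cball x0 r') y * (\<bar>u y\<bar> + k) powr (\<gamma> * gain * p) \<le> (\<eta> y * (\<bar>u y\<bar> + k) powr \<gamma>) powr (gain * p)"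
        using one[of y] by (cases "y \<in> cball x0 r'") (simp_all add: powr_powr mult.assoc)
    qed
    also have "\<dots> \<le> ennreal ((CS Q * \<gamma> powr Q * T powr (Q / p)) powr (gain * p / Q) * mass powr (1 - gain * p / Q))"
      by (rule hoelder_mass[OF _ _ \<omega>(1) _ S0 \<omega>(2) gain(4) Q(2) S]) (use \<eta>(2) in auto)
    also have "(CS Q * \<gamma> powr Q * T powr (Q / p)) powr (gain * p / Q) = CS Q powr (gain * p / Q) * (\<gamma> powr p * T) powr gain"
      unfolding powr_mult powr_powr using Q p0 by (simp add: mult.commute mult.assoc)
    also have "CS Q powr (gain * p / Q) * (\<gamma> powr p * T) powr gain * mass powr (1 - gain * p / Q)
      = (CS Q powr (gain * p / Q) * mass powr (1 - gain * p / Q)) * (\<gamma> powr p * T) powr gain" by (simp only: mult_ac)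
    also have "ennreal \<dots> \<le> ennreal Bd"
      unfolding Bd_def T_def by (intro ennreal_leI mult_right_mono c) auto
    finally show ?thesis .
  qed
  show "(\<integral>\<^sup>+y. ennreal (indicat_real (cball x0 r') y * (\<bar>u y\<bar> + k) powr (\<gamma> * gain * p) * \<omega>1 y) \<partial>lebesgue) \<le> ennreal Bd"
    by (rule key[OF _ \<omega>0(1) mass(2) Q1(4) gain(2) st(1)]) (auto simp: C6_def)
  show "(\<integral>\<^sup>+y. ennreal (indicat_real (cball x0 r') y * (\<bar>u y\<bar> + k) powr (\<gamma> * gain * p) * \<omega>2 y) \<partial>lebesgue) \<le> ennreal Bd"
    by (rule key[OF _ \<omega>0(2) mass(3) Dq(3) gain(3) st(2)]) (auto simp: C6_def)
qed

end

text \<open>\<open>C\<close> is obtained before the solution, the coefficients and \<open>k\<close>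
  are named; only \<open>a\<close> and the four bounds precede it. Along \<gamma> = gain^j the
  powers of \<gamma> and the gradients of the cutoffs grow geometrically in j, a growth that the
  recursion tolerates.\<close>

lemma (in moser_data) moser_bound:
  assumes a: "0 < a"
  obtains C where "0 < C" "\<And>u v \<phi> E N0 A B b c d1 d2 k J. weak_data x0 \<omega>1 \<omega>2 p q D1 D \<epsilon> Cs u v \<phi> E N0 A B b c d1 d2 a k Pb Pc Pd1 Pd2 \<Longrightarrow>
    0 < J \<Longrightarrow> (\<integral>\<^sup>+y. ennreal ((\<bar>u y\<bar> + k) powr p * \<omega>1 y) \<partial>lebesgue) \<le> ennreal J \<Longrightarrow>
    (\<integral>\<^sup>+y. ennreal ((\<bar>u y\<bar> + k) powr p * \<omega>2 y) \<partial>lebesgue) \<le> ennreal J \<Longrightarrow>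
    AE y in lebesgue. y \<in> ball x0 1 \<longrightarrow> (\<bar>u y\<bar> + k) powr p \<le> C * J"
proof -
  have p0: "0 < p" using p by simp
  obtain L0 where L0: "0 < L0" "\<And>r r'. 1 \<le> r \<Longrightarrow> r < r' \<Longrightarrow> r' \<le> 3 / 2 \<Longrightarrow>
    \<exists>\<eta> D. C1_on UNIV \<eta> D \<and> (\<forall>x. 0 \<le> \<eta> x \<and> \<eta> x \<le> 1) \<and> (\<forall>x\<in>cball x0 r. \<eta> x = 1) \<and>
      (\<forall>x. x \<notin> cball x0 r' \<longrightarrow> \<eta> x = 0) \<and> (\<forall>x. x \<notin> cball x0 r' \<longrightarrow> D x = 0) \<and> (\<forall>x. norm (D x) \<le> L0 / (r' - r))"
    by (rule cutoff[of x0]) blast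
  define L where "L = max 1 L0"
  define K where "K = K2 a Pb Pc Pd1 Pd2"
  have KK0: "0 \<le> KK a Pb Pc Pd1 Pd2" using p0 a by (simp add: KK_def)
  then have "0 < a * KK a Pb Pc Pd1 Pd2 + 1" using a by (intro add_nonneg_pos mult_nonneg_nonneg) auto
  then have K0: "0 < K" using a by (simp add: K_def K2_def)
  \<comment> \<open>The total exponent of \<gamma> in one step: p from the Sobolev bound and p * p /
    \<epsilon> from the absorption.\<close>
  define Mx where "Mx = p + p * p / \<epsilon>"
  define A where "A = gain powr Mx * 2 powr p"
  define C5 where "C5 = C6 powr (1 / gain) * (K * (8 * L) powr p)"
  have L1: "1 \<le> L" "L0 \<le> L" by (auto simp: L_def)
  have C5: "0 < C5" using C6 K0 L1 by (simp add: C5_def)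
  have Mx0: "0 \<le> Mx" using p0 \<epsilon> by (simp add: Mx_def)
  have A1': "1 \<le> A"
  proof -
    have "1 \<le> gain powr Mx" "1 \<le> (2::real) powr p" using gain Mx0 p0 by (auto simp: ge_one_powr_ge_zero)
    then have "1 * 1 \<le> A" unfolding A_def by (intro mult_mono) auto
    then show ?thesis by simp
  qed
  obtain e A1 where e: "0 < e" "1 \<le> A1" and
    rec: "\<And>J j. 0 < J \<Longrightarrow> (C5 * A ^ j * ((e * J) powr (gain ^ j) / (e * A1 ^ j))) powr gain = (e * J) powr (gain ^ Suc j) / (e * A1 ^ Suc j)"
    by (rule moser_recursion[OF gain(1) C5 A1']) blast
  have "0 < 2 * e" using e by simp
  moreover have "AE y in lebesgue. y \<in> ball x0 1 \<longrightarrow> (\<bar>u y\<bar> + k) powr p \<le> (2 * e) * J"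
    if wd: "weak_data x0 \<omega>1 \<omega>2 p q D1 D \<epsilon> Cs u v \<phi> E N0 A' B b c d1 d2 a k Pb Pc Pd1 Pd2" and J: "0 < J"
      and J1: "(\<integral>\<^sup>+y. ennreal ((\<bar>u y\<bar> + k) powr p * \<omega>1 y) \<partial>lebesgue) \<le> ennreal J"
      and J2: "(\<integral>\<^sup>+y. ennreal ((\<bar>u y\<bar> + k) powr p * \<omega>2 y) \<partial>lebesgue) \<le> ennreal J"
    for u v \<phi> E N0 A' B b c d1 d2 k J
  proof -
    interpret w: weak_data x0 \<omega>1 \<omega>2 p q D1 D \<epsilon> Cs u v \<phi> E N0 A' B b c d1 d2 a k Pb Pc Pd1 Pd2 by (rule wd)
    \<comment> \<open>The radii decrease from 5/4 towards 1; the gaps 2^-j / 8 lead to cutoff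
      gradients of size 8 L 2^j.\<close>
    define r where "r = (\<lambda>j::nat. 1 + (1 / 4) * (1 / 2) ^ j :: real)"
    have r: "1 \<le> r j" "1 \<le> r (Suc j)" "r j \<le> 5 / 4" "r (Suc j) < r j" "r j - r (Suc j) = (1 / 8) * (1 / 2) ^ j" for j
      by (auto simp: r_def power_le_one)
    define b' where "b' = (\<lambda>j. (e * J) powr (gain ^ j) / (e * A1 ^ j))"
    have b0: "0 < b' j" for j using e J by (simp add: b'_def)
    have it: "(\<integral>\<^sup>+y. ennreal (indicat_real (cball x0 (r j)) y * (\<bar>u y\<bar> + k) powr (gain ^ j * p) * \<omega>1 y) \<partial>lebesgue) \<le> ennreal (b' j) \<and>
      (\<integral>\<^sup>+y. ennreal (indicat_real (cball x0 (r j)) y * (\<bar>u y\<bar> + k) powr (gain ^ j * p) * \<omega>2 y) \<partial>lebesgue) \<le> ennreal (b' j)" for j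
    proof (induction j)
      case 0
      have b1: "b' 0 = J" using e J by (simp add: b'_def)
      have "(\<integral>\<^sup>+y. ennreal (indicat_real (cball x0 (r 0)) y * (\<bar>u y\<bar> + k) powr (gain ^ 0 * p) * \<omega> y) \<partial>lebesgue) \<le> (\<integral>\<^sup>+y. ennreal ((\<bar>u y\<bar> + k) powr p * \<omega> y) \<partial>lebesgue)"
        if "\<And>y. 0 \<le> \<omega> y" for \<omega>
        using that by (intro nn_integral_mono ennreal_leI mult_right_mono) (auto simp: indicator_def)
      from this[OF \<omega>0(1)] this[OF \<omega>0(2)] show ?case using J1 J2 unfolding b1 by (meson order_trans)
    next
      case (Suc j)
      have "\<exists>\<eta> D. C1_on UNIV \<eta> D \<and> (\<forall>x. 0 \<le> \<eta> x \<and> \<eta> x \<le> 1) \<and> (\<forall>x\<in>cball x0 (r (Suc j)). \<eta> x = 1) \<and>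
        (\<forall>x. x \<notin> cball x0 (r j) \<longrightarrow> \<eta> x = 0) \<and> (\<forall>x. x \<notin> cball x0 (r j) \<longrightarrow> D x = 0) \<and> (\<forall>x. norm (D x) \<le> L0 / (r j - r (Suc j)))"
        using r[of j] by (intro L0(2)) auto
      then obtain \<eta> D\<eta> where \<eta>: "C1_on UNIV \<eta> D\<eta>" "\<forall>x. 0 \<le> \<eta> x \<and> \<eta> x \<le> 1" "\<forall>x\<in>cball x0 (r (Suc j)). \<eta> x = 1"
        "\<forall>x. x \<notin> cball x0 (r j) \<longrightarrow> \<eta> x = 0" "\<forall>x. norm (D\<eta> x) \<le> L0 / (r j - r (Suc j))"
        by (elim exE conjE)
      define \<Lambda> where "\<Lambda> = 8 * L * 2 ^ j"
      have Lj: "L0 / (r j - r (Suc j)) \<le> \<Lambda>" "1 \<le> \<Lambda>"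
      proof -
        have "L0 / (r j - r (Suc j)) = 8 * L0 * 2 ^ j" unfolding r(5) by (simp add: power_one_over field_simps)
        then show "L0 / (r j - r (Suc j)) \<le> \<Lambda>" using L1 by (simp add: \<Lambda>_def)
        have "1 * 1 \<le> (8 * L) * 2 ^ j" using L1 by (intro mult_mono) auto
        then show "1 \<le> \<Lambda>" by (simp add: \<Lambda>_def)
      qed
      have g1: "1 \<le> gain ^ j" using gain by simp
      have n: "norm (D\<eta> y) \<le> \<Lambda>" for y using \<eta>(5) Lj(1) order_trans by blast
      have step: "C6 * ((gain ^ j) powr p * (K2 a Pb Pc Pd1 Pd2 * (gain ^ j) powr (p * p / \<epsilon>) * (\<Lambda> powr p * b' j))) powr gain = b' (Suc j)"
      proof -
        have gj: "(gain ^ j) powr p * (gain ^ j) powr (p * p / \<epsilon>) = (gain powr Mx) ^ j"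
          unfolding powr_add[symmetric] Mx_def[symmetric] using gain by (simp add: powr_realpow[symmetric] powr_powr mult.commute)
        have lj: "\<Lambda> powr p = (8 * L) powr p * (2 powr p) ^ j"
          unfolding \<Lambda>_def powr_mult[of "8 * L"] by (simp add: powr_realpow[symmetric] powr_powr mult.commute)
        have "(gain ^ j) powr p * (K * (gain ^ j) powr (p * p / \<epsilon>) * (\<Lambda> powr p * b' j))
          = K * ((gain ^ j) powr p * (gain ^ j) powr (p * p / \<epsilon>)) * \<Lambda> powr p * b' j" by (simp only: mult_ac)
        also have "\<dots> = (K * (8 * L) powr p) * ((gain powr Mx) ^ j * (2 powr p) ^ j) * b' j"
          unfolding gj lj by (simp only: mult_ac)
        also have "(gain powr Mx) ^ j * (2 powr p) ^ j = A ^ j" by (simp add: A_def power_mult_distrib)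
        finally have 1: "(gain ^ j) powr p * (K * (gain ^ j) powr (p * p / \<epsilon>) * (\<Lambda> powr p * b' j)) = (K * (8 * L) powr p) * A ^ j * b' j" .
        have "C6 = (C6 powr (1 / gain)) powr gain" using C6 gain by (simp add: powr_powr)
        then have "C6 * ((K * (8 * L) powr p) * A ^ j * b' j) powr gain = (C6 powr (1 / gain) * ((K * (8 * L) powr p) * A ^ j * b' j)) powr gain"
          by (simp only: powr_mult)
        also have "C6 powr (1 / gain) * ((K * (8 * L) powr p) * A ^ j * b' j) = C5 * A ^ j * b' j" by (simp add: C5_def mult.assoc)
        also have "(C5 * A ^ j * b' j) powr gain = b' (Suc j)" unfolding b'_def by (rule rec[OF J])
        finally show ?thesis unfolding 1[symmetric] K_def[symmetric] .
      qed
      have gs: "gain ^ Suc j * p = gain ^ j * gain * p" by (simp add: mult_ac)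
      show ?case
        unfolding gs step[symmetric]
        by (intro conjI w.moser_step_ball[where \<eta>=\<eta> and D\<eta>=D\<eta> and r="r j"])
           (use Suc g1 \<eta> n r[of j] Lj b0 in auto)
    qed
    \<comment> \<open>Chebyshev at twice the limiting level: by stage j the \<omega>1-mass of this
      set is at most (1/2)^(gain^j) / e, which tends to 0.\<close>
    let ?N = "{y. y \<in> ball x0 1 \<and> 2 * e * J < (\<bar>u y\<bar> + k) powr p}"
    have mN[measurable]: "?N \<in> sets lebesgue"
      by measurable
    have "(\<integral>\<^sup>+y. ennreal (indicat_real ?N y * \<omega>1 y) \<partial>lebesgue) \<le> ennreal ((1 / 2) powr (gain ^ j) * (1 / e))" for j
    proof -
      let ?c = "(2 * e * J) powr (gain ^ j)"
      have c0: "0 < ?c" using e J by simp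
      have "ennreal ?c * (\<integral>\<^sup>+y. ennreal (indicat_real ?N y * \<omega>1 y) \<partial>lebesgue) = (\<integral>\<^sup>+y. ennreal ?c * ennreal (indicat_real ?N y * \<omega>1 y) \<partial>lebesgue)"
        by (rule nn_integral_cmult[symmetric]) measurable
      also have "\<dots> \<le> (\<integral>\<^sup>+y. ennreal (indicat_real (cball x0 (r j)) y * (\<bar>u y\<bar> + k) powr (gain ^ j * p) * \<omega>1 y) \<partial>lebesgue)"
      proof (intro nn_integral_mono)
        fix y
        show "ennreal ?c * ennreal (indicat_real ?N y * \<omega>1 y) \<le> ennreal (indicat_real (cball x0 (r j)) y * (\<bar>u y\<bar> + k) powr (gain ^ j * p) * \<omega>1 y)"
        proof (cases "y \<in> ?N")
          case True
          have "?c \<le> ((\<bar>u y\<bar> + k) powr p) powr (gain ^ j)"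
            using True e J gain by (intro powr_mono2) auto
          also have "\<dots> = (\<bar>u y\<bar> + k) powr (gain ^ j * p)" by (simp add: powr_powr mult.commute)
          finally have "?c * \<omega>1 y \<le> (\<bar>u y\<bar> + k) powr (gain ^ j * p) * \<omega>1 y" by (intro mult_right_mono \<omega>0)
          moreover have "y \<in> cball x0 (r j)" using True r(1)[of j] by auto
          ultimately show ?thesis using True c0 by (simp add: ennreal_mult'[symmetric] ennreal_leI)
        qed simp
      qed
      also have "\<dots> \<le> ennreal (b' j)" using it by simp
      also have "\<dots> \<le> ennreal ((e * J) powr (gain ^ j) / e)"
      proof (rule ennreal_leI)
        have "e \<le> e * A1 ^ j" using e by (simp add: one_le_power)
        then show "b' j \<le> (e * J) powr (gain ^ j) / e" unfolding b'_def using e by (intro divide_left_mono) auto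
      qed
      also have "(e * J) powr (gain ^ j) / e = ?c * ((1 / 2) powr (gain ^ j) * (1 / e))"
      proof -
        have "(e * J) powr (gain ^ j) = ?c * (1 / 2) powr (gain ^ j)" unfolding powr_mult[symmetric] by simp
        then show ?thesis by simp
      qed
      finally have "ennreal ?c * (\<integral>\<^sup>+y. ennreal (indicat_real ?N y * \<omega>1 y) \<partial>lebesgue) \<le> ennreal ?c * ennreal ((1 / 2) powr (gain ^ j) * (1 / e))"
        using c0 by (simp only: ennreal_mult'[OF less_imp_le[OF c0]])
      then show ?thesis using c0 by (subst (asm) ennreal_mult_le_mult_iff) auto
    qed
    moreover have "(\<lambda>j. ennreal ((1 / 2) powr (gain ^ j) * (1 / e))) \<longlonglongrightarrow> ennreal (0 * (1 / e))"
    proof (intro tendsto_ennrealI tendsto_mult tendsto_const)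
      have lim: "filterlim (\<lambda>j. gain ^ j) at_top sequentially"
        using gain(1) by real_asymp
      have "((\<lambda>x. (1 / 2) powr x) \<longlongrightarrow> (0::real)) at_top" by real_asymp
      then show "(\<lambda>j. (1 / 2) powr (gain ^ j)) \<longlonglongrightarrow> (0::real)" by (rule filterlim_compose[OF _ lim])
    qed
    ultimately have "(\<integral>\<^sup>+y. ennreal (indicat_real ?N y * \<omega>1 y) \<partial>lebesgue) \<le> ennreal (0 * (1 / e))"
      by (intro LIMSEQ_le_const) auto
    then have "(\<integral>\<^sup>+y. ennreal (indicat_real ?N y * \<omega>1 y) \<partial>lebesgue) = 0" by simp
    then have "AE y in lebesgue. ennreal (indicat_real ?N y * \<omega>1 y) = 0"
      by (subst (asm) nn_integral_0_iff_AE) measurable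
    then show ?thesis
      using \<omega>pos
    proof eventually_elim
      case (elim y)
      then show ?case by (cases "2 * e * J < (\<bar>u y\<bar> + k) powr p") (auto simp: ennreal_eq_0_iff indicator_def)
    qed
  qed
  ultimately show ?thesis by (rule that)
qed

section \<open>Weighted norms on the ball of radius two\<close>

lemma epowr_epowr_inverse: "0 < r \<Longrightarrow> epowr (epowr t (1 / r)) r = t"
  by (cases t) (auto simp: epowr_ennreal powr_powr epowr_def)

lemma epowr_le_ennrealD:
  assumes r: "0 < r" and \<kappa>: "0 \<le> \<kappa>" and le: "epowr t r \<le> ennreal \<kappa>"
  shows "t \<le> ennreal (\<kappa> powr (1 / r))"
proof (cases t)
  case (real x)
  then have "x powr r \<le> \<kappa>" using le \<kappa> by (simp add: epowr_ennreal)
  then have "(x powr r) powr (1 / r) \<le> \<kappa> powr (1 / r)" using r by (intro powr_mono2) auto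
  then show ?thesis using real r by (simp add: powr_powr)
qed (use le in \<open>auto simp: epowr_def top_unique\<close>)

text \<open>Membership makes the integral finite, so that \<open>enn2real\<close> loses nothing of
  the norm.\<close>

lemma Lspace_eq_Lnorm_powr:
  assumes "f \<in> Lspace s w U" "0 < s"
  shows "(\<integral>\<^sup>+x\<in>U. (ennreal (\<bar>f x\<bar> powr s) * ennreal (w x)) \<partial>lebesgue) = ennreal (enn2real (Lnorm s w U f) powr s)"
proof -
  let ?I = "\<integral>\<^sup>+x\<in>U. (ennreal (\<bar>f x\<bar> powr s) * ennreal (w x)) \<partial>lebesgue"
  have "?I < \<infinity>" using assms(1) by (simp add: Lspace_def)
  then obtain r where r: "0 \<le> r" "?I = ennreal r" by (cases ?I) auto
  show ?thesis unfolding Lnorm_def r(2) using r(1) assms(2) by (simp add: epowr_ennreal powr_powr)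
qed

lemma indicator_measurable_lebesgue:
  fixes f :: "'a::euclidean_space \<Rightarrow> 'b::euclidean_space"
  assumes "f \<in> borel_measurable (lebesgue_on S)" "S \<in> sets lebesgue" "T \<in> sets lebesgue" "T \<subseteq> S"
  shows "(\<lambda>x. indicat_real T x *\<^sub>R f x) \<in> borel_measurable lebesgue"
proof -
  have [measurable]: "(\<lambda>x. indicat_real S x *\<^sub>R f x) \<in> borel_measurable lebesgue"
    using assms by (subst borel_measurable_restrict_space_iff[symmetric]) auto
  note [measurable] = assms(3)
  have "(\<lambda>x. indicat_real T x *\<^sub>R (indicat_real S x *\<^sub>R f x)) \<in> borel_measurable lebesgue" by measurable
  also have "(\<lambda>x. indicat_real T x *\<^sub>R (indicat_real S x *\<^sub>R f x)) = (\<lambda>x. indicat_real T x *\<^sub>R f x)"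
    using assms(4) by (auto simp: indicator_def fun_eq_iff)
  finally show ?thesis .
qed

lemma borel_measurable_vecI:
  fixes f :: "'a \<Rightarrow> real ^ 'n"
  assumes "\<And>i. (\<lambda>x. f x $ i) \<in> borel_measurable M"
  shows "f \<in> borel_measurable M"
  by (subst borel_measurable_euclidean_space) (use assms in \<open>auto simp: Basis_vec_def inner_axis\<close>)

lemma norm_powr_le_sum:
  fixes z :: "real ^ 'n"
  assumes "0 < p"
  shows "norm z powr p \<le> real CARD('n) powr p * (\<Sum>i\<in>UNIV. \<bar>z $ i\<bar> powr p)"
proof -
  let ?m = "Max (range (\<lambda>i. \<bar>z $ i\<bar>))"
  have m: "\<bar>z $ i\<bar> \<le> ?m" for i by (rule Max_ge) auto
  have "?m \<in> range (\<lambda>i. \<bar>z $ i\<bar>)" by (rule Max_in) auto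
  then obtain i0 where i0: "?m = \<bar>z $ i0\<bar>" by (rule rangeE)
  have "norm z \<le> (\<Sum>i\<in>UNIV. \<bar>z $ i\<bar>)" by (rule norm_le_l1_cart)
  also have "\<dots> \<le> (\<Sum>i\<in>(UNIV :: 'n set). ?m)" by (rule sum_mono) (rule m)
  finally have "norm z powr p \<le> (real CARD('n) * \<bar>z $ i0\<bar>) powr p"
    using assms i0 by (intro powr_mono2) auto
  also have "\<dots> = real CARD('n) powr p * \<bar>z $ i0\<bar> powr p" by (rule powr_mult)
  also have "\<dots> \<le> real CARD('n) powr p * (\<Sum>i\<in>UNIV. \<bar>z $ i\<bar> powr p)"
    by (intro mult_left_mono member_le_sum) auto
  finally show ?thesis .
qed

context local_weight
begin

text \<open>The closed ball of radius 2 may touch the boundary of \<Omega>, where local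
  integrability gives no bound; finiteness comes from one doubling step to the unit ball.\<close>

lemma wmeas_ball2:
  obtains W where "0 < W" "wmeas w (ball x0 2) = ennreal W"
proof -
  obtain \<gamma> where \<gamma>: "0 < \<gamma>" "wmeas w (ball x0 (2 * 1)) \<le> ennreal \<gamma> * wmeas w (ball x0 1)"
    using dbl sub by (auto simp: doubling_weight_def doubling_with_def) (metis mult.right_neutral zero_less_one)
  have s: "ball x0 1 \<subseteq> B74" by auto
  have "wmeas w (ball x0 2) \<le> ennreal (\<gamma> * measure M (ball x0 1))"
    using \<gamma> unfolding wmeas_ball[OF s] by (simp add: ennreal_mult)
  then obtain W where W: "0 \<le> W" "wmeas w (ball x0 2) = ennreal W"
    by (cases "wmeas w (ball x0 2)") (auto simp: top_unique)
  have "ennreal (measure M (ball x0 1)) \<le> wmeas w (ball x0 2)"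
    unfolding wmeas_ball[OF s, symmetric] wmeas_def
    by (intro nn_integral_mono) (auto simp: indicator_def)
  then have "measure M (ball x0 1) \<le> W" using W by simp
  then have "0 < W" using ball_pos[of 1 x0] s by auto
  then show ?thesis using W(2) by (rule that)
qed

lemma w_nonneg: "x \<in> ball x0 2 \<Longrightarrow> 0 \<le> w x"
  using loc sub by (auto simp: loc_integrable_weight_def)

lemma wt_integral_le:
  assumes "\<And>y. y \<in> B74 \<Longrightarrow> 0 \<le> h y \<and> h y \<le> h' y"
  shows "(\<integral>\<^sup>+y. ennreal (h y * wt x0 w y) \<partial>lebesgue) \<le> (\<integral>\<^sup>+y\<in>ball x0 2. (ennreal (h' y) * ennreal (w y)) \<partial>lebesgue)"
proof (rule nn_integral_mono)
  fix y
  show "ennreal (h y * wt x0 w y) \<le> ennreal (h' y) * ennreal (w y) * indicator (ball x0 2) y"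
  proof (cases "y \<in> B74")
    case True
    then have y: "y \<in> ball x0 2" by auto
    have "ennreal (h y * w y) \<le> ennreal (h' y * w y)"
      using assms[OF True] w_nonneg[OF y] by (intro ennreal_leI mult_right_mono) auto
    then show ?thesis using y True w_nonneg[OF y] by (simp add: wt_def ennreal_mult'')
  qed (simp add: wt_def)
qed

lemma wt_integral_eq:
  assumes "\<And>y. 0 \<le> h y"
  shows "(\<integral>\<^sup>+y. ennreal (h y * wt x0 w y) \<partial>lebesgue) = (\<integral>\<^sup>+y\<in>B74. (ennreal (h y) * ennreal (w y)) \<partial>lebesgue)"
proof (rule nn_integral_cong)
  fix y
  show "ennreal (h y * wt x0 w y) = ennreal (h y) * ennreal (w y) * indicator B74 y"
  proof (cases "y \<in> B74")
    case True
    then have y: "0 \<le> w y" by (intro w_nonneg) auto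
    show ?thesis using True y by (simp add: wt_def ennreal_mult'')
  qed (simp add: wt_def)
qed

lemma Lnorm_wt_le:
  assumes "f \<in> Lspace s w (ball x0 2)" "0 < s" "\<And>y. y \<in> B74 \<Longrightarrow> 0 \<le> f y"
  shows "(\<integral>\<^sup>+y. ennreal ((indicat_real B74 y * f y) powr s * wt x0 w y) \<partial>lebesgue) \<le> ennreal (enn2real (Lnorm s w (ball x0 2) f) powr s)"
  unfolding Lspace_eq_Lnorm_powr[OF assms(1,2), symmetric]
  by (rule wt_integral_le) (use assms(3) in auto)

text \<open>The inhomogeneous terms of the structure conditions are divided by a power of \<open>k\<close> and
  added to the coefficients; the weighted norms of the quotients are controlled by the measure.\<close>

lemma coefficient_plus_wt_le:
  assumes f: "f \<in> Lspace s w (ball x0 2)" "\<And>y. y \<in> B74 \<Longrightarrow> 0 \<le> f y"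
    and h: "h \<in> Lspace s w (ball x0 2)" "\<And>y. y \<in> B74 \<Longrightarrow> 0 \<le> h y"
    and s: "0 < s" and \<kappa>: "0 < \<kappa>" and W: "0 < W" "wmeas w (ball x0 2) = ennreal W"
    and avg: "wavg w (ball x0 2) (\<lambda>x. ennreal (\<bar>h x\<bar> powr s)) \<le> ennreal (\<kappa> powr s)"
  shows "(\<integral>\<^sup>+y. ennreal ((indicat_real B74 y * (f y + h y / \<kappa>)) powr s * wt x0 w y) \<partial>lebesgue)
    \<le> ennreal (2 powr s * (enn2real (Lnorm s w (ball x0 2) f) powr s + W))"
proof -
  let ?f = "\<lambda>y. indicat_real B74 y * f y" and ?h = "\<lambda>y. indicat_real B74 y * h y"
  have m: "?f \<in> borel_measurable lebesgue" "?h \<in> borel_measurable lebesgue"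
    using indicator_measurable_lebesgue[of f "ball x0 2" B74] indicator_measurable_lebesgue[of h "ball x0 2" B74] f(1) h(1)
      subset_ball[of "7 / 4" 2 x0] by (auto simp: Lspace_def)
  note [measurable] = m
  have f0: "0 \<le> ?f y" "0 \<le> ?h y" for y using f(2) h(2) by (auto simp: indicator_def)
  have "(\<integral>\<^sup>+y. ennreal (?h y powr s * wt x0 w y) \<partial>lebesgue) \<le> (\<integral>\<^sup>+y\<in>ball x0 2. (ennreal (\<bar>h y\<bar> powr s) * ennreal (w y)) \<partial>lebesgue)"
    by (rule wt_integral_le) (use h(2) in auto)
  also have "\<dots> = wavg w (ball x0 2) (\<lambda>x. ennreal (\<bar>h x\<bar> powr s)) * ennreal W"
    unfolding wavg_def W(2) using W(1) by (simp add: ennreal_divide_times ennreal_divide_self)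
  also have "\<dots> \<le> ennreal (\<kappa> powr s) * ennreal W" by (intro mult_right_mono avg) auto
  finally have hW: "(\<integral>\<^sup>+y. ennreal (?h y powr s * wt x0 w y) \<partial>lebesgue) \<le> ennreal (\<kappa> powr s) * ennreal W" .
  have pd: "(x / \<kappa>) powr s = inverse (\<kappa> powr s) * x powr s" if "0 \<le> x" for x
  proof -
    have "(x / \<kappa>) powr s = x powr s / \<kappa> powr s" using that \<kappa> by (simp add: powr_divide)
    then show ?thesis by (simp only: divide_inverse mult.commute)
  qed
  have ds: "a * (b + c * d) * e = a * (b * e + c * (d * e))" for a b c d e :: real by (simp add: algebra_simps)
  have en: "ennreal (a * (b + c * d)) = ennreal a * (ennreal b + ennreal c * ennreal d)" if "0 \<le> a" "0 \<le> b" "0 \<le> c" "0 \<le> d" for a b c d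
    using that by (simp add: ennreal_mult ennreal_plus)
  have "(\<integral>\<^sup>+y. ennreal ((indicat_real B74 y * (f y + h y / \<kappa>)) powr s * wt x0 w y) \<partial>lebesgue)
    \<le> (\<integral>\<^sup>+y. ennreal (2 powr s) * (ennreal (?f y powr s * wt x0 w y) + ennreal (inverse (\<kappa> powr s)) * ennreal (?h y powr s * wt x0 w y)) \<partial>lebesgue)"
  proof (rule nn_integral_mono)
    fix y
    have "(indicat_real B74 y * (f y + h y / \<kappa>)) powr s = (?f y + ?h y / \<kappa>) powr s" by (simp add: algebra_simps)
    also have "\<dots> \<le> 2 powr s * (?f y powr s + (?h y / \<kappa>) powr s)" using f0[of y] \<kappa> s by (intro powr_sum2) auto
    also have "(?h y / \<kappa>) powr s = inverse (\<kappa> powr s) * ?h y powr s" by (rule pd) (rule f0)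
    finally have "(indicat_real B74 y * (f y + h y / \<kappa>)) powr s \<le> 2 powr s * (?f y powr s + inverse (\<kappa> powr s) * ?h y powr s)" .
    then have "(indicat_real B74 y * (f y + h y / \<kappa>)) powr s * wt x0 w y \<le> 2 powr s * (?f y powr s + inverse (\<kappa> powr s) * ?h y powr s) * wt x0 w y"
      by (rule mult_right_mono[OF _ wt_nonneg])
    also have "\<dots> = 2 powr s * (?f y powr s * wt x0 w y + inverse (\<kappa> powr s) * (?h y powr s * wt x0 w y))" by (rule ds)
    finally have "(indicat_real B74 y * (f y + h y / \<kappa>)) powr s * wt x0 w y
      \<le> 2 powr s * (?f y powr s * wt x0 w y + inverse (\<kappa> powr s) * (?h y powr s * wt x0 w y))" .
    then have "ennreal ((indicat_real B74 y * (f y + h y / \<kappa>)) powr s * wt x0 w y)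
      \<le> ennreal (2 powr s * (?f y powr s * wt x0 w y + inverse (\<kappa> powr s) * (?h y powr s * wt x0 w y)))" by (rule ennreal_leI)
    also have "\<dots> = ennreal (2 powr s) * (ennreal (?f y powr s * wt x0 w y) + ennreal (inverse (\<kappa> powr s)) * ennreal (?h y powr s * wt x0 w y))"
      by (rule en) (auto intro: mult_nonneg_nonneg wt_nonneg)
    finally show "ennreal ((indicat_real B74 y * (f y + h y / \<kappa>)) powr s * wt x0 w y)
      \<le> ennreal (2 powr s) * (ennreal (?f y powr s * wt x0 w y) + ennreal (inverse (\<kappa> powr s)) * ennreal (?h y powr s * wt x0 w y))" .
  qed
  also have "\<dots> = ennreal (2 powr s) * ((\<integral>\<^sup>+y. ennreal (?f y powr s * wt x0 w y) \<partial>lebesgue)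
      + ennreal (inverse (\<kappa> powr s)) * (\<integral>\<^sup>+y. ennreal (?h y powr s * wt x0 w y) \<partial>lebesgue))"
    by (simp add: nn_integral_cmult nn_integral_add)
  also have "\<dots> \<le> ennreal (2 powr s) * (ennreal (enn2real (Lnorm s w (ball x0 2) f) powr s) + ennreal (inverse (\<kappa> powr s)) * (ennreal (\<kappa> powr s) * ennreal W))"
    by (intro mult_left_mono add_mono Lnorm_wt_le f s hW) auto
  also have "\<dots> = ennreal (2 powr s * (enn2real (Lnorm s w (ball x0 2) f) powr s + W))"
  proof -
    have "ennreal (inverse (\<kappa> powr s)) * (ennreal (\<kappa> powr s) * ennreal W) = ennreal W"
      using \<kappa> W by (simp add: mult.assoc[symmetric] ennreal_mult[symmetric])
    then show ?thesis using W by (simp add: ennreal_mult ennreal_plus)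
  qed
  finally show ?thesis .
qed

lemma energy_le_H1norm:
  assumes p: "0 < p" and u: "u \<in> borel_measurable (lebesgue_on B74)" and v: "\<And>i. (\<lambda>x. v x $ i) \<in> borel_measurable (lebesgue_on B74)"
  shows "(\<integral>\<^sup>+y. ennreal ((norm (v y) powr p + \<bar>u y\<bar> powr p) * wt x0 w y) \<partial>lebesgue)
    \<le> ennreal (real CARD('n) powr p) * epowr (H1norm p w B74 u v) p"
proof -
  have mw: "(\<lambda>y. ennreal (\<bar>t y\<bar> powr p * wt x0 w y)) \<in> borel_measurable lebesgue"
    if "t \<in> borel_measurable (lebesgue_on B74)" for t
  proof -
    have [measurable]: "(\<lambda>x. indicat_real B74 x *\<^sub>R t x) \<in> borel_measurable lebesgue"
      by (rule indicator_measurable_lebesgue[OF that]) auto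
    have "(\<lambda>y. ennreal (\<bar>indicat_real B74 y *\<^sub>R t y\<bar> powr p * wt x0 w y)) \<in> borel_measurable lebesgue" by measurable
    also have "(\<lambda>y. ennreal (\<bar>indicat_real B74 y *\<^sub>R t y\<bar> powr p * wt x0 w y)) = (\<lambda>y. ennreal (\<bar>t y\<bar> powr p * wt x0 w y))"
      by (auto simp: fun_eq_iff wt_def indicator_def)
    finally show ?thesis .
  qed
  note [measurable] = mw[OF u] mw[OF v]
  let ?n = "real CARD('n)"
  have n1: "1 \<le> ?n powr p" using p by (intro ge_one_powr_ge_zero) (auto simp: Suc_le_eq)
  have I: "(\<integral>\<^sup>+y. ennreal (\<bar>t y\<bar> powr p * wt x0 w y) \<partial>lebesgue) = epowr (Lnorm p w B74 t) p" for t
    unfolding Lnorm_def epowr_epowr_inverse[OF p] by (rule wt_integral_eq) simp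
  have "(\<integral>\<^sup>+y. ennreal ((norm (v y) powr p + \<bar>u y\<bar> powr p) * wt x0 w y) \<partial>lebesgue)
    \<le> (\<integral>\<^sup>+y. ennreal (?n powr p) * (ennreal (\<bar>u y\<bar> powr p * wt x0 w y) + (\<Sum>i\<in>UNIV. ennreal (\<bar>v y $ i\<bar> powr p * wt x0 w y))) \<partial>lebesgue)"
  proof (rule nn_integral_mono)
    fix y
    have "1 * \<bar>u y\<bar> powr p \<le> ?n powr p * \<bar>u y\<bar> powr p" by (intro mult_right_mono n1) simp
    then have "norm (v y) powr p + \<bar>u y\<bar> powr p \<le> ?n powr p * (\<bar>u y\<bar> powr p + (\<Sum>i\<in>UNIV. \<bar>v y $ i\<bar> powr p))"
      using norm_powr_le_sum[OF p, of "v y"] by (simp add: algebra_simps)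
    then have "(norm (v y) powr p + \<bar>u y\<bar> powr p) * wt x0 w y \<le> (?n powr p * (\<bar>u y\<bar> powr p + (\<Sum>i\<in>UNIV. \<bar>v y $ i\<bar> powr p))) * wt x0 w y"
      by (rule mult_right_mono[OF _ wt_nonneg])
    also have "\<dots> = ?n powr p * (\<bar>u y\<bar> powr p * wt x0 w y + (\<Sum>i\<in>UNIV. \<bar>v y $ i\<bar> powr p * wt x0 w y))"
      by (simp add: distrib_left distrib_right sum_distrib_left sum_distrib_right mult_ac)
    finally have "ennreal ((norm (v y) powr p + \<bar>u y\<bar> powr p) * wt x0 w y)
      \<le> ennreal (?n powr p * (\<bar>u y\<bar> powr p * wt x0 w y + (\<Sum>i\<in>UNIV. \<bar>v y $ i\<bar> powr p * wt x0 w y)))" by (rule ennreal_leI)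
    also have "\<dots> = ennreal (?n powr p) * (ennreal (\<bar>u y\<bar> powr p * wt x0 w y) + (\<Sum>i\<in>UNIV. ennreal (\<bar>v y $ i\<bar> powr p * wt x0 w y)))"
      using wt_nonneg[of y] by (subst ennreal_mult, simp, simp add: sum_nonneg, subst ennreal_plus, simp, simp add: sum_nonneg, subst sum_ennreal) auto
    finally show "ennreal ((norm (v y) powr p + \<bar>u y\<bar> powr p) * wt x0 w y)
      \<le> ennreal (?n powr p) * (ennreal (\<bar>u y\<bar> powr p * wt x0 w y) + (\<Sum>i\<in>UNIV. ennreal (\<bar>v y $ i\<bar> powr p * wt x0 w y)))" .
  qed
  also have "\<dots> = ennreal (?n powr p) * ((\<integral>\<^sup>+y. ennreal (\<bar>u y\<bar> powr p * wt x0 w y) \<partial>lebesgue) + (\<Sum>i\<in>UNIV. \<integral>\<^sup>+y. ennreal (\<bar>v y $ i\<bar> powr p * wt x0 w y) \<partial>lebesgue))"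
    by (subst nn_integral_cmult, measurable, subst nn_integral_add, measurable, subst nn_integral_sum) auto
  also have "\<dots> = ennreal (?n powr p) * epowr (H1norm p w B74 u v) p"
    unfolding I H1norm_def epowr_epowr_inverse[OF p] ..
  finally show ?thesis .
qed

text \<open>A subsequence with error 2^-n, the rate on which convergence almost everywhere relies.
  The dimensional factor between the Euclidean norm and the coordinates is built into the tolerance
  \<epsilon>.\<close>

lemma H1_approximation:
  assumes p: "0 < p" and H: "H1 p w B74 u v"
  obtains \<phi> N0 where "\<And>n. Ck_on 1 B74 (\<phi> n)" "\<And>n. \<phi> n \<in> borel_measurable (lebesgue_on B74)"
    "\<And>n i. pderivative i (\<phi> n) \<in> borel_measurable (lebesgue_on B74)"
    "\<And>n. (\<integral>\<^sup>+y. ennreal ((norm (grad (\<phi> n) y - v y) powr p + \<bar>\<phi> n y - u y\<bar> powr p) * wt x0 w y) \<partial>lebesgue) \<le> ennreal ((1 / 2) ^ n)"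
    "0 \<le> N0" "(\<integral>\<^sup>+y. ennreal ((norm (v y) powr p + \<bar>u y\<bar> powr p) * wt x0 w y) \<partial>lebesgue) \<le> ennreal N0"
proof -
  have u: "u \<in> Lspace p w B74" and v: "\<And>i. (\<lambda>x. v x $ i) \<in> Lspace p w B74"
    using H by (auto simp: H1_def)
  have mu: "u \<in> borel_measurable (lebesgue_on B74)" "\<And>i. (\<lambda>x. v x $ i) \<in> borel_measurable (lebesgue_on B74)"
    using u v by (auto simp: Lspace_def)
  obtain \<phi> where \<phi>: "\<forall>n. Ck_on 1 B74 (\<phi> n) \<and> \<phi> n \<in> Lspace p w B74 \<and> (\<forall>i. pderivative i (\<phi> n) \<in> Lspace p w B74)"
    "(\<lambda>n. H1norm p w B74 (\<lambda>x. \<phi> n x - u x) (\<lambda>x. grad (\<phi> n) x - v x)) \<longlonglongrightarrow> 0"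
    using H unfolding H1_def by (elim exE conjE)
  have m\<phi>: "\<phi> n \<in> borel_measurable (lebesgue_on B74)" "pderivative i (\<phi> n) \<in> borel_measurable (lebesgue_on B74)" for n i
    using \<phi>(1) by (auto simp: Lspace_def)
  let ?n = "real CARD('n) powr p"
  have n0: "0 < ?n" by simp
  define \<epsilon> where "\<epsilon> = (\<lambda>n::nat. ((1 / 2) ^ n / ?n) powr (1 / p))"
  have "\<exists>m. H1norm p w B74 (\<lambda>x. \<phi> m x - u x) (\<lambda>x. grad (\<phi> m) x - v x) < ennreal (\<epsilon> n)" for n
  proof -
    have "0 < ennreal (\<epsilon> n)" using n0 by (simp add: \<epsilon>_def)
    from order_tendstoD(2)[OF \<phi>(2) this] show ?thesis by (auto simp: eventually_sequentially)
  qed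
  then obtain m where m: "\<And>n. H1norm p w B74 (\<lambda>x. \<phi> (m n) x - u x) (\<lambda>x. grad (\<phi> (m n)) x - v x) < ennreal (\<epsilon> n)" by metis
  have small: "(\<integral>\<^sup>+y. ennreal ((norm (grad (\<phi> (m n)) y - v y) powr p + \<bar>\<phi> (m n) y - u y\<bar> powr p) * wt x0 w y) \<partial>lebesgue) \<le> ennreal ((1 / 2) ^ n)" for n
  proof -
    let ?H = "H1norm p w B74 (\<lambda>x. \<phi> (m n) x - u x) (\<lambda>x. grad (\<phi> (m n)) x - v x)"
    obtain h where h: "0 \<le> h" "?H = ennreal h" using m[of n] by (cases ?H) auto
    have "h < \<epsilon> n" using m[of n] h by (simp add: ennreal_less_iff)
    then have "h powr p \<le> \<epsilon> n powr p" using h p by (intro powr_mono2) auto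
    then have hp: "?n * h powr p \<le> (1 / 2) ^ n" using p n0 by (simp add: \<epsilon>_def powr_powr field_simps)
    have "(\<integral>\<^sup>+y. ennreal ((norm (grad (\<phi> (m n)) y - v y) powr p + \<bar>\<phi> (m n) y - u y\<bar> powr p) * wt x0 w y) \<partial>lebesgue) \<le> ennreal ?n * epowr ?H p"
      by (rule energy_le_H1norm[OF p]) (use mu m\<phi> in \<open>auto simp: grad_def\<close>)
    also have "\<dots> = ennreal (?n * h powr p)" unfolding h(2) using h(1) by (simp add: epowr_ennreal ennreal_mult)
    also have "\<dots> \<le> ennreal ((1 / 2) ^ n)" using hp by (rule ennreal_leI)
    finally show ?thesis .
  qed
  have L: "epowr (Lnorm p w B74 t) p < \<infinity>" if "t \<in> Lspace p w B74" for t
    using that unfolding Lnorm_def epowr_epowr_inverse[OF p] by (simp add: Lspace_def)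
  have "ennreal ?n * epowr (H1norm p w B74 u v) p < \<infinity>"
    unfolding H1norm_def epowr_epowr_inverse[OF p] using L[OF u] L[OF v] by (simp add: ennreal_mult_less_top)
  moreover have en: "(\<integral>\<^sup>+y. ennreal ((norm (v y) powr p + \<bar>u y\<bar> powr p) * wt x0 w y) \<partial>lebesgue) \<le> ennreal ?n * epowr (H1norm p w B74 u v) p"
    by (rule energy_le_H1norm[OF p mu])
  ultimately obtain N0 where N0: "0 \<le> N0" "ennreal ?n * epowr (H1norm p w B74 u v) p = ennreal N0"
    by (cases "ennreal ?n * epowr (H1norm p w B74 u v) p") auto
  show ?thesis
    by (rule that[of "\<lambda>n. \<phi> (m n)" N0]) (use \<phi>(1) m\<phi> small N0(1) en[unfolded N0(2)] in auto)
qed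

end

lemma C1_on_cong:
  assumes "C1_on U f D" "open U" "\<And>x. x \<in> U \<Longrightarrow> f x = g x" "\<And>x. x \<in> U \<Longrightarrow> D x = E x"
  shows "C1_on U g E"
  unfolding C1_on_def
proof (intro conjI ballI)
  fix x assume x: "x \<in> U"
  have "(f has_derivative (\<lambda>h. inner h (D x))) (at x)" using assms(1) x by (auto simp: C1_on_def gderiv_def)
  then have "(g has_derivative (\<lambda>h. inner h (D x))) (at x)"
    by (rule has_derivative_transform_within_open[OF _ assms(2) x assms(3)])
  then show "GDERIV g x :> E x" using assms(4)[OF x] by (simp add: gderiv_def)
next
  have "continuous_on U D" using assms(1) by (simp add: C1_on_def)
  then show "continuous_on U E" by (rule continuous_on_eq) (rule assms(4))
qed

lemma add_le_ennrealD:
  fixes x y z :: ennreal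
  assumes "x + y \<le> z"
  shows "x \<le> z" "y \<le> z"
  by (rule order_trans[OF _ assms], simp)+

text \<open>As (t + s)^r \<ge> s^r, dividing \<open>h\<close> by s^r turns it into a coefficient of
  (t + s)^r. This is the step that demands a strictly positive shift.\<close>

lemma absorb_constant:
  fixes d t r h s :: real
  assumes "0 \<le> d" "0 \<le> h" "0 < s" "0 \<le> t" "0 \<le> r"
  shows "d * t powr r + h \<le> (d + h / s powr r) * (t + s) powr r"
proof -
  have "t powr r \<le> (t + s) powr r" "s powr r \<le> (t + s) powr r" using assms by (auto intro!: powr_mono2)
  then have "d * t powr r \<le> d * (t + s) powr r" "h / s powr r * s powr r \<le> h / s powr r * (t + s) powr r"
    using assms by (auto intro!: mult_left_mono simp del: times_divide_eq_left)
  then show ?thesis using assms by (simp add: distrib_right)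
qed

text \<open>The bracket is used only through |u|: the shift \<open>k\<close> is dropped and the real
  number \<open>s\<close> is put in its place, at the cost of s^p times the mass.\<close>

lemma (in local_weight) bracket_wt_le:
  assumes mu[measurable]: "(\<lambda>y. indicat_real B74 y * u y) \<in> borel_measurable lebesgue"
    and p: "0 < p" and s: "0 < s" and W: "0 < W" "wmeas w (ball x0 2) = ennreal W"
    and avg: "wavg w (ball x0 2) (\<lambda>x. epowr (ennreal \<bar>u x\<bar> + k) p) \<le> ennreal (s powr p)"
  shows "(\<integral>\<^sup>+y. ennreal ((\<bar>indicat_real B74 y * u y\<bar> + s) powr p * wt x0 w y) \<partial>lebesgue) \<le> ennreal (2 powr p * (s powr p * W + s powr p * W))"
proof -
  let ?u = "\<lambda>y. indicat_real B74 y * u y"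
  have "(\<integral>\<^sup>+y. ennreal (\<bar>?u y\<bar> powr p * wt x0 w y) \<partial>lebesgue) \<le> (\<integral>\<^sup>+y\<in>ball x0 2. (ennreal (\<bar>u y\<bar> powr p) * ennreal (w y)) \<partial>lebesgue)"
    by (rule wt_integral_le) auto
  also have "\<dots> \<le> (\<integral>\<^sup>+y\<in>ball x0 2. (epowr (ennreal \<bar>u y\<bar> + k) p * ennreal (w y)) \<partial>lebesgue)"
  proof (intro nn_integral_mono mult_right_mono)
    fix y
    show "ennreal (\<bar>u y\<bar> powr p) \<le> epowr (ennreal \<bar>u y\<bar> + k) p"
    proof (cases k)
      case (real r)
      have "ennreal \<bar>u y\<bar> + k = ennreal (\<bar>u y\<bar> + r)" unfolding real(2) using real(1) by (subst ennreal_plus) auto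
      then show ?thesis using real(1) p by (simp add: epowr_ennreal powr_mono2 del: ennreal_plus)
    qed (simp add: epowr_def)
  qed auto
  also have "\<dots> = wavg w (ball x0 2) (\<lambda>x. epowr (ennreal \<bar>u x\<bar> + k) p) * ennreal W"
    unfolding wavg_def W(2) using W(1) by (simp add: ennreal_divide_times ennreal_divide_self)
  also have "\<dots> \<le> ennreal (s powr p) * ennreal W" by (intro mult_right_mono avg) auto
  finally have 1: "(\<integral>\<^sup>+y. ennreal (\<bar>?u y\<bar> powr p * wt x0 w y) \<partial>lebesgue) \<le> ennreal (s powr p) * ennreal W" .
  have "(\<integral>\<^sup>+y. ennreal (1 * wt x0 w y) \<partial>lebesgue) \<le> (\<integral>\<^sup>+y\<in>ball x0 2. (ennreal 1 * ennreal (w y)) \<partial>lebesgue)"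
    by (rule wt_integral_le) auto
  then have 2: "(\<integral>\<^sup>+y. ennreal (wt x0 w y) \<partial>lebesgue) \<le> ennreal W" using W(2) by (simp add: wmeas_def)
  have en: "ennreal (a * (b + c * d)) = ennreal a * (ennreal b + ennreal c * ennreal d)" if "0 \<le> a" "0 \<le> b" "0 \<le> c" "0 \<le> d" for a b c d
    using that by (simp add: ennreal_mult ennreal_plus)
  have "(\<integral>\<^sup>+y. ennreal ((\<bar>?u y\<bar> + s) powr p * wt x0 w y) \<partial>lebesgue)
    \<le> (\<integral>\<^sup>+y. ennreal (2 powr p) * (ennreal (\<bar>?u y\<bar> powr p * wt x0 w y) + ennreal (s powr p) * ennreal (wt x0 w y)) \<partial>lebesgue)"
  proof (rule nn_integral_mono)
    fix y
    have "(\<bar>?u y\<bar> + s) powr p \<le> 2 powr p * (\<bar>?u y\<bar> powr p + s powr p)" using p s by (intro powr_sum2) auto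
    then have "(\<bar>?u y\<bar> + s) powr p * wt x0 w y \<le> 2 powr p * (\<bar>?u y\<bar> powr p + s powr p) * wt x0 w y"
      by (rule mult_right_mono[OF _ wt_nonneg])
    also have "\<dots> = 2 powr p * (\<bar>?u y\<bar> powr p * wt x0 w y + s powr p * wt x0 w y)" by (simp only: distrib_left distrib_right mult.assoc)
    finally have "ennreal ((\<bar>?u y\<bar> + s) powr p * wt x0 w y) \<le> ennreal (2 powr p * (\<bar>?u y\<bar> powr p * wt x0 w y + s powr p * wt x0 w y))"
      by (rule ennreal_leI)
    also have "\<dots> = ennreal (2 powr p) * (ennreal (\<bar>?u y\<bar> powr p * wt x0 w y) + ennreal (s powr p) * ennreal (wt x0 w y))"
      by (rule en) (auto intro: mult_nonneg_nonneg wt_nonneg)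
    finally show "ennreal ((\<bar>?u y\<bar> + s) powr p * wt x0 w y)
      \<le> ennreal (2 powr p) * (ennreal (\<bar>?u y\<bar> powr p * wt x0 w y) + ennreal (s powr p) * ennreal (wt x0 w y))" .
  qed
  also have "\<dots> = ennreal (2 powr p) * ((\<integral>\<^sup>+y. ennreal (\<bar>?u y\<bar> powr p * wt x0 w y) \<partial>lebesgue) + ennreal (s powr p) * (\<integral>\<^sup>+y. ennreal (wt x0 w y) \<partial>lebesgue))"
    by (simp add: nn_integral_cmult nn_integral_add)
  also have "\<dots> \<le> ennreal (2 powr p) * (ennreal (s powr p) * ennreal W + ennreal (s powr p) * ennreal W)"
    by (intro mult_left_mono add_mono 1 2) auto
  also have "\<dots> = ennreal (2 powr p * (s powr p * W + s powr p * W))"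
    by (subst en) (use W(1) in \<open>simp_all add: ennreal_mult\<close>)
  finally show ?thesis .
qed

section \<open>Reduction of the equation to homogeneous form\<close>

locale weighted_setting =
  fixes \<Omega> :: "(real ^ 'n) set" and w1 w2 :: "real ^ 'n \<Rightarrow> real" and p q D1 D \<epsilon> :: real and x0 :: "real ^ 'n"
  assumes \<Omega>: "open \<Omega>" "ball x0 2 \<subseteq> \<Omega>"
    and loc: "loc_integrable_weight \<Omega> w1" "loc_integrable_weight \<Omega> w2"
    and dbl: "doubling_weight \<Omega> w1" "doubling_weight \<Omega> w2"
    and poi: "poincare_weight \<Omega> p w1" and bal: "balanced_weights \<Omega> p q w1 w2"
    and D1: "D1 = log 2 (doubling_const \<Omega> w1)" and D: "D = q * p / (q - p)"
    and p: "1 < p" "p < D1" "p < q" and \<epsilon>: "0 < \<epsilon>" "\<epsilon> < 1"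
begin

sublocale l1: local_weight \<Omega> x0 w1 by unfold_locales (use \<Omega> loc dbl in auto)
sublocale l2: local_weight \<Omega> x0 w2 by unfold_locales (use \<Omega> loc dbl in auto)

abbreviation "I74 \<equiv> indicat_real (ball x0 (7 / 4))"

definition W1 :: real where "W1 = enn2real (wmeas w1 (ball x0 2))"
definition W2 :: real where "W2 = enn2real (wmeas w2 (ball x0 2))"

lemma W1: "0 < W1" "wmeas w1 (ball x0 2) = ennreal W1"
  by (rule l1.wmeas_ball2, simp add: W1_def)+

lemma W2: "0 < W2" "wmeas w2 (ball x0 2) = ennreal W2"
  by (rule l2.wmeas_ball2, simp add: W2_def)+

lemma ex_moser_data: "\<exists>Cs. moser_data x0 (wt x0 w1) (wt x0 w2) p q D1 D \<epsilon> Cs"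
proof -
  obtain C where C: "0 < C"
    "\<And>\<psi> D N. C1_on UNIV \<psi> D \<Longrightarrow> (\<And>y. y \<notin> cball x0 (3 / 2) \<Longrightarrow> \<psi> y = 0) \<Longrightarrow> 0 < N \<Longrightarrow>
      (\<integral>\<^sup>+y. ennreal ((norm (D y) powr p + \<bar>\<psi> y\<bar> powr p) * wt x0 w1 y) \<partial>lebesgue) \<le> ennreal N \<Longrightarrow>
      (\<integral>\<^sup>+y. ennreal (\<bar>\<psi> y\<bar> powr (p * D1 / (D1 - p)) * wt x0 w1 y) \<partial>lebesgue) \<le> ennreal (C * N powr (D1 / (D1 - p)))"
    "\<And>\<psi> D N. C1_on UNIV \<psi> D \<Longrightarrow> (\<And>y. y \<notin> cball x0 (3 / 2) \<Longrightarrow> \<psi> y = 0) \<Longrightarrow> 0 < N \<Longrightarrow>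
      (\<integral>\<^sup>+y. ennreal ((norm (D y) powr p + \<bar>\<psi> y\<bar> powr p) * wt x0 w1 y) \<partial>lebesgue) \<le> ennreal N \<Longrightarrow>
      (\<integral>\<^sup>+y. ennreal (\<bar>\<psi> y\<bar> powr q * wt x0 w2 y) \<partial>lebesgue) \<le> ennreal (C * N powr (q / p))"
    by (rule weighted_sobolev[OF \<Omega> loc(1) dbl(1) poi loc(2) dbl(2) bal D1 p]) blast
  have "moser_data x0 (wt x0 w1) (wt x0 w2) p q D1 D \<epsilon> C"
    by (rule moser_data.intro[OF l1.wt_measurable l2.wt_measurable l1.wt_nonneg l2.wt_nonneg _ _ l1.wt_integrable l2.wt_integrable
          l1.wt_pos p D \<epsilon> C(1)]) (simp add: wt_def, simp add: wt_def, rule C(2), assumption+, rule C(3))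
  then show ?thesis by blast
qed

text \<open>Bounds as functions of a single norm: an inhomogeneous term, divided by its power of
  \<open>s\<close>, contributes at most the mass of the ball, so neither \<open>e\<close>,
  \<open>f\<close>, \<open>g\<close> nor \<open>s\<close> appears here or in \<open>Pd1\<close> and
  \<open>Pd2\<close>.\<close>

definition Pb :: "real \<Rightarrow> real" where "Pb n = 2 powr (D1 / (p - 1)) * (n powr (D1 / (p - 1)) + W1)"
definition Pc :: "real \<Rightarrow> real" where "Pc n = n powr (D / (1 - \<epsilon>))"
definition Pd1 :: "real \<Rightarrow> real" where "Pd1 n = 2 powr (D1 / (p - \<epsilon>)) * (n powr (D1 / (p - \<epsilon>)) + W1)"
definition Pd2 :: "real \<Rightarrow> real" where "Pd2 n = 2 powr (D / (p - \<epsilon>)) * (n powr (D / (p - \<epsilon>)) + W2)"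

end

locale weighted_solution = weighted_setting \<Omega> w1 w2 p q D1 D \<epsilon> x0
  for \<Omega> :: "(real ^ 'n) set" and w1 w2 p q D1 D \<epsilon> x0 +
  fixes A :: "real ^ 'n \<Rightarrow> real \<Rightarrow> real ^ 'n \<Rightarrow> real ^ 'n" and B :: "real ^ 'n \<Rightarrow> real \<Rightarrow> real ^ 'n \<Rightarrow> real"
    and a :: real and b c d1 d2 e f g u :: "real ^ 'n \<Rightarrow> real"
  assumes comp: "measurable_compositions p w1 \<Omega> A B" and a: "0 < a"
    and coef: "\<And>h. h \<in> {b, c, d1, d2, e, f, g} \<Longrightarrow> coefficient \<Omega> h"
    and str: "structure_conditions \<Omega> p w1 w2 A B a b c d1 d2 e f g"
    and Lb: "b \<in> Lspace (D1 / (p - 1)) w1 (ball x0 2)" and Le: "e \<in> Lspace (D1 / (p - 1)) w1 (ball x0 2)"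
    and Lc: "(\<lambda>x. c x * (w2 x / w1 x) powr (1 - 1 / p)) \<in> Lspace (D / (1 - \<epsilon>)) w2 (ball x0 2)"
    and Ld1: "d1 \<in> Lspace (D1 / (p - \<epsilon>)) w1 (ball x0 2)" and Lg: "g \<in> Lspace (D1 / (p - \<epsilon>)) w1 (ball x0 2)"
    and Ld2: "d2 \<in> Lspace (D / (p - \<epsilon>)) w2 (ball x0 2)" and Lf: "f \<in> Lspace (D / (p - \<epsilon>)) w2 (ball x0 2)"
    and sol: "weak_solution p w1 A B (ball x0 2) u"
begin

lemma coef_nonneg: "x \<in> ball x0 2 \<Longrightarrow> h \<in> {b, c, d1, d2, e, f, g} \<Longrightarrow> 0 \<le> h x"
  using coef[of h] \<Omega> by (auto simp: coefficient_def)

lemma coef_measurable [measurable]: "h \<in> {b, c, d1, d2, e, f, g} \<Longrightarrow> (\<lambda>x. I74 x * h x) \<in> borel_measurable lebesgue"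
  using indicator_measurable_lebesgue[of h \<Omega> "ball x0 (7 / 4)"] coef[of h] \<Omega> l1.B74(1) by (auto simp: coefficient_def)

lemma H1_on_ball: "H1_loc p w1 (ball x0 2) u v \<Longrightarrow> H1 p w1 (ball x0 (7 / 4)) u v"
  unfolding H1_loc_def by (auto simp: closure_ball subset_iff)

lemma u_measurable: "u \<in> borel_measurable (lebesgue_on (ball x0 (7 / 4)))"
proof -
  obtain v where "H1_loc p w1 (ball x0 2) u v" using sol by (auto simp: weak_solution_def)
  from H1_on_ball[OF this] show ?thesis by (auto simp: H1_def Lspace_def)
qed

text \<open>Each averaged norm in \<open>k_const\<close> is at most the matching power of the
  divisor, s^(p - 1) for \<open>e\<close> and \<open>f\<close>, s^p for \<open>g\<close>, by which
  that term is going to be divided.\<close>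

lemma k_const_leD:
  assumes s: "0 < s" and k: "k_const p \<epsilon> D1 D w1 w2 (ball x0 2) e f g \<le> ennreal s"
  shows "wavg w1 (ball x0 2) (\<lambda>x. ennreal (\<bar>e x\<bar> powr (D1 / (p - 1)))) \<le> ennreal ((s powr (p - 1)) powr (D1 / (p - 1)))"
    "wavg w2 (ball x0 2) (\<lambda>x. ennreal (\<bar>f x\<bar> powr (D / (p - \<epsilon>)))) \<le> ennreal ((s powr (p - 1)) powr (D / (p - \<epsilon>)))"
    "wavg w1 (ball x0 2) (\<lambda>x. ennreal (\<bar>g x\<bar> powr (D1 / (p - \<epsilon>)))) \<le> ennreal ((s powr p) powr (D1 / (p - \<epsilon>)))"
proof -
  let ?e = "wavg w1 (ball x0 2) (\<lambda>x. ennreal (\<bar>e x\<bar> powr (D1 / (p - 1))))"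
  let ?f = "wavg w2 (ball x0 2) (\<lambda>x. ennreal (\<bar>f x\<bar> powr (D / (p - \<epsilon>))))"
  let ?g = "wavg w1 (ball x0 2) (\<lambda>x. ennreal (\<bar>g x\<bar> powr (D1 / (p - \<epsilon>))))"
  have pos: "0 < p - 1" "0 < p - \<epsilon>" "0 < D1" "0 < D" "0 < p" using p \<epsilon> by (auto simp: D)
  have k1: "epowr (epowr ?e ((p - 1) / D1) + epowr ?f ((p - \<epsilon>) / D)) (1 / (p - 1)) \<le> ennreal s"
    and k2: "epowr (epowr ?g ((p - \<epsilon>) / D1)) (1 / p) \<le> ennreal s"
    using add_le_ennrealD[OF k[unfolded k_const_def]] by simp_all
  have "epowr ?e ((p - 1) / D1) + epowr ?f ((p - \<epsilon>) / D) \<le> ennreal (s powr (1 / (1 / (p - 1))))"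
    by (rule epowr_le_ennrealD) (use pos s k1 in auto)
  then have "epowr ?e ((p - 1) / D1) + epowr ?f ((p - \<epsilon>) / D) \<le> ennreal (s powr (p - 1))" by simp
  note ef = add_le_ennrealD[OF this]
  have g: "epowr ?g ((p - \<epsilon>) / D1) \<le> ennreal (s powr (1 / (1 / p)))"
    by (rule epowr_le_ennrealD) (use pos s k2 in auto)
  have "?e \<le> ennreal ((s powr (p - 1)) powr (1 / ((p - 1) / D1)))" by (rule epowr_le_ennrealD) (use pos ef in auto)
  then show "?e \<le> ennreal ((s powr (p - 1)) powr (D1 / (p - 1)))" by simp
  have "?f \<le> ennreal ((s powr (p - 1)) powr (1 / ((p - \<epsilon>) / D)))" by (rule epowr_le_ennrealD) (use pos ef in auto)
  then show "?f \<le> ennreal ((s powr (p - 1)) powr (D / (p - \<epsilon>)))" by simp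
  have "?g \<le> ennreal ((s powr p) powr (1 / ((p - \<epsilon>) / D1)))" by (rule epowr_le_ennrealD) (use pos g in auto)
  then show "?g \<le> ennreal ((s powr p) powr (D1 / (p - \<epsilon>)))" by simp
qed

end

context weighted_solution
begin

text \<open>Multiplication by the indicator of the ball of radius 7/4 makes all functions measurable
  on the whole space. Nothing is lost: the test functions live in radius 3/2 and the cut-off weights
  vanish outside. The number \<open>s\<close> takes the place of \<open>k\<close>.\<close>

lemma ex_weak_data:
  assumes md: "moser_data x0 (wt x0 w1) (wt x0 w2) p q D1 D \<epsilon> Cs" and s: "0 < s"
    and k: "k_const p \<epsilon> D1 D w1 w2 (ball x0 2) e f g \<le> ennreal s"
  shows "\<exists>v \<phi> E N0 A' B' b' c' d1' d2'. weak_data x0 (wt x0 w1) (wt x0 w2) p q D1 D \<epsilon> Cs (\<lambda>x. I74 x * u x) v \<phi> E N0 A' B' b' c' d1' d2' a s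
    (Pb (enn2real (Lnorm (D1 / (p - 1)) w1 (ball x0 2) b)))
    (Pc (enn2real (Lnorm (D / (1 - \<epsilon>)) w2 (ball x0 2) (\<lambda>x. c x * (w2 x / w1 x) powr (1 - 1 / p)))))
    (Pd1 (enn2real (Lnorm (D1 / (p - \<epsilon>)) w1 (ball x0 2) d1)))
    (Pd2 (enn2real (Lnorm (D / (p - \<epsilon>)) w2 (ball x0 2) d2)))"
proof -
  interpret m: moser_data x0 "wt x0 w1" "wt x0 w2" p q D1 D \<epsilon> Cs by (rule md)
  let ?V = "ball x0 (7 / 4)"
  have V2: "y \<in> ball x0 2" if "y \<in> ?V" for y using that by auto
  have p0: "0 < p" "0 < p - 1" "0 < p - \<epsilon>" "0 < 1 - \<epsilon>" using p \<epsilon> by auto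
  have Vm: "?V \<in> sets lebesgue" "ball x0 2 \<in> sets lebesgue" by auto
  obtain v where v: "H1_loc p w1 (ball x0 2) u v"
    and test: "\<And>\<psi>. test_function (ball x0 2) \<psi> \<Longrightarrow>
         set_integrable lebesgue (ball x0 2) (\<lambda>x. A x (u x) (v x) \<bullet> grad \<psi> x + B x (u x) (v x) * \<psi> x) \<and>
         (LINT x:ball x0 2|lebesgue. A x (u x) (v x) \<bullet> grad \<psi> x + B x (u x) (v x) * \<psi> x) = 0"
    using sol unfolding weak_solution_def by (elim exE conjE) blast
  have H: "H1 p w1 ?V u v" by (rule H1_on_ball[OF v])
  have mv: "v \<in> borel_measurable (lebesgue_on ?V)" using H by (intro borel_measurable_vecI) (auto simp: H1_def Lspace_def)
  obtain \<phi> N0 where \<phi>: "\<And>n. Ck_on 1 ?V (\<phi> n)" "\<And>n. \<phi> n \<in> borel_measurable (lebesgue_on ?V)"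
    "\<And>n i. pderivative i (\<phi> n) \<in> borel_measurable (lebesgue_on ?V)"
    "\<And>n. (\<integral>\<^sup>+y. ennreal ((norm (grad (\<phi> n) y - v y) powr p + \<bar>\<phi> n y - u y\<bar> powr p) * wt x0 w1 y) \<partial>lebesgue) \<le> ennreal ((1 / 2) ^ n)"
    and N0: "0 \<le> N0" "(\<integral>\<^sup>+y. ennreal ((norm (v y) powr p + \<bar>u y\<bar> powr p) * wt x0 w1 y) \<partial>lebesgue) \<le> ennreal N0"
    by (rule l1.H1_approximation[OF p0(1) H]) blast
  have mg: "grad (\<phi> n) \<in> borel_measurable (lebesgue_on ?V)" for n
    by (rule borel_measurable_vecI) (simp add: grad_def \<phi>(3))
  have mAB: "(\<lambda>x. A x (u x) (v x)) \<in> borel_measurable (lebesgue_on (ball x0 2))" "(\<lambda>x. B x (u x) (v x)) \<in> borel_measurable (lebesgue_on (ball x0 2))"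
    using comp v \<Omega>(2) unfolding measurable_compositions_def by auto
  note im = indicator_measurable_lebesgue
  have sub: "?V \<subseteq> ball x0 2" by auto
  let ?u = "\<lambda>x. I74 x * u x" and ?v = "\<lambda>x. I74 x *\<^sub>R v x"
  let ?\<phi> = "\<lambda>n x. I74 x * \<phi> n x" and ?E = "\<lambda>n x. I74 x *\<^sub>R grad (\<phi> n) x"
  let ?A = "\<lambda>x. I74 x *\<^sub>R A x (u x) (v x)" and ?B = "\<lambda>x. I74 x * B x (u x) (v x)"
  let ?b = "\<lambda>x. I74 x * (b x + e x / s powr (p - 1))" and ?c = "\<lambda>x. I74 x * c x"
  let ?d1 = "\<lambda>x. I74 x * (d1 x + g x / s powr p)" and ?d2 = "\<lambda>x. I74 x * (d2 x + f x / s powr (p - 1))"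
  have appr: "approximated x0 (wt x0 w1) (wt x0 w2) p q D1 D \<epsilon> Cs ?u ?v ?\<phi> ?E N0"
  proof (intro approximated.intro[OF md] approximated_axioms.intro)
    show "?u \<in> borel_measurable lebesgue" using im[OF u_measurable Vm(1) Vm(1)] by simp
    show "?v \<in> borel_measurable lebesgue" by (rule im[OF mv Vm(1) Vm(1) order_refl])
    show "?\<phi> n \<in> borel_measurable lebesgue" for n using im[OF \<phi>(2) Vm(1) Vm(1)] by simp
    show "?E n \<in> borel_measurable lebesgue" for n by (rule im[OF mg Vm(1) Vm(1) order_refl])
    show "C1_on ?V (?\<phi> n) (?E n)" for n
      by (rule C1_on_cong[OF Ck_on_1_C1_on[OF \<phi>(1)]]) auto
    show "m.En (\<lambda>y. ?\<phi> n y - ?u y) (\<lambda>y. ?E n y - ?v y) \<le> ennreal ((1 / 2) ^ n)" for n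
    proof -
      have "m.En (\<lambda>y. ?\<phi> n y - ?u y) (\<lambda>y. ?E n y - ?v y)
        = (\<integral>\<^sup>+y. ennreal ((norm (grad (\<phi> n) y - v y) powr p + \<bar>\<phi> n y - u y\<bar> powr p) * wt x0 w1 y) \<partial>lebesgue)"
        unfolding m.En_def by (rule nn_integral_cong) (auto simp: wt_def indicator_def)
      then show ?thesis using \<phi>(4) by simp
    qed
    show "0 \<le> N0" by (rule N0)
    show "m.En ?u ?v \<le> ennreal N0"
    proof -
      have "m.En ?u ?v = (\<integral>\<^sup>+y. ennreal ((norm (v y) powr p + \<bar>u y\<bar> powr p) * wt x0 w1 y) \<partial>lebesgue)"
        unfolding m.En_def by (rule nn_integral_cong) (auto simp: wt_def indicator_def)
      then show ?thesis using N0 by simp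
    qed
  qed
  have nn: "0 \<le> b y" "0 \<le> c y" "0 \<le> d1 y" "0 \<le> d2 y" "0 \<le> e y" "0 \<le> f y" "0 \<le> g y" if "y \<in> ?V" for y
    using coef_nonneg[OF V2[OF that]] by auto
  have st: "A y (u y) (v y) \<bullet> v y \<ge> w1 y * (inverse a * norm (v y) powr p - d1 y * \<bar>u y\<bar> powr p - g y)"
       "norm (A y (u y) (v y)) \<le> w1 y * (a * norm (v y) powr (p - 1) + b y * \<bar>u y\<bar> powr (p - 1) + e y)"
       "\<bar>B y (u y) (v y)\<bar> \<le> w2 y * (c y * norm (v y) powr (p - 1) + d2 y * \<bar>u y\<bar> powr (p - 1) + f y)" if "y \<in> ?V" for y
    using str \<Omega>(2) V2[OF that] unfolding structure_conditions_def by auto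
  note kb = k_const_leD[OF s k]
  have D0: "0 < D1 / (p - 1)" "0 < D1 / (p - \<epsilon>)" "0 < D / (p - \<epsilon>)" "0 < D / (1 - \<epsilon>)"
    using p0 m.Q1 m.Dq by auto
  have wd: "weak_data x0 (wt x0 w1) (wt x0 w2) p q D1 D \<epsilon> Cs ?u ?v ?\<phi> ?E N0 ?A ?B ?b ?c ?d1 ?d2 a s
    (Pb (enn2real (Lnorm (D1 / (p - 1)) w1 (ball x0 2) b)))
    (Pc (enn2real (Lnorm (D / (1 - \<epsilon>)) w2 (ball x0 2) (\<lambda>x. c x * (w2 x / w1 x) powr (1 - 1 / p)))))
    (Pd1 (enn2real (Lnorm (D1 / (p - \<epsilon>)) w1 (ball x0 2) d1)))
    (Pd2 (enn2real (Lnorm (D / (p - \<epsilon>)) w2 (ball x0 2) d2)))"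
  proof (intro weak_data.intro[OF appr] weak_data_axioms.intro)
    show "?A \<in> borel_measurable lebesgue" by (rule im[OF mAB(1) Vm(2) Vm(1) sub])
    show "?B \<in> borel_measurable lebesgue" using im[OF mAB(2) Vm(2) Vm(1) sub] by simp
    have quot: "(\<lambda>x. I74 x * (h x + h' x / r)) \<in> borel_measurable lebesgue"
      if h: "h \<in> {b, c, d1, d2, e, f, g}" "h' \<in> {b, c, d1, d2, e, f, g}" for h h' r
    proof -
      note [measurable] = coef_measurable[OF h(1)] coef_measurable[OF h(2)]
      have "(\<lambda>x. I74 x * h x + I74 x * h' x / r) \<in> borel_measurable lebesgue" by measurable
      then show ?thesis by (simp add: distrib_left)
    qed
    show "?b \<in> borel_measurable lebesgue" "?d1 \<in> borel_measurable lebesgue" "?d2 \<in> borel_measurable lebesgue"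
      by (rule quot; simp)+
    show "?c \<in> borel_measurable lebesgue" by (rule coef_measurable) simp
    show "0 \<le> ?b x" "0 \<le> ?c x" "0 \<le> ?d1 x" "0 \<le> ?d2 x" for x
      using nn[of x] s by (auto simp: indicator_def)
    show "0 < a" "0 < s" by (rule a s)+
    show "0 \<le> Pb (enn2real (Lnorm (D1 / (p - 1)) w1 (ball x0 2) b))"
      "0 \<le> Pc (enn2real (Lnorm (D / (1 - \<epsilon>)) w2 (ball x0 2) (\<lambda>x. c x * (w2 x / w1 x) powr (1 - 1 / p))))"
      "0 \<le> Pd1 (enn2real (Lnorm (D1 / (p - \<epsilon>)) w1 (ball x0 2) d1))"
      "0 \<le> Pd2 (enn2real (Lnorm (D / (p - \<epsilon>)) w2 (ball x0 2) d2))"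
      using W1(1) W2(1) by (auto simp: Pb_def Pc_def Pd1_def Pd2_def)
    show "(\<integral>\<^sup>+x. ennreal (?b x powr (D1 / (p - 1)) * wt x0 w1 x) \<partial>lebesgue) \<le> ennreal (Pb (enn2real (Lnorm (D1 / (p - 1)) w1 (ball x0 2) b)))"
      unfolding Pb_def by (rule l1.coefficient_plus_wt_le[OF Lb nn(1) Le nn(5) D0(1) _ W1 kb(1)]) (use s in auto)
    show "(\<integral>\<^sup>+x. ennreal (?d1 x powr (D1 / (p - \<epsilon>)) * wt x0 w1 x) \<partial>lebesgue) \<le> ennreal (Pd1 (enn2real (Lnorm (D1 / (p - \<epsilon>)) w1 (ball x0 2) d1)))"
      unfolding Pd1_def by (rule l1.coefficient_plus_wt_le[OF Ld1 nn(3) Lg nn(7) D0(2) _ W1 kb(3)]) (use s in auto)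
    show "(\<integral>\<^sup>+x. ennreal (?d2 x powr (D / (p - \<epsilon>)) * wt x0 w2 x) \<partial>lebesgue) \<le> ennreal (Pd2 (enn2real (Lnorm (D / (p - \<epsilon>)) w2 (ball x0 2) d2)))"
      unfolding Pd2_def by (rule l2.coefficient_plus_wt_le[OF Ld2 nn(4) Lf nn(6) D0(3) _ W2 kb(2)]) (use s in auto)
    show "(\<integral>\<^sup>+x. ennreal ((?c x * (wt x0 w2 x / wt x0 w1 x) powr (1 - 1 / p)) powr (D / (1 - \<epsilon>)) * wt x0 w2 x) \<partial>lebesgue)
      \<le> ennreal (Pc (enn2real (Lnorm (D / (1 - \<epsilon>)) w2 (ball x0 2) (\<lambda>x. c x * (w2 x / w1 x) powr (1 - 1 / p)))))"
    proof -
      have "(\<integral>\<^sup>+x. ennreal ((?c x * (wt x0 w2 x / wt x0 w1 x) powr (1 - 1 / p)) powr (D / (1 - \<epsilon>)) * wt x0 w2 x) \<partial>lebesgue)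
        = (\<integral>\<^sup>+x. ennreal ((I74 x * (c x * (w2 x / w1 x) powr (1 - 1 / p))) powr (D / (1 - \<epsilon>)) * wt x0 w2 x) \<partial>lebesgue)"
        by (rule nn_integral_cong) (auto simp: wt_def indicator_def)
      also have "\<dots> \<le> ennreal (Pc (enn2real (Lnorm (D / (1 - \<epsilon>)) w2 (ball x0 2) (\<lambda>x. c x * (w2 x / w1 x) powr (1 - 1 / p)))))"
        unfolding Pc_def by (rule l2.Lnorm_wt_le[OF Lc D0(4)]) (simp add: nn)
      finally show ?thesis .
    qed
    show "wt x0 w1 x * (inverse a * norm (?v x) powr p - ?d1 x * (\<bar>?u x\<bar> + s) powr p) \<le> ?A x \<bullet> ?v x" for x
    proof (cases "x \<in> ?V")
      case True
      have "d1 x * \<bar>u x\<bar> powr p + g x \<le> (d1 x + g x / s powr p) * (\<bar>u x\<bar> + s) powr p"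
        by (rule absorb_constant) (use nn[OF True] s p0 in auto)
      then have "w1 x * (inverse a * norm (v x) powr p - (d1 x + g x / s powr p) * (\<bar>u x\<bar> + s) powr p)
        \<le> w1 x * (inverse a * norm (v x) powr p - d1 x * \<bar>u x\<bar> powr p - g x)"
        by (intro mult_left_mono l1.w_nonneg V2 True) simp
      also note st(1)[OF True]
      finally show ?thesis using True by (simp add: wt_def)
    qed (simp add: wt_def)
    show "norm (?A x) \<le> wt x0 w1 x * (a * norm (?v x) powr (p - 1) + ?b x * (\<bar>?u x\<bar> + s) powr (p - 1))" for x
    proof (cases "x \<in> ?V")
      case True
      have 1: "b x * \<bar>u x\<bar> powr (p - 1) + e x \<le> (b x + e x / s powr (p - 1)) * (\<bar>u x\<bar> + s) powr (p - 1)"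
        by (rule absorb_constant) (use nn[OF True] s p0 in auto)
      note st(2)[OF True]
      also have "w1 x * (a * norm (v x) powr (p - 1) + b x * \<bar>u x\<bar> powr (p - 1) + e x)
        \<le> w1 x * (a * norm (v x) powr (p - 1) + (b x + e x / s powr (p - 1)) * (\<bar>u x\<bar> + s) powr (p - 1))"
        by (intro mult_left_mono l1.w_nonneg V2 True) (use 1 in simp)
      finally show ?thesis using True by (simp add: wt_def)
    qed (simp add: wt_def)
    show "\<bar>?B x\<bar> \<le> wt x0 w2 x * (?c x * norm (?v x) powr (p - 1) + ?d2 x * (\<bar>?u x\<bar> + s) powr (p - 1))" for x
    proof (cases "x \<in> ?V")
      case True
      have 1: "d2 x * \<bar>u x\<bar> powr (p - 1) + f x \<le> (d2 x + f x / s powr (p - 1)) * (\<bar>u x\<bar> + s) powr (p - 1)"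
        by (rule absorb_constant) (use nn[OF True] s p0 in auto)
      note st(3)[OF True]
      also have "w2 x * (c x * norm (v x) powr (p - 1) + d2 x * \<bar>u x\<bar> powr (p - 1) + f x)
        \<le> w2 x * (c x * norm (v x) powr (p - 1) + (d2 x + f x / s powr (p - 1)) * (\<bar>u x\<bar> + s) powr (p - 1))"
        by (intro mult_left_mono l2.w_nonneg V2 True) (use 1 in simp)
      finally show ?thesis using True by (simp add: wt_def)
    qed (simp add: wt_def)
    fix \<psi> :: "real ^ 'n \<Rightarrow> real"
    assume C: "\<And>k. Ck_on k UNIV \<psi>" and out: "\<And>y. y \<notin> cball x0 (3 / 2) \<Longrightarrow> \<psi> y = 0"
    have cl: "closure {x. \<psi> x \<noteq> 0} \<subseteq> cball x0 (3 / 2)"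
      using out by (intro closure_minimal closed_cball) blast
    have tf: "test_function (ball x0 2) \<psi>"
      unfolding test_function_def
    proof (intro conjI allI C)
      show "compact (closure {x. \<psi> x \<noteq> 0})" using bounded_subset[OF bounded_cball cl] by (simp add: compact_eq_bounded_closed)
      show "closure {x. \<psi> x \<noteq> 0} \<subseteq> ball x0 2" using cl by (rule order_trans) auto
    qed
    have g0: "grad \<psi> x = 0" if "x \<notin> cball x0 (3 / 2)" for x
      by (rule C1_on_outside_support[OF Ck_on_1_C1_on[OF C] closed_cball out that])
    have eq: "(\<lambda>x. ?A x \<bullet> grad \<psi> x + ?B x * \<psi> x)
      = (\<lambda>x. indicat_real (ball x0 2) x *\<^sub>R (A x (u x) (v x) \<bullet> grad \<psi> x + B x (u x) (v x) * \<psi> x))"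
    proof
      fix x
      show "?A x \<bullet> grad \<psi> x + ?B x * \<psi> x = indicat_real (ball x0 2) x *\<^sub>R (A x (u x) (v x) \<bullet> grad \<psi> x + B x (u x) (v x) * \<psi> x)"
      proof (cases "x \<in> cball x0 (3 / 2)")
        case False
        then show ?thesis using g0[OF False] out[OF False] by simp
      qed simp
    qed
    show "integrable lebesgue (\<lambda>x. ?A x \<bullet> grad \<psi> x + ?B x * \<psi> x) \<and> (\<integral>x. ?A x \<bullet> grad \<psi> x + ?B x * \<psi> x \<partial>lebesgue) = 0"
      unfolding eq using test[OF tf] unfolding set_integrable_def set_lebesgue_integral_def .
  qed
  then show ?thesis by blast
qed

end

text \<open>The four norms are fixed as numbers before \<open>K\<close> is obtained; coefficients
  enter afterwards, through equations with these numbers. This order of quantifiers is the claimed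
  dependence of the constant.\<close>

lemma (in weighted_setting) local_bound:
  assumes a: "0 < a"
  obtains K where "0 < K" "\<And>A B b c d1 d2 e f g u s.
    weighted_solution \<Omega> w1 w2 p q D1 D \<epsilon> x0 A B a b c d1 d2 e f g u \<Longrightarrow>
    nb = enn2real (Lnorm (D1 / (p - 1)) w1 (ball x0 2) b) \<Longrightarrow>
    nc = enn2real (Lnorm (D / (1 - \<epsilon>)) w2 (ball x0 2) (\<lambda>x. c x * (w2 x / w1 x) powr (1 - 1 / p))) \<Longrightarrow>
    nd1 = enn2real (Lnorm (D1 / (p - \<epsilon>)) w1 (ball x0 2) d1) \<Longrightarrow>
    nd2 = enn2real (Lnorm (D / (p - \<epsilon>)) w2 (ball x0 2) d2) \<Longrightarrow>
    0 < s \<Longrightarrow> k_const p \<epsilon> D1 D w1 w2 (ball x0 2) e f g \<le> ennreal s \<Longrightarrow>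
    bracket (k_const p \<epsilon> D1 D w1 w2 (ball x0 2) e f g) w1 w2 p (ball x0 2) u \<le> ennreal s \<Longrightarrow>
    esssup (lebesgue_on (ball x0 1)) (\<lambda>x. ennreal \<bar>u x\<bar>) \<le> ennreal (K * s)"
proof -
  have p0: "0 < p" using p by simp
  obtain Cs where md: "moser_data x0 (wt x0 w1) (wt x0 w2) p q D1 D \<epsilon> Cs" using ex_moser_data by blast
  interpret m: moser_data x0 "wt x0 w1" "wt x0 w2" p q D1 D \<epsilon> Cs by (rule md)
  obtain C where C: "0 < C" "\<And>u v \<phi> E N0 A B b c d1 d2 k J.
    weak_data x0 (wt x0 w1) (wt x0 w2) p q D1 D \<epsilon> Cs u v \<phi> E N0 A B b c d1 d2 a k (Pb nb) (Pc nc) (Pd1 nd1) (Pd2 nd2) \<Longrightarrow>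
    0 < J \<Longrightarrow> (\<integral>\<^sup>+y. ennreal ((\<bar>u y\<bar> + k) powr p * wt x0 w1 y) \<partial>lebesgue) \<le> ennreal J \<Longrightarrow>
    (\<integral>\<^sup>+y. ennreal ((\<bar>u y\<bar> + k) powr p * wt x0 w2 y) \<partial>lebesgue) \<le> ennreal J \<Longrightarrow>
    AE y in lebesgue. y \<in> ball x0 1 \<longrightarrow> (\<bar>u y\<bar> + k) powr p \<le> C * J"
    by (rule m.moser_bound[OF a]) (rule that)
  define W where "W = W1 + W2"
  define K where "K = (C * (2 powr p * (2 * W))) powr (1 / p)"
  have W: "0 < W" "W1 \<le> W" "W2 \<le> W" using W1(1) W2(1) by (auto simp: W_def)
  have K: "0 < K" using C W by (simp add: K_def)
  show ?thesis
  proof (rule that[OF K])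
    fix A B b c d1 d2 e f g u s
    assume ws: "weighted_solution \<Omega> w1 w2 p q D1 D \<epsilon> x0 A B a b c d1 d2 e f g u"
      and n: "nb = enn2real (Lnorm (D1 / (p - 1)) w1 (ball x0 2) b)"
        "nc = enn2real (Lnorm (D / (1 - \<epsilon>)) w2 (ball x0 2) (\<lambda>x. c x * (w2 x / w1 x) powr (1 - 1 / p)))"
        "nd1 = enn2real (Lnorm (D1 / (p - \<epsilon>)) w1 (ball x0 2) d1)"
        "nd2 = enn2real (Lnorm (D / (p - \<epsilon>)) w2 (ball x0 2) d2)"
      and s: "0 < s" and k: "k_const p \<epsilon> D1 D w1 w2 (ball x0 2) e f g \<le> ennreal s"
      and br: "bracket (k_const p \<epsilon> D1 D w1 w2 (ball x0 2) e f g) w1 w2 p (ball x0 2) u \<le> ennreal s"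
    interpret ws: weighted_solution \<Omega> w1 w2 p q D1 D \<epsilon> x0 A B a b c d1 d2 e f g u by (rule ws)
    let ?k = "k_const p \<epsilon> D1 D w1 w2 (ball x0 2) e f g"
    let ?u = "\<lambda>y. I74 y * u y" and ?J = "2 powr p * (2 * W) * s powr p"
    have mu: "?u \<in> borel_measurable lebesgue"
      using indicator_measurable_lebesgue[OF ws.u_measurable] by simp
    have av: "wavg w1 (ball x0 2) (\<lambda>x. epowr (ennreal \<bar>u x\<bar> + ?k) p) \<le> ennreal (s powr p)"
      "wavg w2 (ball x0 2) (\<lambda>x. epowr (ennreal \<bar>u x\<bar> + ?k) p) \<le> ennreal (s powr p)"
    proof -
      note b = add_le_ennrealD[OF br[unfolded bracket_def]]
      show "wavg w1 (ball x0 2) (\<lambda>x. epowr (ennreal \<bar>u x\<bar> + ?k) p) \<le> ennreal (s powr p)"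
        using epowr_le_ennrealD[OF _ _ b(1)] p0 s by simp
      show "wavg w2 (ball x0 2) (\<lambda>x. epowr (ennreal \<bar>u x\<bar> + ?k) p) \<le> ennreal (s powr p)"
        using epowr_le_ennrealD[OF _ _ b(2)] p0 s by simp
    qed
    have J: "2 powr p * (s powr p * V + s powr p * V) \<le> ?J" if "V \<le> W" for V
    proof -
      have "2 powr p * (s powr p * V + s powr p * V) = (2 powr p * 2 * s powr p) * V" by (simp add: algebra_simps)
      also have "\<dots> \<le> (2 powr p * 2 * s powr p) * W" using that by (intro mult_left_mono) auto
      finally show ?thesis by (simp add: algebra_simps)
    qed
    obtain v \<phi> E N0 A' B' b' c' d1' d2' where wd: "weak_data x0 (wt x0 w1) (wt x0 w2) p q D1 D \<epsilon> Cs ?u v \<phi> E N0 A' B' b' c' d1' d2' a s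
      (Pb nb) (Pc nc) (Pd1 nd1) (Pd2 nd2)"
      using ws.ex_weak_data[OF md s k] unfolding n[symmetric] by (elim exE)
    have "AE y in lebesgue. y \<in> ball x0 1 \<longrightarrow> (\<bar>?u y\<bar> + s) powr p \<le> C * ?J"
    proof (rule C(2)[OF wd])
      show "0 < ?J" using W s by simp
      show "(\<integral>\<^sup>+y. ennreal ((\<bar>?u y\<bar> + s) powr p * wt x0 w1 y) \<partial>lebesgue) \<le> ennreal ?J"
        using l1.bracket_wt_le[OF mu p0 s W1 av(1)] ennreal_leI[OF J[OF W(2)]] by (rule order_trans)
      show "(\<integral>\<^sup>+y. ennreal ((\<bar>?u y\<bar> + s) powr p * wt x0 w2 y) \<partial>lebesgue) \<le> ennreal ?J"
        using l2.bracket_wt_le[OF mu p0 s W2 av(2)] ennreal_leI[OF J[OF W(3)]] by (rule order_trans)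
    qed
    then have "AE y in lebesgue. y \<in> ball x0 1 \<longrightarrow> ennreal \<bar>u y\<bar> \<le> ennreal (K * s)"
    proof eventually_elim
      case (elim y)
      show ?case
      proof
        assume y: "y \<in> ball x0 1"
        then have "(\<bar>u y\<bar> + s) powr p \<le> C * ?J" using elim by auto
        then have "((\<bar>u y\<bar> + s) powr p) powr (1 / p) \<le> (C * ?J) powr (1 / p)" using p0 by (intro powr_mono2) auto
        also have "(C * ?J) powr (1 / p) = K * s"
          unfolding K_def mult.assoc[symmetric] powr_mult[of _ "s powr p"] using p0 s by (simp add: powr_powr)
        finally have "\<bar>u y\<bar> + s \<le> K * s" using p0 s by (simp add: powr_powr)
        then show "ennreal \<bar>u y\<bar> \<le> ennreal (K * s)" using s by (intro ennreal_leI) simp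
      qed
    qed
    then have ae: "AE y in lebesgue_on (ball x0 1). ennreal \<bar>u y\<bar> \<le> ennreal (K * s)"
      by (simp add: AE_restrict_space_iff)
    have "u \<in> borel_measurable (lebesgue_on (ball x0 1))"
      by (rule measurable_restrict_mono[OF ws.u_measurable]) auto
    then show "esssup (lebesgue_on (ball x0 1)) (\<lambda>x. ennreal \<bar>u x\<bar>) \<le> ennreal (K * s)"
      by (intro esssup_I ae) measurable
  qed
qed

theorem theorem1p1:
  fixes \<Omega> :: "(real ^ 'n) set"
    and w1 w2 :: "real ^ 'n \<Rightarrow> real"
    and p q D1 D \<epsilon> :: real
    and x0 :: "real ^ 'n"
  assumes "open \<Omega>"
    and "loc_integrable_weight \<Omega> w1" and "loc_integrable_weight \<Omega> w2"
    and "doubling_weight \<Omega> w1" and "doubling_weight \<Omega> w2"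
    and "poincare_weight \<Omega> p w1"
    and "q > p" and "balanced_weights \<Omega> p q w1 w2"
    and "D1 = log 2 (doubling_const \<Omega> w1)"
    and "D = q * p / (q - p)"
    and "1 < p" and "p < min D1 D"
    and "0 < \<epsilon>" and "\<epsilon> < 1"
    and "ball x0 2 \<subseteq> \<Omega>"
  shows "\<exists>K :: real \<Rightarrow> real \<Rightarrow> real \<Rightarrow> real \<Rightarrow> real \<Rightarrow> real.
    (\<forall>a nb nc nd1 nd2. 0 < K a nb nc nd1 nd2) \<and>
    (\<forall>(A :: real ^ 'n \<Rightarrow> real \<Rightarrow> real ^ 'n \<Rightarrow> real ^ 'n)
      (B :: real ^ 'n \<Rightarrow> real \<Rightarrow> real ^ 'n \<Rightarrow> real)
      (a :: real)
      (b :: real ^ 'n \<Rightarrow> real) (c :: real ^ 'n \<Rightarrow> real)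
      (d1 :: real ^ 'n \<Rightarrow> real) (d2 :: real ^ 'n \<Rightarrow> real)
      (e :: real ^ 'n \<Rightarrow> real) (f :: real ^ 'n \<Rightarrow> real) (g :: real ^ 'n \<Rightarrow> real)
      (u :: real ^ 'n \<Rightarrow> real).
      measurable_compositions p w1 \<Omega> A B \<and> 0 < a \<and>
      (\<forall>h\<in>{b, c, d1, d2, e, f, g}. coefficient \<Omega> h) \<and>
      structure_conditions \<Omega> p w1 w2 A B a b c d1 d2 e f g \<and>
      b \<in> Lspace (D1 / (p - 1)) w1 (ball x0 2) \<and>
      e \<in> Lspace (D1 / (p - 1)) w1 (ball x0 2) \<and>
      (\<lambda>x. c x * (w2 x / w1 x) powr (1 - 1 / p)) \<in> Lspace (D / (1 - \<epsilon>)) w2 (ball x0 2) \<and>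
      d1 \<in> Lspace (D1 / (p - \<epsilon>)) w1 (ball x0 2) \<and>
      g \<in> Lspace (D1 / (p - \<epsilon>)) w1 (ball x0 2) \<and>
      d2 \<in> Lspace (D / (p - \<epsilon>)) w2 (ball x0 2) \<and>
      f \<in> Lspace (D / (p - \<epsilon>)) w2 (ball x0 2) \<and>
      weak_solution p w1 A B (ball x0 2) u
      \<longrightarrow>
      esssup (lebesgue_on (ball x0 1)) (\<lambda>x. ennreal \<bar>u x\<bar>)
      \<le> ennreal (K a
            (enn2real (Lnorm (D1 / (p - 1)) w1 (ball x0 2) b))
            (enn2real (Lnorm (D / (1 - \<epsilon>)) w2 (ball x0 2)
               (\<lambda>x. c x * (w2 x / w1 x) powr (1 - 1 / p))))
            (enn2real (Lnorm (D1 / (p - \<epsilon>)) w1 (ball x0 2) d1))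
            (enn2real (Lnorm (D / (p - \<epsilon>)) w2 (ball x0 2) d2))) *
         (bracket (k_const p \<epsilon> D1 D w1 w2 (ball x0 2) e f g) w1 w2 p (ball x0 2) u
          + k_const p \<epsilon> D1 D w1 w2 (ball x0 2) e f g))"
proof -
  interpret weighted_setting \<Omega> w1 w2 p q D1 D \<epsilon> x0 by unfold_locales (use assms in auto)
  let ?B = "ball x0 2"
  \<comment> \<open>The estimate for all data with prescribed norms becomes a predicate of the
    constant; choosing one constant per tuple of numbers yields a function of \<open>a\<close> and
    the norms alone. For a \<le> 0 only positivity is asked.\<close>
  define good where "good = (\<lambda>a nb nc nd1 nd2 K :: real. 0 < K \<and> (0 < a \<longrightarrow> (\<forall>A B b c d1 d2 e f g u s.
    weighted_solution \<Omega> w1 w2 p q D1 D \<epsilon> x0 A B a b c d1 d2 e f g u \<longrightarrow>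
    nb = enn2real (Lnorm (D1 / (p - 1)) w1 ?B b) \<longrightarrow>
    nc = enn2real (Lnorm (D / (1 - \<epsilon>)) w2 ?B (\<lambda>x. c x * (w2 x / w1 x) powr (1 - 1 / p))) \<longrightarrow>
    nd1 = enn2real (Lnorm (D1 / (p - \<epsilon>)) w1 ?B d1) \<longrightarrow>
    nd2 = enn2real (Lnorm (D / (p - \<epsilon>)) w2 ?B d2) \<longrightarrow>
    0 < s \<longrightarrow> k_const p \<epsilon> D1 D w1 w2 ?B e f g \<le> ennreal s \<longrightarrow>
    bracket (k_const p \<epsilon> D1 D w1 w2 ?B e f g) w1 w2 p ?B u \<le> ennreal s \<longrightarrow>
    esssup (lebesgue_on (ball x0 1)) (\<lambda>x. ennreal \<bar>u x\<bar>) \<le> ennreal (K * s))))"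
  have ex: "\<exists>K. good a nb nc nd1 nd2 K" for a nb nc nd1 nd2
  proof (cases "0 < a")
    case True
    obtain K where "0 < K" "\<And>A B b c d1 d2 e f g u s.
      weighted_solution \<Omega> w1 w2 p q D1 D \<epsilon> x0 A B a b c d1 d2 e f g u \<Longrightarrow>
      nb = enn2real (Lnorm (D1 / (p - 1)) w1 ?B b) \<Longrightarrow>
      nc = enn2real (Lnorm (D / (1 - \<epsilon>)) w2 ?B (\<lambda>x. c x * (w2 x / w1 x) powr (1 - 1 / p))) \<Longrightarrow>
      nd1 = enn2real (Lnorm (D1 / (p - \<epsilon>)) w1 ?B d1) \<Longrightarrow>
      nd2 = enn2real (Lnorm (D / (p - \<epsilon>)) w2 ?B d2) \<Longrightarrow>
      0 < s \<Longrightarrow> k_const p \<epsilon> D1 D w1 w2 ?B e f g \<le> ennreal s \<Longrightarrow>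
      bracket (k_const p \<epsilon> D1 D w1 w2 ?B e f g) w1 w2 p ?B u \<le> ennreal s \<Longrightarrow>
      esssup (lebesgue_on (ball x0 1)) (\<lambda>x. ennreal \<bar>u x\<bar>) \<le> ennreal (K * s)"
      using True by (rule local_bound) (rule that)
    then show ?thesis unfolding good_def by (intro exI[of _ K] conjI impI allI) assumption+
  qed (auto simp: good_def intro!: exI[of _ 1])
  define K where "K = (\<lambda>a nb nc nd1 nd2. SOME K. good a nb nc nd1 nd2 K)"
  have K: "good a nb nc nd1 nd2 (K a nb nc nd1 nd2)" for a nb nc nd1 nd2
    unfolding K_def by (rule someI_ex[OF ex])
  show ?thesis
  proof (intro exI[of _ K] conjI allI impI)
    show K0: "0 < K a nb nc nd1 nd2" for a nb nc nd1 nd2 using K[of a nb nc nd1 nd2] by (simp add: good_def)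
    fix A B a b c d1 d2 e f g u
    let ?k = "k_const p \<epsilon> D1 D w1 w2 ?B e f g"
    let ?nb = "enn2real (Lnorm (D1 / (p - 1)) w1 ?B b)"
    let ?nc = "enn2real (Lnorm (D / (1 - \<epsilon>)) w2 ?B (\<lambda>x. c x * (w2 x / w1 x) powr (1 - 1 / p)))"
    let ?nd1 = "enn2real (Lnorm (D1 / (p - \<epsilon>)) w1 ?B d1)"
    let ?nd2 = "enn2real (Lnorm (D / (p - \<epsilon>)) w2 ?B d2)"
    let ?K = "K a ?nb ?nc ?nd1 ?nd2"
    let ?br = "bracket ?k w1 w2 p ?B u"
    assume *: "measurable_compositions p w1 \<Omega> A B \<and> 0 < a \<and>
      (\<forall>h\<in>{b, c, d1, d2, e, f, g}. coefficient \<Omega> h) \<and>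
      structure_conditions \<Omega> p w1 w2 A B a b c d1 d2 e f g \<and>
      b \<in> Lspace (D1 / (p - 1)) w1 (ball x0 2) \<and>
      e \<in> Lspace (D1 / (p - 1)) w1 (ball x0 2) \<and>
      (\<lambda>x. c x * (w2 x / w1 x) powr (1 - 1 / p)) \<in> Lspace (D / (1 - \<epsilon>)) w2 (ball x0 2) \<and>
      d1 \<in> Lspace (D1 / (p - \<epsilon>)) w1 (ball x0 2) \<and>
      g \<in> Lspace (D1 / (p - \<epsilon>)) w1 (ball x0 2) \<and>
      d2 \<in> Lspace (D / (p - \<epsilon>)) w2 (ball x0 2) \<and>
      f \<in> Lspace (D / (p - \<epsilon>)) w2 (ball x0 2) \<and>
      weak_solution p w1 A B (ball x0 2) u"
    have ws: "weighted_solution \<Omega> w1 w2 p q D1 D \<epsilon> x0 A B a b c d1 d2 e f g u"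
      by unfold_locales (use * in blast)+
    have a: "0 < a" using * by blast
    have bound: "esssup (lebesgue_on (ball x0 1)) (\<lambda>x. ennreal \<bar>u x\<bar>) \<le> ennreal (?K * s)"
      if "0 < s" "?k \<le> ennreal s" "?br \<le> ennreal s" for s
      using K[of a ?nb ?nc ?nd1 ?nd2, unfolded good_def] a ws that by blast
    show "esssup (lebesgue_on (ball x0 1)) (\<lambda>x. ennreal \<bar>u x\<bar>) \<le> ennreal ?K * (?br + ?k)"
    proof (cases "?br + ?k = \<infinity>")
      case True
      have "ennreal ?K * (?br + ?k) = top" unfolding True using K0[of a ?nb ?nc ?nd1 ?nd2] by (simp add: ennreal_mult_top)
      then show ?thesis by (simp only: top_greatest)
    next
      case False
      then obtain \<beta> k where \<beta>: "0 \<le> \<beta>" "?br = ennreal \<beta>" and k: "0 \<le> k" "?k = ennreal k"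
        by (cases ?br; cases ?k) auto
      show ?thesis
      proof (rule ennreal_le_epsilon)
        fix \<delta> :: real assume \<delta>: "0 < \<delta>"
        \<comment> \<open>The summand \<delta> / K keeps the shift positive even if bracket and
          \<open>k_const\<close> both vanish; multiplied by K it contributes just \<delta>.\<close>
        let ?s = "\<beta> + k + \<delta> / ?K"
        have d: "0 < \<delta> / ?K" using \<delta> K0[of a ?nb ?nc ?nd1 ?nd2] by simp
        have "esssup (lebesgue_on (ball x0 1)) (\<lambda>x. ennreal \<bar>u x\<bar>) \<le> ennreal (?K * ?s)"
        proof (rule bound)
          show "0 < ?s" using \<beta>(1) k(1) d by simp
          show "?k \<le> ennreal ?s" by (subst k(2), rule ennreal_leI) (use \<beta>(1) d in simp)
          show "?br \<le> ennreal ?s" by (subst \<beta>(2), rule ennreal_leI) (use k(1) d in simp)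
        qed
        also have "?K * ?s = ?K * (\<beta> + k) + \<delta>" using K0[of a ?nb ?nc ?nd1 ?nd2] by (simp add: algebra_simps)
        also have "ennreal \<dots> = ennreal ?K * (?br + ?k) + ennreal \<delta>"
        proof -
          have "0 \<le> ?K * (\<beta> + k)" using \<beta>(1) k(1) K0[of a ?nb ?nc ?nd1 ?nd2] by simp
          then have "ennreal (?K * (\<beta> + k) + \<delta>) = ennreal ?K * (ennreal \<beta> + ennreal k) + ennreal \<delta>"
            using \<beta>(1) k(1) \<delta> K0[of a ?nb ?nc ?nd1 ?nd2] by (simp only: ennreal_plus ennreal_mult less_imp_le add_nonneg_nonneg)
          then show ?thesis by (simp only: \<beta>(2)[symmetric] k(2)[symmetric])
        qed
        finally show "esssup (lebesgue_on (ball x0 1)) (\<lambda>x. ennreal \<bar>u x\<bar>) \<le> ennreal ?K * (?br + ?k) + ennreal \<delta>" .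
      qed
    qed
  qed
qed

end
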